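(* Let $A=(a_{i,j}),B\in\Xi_{N,2r}$ and $\varepsilon=\mathrm{sgn}(A)$, and assume $\mathrm{co}(B)=\mathrm{ro}(A)$, $B\in\Xi^{\circ\circ\bullet}$, and $B-E^\theta_{n,n+1}$ is diagonal. Let $$g_{n,A,p}=\begin{cases}\boldsymbol q^{\sum_{j>p}a_{n,j}}[\![a_{n,p}+1]\!],&a_{n+1,p}>0,\\0,&a_{n+1,p}=0.\end{cases}$$ Then the following hold in $S^{D}_{\boldsymbol q}(n,r)$ (terms with coefficient $g_{n,A,p}=0$ being zero): (1) If $A\in\Xi^{\bullet}$, then $$\phi_{{}^{+}B^{+}}\,\phi_{\dot A}=g_{n,A,n+1}\,\phi_{{}^{+}({}_nA_{n+1})^{\varepsilon}},\qquad \phi_{{}^{-}B^{-}}\,\phi_{\dot A}=g_{n,A,n+1}\,\phi_{{}^{-}({}_nA_{n+1})^{-\varepsilon}}.$$ (2) If $A\in\Xi^{\bullet\circ\bullet}\sqcup\Xi^{\bullet\circ\circ}$, then $$\phi_{{}^{+}B^{+}}\,\phi_{{}^{+}A^{\varepsilon}}=\sum_{1\le p<n+1}g_{n,A,p}\,\phi_{{}^{+}({}_nA_p)^{\varepsilon}},\qquad \phi_{{}^{-}B^{-}}\,\phi_{{}^{-}A^{-\varepsilon}}=\sum_{1\le p<n+1}g_{n,A,p}\,\phi_{{}^{-}({}_nA_p)^{-\varepsilon}},$$ $$\phi_{{}^{+}B^{+}}\,\phi_{{}^{-}A^{-\varepsilon}}=\sum_{p>n+1}g_{n,A,p}\,\phi_{{}^{+}({}_nA_p)^{-\varepsilon}},\qquad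 \phi_{{}^{-}B^{-}}\,\phi_{{}^{+}A^{\varepsilon}}=\sum_{p>n+1}g_{n,A,p}\,\phi_{{}^{-}({}_nA_p)^{\varepsilon}}.$$
   Context: Let $n\ge1$, $r\ge4$, $N=2n+1$, $[a,b]=\{x\in\mathbb Z:a\le x\le b\}$, $\mathcal A=\mathbb Z[\boldsymbol q]$ with $\boldsymbol q$ an indeterminate, $[\![m]\!]=(\boldsymbol q^m-1)/(\boldsymbol q-1)$. $W$ is the group of permutations $w$ of $[1,2r]$ with $w(i)+w(2r+1-i)=2r+1$ for all $i$ (type $B_r$), with Coxeter generators $s_i=(i,i+1)(2r-i,2r+1-i)$ ($1\le i<r$) and $s_r=(r,r+1)$. $H=H_{\boldsymbol q,1}$ is the $\mathcal A$-algebra generated by $T_1,\dots,T_r$ with relations $T_iT_j=T_jT_i$ ($|i-j|\ge2$), $T_jT_{j+1}T_j=T_{j+1}T_jT_{j+1}$ ($1\le j<r-1$), $T_{r-1}T_rT_{r-1}T_r=T_rT_{r-1}T_rT_{r-1}$, $T_i^2=(\boldsymbol q-1)T_i+\boldsymbol q$ ($i<r$), $T_r^2=1$; it has basis $\{T_w\}_{w\in W}$ defined via reduced expressions. $\Lambda(n+1,r)=\{\lambda\in\mathbb N^{n+1}:\sum\lambda_i=r\}$, $\widehat\lambda=(\lambda_1,\dots,\lambda_n,2\lambda_{n+1},\lambda_n,\dots,\lambda_1)$. $W_\lambda$ is generated by the $s_j$, $j\in[1,r]$, with $j\notin\{\lambda_1+\dots+\lambda_i:i\in[1,n]\}$. $\Xi_{N,2r}$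 is the set of $N\times N$ matrices $A=(a_{i,j})$ over $\mathbb N$ with $a_{i,j}=a_{N+1-i,N+1-j}$ and $\sum a_{i,j}=2r$; $\mathrm{ro}(A),\mathrm{co}(A)$ are the row sum and column sum vectors. Let $R_i^{\widehat\lambda}$ ($1\le i\le N$) be the consecutive intervals of lengths $\widehat\lambda_i$ partitioning $[1,2r]$. The map $(\lambda,d,\mu)\mapsto(|R_i^{\widehat\lambda}\cap dR_j^{\widehat\mu}|)_{i,j}$, with $\lambda,\mu\in\Lambda(n+1,r)$ and $d$ a minimal length representative of a $W_\lambda$-$W_\mu$ double coset, is a bijection onto $\Xi_{N,2r}$; if $A$ is the image of $(\lambda,d,\mu)$ write $d_A=d$ (then $\mathrm{ro}(A)=\widehat\lambda$, $\mathrm{co}(A)=\widehat\mu$). $\check W\le W$ is the subgroup of $w$ with $\#\{i\in[1,r]:w(i)>r\}$ even (type $D_r$), with Coxeter generators $s_1,\dots,s_{r-1},s_rs_{r-1}s_r$; $\check H\subset H$ is the subalgebra generated by $T_1,\dots,T_{r-1},T_rT_{r-1}T_r$, with basis $\{T_w\}_{w\in\check W}$. $\Lambda^{D}(n,r)$ consists of symbols $\lambda^\bullet$ ($\lambda\in\Lambda(n+1,r)$, $\lambda_{n+1}\ne0$) and $\lambda^+,\lambda^-$ ($\lambda_{n+1}=0$); $\check W_{\lambda^\bullet}=W_\lambda\cap\check W$, $\check W_{\lambda^+}=W_\lambda$, $\check W_{\lambda^-}=s_rW_\lambda s_r$; $\check x_\alpha=\sum_{w\in\check W_\alpha}T_w$;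 $S^{D}_{\boldsymbol q}(n,r)=\mathrm{End}_{\check H}(\bigoplus_{\alpha\in\Lambda^{D}(n,r)}\check x_\alpha\check H)$, product being composition (also written $*$). For $\alpha,\beta\in\Lambda^{D}(n,r)$ and $d$ the minimal length representative (for $\check W$) of a $\check W_\alpha$-$\check W_\beta$ double coset in $\check W$, $\phi^d_{\alpha,\beta}(\check x_\gamma h)=\delta_{\beta,\gamma}\sum_{w\in\check W_\alpha d\check W_\beta}T_wh$. $\mathrm{sgn}(A)\in\{+,-\}$ is $+$ iff $\sum_{i\in[1,n],\,j\in[n+2,N]}a_{i,j}$ is even; signs multiply as usual and $-\varepsilon$ is the opposite sign. One has symbols $\dot A$ for $A\in\Xi_{N,2r}$ with $a_{n+1,n+1}\ne0$ and ${}^{\varepsilon}A^{\varepsilon'}$ for $A\in\Xi_{N,2r}$ with $a_{n+1,n+1}=0$ and $\varepsilon\varepsilon'=\mathrm{sgn}(A)$. With $\mathrm{ro}(A)=\widehat\lambda$, $\mathrm{co}(A)=\widehat\mu$, put $\lambda^{[\varepsilon]}=\lambda^\varepsilon$ if $\lambda_{n+1}=0$, $\lambda^{[\varepsilon]}=\lambda^\bullet$ otherwise (same for $\mu$), $s^{+}=1$, $s^{-}=s_r$. Then $\phi_{\dot A}=\phi^{d}_{\lambda^\bullet,\mu^\bullet}$, $d$ the minimal representative of $\check W_{\lambda^\bullet}d_A\check W_{\mu^\bullet}$ if $d_A\in\check W$, of $\check W_{\lambda^\bullet}s_rd_A\check W_{\mu^\bullet}$ if $d_A\notin\check W$; and $\phi_{{}^{\varepsilon}A^{\varepsilon'}}=\phi^{d}_{\lambda^{[\varepsilon]},\mu^{[\varepsilon']}}$,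 $d$ the minimal representative of $\check W_{\lambda^{[\varepsilon]}}s^{\varepsilon}d_As^{\varepsilon'}\check W_{\mu^{[\varepsilon']}}$. $\Xi^{\bullet}=\{A\in\Xi_{N,2r}:a_{n+1,n+1}\ne0\}$. With $\mathrm{ro}(A)=\widehat\lambda,\mathrm{co}(A)=\widehat\mu$, the matrices with $a_{n+1,n+1}=0$ are divided into $\Xi^{\circ\circ\circ}$ ($\lambda_{n+1}=0=\mu_{n+1}$), $\Xi^{\circ\circ\bullet}$ ($\lambda_{n+1}=0\ne\mu_{n+1}$), $\Xi^{\bullet\circ\circ}$ ($\lambda_{n+1}\ne0=\mu_{n+1}$), $\Xi^{\bullet\circ\bullet}$ ($\lambda_{n+1}\ne0\ne\mu_{n+1}$). $E^\theta_{i,j}=E_{i,j}+E_{N+1-i,N+1-j}$ ($E_{i,j}$ matrix units), ${}_nA_p=A+E^\theta_{n,p}-E^\theta_{n+1,p}$. *)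

theory Defs
  imports
    "HOL-Library.Poly_Mapping"
    "HOL-Library.FuncSet"
    "HOL-Computational_Algebra.Polynomial"
    "HOL-Combinatorics.Permutations"
    "HOL-Algebra.QuotRing"
    "HOL-Algebra.Generated_Groups"
    "HOL-Algebra.Generated_Rings"
    "HOL-Algebra.Module"
begin

text \<open>
  The coefficient ring \<open>Z[q]\<close> is the type \<^typ>\<open>int poly\<close>.  Vectors and matrices indexed by
  \<open>{1..m}\<close> are functions on \<^typ>\<open>nat\<close> that vanish outside the index range.  Products of
  permutations are compositions of maps, \<open>(v w)(i) = v (w i)\<close>.
\<close>

definition qq :: "int poly" where
  "qq = [:0, 1:]"

definition qint :: "nat \<Rightarrow> int poly" where
  "qint m = (qq ^ m - 1) div (qq - 1)"  \<comment> \<open>an exact division\<close>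


section \<open>Weyl groups of types B and D\<close>

definition WB :: "nat \<Rightarrow> (nat \<Rightarrow> nat) set" where
  "WB r = {w. w permutes {1..2*r} \<and> (\<forall>i\<in>{1..2*r}. w i + w (2*r + 1 - i) = 2*r + 1)}"

definition WB_group :: "nat \<Rightarrow> (nat \<Rightarrow> nat) monoid" where
  "WB_group r = \<lparr>carrier = WB r, mult = (\<circ>), one = id\<rparr>"

definition cs :: "nat \<Rightarrow> nat \<Rightarrow> nat \<Rightarrow> nat" where
  "cs r i = (if i = r then transpose r (r + 1)
             else transpose i (i + 1) \<circ> transpose (2*r - i) (2*r + 1 - i))"

definition WD :: "nat \<Rightarrow> (nat \<Rightarrow> nat) set" where
  "WD r = {w \<in> WB r. even (card {i \<in> {1..r}. w i > r})}"

definition gensB :: "nat \<Rightarrow> (nat \<Rightarrow> nat) set" where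
  "gensB r = cs r ` {1..r}"

definition gensD :: "nat \<Rightarrow> (nat \<Rightarrow> nat) set" where
  "gensD r = cs r ` {1..<r} \<union> {cs r r \<circ> cs r (r - 1) \<circ> cs r r}"

definition word_length :: "(nat \<Rightarrow> nat) set \<Rightarrow> (nat \<Rightarrow> nat) \<Rightarrow> nat" where
  "word_length S w = (LEAST k. \<exists>us. set us \<subseteq> S \<and> length us = k \<and> foldr (\<circ>) us id = w)"

definition reduced_expr :: "nat \<Rightarrow> nat list \<Rightarrow> (nat \<Rightarrow> nat) \<Rightarrow> bool" where
  "reduced_expr r is w \<longleftrightarrow>
     set is \<subseteq> {1..r} \<and> foldr (\<circ>) (map (cs r) is) id = w \<and> length is = word_length (gensB r) w"

definition dcoset :: "(nat \<Rightarrow> nat) set \<Rightarrow> (nat \<Rightarrow> nat) \<Rightarrow> (nat \<Rightarrow> nat) set \<Rightarrow> (nat \<Rightarrow> nat) set" where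
  "dcoset X d Y = {u \<circ> d \<circ> v | u v. u \<in> X \<and> v \<in> Y}"

definition min_repD :: "nat \<Rightarrow> (nat \<Rightarrow> nat) set \<Rightarrow> nat \<Rightarrow> nat" where
  "min_repD r C = arg_min_on (word_length (gensD r)) C"


section \<open>The Hecke algebra with parameters q and 1\<close>

text \<open>The free \<open>Z[q]\<close>-algebra is the monoid algebra of the free monoid on the letters \<open>1, \<dots>, r\<close>.\<close>

datatype gword = Word (letters: "nat list")

instantiation gword :: monoid_add
begin

definition zero_gword :: gword where
  "0 = Word []"

definition plus_gword :: "gword \<Rightarrow> gword \<Rightarrow> gword" where
  "u + v = Word (letters u @ letters v)"

instance
  by standard (simp_all add: zero_gword_def plus_gword_def)

end

type_synonym free_elt = "gword \<Rightarrow>\<^sub>0 int poly"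
type_synonym hecke_elt = "free_elt set"

definition free_alg :: "nat \<Rightarrow> free_elt ring" where
  "free_alg r =
     \<lparr>carrier = {f. \<forall>w \<in> Poly_Mapping.keys f. set (letters w) \<subseteq> {1..r}},
      mult = (*), one = 1, zero = 0, add = (+)\<rparr>"

definition fgen :: "nat \<Rightarrow> free_elt" where
  "fgen i = Poly_Mapping.single (Word [i]) 1"

definition fconst :: "int poly \<Rightarrow> free_elt" where
  "fconst c = Poly_Mapping.single (Word []) c"

definition hecke_rels :: "nat \<Rightarrow> free_elt set" where
  "hecke_rels r =
     {fgen i * fgen j - fgen j * fgen i | i j.
        i \<in> {1..r} \<and> j \<in> {1..r} \<and> (i + 2 \<le> j \<or> j + 2 \<le> i)}
   \<union> {fgen j * fgen (j+1) * fgen j - fgen (j+1) * fgen j * fgen (j+1) | j. 1 \<le> j \<and> j < r - 1}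
   \<union> {fgen (r-1) * fgen r * fgen (r-1) * fgen r - fgen r * fgen (r-1) * fgen r * fgen (r-1)}
   \<union> {fgen i * fgen i - (fconst (qq - 1) * fgen i + fconst qq) | i. 1 \<le> i \<and> i < r}
   \<union> {fgen r * fgen r - 1}"

definition hecke_ideal :: "nat \<Rightarrow> free_elt set" where
  "hecke_ideal r = genideal (free_alg r) (hecke_rels r)"

definition hecke_class :: "nat \<Rightarrow> free_elt \<Rightarrow> hecke_elt" where
  "hecke_class r f = hecke_ideal r +>\<^bsub>free_alg r\<^esub> f"

definition hecke :: "nat \<Rightarrow> (int poly, hecke_elt) module" where
  "hecke r =
     (let Q = free_alg r Quot hecke_ideal r in
      \<lparr>carrier = carrier Q, mult = mult Q, one = one Q, zero = zero Q, add = add Q,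
       smult = (\<lambda>c x. hecke_class r (fconst c) \<otimes>\<^bsub>Q\<^esub> x)\<rparr>)"

definition Tgen :: "nat \<Rightarrow> nat \<Rightarrow> hecke_elt" where
  "Tgen r i = hecke_class r (fgen i)"

definition Tw :: "nat \<Rightarrow> (nat \<Rightarrow> nat) \<Rightarrow> hecke_elt" where
  "Tw r w = foldr (\<lambda>i x. Tgen r i \<otimes>\<^bsub>hecke r\<^esub> x) (SOME is. reduced_expr r is w) \<one>\<^bsub>hecke r\<^esub>"

definition Tsum :: "nat \<Rightarrow> (nat \<Rightarrow> nat) set \<Rightarrow> hecke_elt" where
  "Tsum r X = (\<Oplus>\<^bsub>hecke r\<^esub>w\<in>X. Tw r w)"

text \<open>The generated \<open>Z[q]\<close>-subalgebra is the subring generated together with the scalars.\<close>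

definition heckeD :: "nat \<Rightarrow> hecke_elt set" where
  "heckeD r = generate_ring (hecke r)
     (Tgen r ` {1..<r}
      \<union> {Tgen r r \<otimes>\<^bsub>hecke r\<^esub> Tgen r (r - 1) \<otimes>\<^bsub>hecke r\<^esub> Tgen r r}
      \<union> {c \<odot>\<^bsub>hecke r\<^esub> \<one>\<^bsub>hecke r\<^esub> | c. True})"


section \<open>Compositions and matrices\<close>

definition Lam :: "nat \<Rightarrow> nat \<Rightarrow> (nat \<Rightarrow> nat) set" where
  "Lam n r = {l. (\<forall>i. i \<notin> {1..n+1} \<longrightarrow> l i = 0) \<and> (\<Sum>i\<in>{1..n+1}. l i) = r}"

definition hat :: "nat \<Rightarrow> (nat \<Rightarrow> nat) \<Rightarrow> nat \<Rightarrow> nat" where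
  "hat n l i = (if i \<in> {1..n} then l i
                else if i = n + 1 then 2 * l (n + 1)
                else if i \<in> {n+2..2*n+1} then l (2*n + 2 - i)
                else 0)"

definition parabolic :: "nat \<Rightarrow> nat \<Rightarrow> (nat \<Rightarrow> nat) \<Rightarrow> (nat \<Rightarrow> nat) set" where
  "parabolic n r l =
     generate (WB_group r) (cs r ` ({1..r} - {\<Sum>k\<in>{1..i}. l k | i. i \<in> {1..n}}))"

definition block :: "nat \<Rightarrow> (nat \<Rightarrow> nat) \<Rightarrow> nat \<Rightarrow> nat set" where
  "block n l i = {(\<Sum>k\<in>{1..<i}. hat n l k) <.. (\<Sum>k\<in>{1..i}. hat n l k)}"

definition Xi :: "nat \<Rightarrow> nat \<Rightarrow> (nat \<Rightarrow> nat \<Rightarrow> nat) set" where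
  "Xi n r = {A. (\<forall>i j. i \<notin> {1..2*n+1} \<or> j \<notin> {1..2*n+1} \<longrightarrow> A i j = 0)
              \<and> (\<forall>i\<in>{1..2*n+1}. \<forall>j\<in>{1..2*n+1}. A i j = A (2*n + 2 - i) (2*n + 2 - j))
              \<and> (\<Sum>i\<in>{1..2*n+1}. \<Sum>j\<in>{1..2*n+1}. A i j) = 2*r}"

definition ro :: "nat \<Rightarrow> (nat \<Rightarrow> nat \<Rightarrow> nat) \<Rightarrow> nat \<Rightarrow> nat" where
  "ro n A i = (\<Sum>j\<in>{1..2*n+1}. A i j)"

definition co :: "nat \<Rightarrow> (nat \<Rightarrow> nat \<Rightarrow> nat) \<Rightarrow> nat \<Rightarrow> nat" where
  "co n A j = (\<Sum>i\<in>{1..2*n+1}. A i j)"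

definition min_triples :: "nat \<Rightarrow> nat \<Rightarrow> ((nat \<Rightarrow> nat) \<times> (nat \<Rightarrow> nat) \<times> (nat \<Rightarrow> nat)) set" where
  "min_triples n r = {(l, d, m). l \<in> Lam n r \<and> m \<in> Lam n r \<and> d \<in> WB r
      \<and> (\<forall>w \<in> dcoset (parabolic n r l) d (parabolic n r m).
            word_length (gensB r) d \<le> word_length (gensB r) w)}"

definition triple_matrix ::
    "nat \<Rightarrow> (nat \<Rightarrow> nat) \<times> (nat \<Rightarrow> nat) \<times> (nat \<Rightarrow> nat) \<Rightarrow> nat \<Rightarrow> nat \<Rightarrow> nat" where
  "triple_matrix n = (\<lambda>(l, d, m) i j.
     if i \<in> {1..2*n+1} \<and> j \<in> {1..2*n+1} then card (block n l i \<inter> d ` block n m j) else 0)"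

text \<open>The triple \<open>(\<lambda>, d, \<mu>)\<close> of \<open>A\<close>, under the inverse of the bijection \<^const>\<open>triple_matrix\<close>
  from \<^const>\<open>min_triples\<close> onto \<^const>\<open>Xi\<close>.\<close>

definition triple_of :: "nat \<Rightarrow> nat \<Rightarrow> (nat \<Rightarrow> nat \<Rightarrow> nat) \<Rightarrow> (nat \<Rightarrow> nat) \<times> (nat \<Rightarrow> nat) \<times> (nat \<Rightarrow> nat)" where
  "triple_of n r A = inv_into (min_triples n r) (triple_matrix n) A"

definition row_comp :: "nat \<Rightarrow> nat \<Rightarrow> (nat \<Rightarrow> nat \<Rightarrow> nat) \<Rightarrow> nat \<Rightarrow> nat" where
  "row_comp n r A = inv_into (Lam n r) (hat n) (ro n A)"

definition col_comp :: "nat \<Rightarrow> nat \<Rightarrow> (nat \<Rightarrow> nat \<Rightarrow> nat) \<Rightarrow> nat \<Rightarrow> nat" where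
  "col_comp n r A = inv_into (Lam n r) (hat n) (co n A)"

definition d_of :: "nat \<Rightarrow> nat \<Rightarrow> (nat \<Rightarrow> nat \<Rightarrow> nat) \<Rightarrow> nat \<Rightarrow> nat" where
  "d_of n r A = fst (snd (triple_of n r A))"

text \<open>In the names below, \<open>o\<close> and \<open>b\<close> stand for the superscripts circle and bullet.\<close>

definition Xi_b :: "nat \<Rightarrow> nat \<Rightarrow> (nat \<Rightarrow> nat \<Rightarrow> nat) set" where
  "Xi_b n r = {A \<in> Xi n r. A (n+1) (n+1) \<noteq> 0}"

definition Xi_oob :: "nat \<Rightarrow> nat \<Rightarrow> (nat \<Rightarrow> nat \<Rightarrow> nat) set" where
  "Xi_oob n r = {A \<in> Xi n r. A (n+1) (n+1) = 0
                   \<and> row_comp n r A (n+1) = 0 \<and> col_comp n r A (n+1) \<noteq> 0}"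

definition Xi_boo :: "nat \<Rightarrow> nat \<Rightarrow> (nat \<Rightarrow> nat \<Rightarrow> nat) set" where
  "Xi_boo n r = {A \<in> Xi n r. A (n+1) (n+1) = 0
                   \<and> row_comp n r A (n+1) \<noteq> 0 \<and> col_comp n r A (n+1) = 0}"

definition Xi_bob :: "nat \<Rightarrow> nat \<Rightarrow> (nat \<Rightarrow> nat \<Rightarrow> nat) set" where
  "Xi_bob n r = {A \<in> Xi n r. A (n+1) (n+1) = 0
                   \<and> row_comp n r A (n+1) \<noteq> 0 \<and> col_comp n r A (n+1) \<noteq> 0}"

definition Eth :: "nat \<Rightarrow> nat \<Rightarrow> nat \<Rightarrow> nat \<Rightarrow> nat \<Rightarrow> nat" where
  "Eth n h p i j = (if i = h \<and> j = p then 1 else 0)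
                 + (if i = 2*n + 2 - h \<and> j = 2*n + 2 - p then 1 else 0)"

text \<open>The matrix \<open>A + E\<^sup>\<theta>(n, p) - E\<^sup>\<theta>(n+1, p)\<close>.  The subtraction of natural numbers is exact
  whenever \<open>A \<in> Xi n r\<close> and \<open>A (n+1) p > 0\<close> (the middle entry of \<open>A\<close> is even).\<close>

definition shiftA :: "nat \<Rightarrow> (nat \<Rightarrow> nat \<Rightarrow> nat) \<Rightarrow> nat \<Rightarrow> nat \<Rightarrow> nat \<Rightarrow> nat" where
  "shiftA n A p i j = A i j + Eth n n p i j - Eth n (n+1) p i j"

definition gcoef :: "nat \<Rightarrow> (nat \<Rightarrow> nat \<Rightarrow> nat) \<Rightarrow> nat \<Rightarrow> int poly" where
  "gcoef n A p = (if A (n+1) p > 0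
                  then qq ^ (\<Sum>j\<in>{p<..2*n+1}. A n j) * qint (A n p + 1) else 0)"


section \<open>Signs and decorated compositions\<close>

datatype sign = Pos | Neg

instantiation sign :: "{times, uminus}"
begin

definition times_sign :: "sign \<Rightarrow> sign \<Rightarrow> sign" where
  "e * f = (if e = f then Pos else Neg)"

definition uminus_sign :: "sign \<Rightarrow> sign" where
  "- e = (if e = Pos then Neg else Pos)"

instance ..

end

definition msgn :: "nat \<Rightarrow> (nat \<Rightarrow> nat \<Rightarrow> nat) \<Rightarrow> sign" where
  "msgn n A = (if even (\<Sum>i\<in>{1..n}. \<Sum>j\<in>{n+2..2*n+1}. A i j) then Pos else Neg)"

datatype dsym = Bullet "nat \<Rightarrow> nat" | Signed sign "nat \<Rightarrow> nat"

definition LamD :: "nat \<Rightarrow> nat \<Rightarrow> dsym set" where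
  "LamD n r = {Bullet l | l. l \<in> Lam n r \<and> l (n+1) \<noteq> 0}
            \<union> {Signed e l | e l. l \<in> Lam n r \<and> l (n+1) = 0}"

definition decor :: "nat \<Rightarrow> (nat \<Rightarrow> nat) \<Rightarrow> sign \<Rightarrow> dsym" where
  "decor n l e = (if l (n+1) = 0 then Signed e l else Bullet l)"

fun parabolicD :: "nat \<Rightarrow> nat \<Rightarrow> dsym \<Rightarrow> (nat \<Rightarrow> nat) set" where
  "parabolicD n r (Bullet l) = parabolic n r l \<inter> WD r"
| "parabolicD n r (Signed Pos l) = parabolic n r l"
| "parabolicD n r (Signed Neg l) = {cs r r \<circ> w \<circ> cs r r | w. w \<in> parabolic n r l}"

fun spow :: "nat \<Rightarrow> sign \<Rightarrow> nat \<Rightarrow> nat" where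
  "spow r Pos = id"
| "spow r Neg = cs r r"


section \<open>The q-Schur algebra of type D\<close>

definition xD :: "nat \<Rightarrow> nat \<Rightarrow> dsym \<Rightarrow> hecke_elt" where
  "xD n r a = Tsum r (parabolicD n r a)"

text \<open>The direct sum of the right \<^const>\<open>heckeD\<close>-modules generated by the \<^const>\<open>xD\<close>; the index set
  is finite, so it is the set of all families of elements.\<close>

definition Msum :: "nat \<Rightarrow> nat \<Rightarrow> (dsym \<Rightarrow> hecke_elt) set" where
  "Msum n r = (\<Pi>\<^sub>E a\<in>LamD n r. xD n r a <#\<^bsub>hecke r\<^esub> heckeD r)"

definition Madd :: "nat \<Rightarrow> nat \<Rightarrow> (dsym \<Rightarrow> hecke_elt) \<Rightarrow> (dsym \<Rightarrow> hecke_elt) \<Rightarrow> dsym \<Rightarrow> hecke_elt" where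
  "Madd n r x y = (\<lambda>a\<in>LamD n r. x a \<oplus>\<^bsub>hecke r\<^esub> y a)"

definition Mact :: "nat \<Rightarrow> nat \<Rightarrow> (dsym \<Rightarrow> hecke_elt) \<Rightarrow> hecke_elt \<Rightarrow> dsym \<Rightarrow> hecke_elt" where
  "Mact n r x h = (\<lambda>a\<in>LamD n r. x a \<otimes>\<^bsub>hecke r\<^esub> h)"

definition Mincl :: "nat \<Rightarrow> nat \<Rightarrow> dsym \<Rightarrow> hecke_elt \<Rightarrow> dsym \<Rightarrow> hecke_elt" where
  "Mincl n r b x = (\<lambda>a\<in>LamD n r. if a = b then x else \<zero>\<^bsub>hecke r\<^esub>)"

definition Mzero :: "nat \<Rightarrow> nat \<Rightarrow> dsym \<Rightarrow> hecke_elt" where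
  "Mzero n r = (\<lambda>a\<in>LamD n r. \<zero>\<^bsub>hecke r\<^esub>)"

text \<open>Endomorphisms are extensional functions on \<^const>\<open>Msum\<close>.  They are automatically
  \<open>Z[q]\<close>-linear, since \<^const>\<open>heckeD\<close> contains the scalars.\<close>

definition SD :: "nat \<Rightarrow> nat \<Rightarrow> (int poly, (dsym \<Rightarrow> hecke_elt) \<Rightarrow> dsym \<Rightarrow> hecke_elt) module" where
  "SD n r =
     \<lparr>carrier = {f \<in> Msum n r \<rightarrow>\<^sub>E Msum n r.
         (\<forall>x\<in>Msum n r. \<forall>y\<in>Msum n r. f (Madd n r x y) = Madd n r (f x) (f y)) \<and>
         (\<forall>x\<in>Msum n r. \<forall>h\<in>heckeD r. f (Mact n r x h) = Mact n r (f x) h)},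
      mult = compose (Msum n r),
      one = (\<lambda>x\<in>Msum n r. x),
      zero = (\<lambda>x\<in>Msum n r. Mzero n r),
      add = (\<lambda>f g. \<lambda>x\<in>Msum n r. Madd n r (f x) (g x)),
      smult = (\<lambda>c f. \<lambda>x\<in>Msum n r. \<lambda>a\<in>LamD n r. c \<odot>\<^bsub>hecke r\<^esub> f x a)\<rparr>"

definition phi :: "nat \<Rightarrow> nat \<Rightarrow> dsym \<Rightarrow> (nat \<Rightarrow> nat) \<Rightarrow> dsym
    \<Rightarrow> (dsym \<Rightarrow> hecke_elt) \<Rightarrow> dsym \<Rightarrow> hecke_elt" where
  "phi n r a d b = (THE f. f \<in> carrier (SD n r) \<and>
     (\<forall>c\<in>LamD n r. \<forall>h\<in>heckeD r.
        f (Mincl n r c (xD n r c \<otimes>\<^bsub>hecke r\<^esub> h)) =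
          (if b = c
           then Mincl n r a (Tsum r (dcoset (parabolicD n r a) d (parabolicD n r b)) \<otimes>\<^bsub>hecke r\<^esub> h)
           else Mzero n r)))"

definition phi_dot :: "nat \<Rightarrow> nat \<Rightarrow> (nat \<Rightarrow> nat \<Rightarrow> nat) \<Rightarrow> (dsym \<Rightarrow> hecke_elt) \<Rightarrow> dsym \<Rightarrow> hecke_elt" where
  "phi_dot n r A =
     (let a = Bullet (row_comp n r A); b = Bullet (col_comp n r A);
          w = (if d_of n r A \<in> WD r then d_of n r A else cs r r \<circ> d_of n r A)
      in phi n r a (min_repD r (dcoset (parabolicD n r a) w (parabolicD n r b))) b)"

text \<open>\<open>phi_eps n r e A e'\<close> is meaningful when \<open>A (n+1) (n+1) = 0\<close> and \<open>e * e' = msgn n A\<close>.\<close>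

definition phi_eps :: "nat \<Rightarrow> nat \<Rightarrow> sign \<Rightarrow> (nat \<Rightarrow> nat \<Rightarrow> nat) \<Rightarrow> sign
    \<Rightarrow> (dsym \<Rightarrow> hecke_elt) \<Rightarrow> dsym \<Rightarrow> hecke_elt" where
  "phi_eps n r e A e' =
     (let a = decor n (row_comp n r A) e; b = decor n (col_comp n r A) e';
          w = spow r e \<circ> d_of n r A \<circ> spow r e'
      in phi n r a (min_repD r (dcoset (parabolicD n r a) w (parabolicD n r b))) b)"

text \<open>A scalar multiple in which a term with zero coefficient is zero by convention, even if its
  basis symbol is meaningless.\<close>

definition sterm :: "nat \<Rightarrow> nat \<Rightarrow> int poly \<Rightarrow> ((dsym \<Rightarrow> hecke_elt) \<Rightarrow> dsym \<Rightarrow> hecke_elt)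
    \<Rightarrow> (dsym \<Rightarrow> hecke_elt) \<Rightarrow> dsym \<Rightarrow> hecke_elt" where
  "sterm n r c f = (if c = 0 then \<zero>\<^bsub>SD n r\<^esub> else c \<odot>\<^bsub>SD n r\<^esub> f)"

end

theory Submission
  imports Defs "HOL-Library.Product_Lexorder"
begin

text \<open>
  Let \<open>\<mu>\<close> be the column composition of \<open>B\<close>, which is the row composition of \<open>A\<close>, and \<open>\<lambda>\<close> the row
  composition of \<open>B\<close>. As \<open>B\<close> is diagonal up to \<open>E\<^sup>\<theta>(n, n+1)\<close> and has middle entry \<open>0\<close>, the middle part
  of \<open>\<mu>\<close> is \<open>1\<close>, and \<open>\<lambda>\<close> arises from \<open>\<mu>\<close> by moving this one box to part \<open>n\<close> (\<open>near_diagonal\<close>). On the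
  points \<open>1, ..., 2r\<close> the middle block \<open>{r, r+1}\<close> of \<open>\<mu>\<close> is torn apart: \<open>r\<close> joins block \<open>n\<close> and \<open>r+1\<close>
  joins block \<open>n+2\<close>. Therefore the even part \<open>Y\<close> of \<open>W\<^sub>\<mu>\<close> is the stabilizer of \<open>r\<close> in \<open>X = W\<^sub>\<lambda>\<close>, the
  double coset of \<open>B\<close> is \<open>X\<close> itself, and up to conjugation by \<open>T\<^sub>r\<close> the map of \<open>B\<close> sends \<open>x\<^sub>Y h\<close> to
  \<open>x\<^sub>X h\<close>, where \<open>x\<^sub>G\<close> denotes the sum of the \<open>T\<^sub>w\<close> with \<open>w \<in> G\<close>.

  Let \<open>D\<close> be the double coset of \<open>A\<close>. With representatives \<open>d\<close> of the cosets of \<open>Y\<close> in \<open>D\<close> that are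
  shortest up to \<open>s\<^sub>r\<close>, its sum is \<open>x\<^sub>Y \<Sum>\<^sub>d T\<^sub>d\<close>, so the product is given by \<open>x\<^sub>X \<Sum>\<^sub>d T\<^sub>d\<close>. The
  quadratic relations give \<open>x\<^sub>X T\<^sub>d = q\<^sup>e T(Xd)\<close>, where \<open>T(Xd)\<close> is the sum over the coset \<open>Xd\<close> and \<open>e\<close>
  is the number of inversions of the inverse of \<open>d\<close> inside the blocks of \<open>\<lambda>\<close> (\<open>tsum_stab_tw\<close>). The
  representatives \<open>d\<close> lying in one coset \<open>Xw\<close> are told apart by the point \<open>x\<close> with \<open>d(x) = r\<close>, which runs
  through points that \<open>w\<close> sends to block \<open>n\<close>, and \<open>e\<close> is the number of points beyond \<open>x\<close> that \<open>w\<close> sends to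
  block \<open>n\<close>. If \<open>x\<close> lies in column \<open>p\<close>, then \<open>Xw\<close> has the matrix \<open>A\<close> shifted at \<open>p\<close>, and its \<open>a(n,p) + 1\<close>
  points \<open>x\<close> contribute \<open>q\<^sup>c (1 + q + ... + q\<^sup>a)\<close> with \<open>c = \<Sum>\<^sub>j\<^sub>>\<^sub>p a(n,j)\<close> and \<open>a = a(n,p)\<close>. This is the
  coefficient in the formula (\<open>coset_sum_coefficient\<close>, \<open>symmetrizer_formula\<close>).

  The signs come from two facts. Since \<open>T\<^sub>r\<close> squares to \<open>1\<close>, multiplication by \<open>s\<^sub>r\<close> is always compatible
  with \<open>w \<mapsto> T\<^sub>w\<close>; so a label \<open>-\<close> is a label \<open>+\<close> conjugated by \<open>T\<^sub>r\<close>, and minimal representatives may be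
  corrected by \<open>s\<^sub>r\<close> to become even. And a set of signed permutations with given matrix and parity is
  one double coset of even parabolic subgroups when the middle entry of the matrix is nonzero or its
  row composition has no middle part (\<open>dcoset_fibre\<close>); for \<open>A\<close> with middle entry \<open>0\<close> it splits into two,
  according to the side of the middle on which the point sent to \<open>r\<close> lies (\<open>dcoset_mid_fibre\<close>). The two
  sides are the ranges \<open>p < n+1\<close> and \<open>p > n+1\<close> of the sums.

  Three foundations are established on the way: Matsumoto's theorem, by which \<open>T\<^sub>w\<close> does not depend on
  the reduced word; the existence of a signed permutation with a prescribed matrix; and the
  description of the maps \<open>\<phi>\<close> as left multiplications by elements of the Hecke algebra
  (\<open>phi_dcoset\<close>).
\<close>

section \<open>Signed permutations and their length\<close>

abbreviation (input) pinv :: "(nat \<Rightarrow> nat) \<Rightarrow> nat \<Rightarrow> nat" where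
  "pinv w \<equiv> inv_into UNIV w"

lemma WB_permutes: "w \<in> WB r \<Longrightarrow> w permutes {1..2*r}"
  by (simp add: WB_def)

lemma WB_bij: "w \<in> WB r \<Longrightarrow> bij w"
  using WB_permutes permutes_bij by blast

lemma WB_inj: "w \<in> WB r \<Longrightarrow> inj w"
  using WB_bij bij_is_inj by blast

lemma WB_mem: "w \<in> WB r \<Longrightarrow> w x \<in> {1..2*r} \<longleftrightarrow> x \<in> {1..2*r}"
  using WB_permutes permutes_in_image by metis

lemma WB_eq: "w \<in> WB r \<Longrightarrow> w x = w y \<longleftrightarrow> x = y"
  using WB_inj inj_eq by metis

lemma WB_opp: "w \<in> WB r \<Longrightarrow> x \<in> {1..2*r} \<Longrightarrow> w (2*r + 1 - x) = 2*r + 1 - w x"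
  unfolding WB_def by (metis (mono_tags, lifting) add_diff_cancel_left' mem_Collect_eq)

lemma WB_I:
  assumes "w permutes {1..2*r}" and "\<And>x. x \<in> {1..2*r} \<Longrightarrow> w (2*r + 1 - x) = 2*r + 1 - w x"
  shows "w \<in> WB r"
proof -
  have "w i + w (2*r + 1 - i) = 2*r + 1" if "i \<in> {1..2*r}" for i
    using assms(2)[OF that] permutes_in_image[OF assms(1), of i] that by simp
  then show ?thesis using assms(1) by (simp add: WB_def)
qed

lemma WB_id: "id \<in> WB r"
  by (rule WB_I) (auto simp: permutes_id)

lemma WB_comp: "v \<in> WB r \<Longrightarrow> w \<in> WB r \<Longrightarrow> v \<circ> w \<in> WB r"
proof (rule WB_I)
  assume v: "v \<in> WB r" and w: "w \<in> WB r"
  show "v \<circ> w permutes {1..2*r}"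
    using v w by (intro permutes_compose) (auto dest: WB_permutes)
  show "(v \<circ> w) (2*r + 1 - x) = 2*r + 1 - (v \<circ> w) x" if "x \<in> {1..2*r}" for x
    using WB_opp[OF w that] WB_opp[OF v, of "w x"] WB_mem[OF w, of x] that by (metis comp_apply)
qed

lemma WB_inv_apply: "w \<in> WB r \<Longrightarrow> pinv w (w x) = x"
  "w \<in> WB r \<Longrightarrow> w (pinv w x) = x"
  using WB_permutes permutes_inverses by metis+

lemma WB_inv_comp: "w \<in> WB r \<Longrightarrow> pinv w \<circ> w = id" "w \<in> WB r \<Longrightarrow> w \<circ> pinv w = id"
  by (auto simp: fun_eq_iff WB_inv_apply)

lemma WB_inv: "w \<in> WB r \<Longrightarrow> pinv w \<in> WB r"
proof (rule WB_I)
  assume w: "w \<in> WB r"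
  show p: "pinv w permutes {1..2*r}" using w WB_permutes permutes_inv by blast
  fix x assume x: "x \<in> {1..2*r}"
  have y: "pinv w x \<in> {1..2*r}" using p x permutes_in_image by metis
  have "w (2*r + 1 - pinv w x) = 2*r + 1 - x" using WB_opp[OF w y] WB_inv_apply(2)[OF w] by metis
  then show "pinv w (2*r + 1 - x) = 2*r + 1 - pinv w x"
    using WB_inv_apply(1)[OF w] by metis
qed

lemma WB_inv_inv: "w \<in> WB r \<Longrightarrow> pinv (pinv w) = w"
  using WB_bij inv_inv_eq by blast

lemma WB_inv_compose: "v \<in> WB r \<Longrightarrow> w \<in> WB r \<Longrightarrow> pinv (v \<circ> w) = pinv w \<circ> pinv v"
  by (rule o_inv_distrib) (auto dest: WB_bij)

lemma finite_WB: "finite (WB r)"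
proof -
  have "WB r \<subseteq> {w. w permutes {1..2*r}}" by (auto simp: WB_def)
  then show ?thesis using finite_permutations[of "{1..2*r}"] finite_subset by blast
qed

lemma cs_left: "i \<in> {1..r} \<Longrightarrow> cs r i i = i + 1"
  by (auto simp: cs_def transpose_def)

lemma cs_right: "i \<in> {1..r} \<Longrightarrow> cs r i (i + 1) = i"
  by (auto simp: cs_def transpose_def)

lemma cs_other: "i \<in> {1..r} \<Longrightarrow> x \<noteq> i \<Longrightarrow> x \<noteq> i + 1 \<Longrightarrow> x \<noteq> 2*r - i \<Longrightarrow> x \<noteq> 2*r + 1 - i \<Longrightarrow> cs r i x = x"
  by (auto simp: cs_def transpose_def)

lemma cs_small: "i \<in> {1..<r} \<Longrightarrow> x \<le> r \<Longrightarrow> cs r i x = transpose i (i+1) x"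
proof -
  assume "i \<in> {1..<r}" "x \<le> r"
  then have "i \<noteq> r" "x \<noteq> 2*r - i" "x \<noteq> 2*r + 1 - i" by auto
  then show ?thesis by (simp add: cs_def transpose_def)
qed

lemma cs_last: "cs r r = transpose r (r + 1)"
  by (simp add: cs_def)

lemma cs_cs: "cs r i \<circ> cs r i = id"
proof (cases "i = r")
  case False
  have *: "transpose a b (transpose c d x) = transpose c d (transpose a b x)"
    if "a \<noteq> c" "a \<noteq> d" "b \<noteq> c" "b \<noteq> d" for a b c d x :: nat
    using that by (simp add: transpose_def)
  have "cs r i (cs r i x) = x" for x
  proof -
    have "i \<noteq> 2*r - i" "i \<noteq> 2*r + 1 - i" "i + 1 \<noteq> 2*r - i" "i + 1 \<noteq> 2*r + 1 - i"
      using False by presburger+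
    then show ?thesis using False *[of i "2*r - i" "2*r + 1 - i" "i+1"]
      by (simp add: cs_def)
  qed
  then show ?thesis by auto
qed (auto simp: cs_def fun_eq_iff)

lemma cs_cs_apply: "cs r i (cs r i x) = x"
  using cs_cs[of r i] by (metis comp_apply id_apply)

lemma comp_cs_cs: "w \<circ> cs r i \<circ> cs r i = w" "cs r i \<circ> (cs r i \<circ> w) = w"
  by (auto simp: fun_eq_iff cs_cs_apply)

lemma cs_WB: assumes "i \<in> {1..r}" shows "cs r i \<in> WB r"
proof (rule WB_I)
  show "cs r i permutes {1..2*r}"
  proof (cases "i = r")
    case True then show ?thesis using assms by (auto simp: cs_def intro!: permutes_swap_id)
  next
    case False then show ?thesis using assms
      by (auto simp: cs_def intro!: permutes_compose permutes_swap_id)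
  qed
  fix x assume "x \<in> {1..2*r}"
  then have x: "1 \<le> x" "x \<le> 2*r" by auto
  consider "i = r" | "i < r" using assms by force
  then show "cs r i (2*r + 1 - x) = 2*r + 1 - cs r i x"
  proof cases
    case 1 then show ?thesis using x by (auto simp: cs_last transpose_def)
  next
    case 2
    have e: "2*r + 1 - x = i \<longleftrightarrow> x = 2*r + 1 - i" "2*r + 1 - x = i + 1 \<longleftrightarrow> x = 2*r - i"
      "2*r + 1 - x = 2*r - i \<longleftrightarrow> x = i + 1" "2*r + 1 - x = 2*r + 1 - i \<longleftrightarrow> x = i"
      using x 2 by linarith+
    have d: "i \<noteq> 2*r - i" "i \<noteq> 2*r + 1 - i" "i + 1 \<noteq> 2*r - i" "i + 1 \<noteq> 2*r + 1 - i" "2*r - i \<noteq> 2*r + 1 - i"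
      using 2 by linarith+
    have v: "2*r + 1 - (i + 1) = 2*r - i" "2*r + 1 - (2*r - i) = i + 1" "2*r + 1 - (2*r + 1 - i) = i"
      using 2 by linarith+
    have c: "cs r i (2*r - i) = 2*r + 1 - i" "cs r i (2*r + 1 - i) = 2*r - i" "cs r i i = i + 1" "cs r i (i + 1) = i"
      using d 2 by (simp_all add: cs_def transpose_def)
    consider "x = i" | "x = i + 1" | "x = 2*r - i" | "x = 2*r + 1 - i"
      | "x \<noteq> i" "x \<noteq> i + 1" "x \<noteq> 2*r - i" "x \<noteq> 2*r + 1 - i" by blast
    then show ?thesis
    proof cases
      case 5 then show ?thesis using 2 e cs_other[OF assms] by metis
    qed (use c v in metis)+
  qed
qed

lemma WB_comp_cs: "w \<in> WB r \<Longrightarrow> Suc 0 \<le> i \<Longrightarrow> i \<le> r \<Longrightarrow> w \<circ> cs r i \<in> WB r"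
  by (rule WB_comp) (auto intro: cs_WB)

lemma WB_cs_comp: "w \<in> WB r \<Longrightarrow> Suc 0 \<le> i \<Longrightarrow> i \<le> r \<Longrightarrow> cs r i \<circ> w \<in> WB r"
  by (rule WB_comp) (auto intro: cs_WB)

lemma cs_inv: "pinv (cs r i) = cs r i"
  by (rule inv_unique_comp) (simp_all add: cs_cs)

text \<open>The inversions of a function among the pairs of a given set; the same count yields the Coxeter
  length (all pairs) and the exponents of \<open>q\<close> in the formulas (pairs within a block).\<close>

definition linv :: "(nat \<times> nat) set \<Rightarrow> (nat \<Rightarrow> nat) \<Rightarrow> nat" where
  "linv Q f = card {(a, b) \<in> Q. a < b \<and> f b < f a}"

lemma transpose_Suc_less:
  "a < b \<Longrightarrow> (a, b) \<noteq> (k, Suc k) \<Longrightarrow> transpose k (Suc k) a < transpose k (Suc k) b"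
  by (auto simp: transpose_def)

text \<open>Exchanging two adjacent positions permutes the inversions other than the exchanged pair itself.\<close>

lemma linv_swap:
  assumes "finite Q" and st: "\<And>a b. (a, b) \<in> Q \<Longrightarrow> (transpose k (Suc k) a, transpose k (Suc k) b) \<in> Q"
    and k: "(k, Suc k) \<in> Q" and up: "f k < f (Suc k)"
  shows "linv Q (f \<circ> transpose k (Suc k)) = Suc (linv Q f)"
proof -
  let ?t = "transpose k (Suc k)"
  let ?N = "{(a, b) \<in> Q. a < b \<and> f b < f a}"
  have "{(a, b) \<in> Q. a < b \<and> (f \<circ> ?t) b < (f \<circ> ?t) a} = insert (k, Suc k) (map_prod ?t ?t ` ?N)"
    (is "?L = ?R")
  proof
    show "?L \<subseteq> ?R"
    proof (rule subrelI)
      fix a b assume "(a, b) \<in> ?L"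
      then have ab: "(a, b) \<in> Q" "a < b" "f (?t b) < f (?t a)" by auto
      show "(a, b) \<in> ?R"
      proof (cases "(a, b) = (k, Suc k)")
        case False
        have "(?t a, ?t b) \<in> ?N" using ab st transpose_Suc_less[OF ab(2) False] by simp
        then have "map_prod ?t ?t (?t a, ?t b) \<in> map_prod ?t ?t ` ?N" by (rule imageI)
        then show ?thesis by simp
      qed simp
    qed
    show "?R \<subseteq> ?L"
    proof (rule subrelI)
      fix a b assume *: "(a, b) \<in> ?R"
      show "(a, b) \<in> ?L"
      proof (cases "(a, b) = (k, Suc k)")
        case True then show ?thesis using k up by simp
      next
        case False
        then obtain c d where cd: "(c, d) \<in> ?N" "a = ?t c" "b = ?t d" using * by auto
        then have "(c, d) \<noteq> (k, Suc k)" using up by auto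
        then show ?thesis using cd st transpose_Suc_less[of c d k] by simp
      qed
    qed
  qed
  then have e: "{(a, b). (a, b) \<in> Q \<and> a < b \<and> (f \<circ> ?t) b < (f \<circ> ?t) a}
      = insert (k, Suc k) (map_prod ?t ?t ` ?N)" by simp
  have ni: "(k, Suc k) \<notin> map_prod ?t ?t ` ?N"
    by (auto simp: transpose_def split: if_splits)
  have "inj (map_prod ?t ?t)" by (intro prod.inj_map) auto
  then have "card (map_prod ?t ?t ` ?N) = card ?N" by (rule card_image[OF inj_on_subset[OF _ subset_UNIV]])
  moreover have "finite ?N" by (rule finite_subset[OF _ \<open>finite Q\<close>]) auto
  ultimately show ?thesis unfolding linv_def e
    using card_insert_disjoint[OF _ ni] by simp
qed

definition neg :: "nat \<Rightarrow> (nat \<Rightarrow> nat) \<Rightarrow> nat" where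
  "neg r w = card {i \<in> {1..r}. r < w i}"

text \<open>Twice the Coxeter length. An inversion \<open>(a, b)\<close> of \<open>w\<close> on \<open>1, ..., 2r\<close> is counted together with the
  opposite inversion \<open>(2r+1-b, 2r+1-a)\<close>. Those that coincide with their opposite are the \<open>(i, 2r+1-i)\<close>
  with \<open>w i > r\<close>; they are counted a second time by \<open>neg\<close>.\<close>

definition lenB :: "nat \<Rightarrow> (nat \<Rightarrow> nat) \<Rightarrow> nat" where
  "lenB r w = linv ({1..2*r} \<times> {1..2*r}) w + neg r w"

lemma WB_mid: "w \<in> WB r \<Longrightarrow> r \<ge> 1 \<Longrightarrow> w (r + 1) = 2*r + 1 - w r"
  using WB_opp[of w r r] by simp

lemma neg_cs_less:
  assumes w: "w \<in> WB r" and i: "i \<in> {1..<r}"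
  shows "neg r (w \<circ> cs r i) = neg r w"
proof -
  have st1: "cs r i x \<in> {1..r}" if "x \<in> {1..r}" for x
    using i that cs_small[OF i, of x] by (auto simp: transpose_def)
  then have st: "cs r i x \<in> {1..r} \<longleftrightarrow> x \<in> {1..r}" for x
    using cs_cs_apply[of r i x] by metis
  have "{x \<in> {1..r}. r < (w \<circ> cs r i) x} = cs r i ` {x \<in> {1..r}. r < w x}"
  proof safe
    fix x assume "x \<in> {1..r}" "r < (w \<circ> cs r i) x"
    then have "cs r i x \<in> {x \<in> {1..r}. r < w x}" using st[of x] by auto
    then show "x \<in> cs r i ` {x \<in> {1..r}. r < w x}" using cs_cs_apply[of r i x] by (metis imageI)
  qed (use st cs_cs_apply[of r i] in auto)
  moreover have "inj (cs r i)" using cs_WB[of i r] i WB_inj by auto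
  ultimately show ?thesis unfolding neg_def by (simp add: card_image inj_on_subset[of _ UNIV])
qed

lemma neg_cs_last_up:
  assumes w: "w \<in> WB r" and r: "r \<ge> 1" and up: "w r < w (r + 1)"
  shows "neg r (w \<circ> cs r r) = Suc (neg r w)"
proof -
  have le: "w r \<le> r" using up WB_mid[OF w r] by simp
  have "{x \<in> {1..r}. r < (w \<circ> cs r r) x} = insert r {x \<in> {1..r}. r < w x}"
    using le r WB_mid[OF w r] by (auto simp: cs_last transpose_def split: if_splits)
  moreover have "r \<notin> {x \<in> {1..r}. r < w x}" using le by simp
  ultimately show ?thesis by (simp add: neg_def)
qed

text \<open>A generator \<open>s\<^sub>i\<close> with \<open>i < r\<close> exchanges two opposite pairs of adjacent positions, each adding one
  inversion; \<open>s\<^sub>r\<close> exchanges one pair and adds one sign change.\<close>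

lemma lenB_up:
  assumes w: "w \<in> WB r" and i: "i \<in> {1..r}" and up: "w i < w (i + 1)"
  shows "lenB r (w \<circ> cs r i) = lenB r w + 2"
proof (cases "i = r")
  case True
  have "linv ({1..2*r} \<times> {1..2*r}) (w \<circ> cs r r) = Suc (linv ({1..2*r} \<times> {1..2*r}) w)"
    unfolding cs_last Suc_eq_plus1[symmetric]
    by (rule linv_swap) (use i True up in \<open>auto simp: transpose_def\<close>)
  then show ?thesis using True neg_cs_last_up[OF w] i up by (simp add: lenB_def)
next
  case False
  then have i': "i \<in> {1..<r}" using i by auto
  let ?Q = "{1..2*r} \<times> {1..2*r}"
  define k where "k = 2*r - i"
  have k: "Suc k = 2*r + 1 - i" "k \<noteq> i" "k \<noteq> Suc i" "Suc k \<noteq> i" "i \<le> 2*r" using i' by (auto simp: k_def)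
  have "linv ?Q (w \<circ> transpose i (Suc i)) = Suc (linv ?Q w)"
    by (rule linv_swap) (use i' up in \<open>auto simp: transpose_def\<close>)
  moreover have "linv ?Q ((w \<circ> transpose i (Suc i)) \<circ> transpose k (Suc k)) = Suc (linv ?Q (w \<circ> transpose i (Suc i)))"
  proof (rule linv_swap)
    show "(w \<circ> transpose i (Suc i)) k < (w \<circ> transpose i (Suc i)) (Suc k)"
    proof -
      have "w k = 2*r + 1 - w (i+1)" "w (Suc k) = 2*r + 1 - w i"
        using WB_opp[OF w, of "i+1"] WB_opp[OF w, of i] i' k by (auto simp: k_def)
      moreover have "w (i+1) \<in> {1..2*r}" using WB_mem[OF w, of "i+1"] i' by auto
      ultimately show ?thesis using k up by (auto simp: transpose_def)
    qed
  qed (use i' in \<open>auto simp: transpose_def k_def\<close>)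
  moreover have "cs r i = transpose i (Suc i) \<circ> transpose k (Suc k)"
    using i' k(1) by (simp add: cs_def k_def)
  ultimately show ?thesis using neg_cs_less[OF w i'] by (simp add: lenB_def comp_assoc)
qed

lemma lenB_down:
  assumes w: "w \<in> WB r" and i: "i \<in> {1..r}" and down: "w (i + 1) < w i"
  shows "lenB r w = lenB r (w \<circ> cs r i) + 2"
proof -
  have "lenB r (w \<circ> cs r i \<circ> cs r i) = lenB r (w \<circ> cs r i) + 2"
    by (rule lenB_up) (use assms in \<open>auto simp: cs_left cs_right[simplified] intro: WB_comp_cs WB_cs_comp\<close>)
  then show ?thesis by (simp add: comp_cs_cs)
qed

lemma WB_up_or_down: "w \<in> WB r \<Longrightarrow> w i < w (i + 1) \<or> w (i + 1) < w i"
  using WB_eq[of w r i "i+1"] by simp (metis linorder_neqE_nat n_not_Suc_n)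

lemma lenB_cs_le: "w \<in> WB r \<Longrightarrow> i \<in> {1..r} \<Longrightarrow> lenB r (w \<circ> cs r i) \<le> lenB r w + 2"
  using WB_up_or_down[of w r i] lenB_up[of w r i] lenB_down[of w r i] by auto

text \<open>The base of every induction on the length.\<close>

lemma WB_increasing:
  assumes w: "w \<in> WB r" and up: "\<And>i. i \<in> {1..r} \<Longrightarrow> w i < w (i + 1)"
  shows "w = id"
proof -
  have up': "w i < w (i + 1)" if "1 \<le> i" "i < 2*r" for i
  proof (cases "i \<le> r")
    case False
    let ?j = "2*r - i"
    have "w ?j < w (?j + 1)" by (rule up) (use that False in auto)
    moreover have "w (i+1) = 2*r + 1 - w ?j" "w i = 2*r + 1 - w (?j + 1)"
      using WB_opp[OF w, of ?j] WB_opp[OF w, of "?j + 1"] that by (auto simp: Suc_diff_le)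
    moreover have "w (?j + 1) \<in> {1..2*r}" using WB_mem[OF w, of "?j + 1"] that False by auto
    ultimately show ?thesis by simp linarith
  qed (use up that in auto)
  have ge: "x \<le> w x" if "x \<in> {1..2*r}" for x
    using that
  proof (induction x)
    case (Suc x)
    show ?case
    proof (cases "x = 0")
      case True then show ?thesis using WB_mem[OF w, of 1] Suc.prems by auto
    next
      case False then show ?thesis using Suc up'[of x] by auto
    qed
  qed simp
  have "w x = x" for x
  proof (cases "x \<in> {1..2*r}")
    case True
    then have "2*r + 1 - x \<in> {1..2*r}" by auto
    then have "2*r + 1 - x \<le> 2*r + 1 - w x" using ge[of "2*r + 1 - x"] WB_opp[OF w True] by metis
    then show ?thesis using ge[OF True] True WB_mem[OF w, of x] by auto
  next
    case False then show ?thesis using WB_permutes[OF w] permutes_not_in by metis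
  qed
  then show ?thesis by auto
qed

text \<open>Induction along reduced words, without mentioning words.\<close>

lemma WB_induct [consumes 1, case_names id step]:
  assumes "w \<in> WB r" and "P id"
    and step: "\<And>w i. w \<in> WB r \<Longrightarrow> i \<in> {1..r} \<Longrightarrow> w i < w (i+1) \<Longrightarrow> P w \<Longrightarrow> P (w \<circ> cs r i)"
  shows "P w"
  using \<open>w \<in> WB r\<close>
proof (induction "lenB r w" arbitrary: w rule: less_induct)
  case less
  show ?case
  proof (cases "\<exists>i\<in>{1..r}. w (i+1) < w i")
    case True
    then obtain i where i: "i \<in> {1..r}" "w (i+1) < w i" by blast
    have w': "w \<circ> cs r i \<in> WB r" using less.prems i cs_WB WB_comp by blast
    have "P (w \<circ> cs r i)" using less.hyps[OF _ w'] lenB_down[OF less.prems i] by simp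
    then have "P (w \<circ> cs r i \<circ> cs r i)"
      by (rule step[OF w' i(1), rotated]) (use i in \<open>simp add: cs_left cs_right[simplified]\<close>)
    then show ?thesis by (simp add: comp_cs_cs)
  next
    case False
    then have "w i < w (i + 1)" if "i \<in> {1..r}" for i using that WB_up_or_down[OF less.prems] by blast
    then have "w = id" using WB_increasing[OF less.prems] by blast
    then show ?thesis using \<open>P id\<close> by simp
  qed
qed

lemma lenB_id: "lenB r id = 0"
proof -
  have "{(a, b). (a, b) \<in> {1..2*r} \<times> {1..2*r} \<and> a < b \<and> id b < id a} = {}" by auto
  moreover have "{i \<in> {1..r}. r < id i} = {}" by auto
  ultimately show ?thesis unfolding lenB_def linv_def neg_def by (metis card.empty add_0)
qed

text \<open>The parity of the number of sign changes is a character because only the generator \<open>s\<^sub>r\<close> affects it.\<close>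

lemma even_neg_comp:
  assumes v: "v \<in> WB r" and w: "w \<in> WB r"
  shows "even (neg r (w \<circ> v)) \<longleftrightarrow> (even (neg r w) \<longleftrightarrow> even (neg r v))"
proof -
  have *: "even (neg r (u \<circ> cs r i)) \<longleftrightarrow> (if i = r then odd (neg r u) else even (neg r u))"
    if u: "u \<in> WB r" and i: "i \<in> {1..r}" for u i
  proof (cases "i = r")
    case False then show ?thesis using neg_cs_less[OF u] i by auto
  next
    case True
    have r: "r \<ge> 1" using i by auto
    show ?thesis
    proof (cases "u r < u (r + 1)")
      case True then show ?thesis using neg_cs_last_up[OF u r] \<open>i = r\<close> by simp
    next
      case False
      then have "u (r + 1) < u r" using WB_up_or_down[OF u] by blast
      then have "neg r (u \<circ> cs r r \<circ> cs r r) = Suc (neg r (u \<circ> cs r r))"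
        using r u by (intro neg_cs_last_up) (auto intro: WB_comp_cs WB_cs_comp simp: cs_left cs_right[simplified])
      then show ?thesis using \<open>i = r\<close> by (simp add: comp_cs_cs)
    qed
  qed
  show ?thesis using v
  proof (induction rule: WB_induct)
    case id
    have "neg r id = 0" using lenB_id[of r] by (simp add: lenB_def)
    then show "even (neg r (w \<circ> id)) \<longleftrightarrow> (even (neg r w) \<longleftrightarrow> even (neg r id))" by simp
  next
    case (step v i)
    have IH: "even (neg r (w \<circ> v)) \<longleftrightarrow> (even (neg r w) \<longleftrightarrow> even (neg r v))" by (rule step.IH)
    have "w \<circ> v \<in> WB r" by (rule WB_comp[OF w step.hyps(1)])
    then have "even (neg r (w \<circ> (v \<circ> cs r i)))
        \<longleftrightarrow> (even (neg r w) \<longleftrightarrow> even (neg r (v \<circ> cs r i)))"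
      using *[OF step.hyps(1,2)] *[OF _ step.hyps(2), of "w \<circ> v"] IH unfolding comp_assoc[symmetric] by metis
    then show ?case .
  qed
qed

lemma WD_iff: "w \<in> WD r \<longleftrightarrow> w \<in> WB r \<and> even (neg r w)"
  by (simp add: WD_def neg_def)

lemma WD_comp_iff:
  "v \<in> WB r \<Longrightarrow> w \<in> WB r \<Longrightarrow> v \<circ> w \<in> WD r \<longleftrightarrow> (v \<in> WD r \<longleftrightarrow> w \<in> WD r)"
  using even_neg_comp[of w r v] WB_comp[of v r w] by (auto simp: WD_iff)

lemma WD_id: "id \<in> WD r"
  using lenB_id[of r] by (simp add: WD_iff WB_id lenB_def)

lemma WD_inv_iff: "w \<in> WB r \<Longrightarrow> pinv w \<in> WD r \<longleftrightarrow> w \<in> WD r"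
  using WD_comp_iff[OF WB_inv[of w r], of w] WD_id[of r] by (simp add: WB_inv_comp)

lemma cs_WD_iff: "i \<in> {1..r} \<Longrightarrow> cs r i \<in> WD r \<longleftrightarrow> i \<noteq> r"
proof -
  assume i: "i \<in> {1..r}"
  have n0: "neg r id = 0" using lenB_id[of r] by (simp add: lenB_def)
  show ?thesis
  proof (cases "i = r")
    case True
    then have "neg r (id \<circ> cs r r) = Suc (neg r id)" using i by (intro neg_cs_last_up WB_id) auto
    then show ?thesis using True n0 by (simp add: WD_iff)
  next
    case False
    then have "neg r (id \<circ> cs r i) = neg r id" using i by (intro neg_cs_less WB_id) auto
    then show ?thesis using False n0 cs_WB[OF i] by (simp add: WD_iff)
  qed
qed

section \<open>Reduced words\<close>

definition wprod :: "nat \<Rightarrow> nat list \<Rightarrow> nat \<Rightarrow> nat" where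
  "wprod r is = foldr (\<circ>) (map (cs r) is) id"

lemma wprod_Nil: "wprod r [] = id" and wprod_Cons: "wprod r (i # is) = cs r i \<circ> wprod r is"
  by (simp_all add: wprod_def)

lemma wprod_append: "wprod r (is @ js) = wprod r is \<circ> wprod r js"
  by (induction "is") (simp_all add: wprod_Nil wprod_Cons comp_assoc)

lemma wprod_snoc: "wprod r (is @ [i]) = wprod r is \<circ> cs r i"
  by (simp add: wprod_append wprod_Nil wprod_Cons)

lemma wprod_WB: "set is \<subseteq> {1..r} \<Longrightarrow> wprod r is \<in> WB r"
  by (induction "is") (auto simp: wprod_Nil wprod_Cons WB_id intro: WB_comp_cs WB_cs_comp)

lemma lenB_wprod: "set is \<subseteq> {1..r} \<Longrightarrow> lenB r (wprod r is) \<le> 2 * length is"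
proof (induction "is" rule: rev_induct)
  case (snoc i "is")
  then show "lenB r (wprod r (is @ [i])) \<le> 2 * length (is @ [i])"
    using lenB_cs_le[of "wprod r is" r i] wprod_WB[of "is" r] by (simp add: wprod_snoc)
next
  case Nil
  show "lenB r (wprod r []) \<le> 2 * length []" by (simp add: wprod_Nil lenB_id)
qed

lemma WB_word_exists:
  assumes "w \<in> WB r" shows "\<exists>is. set is \<subseteq> {1..r} \<and> wprod r is = w \<and> 2 * length is = lenB r w"
  using assms
proof (induction rule: WB_induct)
  case id
  show "\<exists>is. set is \<subseteq> {1..r} \<and> wprod r is = id \<and> 2 * length is = lenB r id"
    by (intro exI[of _ "[]"]) (simp add: wprod_Nil lenB_id)
next
  case (step w i)
  then obtain "is" where "set is \<subseteq> {1..r}" "wprod r is = w" "2 * length is = lenB r w" by blast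
  then have "set (is @ [i]) \<subseteq> {1..r} \<and> wprod r (is @ [i]) = w \<circ> cs r i \<and> 2 * length (is @ [i]) = lenB r (w \<circ> cs r i)"
    using lenB_up[OF step(1-3)] step(2) by (simp add: wprod_snoc)
  then show ?case by blast
qed

text \<open>A letter changes \<open>lenB\<close> by at most two, and following descents to the identity yields a word that
  attains this bound.\<close>

lemma word_length_lenB:
  assumes "w \<in> WB r" shows "2 * word_length (gensB r) w = lenB r w"
proof -
  obtain "is" where i: "set is \<subseteq> {1..r}" "wprod r is = w" "2 * length is = lenB r w"
    using WB_word_exists[OF assms] by blast
  have "word_length (gensB r) w = length is"
    unfolding word_length_def
  proof (rule Least_equality)
    show "\<exists>us. set us \<subseteq> gensB r \<and> length us = length is \<and> foldr (\<circ>) us id = w"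
      using i by (intro exI[of _ "map (cs r) is"]) (auto simp: gensB_def wprod_def)
    fix k assume "\<exists>us. set us \<subseteq> gensB r \<and> length us = k \<and> foldr (\<circ>) us id = w"
    then obtain us where us: "set us \<subseteq> gensB r" "length us = k" "foldr (\<circ>) us id = w" by blast
    have "us \<in> lists (cs r ` {1..r})" using us(1) by (auto simp: gensB_def)
    then have "us \<in> map (cs r) ` lists {1..r}" by (simp add: lists_image)
    then obtain js where js: "set js \<subseteq> {1..r}" "us = map (cs r) js" by auto
    have "lenB r w \<le> 2 * k" using lenB_wprod[OF js(1)] js us by (simp add: wprod_def)
    then show "length is \<le> k" using i by simp
  qed
  then show ?thesis using i by simp
qed

lemma reduced_expr_iff:
  assumes "w \<in> WB r"
  shows "reduced_expr r is w \<longleftrightarrow> set is \<subseteq> {1..r} \<and> wprod r is = w \<and> 2 * length is = lenB r w"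
proof -
  have "length is = word_length (gensB r) w \<longleftrightarrow> 2 * length is = lenB r w"
    using word_length_lenB[OF assms] by linarith
  then show ?thesis by (simp only: reduced_expr_def wprod_def)
qed

lemma reduced_exists: "w \<in> WB r \<Longrightarrow> \<exists>is. reduced_expr r is w"
  using WB_word_exists reduced_expr_iff by metis

lemma reduced_snoc:
  assumes "w \<in> WB r" "i \<in> {1..r}" "w i < w (i+1)" "reduced_expr r is w"
  shows "reduced_expr r (is @ [i]) (w \<circ> cs r i)"
proof -
  have "w \<circ> cs r i \<in> WB r" using assms WB_comp cs_WB by blast
  then show ?thesis using assms lenB_up[OF assms(1-3)] by (simp add: reduced_expr_iff wprod_snoc)
qed

text \<open>If \<open>i\<close> were an ascent, the word without its last letter would be too short for its value.\<close>

lemma reduced_snocD: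
  assumes w: "w \<in> WB r" and red: "reduced_expr r (is @ [i]) w"
  shows "i \<in> {1..r} \<and> w (i+1) < w i \<and> reduced_expr r is (w \<circ> cs r i)"
proof -
  have *: "set is \<subseteq> {1..r}" "i \<in> {1..r}" "wprod r is \<circ> cs r i = w" "2 * length is + 2 = lenB r w"
    using red by (auto simp: reduced_expr_iff[OF w] wprod_snoc)
  then have w': "w \<circ> cs r i = wprod r is" by (auto simp: comp_cs_cs)
  have le: "lenB r (w \<circ> cs r i) \<le> 2 * length is" using lenB_wprod[OF *(1)] w' by simp
  have d: "w (i+1) < w i"
  proof (rule ccontr)
    assume "\<not> w (i+1) < w i"
    then have "lenB r (w \<circ> cs r i) = lenB r w + 2" using WB_up_or_down[OF w] lenB_up[OF w *(2)] by blast
    then show False using le * by simp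
  qed
  have "reduced_expr r is (w \<circ> cs r i)"
    using lenB_down[OF w *(2) d] * w' WB_comp[OF w cs_WB[OF *(2)]] by (simp add: reduced_expr_iff)
  then show ?thesis using d * by blast
qed

lemma lenB_inv: assumes "w \<in> WB r" shows "lenB r (pinv w) = lenB r w"
proof -
  have le: "lenB r (pinv w) \<le> lenB r w" if w: "w \<in> WB r" for w
  proof -
    obtain "is" where i: "set is \<subseteq> {1..r}" "wprod r is = w" "2 * length is = lenB r w"
      using WB_word_exists[OF w] by blast
    have "wprod r (rev is) = pinv (wprod r is)" using i(1)
    proof (induction "is")
      case (Cons a "is")
      then show "wprod r (rev (a # is)) = pinv (wprod r (a # is))" using wprod_WB[of "is" r] cs_WB[of a r]
        by (simp add: wprod_append wprod_Cons wprod_Nil WB_inv_compose cs_inv)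
    next
      case Nil
      show "wprod r (rev []) = pinv (wprod r [])" by (simp add: wprod_Nil)
    qed
    then show ?thesis using lenB_wprod[of "rev is" r] i by simp
  qed
  show ?thesis using le[OF assms] le[OF WB_inv[OF assms]] WB_inv_inv[OF assms] by simp
qed

lemma reduced_Cons:
  assumes w: "w \<in> WB r" and i: "i \<in> {1..r}" and up: "pinv w i < pinv w (i+1)" and red: "reduced_expr r is w"
  shows "reduced_expr r (i # is) (cs r i \<circ> w)"
proof -
  have s: "cs r i \<circ> w \<in> WB r" using w i WB_comp cs_WB by blast
  have "lenB r (cs r i \<circ> w) = lenB r (pinv w \<circ> cs r i)"
    using lenB_inv[OF s] WB_inv_compose[OF cs_WB[OF i] w] by (simp add: cs_inv)
  also have "\<dots> = lenB r w + 2" using lenB_up[OF WB_inv[OF w] i up] lenB_inv[OF w] by simp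
  finally show ?thesis using red i by (simp add: reduced_expr_iff[OF s] reduced_expr_iff[OF w] wprod_Cons)
qed

section \<open>Blocks\<close>

definition cum :: "nat \<Rightarrow> (nat \<Rightarrow> nat) \<Rightarrow> nat \<Rightarrow> nat" where
  "cum n l i = (\<Sum>k\<in>{1..<i}. hat n l k)"

text \<open>The index of the block of \<open>l\<close> that contains \<open>x\<close>, meaningful for \<open>x \<in> {1..2*r}\<close>. As a monotone function
  compatible with the reversal \<open>x \<mapsto> 2r+1-x\<close> it is easier to handle than the family of intervals.\<close>

definition bk :: "nat \<Rightarrow> (nat \<Rightarrow> nat) \<Rightarrow> nat \<Rightarrow> nat" where
  "bk n l x = (LEAST i. x \<le> cum n l (i + 1))"

lemma cum_Suc: "i \<ge> 1 \<Longrightarrow> cum n l (Suc i) = cum n l i + hat n l i"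
  by (simp add: cum_def)

lemma cum_mono: "i \<le> j \<Longrightarrow> cum n l i \<le> cum n l j"
  unfolding cum_def by (rule sum_mono2) auto

lemma block_cum: "block n l i = {cum n l i <.. cum n l (i + 1)}"
  by (simp add: block_def cum_def atLeastLessThanSuc_atLeastAtMost)

lemma cum_hat_rev: "i \<le> 2*n + 2 \<Longrightarrow> (\<Sum>k\<in>{i..<2*n+2}. hat n l k) = cum n l (2*n + 3 - i)" if "i \<ge> 1"
  unfolding cum_def
  by (rule sum.reindex_bij_witness[of _ "\<lambda>k. 2*n + 2 - k" "\<lambda>k. 2*n + 2 - k"])
     (use that in \<open>auto simp: hat_def\<close>)

lemma cum_low: "i \<le> n + 1 \<Longrightarrow> cum n l i = (\<Sum>k\<in>{1..<i}. l k)"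
  unfolding cum_def by (rule sum.cong) (auto simp: hat_def)

lemma Lam_cum_mid:
  assumes "l \<in> Lam n r" shows "cum n l (n + 1) + l (n + 1) = r"
proof -
  have "{1..n+1} = insert (n+1) {1..<n+1}" by auto
  then show ?thesis using assms cum_low[of "n+1" n l] by (simp add: Lam_def)
qed

lemma Lam_cum_mid2:
  assumes "l \<in> Lam n r" shows "cum n l (n + 2) = r + l (n + 1)"
  using cum_Suc[of "n+1" n l] Lam_cum_mid[OF assms] by (simp add: hat_def)

lemma Lam_cum_top:
  assumes "l \<in> Lam n r" shows "cum n l (2*n + 2) = 2 * r"
proof -
  have "cum n l (2*n + 2) = cum n l (n + 2) + (\<Sum>k\<in>{n+2..<2*n+2}. hat n l k)"
    unfolding cum_def by (rule sum.atLeastLessThan_concat[symmetric]) auto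
  also have "(\<Sum>k\<in>{n+2..<2*n+2}. hat n l k) = cum n l (n + 1)"
    using cum_hat_rev[of "n+2" n l] by simp
  finally show ?thesis using Lam_cum_mid[OF assms] Lam_cum_mid2[OF assms] by simp
qed

lemma cum_sym:
  assumes "l \<in> Lam n r" "1 \<le> i" "i \<le> 2*n + 2"
  shows "cum n l (2*n + 3 - i) + cum n l i = 2 * r"
proof -
  have "cum n l (2*n + 2) = cum n l i + (\<Sum>k\<in>{i..<2*n+2}. hat n l k)"
    unfolding cum_def by (rule sum.atLeastLessThan_concat[symmetric]) (use assms in auto)
  then show ?thesis using cum_hat_rev[of i n l] assms Lam_cum_top[OF assms(1)] by simp
qed

lemma bk_bounds:
  assumes "l \<in> Lam n r" "x \<in> {1..2*r}"
  shows "1 \<le> bk n l x" "bk n l x \<le> 2*n + 1" "cum n l (bk n l x) < x" "x \<le> cum n l (bk n l x + 1)"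
proof -
  have ex: "x \<le> cum n l ((2*n + 1) + 1)" using Lam_cum_top[OF assms(1)] assms(2) by simp
  show "bk n l x \<le> 2*n + 1" unfolding bk_def by (rule Least_le[of "\<lambda>i. x \<le> cum n l (i + 1)", OF ex])
  show up: "x \<le> cum n l (bk n l x + 1)" unfolding bk_def
    by (rule LeastI[of "\<lambda>i. x \<le> cum n l (i + 1)", OF ex])
  have "cum n l 1 = 0" by (simp add: cum_def)
  then show ge: "1 \<le> bk n l x" using up assms(2) by (cases "bk n l x = 0") auto
  then have "\<not> x \<le> cum n l ((bk n l x - 1) + 1)"
    unfolding bk_def by (intro not_less_Least) simp
  then show "cum n l (bk n l x) < x" using ge by simp
qed

lemma bk_unique:
  assumes "l \<in> Lam n r" "x \<in> {1..2*r}" "cum n l i < x" "x \<le> cum n l (i + 1)"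
  shows "bk n l x = i"
proof (rule ccontr)
  note b = bk_bounds[OF assms(1,2)]
  assume "bk n l x \<noteq> i"
  then consider "bk n l x + 1 \<le> i" | "i + 1 \<le> bk n l x" by linarith
  then show False using cum_mono[of "bk n l x + 1" i n l] cum_mono[of "i + 1" "bk n l x" n l] b assms
    by cases auto
qed

lemma block_bk:
  assumes "l \<in> Lam n r" "i \<in> {1..2*n+1}"
  shows "block n l i = {x \<in> {1..2*r}. bk n l x = i}"
proof -
  have "cum n l (i + 1) \<le> 2*r" using cum_mono[of "i+1" "2*n+2" n l] Lam_cum_top[OF assms(1)] assms(2) by auto
  then show ?thesis using bk_bounds[OF assms(1)] bk_unique[OF assms(1)] by (force simp: block_cum)
qed

lemma card_bk:
  assumes "l \<in> Lam n r" "i \<in> {1..2*n+1}"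
  shows "card {x \<in> {1..2*r}. bk n l x = i} = hat n l i"
  unfolding block_bk[OF assms, symmetric] block_cum using cum_Suc[of i n l] assms(2) by simp

lemma bk_mono:
  assumes "l \<in> Lam n r" "x \<in> {1..2*r}" "y \<in> {1..2*r}" "x \<le> y"
  shows "bk n l x \<le> bk n l y"
proof (rule ccontr)
  assume "\<not> bk n l x \<le> bk n l y"
  then have "cum n l (bk n l y + 1) \<le> cum n l (bk n l x)" by (intro cum_mono) simp
  then show False using bk_bounds(3)[OF assms(1,2)] bk_bounds(4)[OF assms(1,3)] assms(4) by linarith
qed

lemma bk_sym:
  assumes "l \<in> Lam n r" "x \<in> {1..2*r}"
  shows "bk n l (2*r + 1 - x) = 2*n + 2 - bk n l x"
proof (rule bk_unique[OF assms(1)])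
  note b = bk_bounds[OF assms]
  show "2*r + 1 - x \<in> {1..2*r}" using assms by auto
  have "cum n l (2*n + 3 - (bk n l x + 1)) + cum n l (bk n l x + 1) = 2*r"
    using cum_sym[OF assms(1), of "bk n l x + 1"] b by simp
  then show "cum n l (2*n + 2 - bk n l x) < 2*r + 1 - x" using b assms(2) by simp
  have "2*n + 2 - bk n l x + 1 = 2*n + 3 - bk n l x" using b by simp
  then show "2*r + 1 - x \<le> cum n l (2*n + 2 - bk n l x + 1)"
    using cum_sym[OF assms(1), of "bk n l x"] b by simp
qed

lemma bk_le_mid: assumes "l \<in> Lam n r" "x \<in> {1..r}" shows "bk n l x \<le> n + 1"
proof -
  have "bk n l x \<le> bk n l (2*r + 1 - x)" using assms by (intro bk_mono) auto
  then show ?thesis using bk_sym[of l n r x] assms bk_bounds[of l n r x] by auto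
qed

lemma bk_ge_mid: assumes "l \<in> Lam n r" "x \<in> {r+1..2*r}" shows "n + 1 \<le> bk n l x"
proof -
  have "2*r + 1 - x \<in> {1..r}" using assms by auto
  then have "bk n l (2*r + 1 - x) \<le> n + 1" by (rule bk_le_mid[OF assms(1)])
  then show ?thesis using bk_sym[of l n r x] assms bk_bounds[of l n r x] by auto
qed

lemma bk_r_mid:
  assumes "l \<in> Lam n r" "l (n + 1) \<noteq> 0"
  shows "bk n l r = n + 1" "bk n l (r + 1) = n + 1"
proof -
  have "cum n l (n + 1) < r" "r + 1 \<le> cum n l (n + 1 + 1)"
    using Lam_cum_mid[OF assms(1)] Lam_cum_mid2[OF assms(1)] assms(2) by auto
  then show "bk n l r = n + 1" "bk n l (r + 1) = n + 1"
    by (auto intro!: bk_unique[OF assms(1)])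
qed

lemma bk_no_mid:
  assumes "l \<in> Lam n r" "l (n + 1) = 0" "x \<in> {1..2*r}"
  shows "bk n l x \<noteq> n + 1"
  using bk_bounds(3,4)[OF assms(1,3)] Lam_cum_mid[OF assms(1)] Lam_cum_mid2[OF assms(1)] assms(2) by auto

section \<open>Parabolic subgroups as block stabilizers\<close>

definition stab :: "nat \<Rightarrow> nat \<Rightarrow> (nat \<Rightarrow> nat) \<Rightarrow> (nat \<Rightarrow> nat) set" where
  "stab n r l = {w \<in> WB r. \<forall>x\<in>{1..2*r}. bk n l (w x) = bk n l x}"

lemma stab_WB: "w \<in> stab n r l \<Longrightarrow> w \<in> WB r"
  by (simp add: stab_def)

lemma stab_bk: "w \<in> stab n r l \<Longrightarrow> x \<in> {1..2*r} \<Longrightarrow> bk n l (w x) = bk n l x"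
  by (simp add: stab_def)

lemma stab_id: "id \<in> stab n r l"
  by (simp add: stab_def WB_id)

lemma stab_comp: "u \<in> stab n r l \<Longrightarrow> v \<in> stab n r l \<Longrightarrow> u \<circ> v \<in> stab n r l"
  by (simp add: stab_def WB_comp) (metis WB_mem atLeastAtMost_iff One_nat_def)

lemma stab_inv: assumes "u \<in> stab n r l" shows "pinv u \<in> stab n r l"
proof -
  have u: "u \<in> WB r" using assms by (rule stab_WB)
  have "bk n l (pinv u x) = bk n l x" if "x \<in> {1..2*r}" for x
    using stab_bk[OF assms, of "pinv u x"] WB_mem[OF WB_inv[OF u], of x] that WB_inv_apply(2)[OF u] by metis
  then show ?thesis using WB_inv[OF u] by (simp add: stab_def)
qed

lemma cs_stab:
  assumes "l \<in> Lam n r" "i \<in> {1..r}" "bk n l i = bk n l (i + 1)"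
  shows "cs r i \<in> stab n r l"
proof -
  have i: "1 \<le> i" "i \<le> r" using assms by auto
  have "bk n l (cs r i x) = bk n l x" if x: "x \<in> {1..2*r}" for x
  proof -
    have c: "cs r i (2*r + 1 - i) = 2*r + 1 - cs r i i" "cs r i (2*r + 1 - (i+1)) = 2*r + 1 - cs r i (i+1)"
      using WB_opp[OF cs_WB[OF assms(2)], of i] WB_opp[OF cs_WB[OF assms(2)], of "i+1"] i by auto
    have b: "bk n l (2*r + 1 - i) = 2*n + 2 - bk n l i" "bk n l (2*r + 1 - (i+1)) = 2*n + 2 - bk n l (i+1)"
      by (rule bk_sym[OF assms(1)]; use i in simp)+
    consider "x = i" | "x = i + 1" | "x = 2*r + 1 - i" | "x = 2*r + 1 - (i+1)"
      | "x \<noteq> i" "x \<noteq> i + 1" "x \<noteq> 2*r - i" "x \<noteq> 2*r + 1 - i" by force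
    then show ?thesis
      using cs_left[OF assms(2)] cs_right[OF assms(2)] c b assms(3) cs_other[OF assms(2), of x]
      by cases metis+
  qed
  then show ?thesis using cs_WB[OF assms(2)] by (simp add: stab_def)
qed

text \<open>Block indices are monotone, so in the stabilizer a descent can only occur within a block.\<close>

lemma stab_step:
  assumes l: "l \<in> Lam n r" and w: "w \<in> WB r" and i: "i \<in> {1..r}" and up: "w i < w (i+1)"
    and st: "w \<circ> cs r i \<in> stab n r l"
  shows "bk n l i = bk n l (i+1)" "w \<in> stab n r l"
proof -
  have i2: "i \<in> {1..2*r}" "i + 1 \<in> {1..2*r}" using i by auto
  have e: "bk n l (w (i+1)) = bk n l i" "bk n l (w i) = bk n l (i+1)"
    using stab_bk[OF st i2(1)] stab_bk[OF st i2(2)] cs_left[OF i] cs_right[OF i] by (metis comp_apply)+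
  have "bk n l (w i) \<le> bk n l (w (i+1))"
    using bk_mono[OF l, of "w i" "w (i+1)"] up i2 WB_mem[OF w, of i] WB_mem[OF w, of "i+1"] by (simp only: less_imp_le)
  moreover have "bk n l i \<le> bk n l (i+1)" by (rule bk_mono[OF l i2]) simp
  ultimately show eq: "bk n l i = bk n l (i+1)" using e by simp
  have "w \<circ> cs r i \<circ> cs r i \<in> stab n r l" using stab_comp[OF st cs_stab[OF l i eq]] .
  then show "w \<in> stab n r l" by (simp only: comp_cs_cs)
qed

lemma group_WB: "group (WB_group r)"
proof (rule groupI)
  fix x assume "x \<in> carrier (WB_group r)"
  then show "\<exists>y\<in>carrier (WB_group r). y \<otimes>\<^bsub>WB_group r\<^esub> x = \<one>\<^bsub>WB_group r\<^esub>"
    by (intro bexI[of _ "pinv x"]) (auto simp: WB_group_def WB_inv_comp WB_inv)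
qed (auto simp: WB_group_def WB_comp WB_id comp_assoc)

text \<open>The partial sums left out in the definition of the parabolic subgroup are the ends of blocks.\<close>

lemma cs_partial_sum:
  assumes l: "l \<in> Lam n r" and i: "i \<in> {1..r}"
  shows "i \<in> {\<Sum>k\<in>{1..j}. l k | j. j \<in> {1..n}} \<longleftrightarrow> bk n l i \<noteq> bk n l (i + 1)"
proof
  have i2: "i \<in> {1..2*r}" "i + 1 \<in> {1..2*r}" using i by auto
  note b1 = bk_bounds[OF l i2(1)] and b2 = bk_bounds[OF l i2(2)]
  {
    assume "i \<in> {\<Sum>k\<in>{1..j}. l k | j. j \<in> {1..n}}"
    then obtain j where j: "j \<in> {1..n}" "i = (\<Sum>k\<in>{1..j}. l k)" by blast
    then have e: "i = cum n l (j + 1)" using cum_low[of "j+1" n l] by (simp add: atLeastLessThanSuc_atLeastAtMost)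
    show "bk n l i \<noteq> bk n l (i + 1)"
    proof
      assume eq: "bk n l i = bk n l (i + 1)"
      have "bk n l i < j + 1" using b1(3) e cum_mono[of "j+1" "bk n l i" n l] by (metis leD not_le_imp_less)
      then have "cum n l (bk n l (i+1) + 1) \<le> i" using e eq cum_mono[of "bk n l i + 1" "j+1" n l] by simp
      then show False using b2(4) by simp
    qed
  }
  assume ne: "bk n l i \<noteq> bk n l (i + 1)"
  define j where "j = bk n l i"
  have lt: "j + 1 \<le> bk n l (i + 1)" using ne bk_mono[OF l i2] j_def by simp
  have e: "i = cum n l (j + 1)"
  proof (rule le_antisym)
    show "i \<le> cum n l (j + 1)" using b1(4) by (simp only: j_def)
    show "cum n l (j + 1) \<le> i" using b2(3) cum_mono[OF lt, of n l] by linarith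
  qed
  have "j \<le> n"
  proof (rule ccontr)
    assume "\<not> j \<le> n"
    then have j1: "j = n + 1" using bk_le_mid[OF l i] j_def by simp
    have "i = r + l (n+1)" using e Lam_cum_mid2[OF l] unfolding j1 by simp
    then have "l (n + 1) = 0" using i by simp
    moreover have "bk n l i = n + 1" using j1 unfolding j_def .
    ultimately show False using bk_no_mid[OF l _ i2(1)] by blast
  qed
  then have jn: "j \<in> {1..n}" using b1(1) unfolding j_def atLeastAtMost_iff by (rule conjI[rotated])
  have "{1..<j+1} = {1..j}" by auto
  then have "cum n l (j + 1) = (\<Sum>k\<in>{1..j}. l k)"
    using cum_low[of "j+1" n l] jn by simp
  with e have "i = (\<Sum>k\<in>{1..j}. l k)" by (rule trans)
  with jn show "i \<in> {\<Sum>k\<in>{1..j}. l k | j. j \<in> {1..n}}" by (intro CollectI exI[of _ j] conjI)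
qed

text \<open>An element of the stabilizer is reduced to the identity by removing descents, and by
  \<open>stab_step\<close> each removed generator belongs to the parabolic subgroup.\<close>

lemma parabolic_stab:
  assumes l: "l \<in> Lam n r" shows "parabolic n r l = stab n r l"
proof -
  interpret G: group "WB_group r" by (rule group_WB)
  define S where "S = {1..r} - {\<Sum>k\<in>{1..i}. l k | i. i \<in> {1..n}}"
  have S: "i \<in> S \<longleftrightarrow> i \<in> {1..r} \<and> bk n l i = bk n l (i + 1)" for i
    by (simp only: S_def Diff_iff cs_partial_sum[OF l] not_not cong: conj_cong)
  have par: "parabolic n r l = generate (WB_group r) (cs r ` S)" by (simp only: parabolic_def S_def)
  have inv_cs: "inv\<^bsub>WB_group r\<^esub> (cs r i) = cs r i" if "i \<in> S" for i
  proof (rule G.inv_equality)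
    show "cs r i \<otimes>\<^bsub>WB_group r\<^esub> cs r i = \<one>\<^bsub>WB_group r\<^esub>" by (simp add: WB_group_def cs_cs)
    show "cs r i \<in> carrier (WB_group r)" "cs r i \<in> carrier (WB_group r)"
      using that S[of i] cs_WB[of i r] by (simp_all add: WB_group_def)
  qed
  have "w \<in> stab n r l" if "w \<in> generate (WB_group r) (cs r ` S)" for w
    using that
  proof induction
    case one show "\<one>\<^bsub>WB_group r\<^esub> \<in> stab n r l" by (simp only: WB_group_def monoid.simps stab_id)
  next
    case (incl h)
    then obtain i where "i \<in> S" "h = cs r i" by blast
    then show ?case using S[of i] cs_stab[OF l, of i] by simp
  next
    case (inv h)
    then obtain i where i: "i \<in> S" "h = cs r i" by blast
    then have "cs r i \<in> stab n r l" using S[of i] cs_stab[OF l, of i] by simp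
    then show ?case using inv_cs[OF i(1)] i(2) by simp
  next
    case (eng h1 h2)
    have "h1 \<circ> h2 \<in> stab n r l" by (rule stab_comp[OF eng.IH])
    then show ?case by (simp only: WB_group_def monoid.simps)
  qed
  moreover have "w \<in> stab n r l \<longrightarrow> w \<in> generate (WB_group r) (cs r ` S)" if "w \<in> WB r" for w
    using that
  proof (induction rule: WB_induct)
    case id
    have "id \<in> generate (WB_group r) (cs r ` S)"
      using generate.one[of "WB_group r" "cs r ` S"] by (simp only: WB_group_def monoid.simps)
    then show ?case by blast
  next
    case (step w i)
    have "w \<circ> cs r i \<in> generate (WB_group r) (cs r ` S)" if st: "w \<circ> cs r i \<in> stab n r l"
    proof -
      note eq = stab_step(1)[OF l step(1,2,3) st]
      have "w \<in> stab n r l" by (rule stab_step(2)[OF l step(1,2,3) st])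
      then have "w \<in> generate (WB_group r) (cs r ` S)" using step.IH by blast
      moreover have "cs r i \<in> generate (WB_group r) (cs r ` S)"
        by (rule generate.incl, rule imageI) (use eq S[of i] step(2) in blast)
      ultimately show ?thesis using generate.eng[of w "WB_group r" "cs r ` S" "cs r i"] by (simp only: WB_group_def monoid.simps)
    qed
    then show ?case by blast
  qed
  ultimately have "generate (WB_group r) (cs r ` S) = stab n r l" using stab_WB by (intro subset_antisym subsetI) blast+
  then show ?thesis using par by simp
qed

section \<open>Matrices\<close>

text \<open>The matrix of \<open>w\<close> counts the points of column block \<open>j\<close> with image in row block \<open>i\<close>. It makes sense
  for every \<open>w\<close>, whether minimal in its double coset or not.\<close>

definition mat :: "nat \<Rightarrow> nat \<Rightarrow> (nat \<Rightarrow> nat) \<Rightarrow> (nat \<Rightarrow> nat) \<Rightarrow> (nat \<Rightarrow> nat) \<Rightarrow> nat \<Rightarrow> nat \<Rightarrow> nat" where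
  "mat n r l w m i j = (if i \<in> {1..2*n+1} \<and> j \<in> {1..2*n+1}
     then card {x \<in> {1..2*r}. bk n l (w x) = i \<and> bk n m x = j} else 0)"

lemma triple_matrix_mat:
  assumes "l \<in> Lam n r" "m \<in> Lam n r" "d \<in> WB r"
  shows "triple_matrix n (l, d, m) = mat n r l d m"
proof (intro ext)
  fix i j
  show "triple_matrix n (l, d, m) i j = mat n r l d m i j"
  proof (cases "i \<in> {1..2*n+1} \<and> j \<in> {1..2*n+1}")
    case True
    have "block n l i \<inter> d ` block n m j = d ` {x \<in> {1..2*r}. bk n l (d x) = i \<and> bk n m x = j}"
      using True WB_mem[OF assms(3)] by (auto simp: block_bk[OF assms(1)] block_bk[OF assms(2)])
    then show ?thesis using True card_image[OF inj_on_subset[OF WB_inj[OF assms(3)] subset_UNIV]]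
      unfolding triple_matrix_def mat_def by (simp only: prod.case if_True)
  next
    case False then show ?thesis by (auto simp: triple_matrix_def mat_def)
  qed
qed

lemma sum_card_fibres:
  assumes "finite X" "finite J"
  shows "(\<Sum>j\<in>J. card {x \<in> X. P x \<and> f x = j}) = card {x \<in> X. P x \<and> f x \<in> J}"
proof -
  have "card {x \<in> X. P x \<and> f x \<in> J} = (\<Sum>x\<in>{x \<in> X. P x \<and> f x \<in> J}. 1)" by simp
  also have "\<dots> = (\<Sum>j\<in>J. \<Sum>x\<in>{x \<in> {x \<in> X. P x \<and> f x \<in> J}. f x = j}. 1)"
    using assms by (intro sum.group[symmetric]) auto
  also have "\<dots> = (\<Sum>j\<in>J. card {x \<in> X. P x \<and> f x = j})"
    by (intro sum.cong refl) (auto intro!: arg_cong[where f = card])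
  finally show ?thesis by simp
qed

lemma sum_mat:
  assumes "I \<subseteq> {1..2*n+1}" "J \<subseteq> {1..2*n+1}"
  shows "(\<Sum>i\<in>I. \<Sum>j\<in>J. mat n r l w m i j) = card {x \<in> {1..2*r}. bk n l (w x) \<in> I \<and> bk n m x \<in> J}"
proof -
  have fin: "finite I" "finite J" using assms finite_subset by blast+
  have "(\<Sum>j\<in>J. mat n r l w m i j) = card {x \<in> {1..2*r}. bk n m x \<in> J \<and> bk n l (w x) = i}" if "i \<in> I" for i
  proof -
    have "(\<Sum>j\<in>J. mat n r l w m i j) = (\<Sum>j\<in>J. card {x \<in> {1..2*r}. bk n l (w x) = i \<and> bk n m x = j})"
      using assms that by (intro sum.cong) (auto simp: mat_def)
    also have "\<dots> = card {x \<in> {1..2*r}. bk n l (w x) = i \<and> bk n m x \<in> J}"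
      by (rule sum_card_fibres) (use fin in auto)
    finally show ?thesis by (simp only: conj_commute)
  qed
  then have "(\<Sum>i\<in>I. \<Sum>j\<in>J. mat n r l w m i j) = (\<Sum>i\<in>I. card {x \<in> {1..2*r}. bk n m x \<in> J \<and> bk n l (w x) = i})"
    by (rule sum.cong[OF refl])
  also have "\<dots> = card {x \<in> {1..2*r}. bk n m x \<in> J \<and> bk n l (w x) \<in> I}"
    by (rule sum_card_fibres) (use fin in auto)
  finally show ?thesis by (simp only: conj_commute)
qed

lemma ro_mat:
  assumes l: "l \<in> Lam n r" and m: "m \<in> Lam n r" and w: "w \<in> WB r"
  shows "ro n (mat n r l w m) = hat n l"
proof (rule ext)
  fix i
  show "ro n (mat n r l w m) i = hat n l i"
  proof (cases "i \<in> {1..2*n+1}")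
    case True
    have "ro n (mat n r l w m) i = (\<Sum>i\<in>{i}. \<Sum>j\<in>{1..2*n+1}. mat n r l w m i j)" by (simp add: ro_def)
    also have "\<dots> = card {x \<in> {1..2*r}. bk n l (w x) \<in> {i} \<and> bk n m x \<in> {1..2*n+1}}"
      by (rule sum_mat) (use True in auto)
    also have "{x \<in> {1..2*r}. bk n l (w x) \<in> {i} \<and> bk n m x \<in> {1..2*n+1}} = pinv w ` {y \<in> {1..2*r}. bk n l y = i}"
    proof (rule Set.set_eqI)
      fix x
      have "w x \<in> {1..2*r} \<longleftrightarrow> x \<in> {1..2*r}" by (rule WB_mem[OF w])
      moreover have "x \<in> {1..2*r} \<Longrightarrow> bk n m x \<in> {1..2*n+1}" using bk_bounds[OF m] by auto
      moreover have "x \<in> pinv w ` {y \<in> {1..2*r}. bk n l y = i} \<longleftrightarrow> w x \<in> {y \<in> {1..2*r}. bk n l y = i}"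
        using WB_inv_apply[OF w] by (metis (no_types, lifting) imageE imageI)
      ultimately show "x \<in> {x \<in> {1..2*r}. bk n l (w x) \<in> {i} \<and> bk n m x \<in> {1..2*n+1}}
        \<longleftrightarrow> x \<in> pinv w ` {y \<in> {1..2*r}. bk n l y = i}" by blast
    qed
    also have "card \<dots> = hat n l i"
      using card_bk[OF l True] card_image[OF inj_on_subset[OF WB_inj[OF WB_inv[OF w]] subset_UNIV]] by metis
    finally show ?thesis .
  next
    case False then show ?thesis by (auto simp: ro_def mat_def hat_def)
  qed
qed

lemma co_mat:
  assumes l: "l \<in> Lam n r" and m: "m \<in> Lam n r" and w: "w \<in> WB r"
  shows "co n (mat n r l w m) = hat n m"
proof (rule ext)
  fix j
  show "co n (mat n r l w m) j = hat n m j"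
  proof (cases "j \<in> {1..2*n+1}")
    case True
    have "co n (mat n r l w m) j = (\<Sum>i\<in>{1..2*n+1}. \<Sum>j\<in>{j}. mat n r l w m i j)" by (simp add: co_def)
    also have "\<dots> = card {x \<in> {1..2*r}. bk n l (w x) \<in> {1..2*n+1} \<and> bk n m x \<in> {j}}"
      by (rule sum_mat) (use True in auto)
    also have "{x \<in> {1..2*r}. bk n l (w x) \<in> {1..2*n+1} \<and> bk n m x \<in> {j}} = {x \<in> {1..2*r}. bk n m x = j}"
      using bk_bounds(1,2)[OF l] WB_mem[OF w] by force
    also have "card \<dots> = hat n m j" by (rule card_bk[OF m True])
    finally show ?thesis .
  next
    case False then show ?thesis by (auto simp: co_def mat_def hat_def)
  qed
qed

lemma mat_Xi:
  assumes l: "l \<in> Lam n r" and m: "m \<in> Lam n r" and w: "w \<in> WB r"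
  shows "mat n r l w m \<in> Xi n r"
proof -
  have "mat n r l w m i j = mat n r l w m (2*n + 2 - i) (2*n + 2 - j)" if ij: "i \<in> {1..2*n+1}" "j \<in> {1..2*n+1}" for i j
  proof -
    let ?X = "\<lambda>i j. {x \<in> {1..2*r}. bk n l (w x) = i \<and> bk n m x = j}"
    have *: "(\<lambda>x. 2*r + 1 - x) ` ?X i j \<subseteq> ?X (2*n + 2 - i) (2*n + 2 - j)" for i j
    proof safe
      fix x assume x: "x \<in> {1..2*r}"
      have wx: "w x \<in> {1..2*r}" using WB_mem[OF w] x by blast
      show "2*r + 1 - x \<in> {1..2*r}" using x by auto
      show "bk n m (2*r + 1 - x) = 2*n + 2 - bk n m x" by (rule bk_sym[OF m x])
      show "bk n l (w (2*r + 1 - x)) = 2*n + 2 - bk n l (w x)" using bk_sym[OF l wx] WB_opp[OF w x] by simp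
    qed
    have inj: "inj_on (\<lambda>x. 2*r + 1 - x) (?X i j)" for i j by (auto simp: inj_on_def)
    have le: "card (?X i j) \<le> card (?X (2*n + 2 - i) (2*n + 2 - j))" for i j
      by (rule card_inj_on_le[OF inj *]) auto
    have "2*n + 2 - (2*n + 2 - i) = i" "2*n + 2 - (2*n + 2 - j) = j" using ij by auto
    then have "card (?X i j) = card (?X (2*n + 2 - i) (2*n + 2 - j))"
      using le[of i j] le[of "2*n + 2 - i" "2*n + 2 - j"] by simp
    then show ?thesis using ij by (auto simp: mat_def)
  qed
  moreover have "(\<Sum>i\<in>{1..2*n+1}. \<Sum>j\<in>{1..2*n+1}. mat n r l w m i j) = 2*r"
  proof -
    have "{x \<in> {1..2*r}. bk n l (w x) \<in> {1..2*n+1} \<and> bk n m x \<in> {1..2*n+1}} = {1..2*r}"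
      using bk_bounds(1,2)[OF l] bk_bounds(1,2)[OF m] WB_mem[OF w] by force
    then show ?thesis by (simp only: sum_mat[OF subset_refl subset_refl] card_atLeastAtMost)
  qed
  moreover have "mat n r l w m i j = 0" if "i \<notin> {1..2*n+1} \<or> j \<notin> {1..2*n+1}" for i j
    using that by (simp only: mat_def) (metis (no_types, lifting))
  ultimately show ?thesis unfolding Xi_def by blast
qed

lemma mat_stab:
  assumes l: "l \<in> Lam n r" and m: "m \<in> Lam n r" and w: "w \<in> WB r" and u: "u \<in> stab n r l" and v: "v \<in> stab n r m"
  shows "mat n r l (u \<circ> w \<circ> v) m = mat n r l w m"
proof (intro ext)
  fix i j
  have "{x \<in> {1..2*r}. bk n l (w x) = i \<and> bk n m x = j}
     = v ` {x \<in> {1..2*r}. bk n l ((u \<circ> w \<circ> v) x) = i \<and> bk n m x = j}" (is "?L = v ` ?R")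
  proof -
    have *: "v x \<in> ?L \<longleftrightarrow> x \<in> ?R" for x
      using WB_mem[OF stab_WB[OF v], of x] stab_bk[OF v, of x] stab_bk[OF u, of "w (v x)"] WB_mem[OF w, of "v x"]
      by auto
    show ?thesis
    proof (rule Set.set_eqI)
      fix y
      have e: "v (pinv v y) = y" by (rule WB_inv_apply(2)[OF stab_WB[OF v]])
      have h: "v (pinv v y) \<in> v ` ?R \<longleftrightarrow> pinv v y \<in> ?R"
        by (rule inj_image_mem_iff[OF WB_inj[OF stab_WB[OF v]]])
      show "y \<in> ?L \<longleftrightarrow> y \<in> v ` ?R" by (rule HOL.trans[OF *[of "pinv v y", unfolded e] h[unfolded e, symmetric]])
    qed
  qed
  then have "card {x \<in> {1..2*r}. bk n l (w x) = i \<and> bk n m x = j} = card ?R"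
    by (simp only: card_image[OF inj_on_subset[OF WB_inj[OF stab_WB[OF v]] subset_UNIV]])
  then show "mat n r l (u \<circ> w \<circ> v) m i j = mat n r l w m i j" unfolding mat_def by (simp only:)
qed

section \<open>Ranks\<close>

text \<open>Ranks turn a finite set ordered by a key into the interval \<open>{1..N}\<close>. They are used to construct signed
  permutations from lexicographic orders.\<close>

definition rank :: "'a set \<Rightarrow> ('a \<Rightarrow> 'k::linorder) \<Rightarrow> 'a \<Rightarrow> nat" where
  "rank P key p = card {q \<in> P. key q \<le> key p}"

lemma rank_less:
  assumes "finite P" "p \<in> P" "q \<in> P" "key p < key q"
  shows "rank P key p < rank P key q"
  unfolding rank_def
proof (rule psubset_card_mono)
  have "{a \<in> P. key a \<le> key p} \<subseteq> {a \<in> P. key a \<le> key q}" using assms by auto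
  moreover have "q \<in> {a \<in> P. key a \<le> key q}" "q \<notin> {a \<in> P. key a \<le> key p}" using assms by auto
  ultimately show "{a \<in> P. key a \<le> key p} \<subset> {a \<in> P. key a \<le> key q}" by blast
qed (use assms in auto)

lemma rank_bij:
  assumes "finite P" "inj_on key P" "card P = N"
  shows "bij_betw (rank P key) P {1..N}"
proof -
  have inj: "inj_on (rank P key) P"
  proof (rule inj_onI)
    fix p q assume pq: "p \<in> P" "q \<in> P" "rank P key p = rank P key q"
    have "key p = key q"
    proof (rule ccontr)
      assume "key p \<noteq> key q"
      then show False using rank_less[OF assms(1) pq(1,2), of key] rank_less[OF assms(1) pq(2,1), of key] pq(3)
        by (metis less_irrefl neqE)
    qed
    then show "p = q" using assms(2) pq inj_onD by metis
  qed
  have "rank P key p \<in> {1..N}" if "p \<in> P" for p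
  proof -
    have "{p} \<subseteq> {q \<in> P. key q \<le> key p}" "{q \<in> P. key q \<le> key p} \<subseteq> P" using that by auto
    then have "card {p} \<le> rank P key p" "rank P key p \<le> card P"
      unfolding rank_def using assms(1) finite_subset card_mono by metis+
    then show ?thesis using assms(3) by simp
  qed
  then have "rank P key ` P \<subseteq> {1..N}" by blast
  moreover have "card (rank P key ` P) = card {1..N}" using card_image[OF inj] assms(3) by simp
  ultimately have "rank P key ` P = {1..N}" by (intro card_subset_eq) auto
  then show ?thesis using inj by (simp add: bij_betw_def)
qed

text \<open>An order reversing involution becomes the reversal \<open>k \<mapsto> N+1-k\<close>; applied to the central symmetry this
  produces signed permutations.\<close>

lemma rank_opp:
  assumes fin: "finite P" and inj: "inj_on key P" and N: "card P = N"
    and \<sigma>: "\<And>p. p \<in> P \<Longrightarrow> \<sigma> p \<in> P" "\<And>p. p \<in> P \<Longrightarrow> \<sigma> (\<sigma> p) = p"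
    and rev: "\<And>p q. p \<in> P \<Longrightarrow> q \<in> P \<Longrightarrow> key p < key q \<Longrightarrow> key (\<sigma> q) < key (\<sigma> p)"
    and p: "p \<in> P"
  shows "rank P key (\<sigma> p) = N + 1 - rank P key p"
proof -
  have iff: "key q \<le> key (\<sigma> p) \<longleftrightarrow> key p \<le> key (\<sigma> q)" if q: "q \<in> P" for q
  proof
    show "key p \<le> key (\<sigma> q)" if "key q \<le> key (\<sigma> p)"
    proof (rule ccontr)
      assume "\<not> key p \<le> key (\<sigma> q)"
      then have "key (\<sigma> p) < key (\<sigma> (\<sigma> q))" using p q \<sigma> by (intro rev) auto
      then show False using that \<sigma>(2)[OF q] by simp
    qed
    show "key q \<le> key (\<sigma> p)" if "key p \<le> key (\<sigma> q)"
    proof (rule ccontr)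
      assume "\<not> key q \<le> key (\<sigma> p)"
      then have "key (\<sigma> q) < key (\<sigma> (\<sigma> p))" using p q \<sigma> by (intro rev) auto
      then show False using that \<sigma>(2)[OF p] by simp
    qed
  qed
  have s: "{q \<in> P. key q \<le> key (\<sigma> p)} = \<sigma> ` {q \<in> P. key p \<le> key q}"
  proof (rule Set.set_eqI)
    fix q
    show "q \<in> {q \<in> P. key q \<le> key (\<sigma> p)} \<longleftrightarrow> q \<in> \<sigma> ` {q \<in> P. key p \<le> key q}"
    proof
      assume "q \<in> {q \<in> P. key q \<le> key (\<sigma> p)}"
      then have "q \<in> P" "key p \<le> key (\<sigma> q)" using iff by auto
      then have "\<sigma> q \<in> {q \<in> P. key p \<le> key q}" "q = \<sigma> (\<sigma> q)" using \<sigma> by auto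
      then show "q \<in> \<sigma> ` {q \<in> P. key p \<le> key q}" by blast
    next
      assume "q \<in> \<sigma> ` {q \<in> P. key p \<le> key q}"
      then obtain q' where "q' \<in> P" "key p \<le> key q'" "q = \<sigma> q'" by blast
      then show "q \<in> {q \<in> P. key q \<le> key (\<sigma> p)}" using iff[of q] \<sigma> by auto
    qed
  qed
  have i: "inj_on \<sigma> P" by (rule inj_on_inverseI[of P \<sigma> \<sigma>]) (rule \<sigma>(2))
  have "{q \<in> P. key p \<le> key q} \<subseteq> P" by blast
  then have cc: "card (\<sigma> ` {q \<in> P. key p \<le> key q}) = card {q \<in> P. key p \<le> key q}"
    by (rule card_image[OF inj_on_subset[OF i]])
  have c: "rank P key (\<sigma> p) = card {q \<in> P. key p \<le> key q}" unfolding rank_def s cc ..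
  have u: "P = {q \<in> P. key q \<le> key p} \<union> ({q \<in> P. key p \<le> key q} - {p})"
  proof (rule Set.set_eqI)
    fix q
    show "q \<in> P \<longleftrightarrow> q \<in> {q \<in> P. key q \<le> key p} \<union> ({q \<in> P. key p \<le> key q} - {p})"
      using p linear[of "key q" "key p"] by (cases "q = p") (simp, blast)
  qed
  have d: "{q \<in> P. key q \<le> key p} \<inter> ({q \<in> P. key p \<le> key q} - {p}) = {}"
  proof -
    have "q = p" if "q \<in> P" "key q \<le> key p" "key p \<le> key q" for q
      using inj_onD[OF inj, of q p] that p by simp
    then show ?thesis by blast
  qed
  have "card ({q \<in> P. key q \<le> key p} \<union> ({q \<in> P. key p \<le> key q} - {p}))
      = rank P key p + card ({q \<in> P. key p \<le> key q} - {p})"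
    unfolding rank_def by (rule card_Un_disjoint[OF _ _ d]) (use fin in auto)
  then have "card P = rank P key p + card ({q \<in> P. key p \<le> key q} - {p})"
    by (simp only: u[symmetric])
  then have "N = rank P key p + card ({q \<in> P. key p \<le> key q} - {p})" using N by simp
  moreover have "card ({q \<in> P. key p \<le> key q} - {p}) + 1 = card {q \<in> P. key p \<le> key q}"
    using card_Suc_Diff1[of "{q \<in> P. key p \<le> key q}" p] p fin by simp
  ultimately show ?thesis using c by simp
qed

text \<open>A key that refines the column index lists the columns one after the other, so the columns occupy the
  consecutive blocks.\<close>

lemma rank_bk:
  assumes fin: "finite P" and inj: "inj_on key P" and N: "card P = 2*r" and l: "l \<in> Lam n r"
    and col: "\<And>p. p \<in> P \<Longrightarrow> col p \<in> {1..2*n+1}"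
    and ref: "\<And>p q. p \<in> P \<Longrightarrow> q \<in> P \<Longrightarrow> col p < col q \<Longrightarrow> key p < key q"
    and cnt: "\<And>j. j \<in> {1..2*n+1} \<Longrightarrow> card {p \<in> P. col p = j} = hat n l j"
    and p: "p \<in> P"
  shows "bk n l (rank P key p) = col p"
proof (rule bk_unique[OF l])
  show r: "rank P key p \<in> {1..2*r}" using rank_bij[OF fin inj N] p bij_betwE by metis
  have cum: "card {q \<in> P. col q < j} = cum n l j" if "j \<le> 2*n+2" for j
  proof -
    have "(\<Sum>i\<in>{1..<j}. card {q \<in> P. True \<and> col q = i}) = card {q \<in> P. True \<and> col q \<in> {1..<j}}"
      by (rule sum_card_fibres) (use fin in auto)
    moreover have "{q \<in> P. True \<and> col q \<in> {1..<j}} = {q \<in> P. col q < j}" using col by force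
    moreover have "(\<Sum>i\<in>{1..<j}. card {q \<in> P. True \<and> col q = i}) = cum n l j"
      unfolding cum_def by (rule sum.cong) (use that cnt in auto)
    ultimately show ?thesis by simp
  qed
  have b: "col p \<le> 2*n+1" using col[OF p] by simp
  have "{q \<in> P. col q < col p} \<subset> {q \<in> P. key q \<le> key p}"
    using ref p by (auto simp: psubset_eq less_imp_le)
  then have "card {q \<in> P. col q < col p} < rank P key p"
    unfolding rank_def using fin by (intro psubset_card_mono) auto
  then show "cum n l (col p) < rank P key p" using cum[of "col p"] b by simp
  have "{q \<in> P. key q \<le> key p} \<subseteq> {q \<in> P. col q < col p + 1}"
    using ref[OF p] by (auto simp: less_Suc_eq_le) (metis leD not_le_imp_less)
  then have "rank P key p \<le> card {q \<in> P. col q < col p + 1}"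
    unfolding rank_def using fin by (intro card_mono) auto
  then show "rank P key p \<le> cum n l (col p + 1)" using cum[of "col p + 1"] b by simp
qed

section \<open>A signed permutation for every symmetric matrix\<close>

lemma hat_inj: "inj_on (hat n) (Lam n r)"
proof (rule inj_onI)
  fix l m assume lm: "l \<in> Lam n r" "m \<in> Lam n r" "hat n l = hat n m"
  have "l i = m i" for i
  proof (cases "i \<in> {1..n+1}")
    case True
    have e: "hat n l i = hat n m i" using lm(3) by simp
    show ?thesis
    proof (cases "i = n + 1")
      case True then show ?thesis using e by (simp add: hat_def)
    next
      case False then show ?thesis using e \<open>i \<in> {1..n+1}\<close> by (simp add: hat_def)
    qed
  next
    case False then show ?thesis using lm by (auto simp: Lam_def)
  qed
  then show "l = m" by auto
qed

lemma row_comp_eq: "l \<in> Lam n r \<Longrightarrow> ro n A = hat n l \<Longrightarrow> row_comp n r A = l"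
  unfolding row_comp_def by (simp add: inv_into_f_f[OF hat_inj])

lemma col_comp_eq: "l \<in> Lam n r \<Longrightarrow> co n A = hat n l \<Longrightarrow> col_comp n r A = l"
  unfolding col_comp_def by (simp add: inv_into_f_f[OF hat_inj])

lemma sum_sym:
  fixes f :: "nat \<Rightarrow> nat"
  assumes "\<And>j. j \<in> {1..2*n+1} \<Longrightarrow> f j = f (2*n + 2 - j)"
  shows "(\<Sum>j\<in>{1..2*n+1}. f j) = f (n + 1) + 2 * (\<Sum>j\<in>{1..n}. f j)"
proof -
  have u: "{1..2*n+1} = {1..n} \<union> ({n+1} \<union> {n+2..2*n+1})" by auto
  have "(\<Sum>j\<in>{n+2..2*n+1}. f j) = (\<Sum>j\<in>{1..n}. f j)"
    by (rule sum.reindex_bij_witness[of _ "\<lambda>j. 2*n + 2 - j" "\<lambda>j. 2*n + 2 - j"])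
       (use assms in auto)
  moreover have "(\<Sum>j\<in>{1..2*n+1}. f j) = (\<Sum>j\<in>{1..n}. f j) + (f (n+1) + (\<Sum>j\<in>{n+2..2*n+1}. f j))"
    unfolding u by (subst sum.union_disjoint, simp, simp, force, subst sum.union_disjoint) auto
  ultimately show ?thesis by simp
qed

lemma hat_exists:
  assumes sym: "\<And>j. j \<in> {1..2*n+1} \<Longrightarrow> f j = f (2*n + 2 - j)"
    and out: "\<And>j. j \<notin> {1..2*n+1} \<Longrightarrow> f j = (0::nat)"
    and tot: "(\<Sum>j\<in>{1..2*n+1}. f j) = 2 * r"
  obtains l where "l \<in> Lam n r" "hat n l = f"
proof
  define l where "l j = (if j \<in> {1..n} then f j else if j = n + 1 then f j div 2 else 0)" for j
  have s: "f (n + 1) + 2 * (\<Sum>j\<in>{1..n}. f j) = 2 * r" using sum_sym[of n f, OF sym] tot by simp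
  then have ev: "2 * (f (n + 1) div 2) = f (n + 1)" by presburger
  have "{1..n+1} = insert (n+1) {1..n}" by auto
  then have "(\<Sum>i\<in>{1..n+1}. l i) = l (n+1) + (\<Sum>i\<in>{1..n}. l i)" by simp
  also have "(\<Sum>i\<in>{1..n}. l i) = (\<Sum>i\<in>{1..n}. f i)" by (rule sum.cong) (auto simp: l_def)
  finally have "(\<Sum>i\<in>{1..n+1}. l i) = r" using s ev by (simp add: l_def)
  then show "l \<in> Lam n r" by (auto simp: Lam_def l_def)
  show "hat n l = f"
  proof
    fix j
    consider "j \<in> {1..n}" | "j = n + 1" | "j \<in> {n+2..2*n+1}" | "j \<notin> {1..2*n+1}" by force
    then show "hat n l j = f j"
    proof cases
      case 2 then show ?thesis using ev by (simp add: hat_def l_def)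
    next
      case 3
      then have "2*n + 2 - j \<in> {1..n}" "f j = f (2*n + 2 - j)" using sym[of j] by auto
      then show ?thesis using 3 by (auto simp: hat_def l_def)
    next
      case 4 then show ?thesis using out[of j] by (auto simp: hat_def)
    qed (simp add: hat_def l_def)
  qed
qed

lemma sum_rev: "(\<Sum>j\<in>{1..2*n+1}. f (2*n + 2 - j)) = (\<Sum>j\<in>{1..2*n+1}. f j)" for f :: "nat \<Rightarrow> nat"
  by (rule sum.reindex_bij_witness[of _ "\<lambda>j. 2*n + 2 - j" "\<lambda>j. 2*n + 2 - j"]) auto

lemma Xi_out: "A \<in> Xi n r \<Longrightarrow> i \<notin> {1..2*n+1} \<or> j \<notin> {1..2*n+1} \<Longrightarrow> A i j = 0"
  unfolding Xi_def by (simp only: mem_Collect_eq)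

lemma Xi_total: "A \<in> Xi n r \<Longrightarrow> (\<Sum>i\<in>{1..2*n+1}. \<Sum>j\<in>{1..2*n+1}. A i j) = 2*r"
  unfolding Xi_def by (simp only: mem_Collect_eq)

lemma Xi_sym: "A \<in> Xi n r \<Longrightarrow> i \<in> {1..2*n+1} \<Longrightarrow> j \<in> {1..2*n+1} \<Longrightarrow> A (2*n + 2 - i) (2*n + 2 - j) = A i j"
  unfolding Xi_def by (simp only: mem_Collect_eq)

lemma Xi_row:
  assumes "A \<in> Xi n r" obtains l where "l \<in> Lam n r" "ro n A = hat n l"
proof -
  have h1: "ro n A i = ro n A (2*n + 2 - i)" if i: "i \<in> {1..2*n+1}" for i
  proof -
    have "ro n A (2*n + 2 - i) = (\<Sum>j\<in>{1..2*n+1}. A (2*n + 2 - i) (2*n + 2 - j))"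
      unfolding ro_def using sum_rev[of "A (2*n + 2 - i)" n] by simp
    also have "\<dots> = (\<Sum>j\<in>{1..2*n+1}. A i j)" by (rule sum.cong) (use Xi_sym[OF assms i] in auto)
    finally show ?thesis by (simp add: ro_def)
  qed
  have h2: "ro n A i = 0" if "i \<notin> {1..2*n+1}" for i
    unfolding ro_def by (rule sum.neutral) (use Xi_out[OF assms] that in blast)
  have h3: "(\<Sum>i\<in>{1..2*n+1}. ro n A i) = 2*r" using Xi_total[OF assms] unfolding ro_def .
  show ?thesis by (rule hat_exists[OF h1 h2 h3]) (simp, simp, rule that, simp, rule sym)
qed

lemma Xi_col:
  assumes "A \<in> Xi n r" obtains l where "l \<in> Lam n r" "co n A = hat n l"
proof -
  have h1: "co n A j = co n A (2*n + 2 - j)" if j: "j \<in> {1..2*n+1}" for j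
  proof -
    have "co n A (2*n + 2 - j) = (\<Sum>i\<in>{1..2*n+1}. A (2*n + 2 - i) (2*n + 2 - j))"
      unfolding co_def using sum_rev[of "\<lambda>i. A i (2*n + 2 - j)" n] by simp
    also have "\<dots> = (\<Sum>i\<in>{1..2*n+1}. A i j)" by (rule sum.cong) (use Xi_sym[OF assms _ j] in auto)
    finally show ?thesis by (simp add: co_def)
  qed
  have h2: "co n A i = 0" if "i \<notin> {1..2*n+1}" for i
    unfolding co_def by (rule sum.neutral) (use Xi_out[OF assms] that in blast)
  have h3: "(\<Sum>i\<in>{1..2*n+1}. co n A i) = 2*r"
    using Xi_total[OF assms] sum.swap[of A "{1..2*n+1}" "{1..2*n+1}"] unfolding co_def by (simp only:)
  show ?thesis by (rule hat_exists[OF h1 h2 h3]) (simp, simp, rule that, simp, rule sym)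
qed

text \<open>Put \<open>A i j\<close> points into the cell \<open>(i, j)\<close>. Numbering all points row by row and column by column, the
  map from column numbers to row numbers has matrix \<open>A\<close>; it is a signed permutation because the central
  symmetry of \<open>A\<close> reverses both orders.\<close>

lemma mat_exists:
  assumes A: "A \<in> Xi n r" and l: "l \<in> Lam n r" "ro n A = hat n l" and m: "m \<in> Lam n r" "co n A = hat n m"
  obtains d where "d \<in> WB r" "mat n r l d m = A"
proof -
  define I where "I = {1..2*n+1}"
  define P where "P = (SIGMA i:I. SIGMA j:I. {1..A i j})"
  define \<sigma> where "\<sigma> = (\<lambda>(i, j, k). (2*n + 2 - i, 2*n + 2 - j, A i j + 1 - k))"
  \<comment> \<open>\<open>kf\<close> lists the points row by row, \<open>kg\<close> column by column.\<close>
  define kf :: "nat \<times> nat \<times> nat \<Rightarrow> nat \<times> nat \<times> nat" where "kf p = p" for p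
  define kg :: "nat \<times> nat \<times> nat \<Rightarrow> nat \<times> nat \<times> nat" where "kg = (\<lambda>(i, j, k). (j, i, k))"
  have finI: "finite I" by (simp add: I_def)
  have Psum: "card P = (\<Sum>i\<in>I. \<Sum>j\<in>I. A i j)" and fin: "finite P"
    by (auto simp: P_def card_SigmaI finI)
  have N: "card P = 2*r" using Psum Xi_total[OF A] unfolding I_def by (simp only:)
  have opp: "2*n + 2 - i \<in> I" if "i \<in> I" for i using that by (auto simp: I_def)
  have sym: "A (2*n + 2 - i) (2*n + 2 - j) = A i j" if "i \<in> I" "j \<in> I" for i j
    using Xi_sym[OF A] that by (simp add: I_def)
  have \<sigma>P: "\<sigma> p \<in> P" if "p \<in> P" for p
    using that opp sym by (auto simp: P_def \<sigma>_def)
  have \<sigma>\<sigma>: "\<sigma> (\<sigma> p) = p" if "p \<in> P" for p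
    using that sym by (auto simp: P_def \<sigma>_def I_def)
  have injf: "inj_on kf P" and injg: "inj_on kg P" by (auto simp: inj_on_def kf_def kg_def)
  have revf: "kf (\<sigma> q) < kf (\<sigma> p)" if "p \<in> P" "q \<in> P" "kf p < kf q" for p q
    using that by (auto simp: P_def \<sigma>_def kf_def I_def less_prod_def')
  have revg: "kg (\<sigma> q) < kg (\<sigma> p)" if "p \<in> P" "q \<in> P" "kg p < kg q" for p q
    using that by (auto simp: P_def \<sigma>_def kg_def I_def less_prod_def')
  let ?f = "rank P kf" let ?g = "rank P kg"
  have bf: "bij_betw ?f P {1..2*r}" and bg: "bij_betw ?g P {1..2*r}"
    by (rule rank_bij[OF fin injf N], rule rank_bij[OF fin injg N])
  have cell: "card {p \<in> P. fst p = i \<and> fst (snd p) = j} = A i j" if "i \<in> I" "j \<in> I" for i j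
  proof -
    have "{p \<in> P. fst p = i \<and> fst (snd p) = j} = (\<lambda>k. (i, j, k)) ` {1..A i j}"
      using that by (auto simp: P_def)
    moreover have "inj (\<lambda>k::nat. (i, j, k))" by (auto simp: inj_on_def)
    ultimately show ?thesis by (simp add: card_image inj_on_def)
  qed
  have row: "card {p \<in> P. fst p = i} = hat n l i" if i: "i \<in> {1..2*n+1}" for i
  proof -
    have "(\<Sum>j\<in>I. card {p \<in> P. fst p = i \<and> fst (snd p) = j}) = card {p \<in> P. fst p = i \<and> fst (snd p) \<in> I}"
      by (rule sum_card_fibres) (use fin finI in auto)
    moreover have "{p \<in> P. fst p = i \<and> fst (snd p) \<in> I} = {p \<in> P. fst p = i}" by (auto simp: P_def)
    moreover have "(\<Sum>j\<in>I. card {p \<in> P. fst p = i \<and> fst (snd p) = j}) = ro n A i"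
      unfolding ro_def I_def[symmetric] by (rule sum.cong) (use cell i in \<open>auto simp: I_def\<close>)
    ultimately show ?thesis using l(2) by simp
  qed
  have colc: "card {p \<in> P. fst (snd p) = j} = hat n m j" if j: "j \<in> {1..2*n+1}" for j
  proof -
    have "(\<Sum>i\<in>I. card {p \<in> P. fst (snd p) = j \<and> fst p = i}) = card {p \<in> P. fst (snd p) = j \<and> fst p \<in> I}"
      by (rule sum_card_fibres) (use fin finI in auto)
    moreover have "{p \<in> P. fst (snd p) = j \<and> fst p \<in> I} = {p \<in> P. fst (snd p) = j}" by (auto simp: P_def)
    moreover have "(\<Sum>i\<in>I. card {p \<in> P. fst (snd p) = j \<and> fst p = i}) = co n A j"
      unfolding co_def I_def[symmetric]
    proof (rule sum.cong[OF refl])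
      fix i assume "i \<in> I"
      moreover have "{p \<in> P. fst (snd p) = j \<and> fst p = i} = {p \<in> P. fst p = i \<and> fst (snd p) = j}" by auto
      ultimately show "card {p \<in> P. fst (snd p) = j \<and> fst p = i} = A i j" using cell[of i j] j by (simp add: I_def)
    qed
    ultimately show ?thesis using m(2) by simp
  qed
  have bkf: "bk n l (?f p) = fst p" if "p \<in> P" for p
    by (rule rank_bk[OF fin injf N l(1) _ _ row that]) (auto simp: P_def I_def kf_def less_prod_def')
  have bkg: "bk n m (?g p) = fst (snd p)" if "p \<in> P" for p
    by (rule rank_bk[OF fin injg N m(1) _ _ colc that]) (auto simp: P_def I_def kg_def less_prod_def')
  define gi where "gi = inv_into P ?g"
  have gi: "bij_betw gi {1..2*r} P" unfolding gi_def by (rule bij_betw_inv_into[OF bg])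
  have gg: "gi (?g p) = p" if "p \<in> P" for p using bij_betw_inv_into_left[OF bg that] by (simp add: gi_def)
  define d where "d x = (if x \<in> {1..2*r} then ?f (gi x) else x)" for x
  have dg: "d (?g p) = ?f p" if "p \<in> P" for p
    using gg[OF that] bij_betwE[OF bg] that by (auto simp: d_def)
  have surj: "\<exists>p\<in>P. x = ?g p" if "x \<in> {1..2*r}" for x using bg that by (force simp: bij_betw_def)
  have dWB: "d \<in> WB r"
  proof (rule WB_I)
    have "bij_betw (\<lambda>x. ?f (gi x)) {1..2*r} {1..2*r}"
      using bij_betw_trans[OF gi bf] by (simp add: comp_def)
    then have "bij_betw d {1..2*r} {1..2*r}" by (rule bij_betw_cong[THEN iffD1, rotated]) (simp add: d_def)
    then show "d permutes {1..2*r}" by (rule bij_imp_permutes) (auto simp: d_def)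
    fix x assume "x \<in> {1..2*r}"
    then obtain p where p: "p \<in> P" "x = ?g p" using surj by blast
    have "?g (\<sigma> p) = 2*r + 1 - ?g p" by (rule rank_opp[OF fin injg N \<sigma>P \<sigma>\<sigma> revg p(1)])
    moreover have "?f (\<sigma> p) = 2*r + 1 - ?f p" by (rule rank_opp[OF fin injf N \<sigma>P \<sigma>\<sigma> revf p(1)])
    ultimately show "d (2*r + 1 - x) = 2*r + 1 - d x" using dg[OF p(1)] dg[OF \<sigma>P[OF p(1)]] p(2) by simp
  qed
  moreover have "mat n r l d m i j = A i j" for i j
  proof (cases "i \<in> I \<and> j \<in> I")
    case True
    have "{x \<in> {1..2*r}. bk n l (d x) = i \<and> bk n m x = j} = ?g ` {p \<in> P. fst p = i \<and> fst (snd p) = j}"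
    proof (rule Set.set_eqI)
      fix x
      show "x \<in> {x \<in> {1..2*r}. bk n l (d x) = i \<and> bk n m x = j} \<longleftrightarrow> x \<in> ?g ` {p \<in> P. fst p = i \<and> fst (snd p) = j}"
      proof (cases "x \<in> {1..2*r}")
        case True
        then obtain p where p: "p \<in> P" "x = ?g p" using surj by blast
        have "x \<in> ?g ` {p \<in> P. fst p = i \<and> fst (snd p) = j} \<longleftrightarrow> p \<in> {p \<in> P. fst p = i \<and> fst (snd p) = j}"
          unfolding p(2) by (rule inj_on_image_mem_iff[OF bij_betw_imp_inj_on[OF bg]]) (use p in auto)
        then show ?thesis using True p bkf[OF p(1)] bkg[OF p(1)] dg[OF p(1)] by auto
      next
        case False
        then show ?thesis using bij_betwE[OF bg] by auto
      qed
    qed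
    moreover have "inj_on ?g {p \<in> P. fst p = i \<and> fst (snd p) = j}"
      by (rule inj_on_subset[OF bij_betw_imp_inj_on[OF bg]]) auto
    ultimately show ?thesis using True cell[of i j] by (simp only: mat_def I_def card_image simp_thms if_True)
  next
    case False
    then have "A i j = 0" using A unfolding Xi_def I_def by blast
    then show ?thesis using False by (auto simp: mat_def I_def)
  qed
  ultimately show ?thesis using that by blast
qed

section \<open>Double cosets are the fibres of the matrix\<close>

text \<open>The stable sorting of the points of each column block by the row block of their image under \<open>w\<close>.\<close>

definition stdz :: "nat \<Rightarrow> nat \<Rightarrow> (nat \<Rightarrow> nat) \<Rightarrow> (nat \<Rightarrow> nat) \<Rightarrow> (nat \<Rightarrow> nat) \<Rightarrow> nat \<Rightarrow> nat" where
  "stdz n r l w m x = (if x \<in> {1..2*r} then rank {1..2*r} (\<lambda>x. (bk n m x, bk n l (w x), x)) x else x)"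

lemma lex_rev:
  fixes a b c a' b' c' M K :: nat
  assumes "(a, b, c) < (a', b', c')" "a' \<le> M" "b' \<le> M" "c' \<le> K"
  shows "(M - a', M - b', K - c') < (M - a, M - b, K - c)"
  using assms by (auto simp: less_prod_def')

lemma stdz_stab:
  assumes l: "l \<in> Lam n r" and m: "m \<in> Lam n r" and w: "w \<in> WB r"
  shows "stdz n r l w m \<in> stab n r m"
proof -
  let ?P = "{1..2*r}" let ?k = "\<lambda>x. (bk n m x, bk n l (w x), x)"
  have fin: "finite ?P" and inj: "inj_on ?k ?P" and N: "card ?P = 2*r" by (auto simp: inj_on_def)
  have b: "bij_betw (rank ?P ?k) ?P ?P" by (rule rank_bij[OF fin inj N])
  have rev: "?k (2*r + 1 - q) < ?k (2*r + 1 - p)" if pq: "p \<in> ?P" "q \<in> ?P" "?k p < ?k q" for p q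
  proof -
    have k: "?k (2*r + 1 - x) = (2*n + 2 - bk n m x, 2*n + 2 - bk n l (w x), 2*r + 1 - x)" if x: "x \<in> ?P" for x
      using bk_sym[OF m x] bk_sym[OF l, of "w x"] WB_opp[OF w x] WB_mem[OF w, of x] x by (simp only: refl)
    have wq: "w q \<in> ?P" using WB_mem[OF w, of q] pq(2) by (simp only:)
    show ?thesis unfolding k[OF pq(1)] k[OF pq(2)]
      by (rule lex_rev[OF pq(3)]) (use bk_bounds(2)[OF m pq(2)] bk_bounds(2)[OF l wq] pq(2) in auto)
  qed
  have "stdz n r l w m \<in> WB r"
  proof (rule WB_I)
    have "bij_betw (stdz n r l w m) ?P ?P"
      using b by (rule bij_betw_cong[THEN iffD1, rotated]) (simp add: stdz_def)
    then show "stdz n r l w m permutes ?P" by (rule bij_imp_permutes) (auto simp: stdz_def)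
    fix x assume x: "x \<in> ?P"
    have "rank ?P ?k (2*r + 1 - x) = 2*r + 1 - rank ?P ?k x"
      by (rule rank_opp[OF fin inj N _ _ rev x]) auto
    moreover have "2*r + 1 - x \<in> ?P" using x by auto
    ultimately show "stdz n r l w m (2*r + 1 - x) = 2*r + 1 - stdz n r l w m x" using x by (simp only: stdz_def if_True)
  qed
  moreover have "bk n m (stdz n r l w m x) = bk n m x" if x: "x \<in> ?P" for x
  proof -
    have "bk n m (rank ?P ?k x) = bk n m x"
      by (rule rank_bk[OF fin inj N m _ _ card_bk[OF m] x]) (use bk_bounds(1,2)[OF m] in \<open>auto simp: less_prod_def'\<close>)
    then show ?thesis using x by (simp only: stdz_def if_True)
  qed
  ultimately show ?thesis by (simp add: stab_def)
qed

text \<open>The rank of \<open>x\<close> in the sorted order determines the row block of its image through sums of matrix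
  entries; so for equal matrices equal ranks give equal row blocks.\<close>

lemma stdz_row_le:
  assumes l: "l \<in> Lam n r" and m: "m \<in> Lam n r" and w: "w \<in> WB r" and d: "d \<in> WB r"
    and eq: "mat n r l w m = mat n r l d m"
    and x: "x \<in> {1..2*r}" and y: "y \<in> {1..2*r}" and xy: "stdz n r l w m x = stdz n r l d m y"
  shows "bk n l (d y) \<le> bk n l (w x)"
proof (rule ccontr)
  let ?P = "{1..2*r}" let ?kw = "\<lambda>x. (bk n m x, bk n l (w x), x)" let ?kd = "\<lambda>x. (bk n m x, bk n l (d x), x)"
  assume lt: "\<not> bk n l (d y) \<le> bk n l (w x)"
  define j where "j = bk n m x"
  define i where "i = bk n l (w x)"
  have ij: "i \<in> {1..2*n+1}" "j \<in> {1..2*n+1}"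
    using bk_bounds(1,2)[OF m x] bk_bounds(1,2)[OF l, of "w x"] WB_mem[OF w, of x] x by (auto simp: i_def j_def)
  have jy: "bk n m y = j"
    using stab_bk[OF stdz_stab[OF l m w] x] stab_bk[OF stdz_stab[OF l m d] y] xy by (simp add: j_def)
  have cnt: "card {q \<in> ?P. bk n m q < j \<or> bk n m q = j \<and> bk n l (v q) \<le> i}
    = (\<Sum>a\<in>{1..2*n+1}. \<Sum>b\<in>{1..<j}. mat n r l v m a b) + (\<Sum>a\<in>{1..i}. \<Sum>b\<in>{j}. mat n r l v m a b)" if v: "v \<in> WB r" for v
  proof -
    have lb: "bk n l (v q) \<in> {1..2*n+1}" "bk n m q \<in> {1..2*n+1}" if "q \<in> ?P" for q
      using bk_bounds(1,2)[OF l, of "v q"] bk_bounds(1,2)[OF m, of q] WB_mem[OF v, of q] that by auto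
    have "{q \<in> ?P. bk n m q < j \<or> bk n m q = j \<and> bk n l (v q) \<le> i}
      = {q \<in> ?P. bk n l (v q) \<in> {1..2*n+1} \<and> bk n m q \<in> {1..<j}} \<union> {q \<in> ?P. bk n l (v q) \<in> {1..i} \<and> bk n m q \<in> {j}}"
      using lb by force
    moreover have "card ({q \<in> ?P. bk n l (v q) \<in> {1..2*n+1} \<and> bk n m q \<in> {1..<j}} \<union> {q \<in> ?P. bk n l (v q) \<in> {1..i} \<and> bk n m q \<in> {j}})
      = card {q \<in> ?P. bk n l (v q) \<in> {1..2*n+1} \<and> bk n m q \<in> {1..<j}} + card {q \<in> ?P. bk n l (v q) \<in> {1..i} \<and> bk n m q \<in> {j}}"
      by (rule card_Un_disjoint) auto
    moreover have "{1..<j} \<subseteq> {1..2*n+1}" "{1..i} \<subseteq> {1..2*n+1}" "{j} \<subseteq> {1..2*n+1}" using ij by auto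
    ultimately show ?thesis by (simp only: sum_mat[OF subset_refl] sum_mat)
  qed
  have "{q \<in> ?P. ?kw q \<le> ?kw x} \<subseteq> {q \<in> ?P. bk n m q < j \<or> bk n m q = j \<and> bk n l (w q) \<le> i}"
    by (auto simp: i_def j_def)
  then have "rank ?P ?kw x \<le> card {q \<in> ?P. bk n m q < j \<or> bk n m q = j \<and> bk n l (w q) \<le> i}"
    unfolding rank_def by (intro card_mono) auto
  also have "\<dots> = card {q \<in> ?P. bk n m q < j \<or> bk n m q = j \<and> bk n l (d q) \<le> i}"
    using cnt[OF w] cnt[OF d] eq by simp
  also have "\<dots> < rank ?P ?kd y"
    unfolding rank_def
  proof (rule psubset_card_mono)
    have "y \<in> {q \<in> ?P. ?kd q \<le> ?kd y}" using y by simp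
    moreover have "y \<notin> {q \<in> ?P. bk n m q < j \<or> bk n m q = j \<and> bk n l (d q) \<le> i}" using jy lt by (simp add: i_def)
    moreover have "{q \<in> ?P. bk n m q < j \<or> bk n m q = j \<and> bk n l (d q) \<le> i} \<subseteq> {q \<in> ?P. ?kd q \<le> ?kd y}"
      using jy lt by (auto simp: i_def)
    ultimately show "{q \<in> ?P. bk n m q < j \<or> bk n m q = j \<and> bk n l (d q) \<le> i} \<subset> {q \<in> ?P. ?kd q \<le> ?kd y}" by blast
  qed simp
  finally show False using xy x y by (simp add: stdz_def)
qed

text \<open>After sorting both within the column blocks, \<open>w\<close> and \<open>d\<close> send equal positions to equal row blocks,
  and hence differ by a permutation that preserves the row blocks.\<close>

lemma double_coset:
  assumes l: "l \<in> Lam n r" and m: "m \<in> Lam n r" and w: "w \<in> WB r" and d: "d \<in> WB r"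
    and eq: "mat n r l w m = mat n r l d m"
  obtains u v where "u \<in> stab n r l" "v \<in> stab n r m" "w = u \<circ> d \<circ> v"
proof
  define vw where "vw = stdz n r l w m"
  define vd where "vd = stdz n r l d m"
  have vw: "vw \<in> stab n r m" and vd: "vd \<in> stab n r m" by (simp_all add: vw_def vd_def stdz_stab assms)
  note WBs = stab_WB[OF vw] stab_WB[OF vd]
  let ?v = "pinv vd \<circ> vw"
  let ?u = "w \<circ> (pinv ?v \<circ> pinv d)"
  show v: "?v \<in> stab n r m" by (intro stab_comp stab_inv vd vw)
  have vWB: "?v \<in> WB r" by (rule stab_WB[OF v])
  have uWB: "?u \<in> WB r" by (intro WB_comp WB_inv w d vWB)
  have key: "bk n l (w x) = bk n l (d (?v x))" if x: "x \<in> {1..2*r}" for x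
  proof -
    have y: "?v x \<in> {1..2*r}" using WB_mem[OF vWB] x by blast
    have "vd (?v x) = vw x" by (simp add: WB_inv_apply[OF WBs(2)])
    then show ?thesis
      using stdz_row_le[OF l m w d eq x y] stdz_row_le[OF l m d w eq[symmetric] y x]
      by (simp add: vw_def vd_def)
  qed
  have "bk n l (?u y) = bk n l y" if y: "y \<in> {1..2*r}" for y
  proof -
    define x where "x = pinv ?v (pinv d y)"
    have x: "x \<in> {1..2*r}" unfolding x_def using WB_mem[OF WB_inv[OF vWB]] WB_mem[OF WB_inv[OF d]] y by blast
    have "d (?v x) = y" unfolding x_def using WB_inv_apply(2)[OF vWB] WB_inv_apply(2)[OF d] by metis
    moreover have "?u y = w x" by (simp add: x_def)
    ultimately show ?thesis using key[OF x] by simp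
  qed
  then show "?u \<in> stab n r l" using uWB by (simp add: stab_def)
  show "w = ?u \<circ> d \<circ> ?v"
  proof
    fix x
    have "pinv ?v (pinv d (d (?v x))) = x" by (simp only: WB_inv_apply(1)[OF d] WB_inv_apply(1)[OF vWB])
    then show "w x = (?u \<circ> d \<circ> ?v) x" by (simp only: comp_apply)
  qed
qed

section \<open>Minimal coset representatives\<close>

text \<open>The minimal length representatives of the cosets of the stabilizer of \<open>l\<close> are increasing on blocks.\<close>

definition incr :: "nat \<Rightarrow> nat \<Rightarrow> (nat \<Rightarrow> nat) \<Rightarrow> (nat \<Rightarrow> nat) \<Rightarrow> bool" where
  "incr n r l w \<longleftrightarrow> (\<forall>x\<in>{1..2*r}. \<forall>y\<in>{1..2*r}. x < y \<longrightarrow> bk n l x = bk n l y \<longrightarrow> w x < w y)"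

lemma incrD: "incr n r l w \<Longrightarrow> x \<in> {1..2*r} \<Longrightarrow> y \<in> {1..2*r} \<Longrightarrow> x < y \<Longrightarrow> bk n l x = bk n l y \<Longrightarrow> w x < w y"
  unfolding incr_def by blast

text \<open>The positions beyond \<open>r\<close> follow by reversal, and blocks are intervals.\<close>

lemma incr_adjacent:
  assumes l: "l \<in> Lam n r" and w: "w \<in> WB r"
    and adj: "\<And>i. i \<in> {1..r} \<Longrightarrow> bk n l i = bk n l (i + 1) \<Longrightarrow> w i < w (i + 1)"
  shows "incr n r l w"
proof -
  have adj2: "w i < w (i + 1)" if i: "1 \<le> i" "i < 2*r" and b: "bk n l i = bk n l (i + 1)" for i
  proof (cases "i \<le> r")
    case True then show ?thesis using adj[of i] i b by simp
  next
    case False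
    define j where "j = 2*r - i"
    have j: "j \<in> {1..r}" "j \<in> {1..2*r}" "j + 1 \<in> {1..2*r}" and ij: "i = 2*r + 1 - (j + 1)" "i + 1 = 2*r + 1 - j"
      using False i by (auto simp: j_def)
    have "bk n l j = bk n l (j + 1)"
    proof -
      have "bk n l (2*r + 1 - (j + 1)) = bk n l (2*r + 1 - j)" using b ij by metis
      then show ?thesis
        using bk_sym[OF l j(2)] bk_sym[OF l j(3)] bk_bounds(2)[OF l j(2)] bk_bounds(2)[OF l j(3)] by linarith
    qed
    then have "w j < w (j + 1)" by (rule adj[OF j(1)])
    moreover have "w i = 2*r + 1 - w (j + 1)" "w (i + 1) = 2*r + 1 - w j"
      using WB_opp[OF w j(3)] WB_opp[OF w j(2)] ij by metis+
    moreover have "w (j + 1) \<in> {1..2*r}" using WB_mem[OF w, of "j+1"] j(3) by blast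
    ultimately show ?thesis by simp
  qed
  have "w x < w (x + Suc k)" if "1 \<le> x" "x + Suc k \<le> 2*r" "bk n l x = bk n l (x + Suc k)" for x k
    using that
  proof (induction k)
    case 0 then show ?case using adj2[of x] by simp
  next
    case (Suc k)
    have m: "bk n l x \<le> bk n l (x + Suc k)" "bk n l (x + Suc k) \<le> bk n l (x + Suc k + 1)"
      by (rule bk_mono[OF l]; use Suc.prems in simp)+
    have e: "bk n l (x + Suc k) = bk n l x" "bk n l (x + Suc k) = bk n l (x + Suc k + 1)"
      using m Suc.prems(3) by simp_all
    have "w x < w (x + Suc k)" by (rule Suc.IH) (use Suc.prems e in simp_all)
    also have "\<dots> < w (x + Suc k + 1)" by (rule adj2) (use Suc.prems e in simp_all)
    finally show ?case by simp
  qed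
  then show ?thesis unfolding incr_def
    by (metis atLeastAtMost_iff less_imp_Suc_add add_Suc_right)
qed

lemma incr_of_min:
  assumes m: "m \<in> Lam n r" and d: "d \<in> WB r"
    and min: "\<And>v. v \<in> stab n r m \<Longrightarrow> lenB r d \<le> lenB r (d \<circ> v)"
  shows "incr n r m d"
proof (rule incr_adjacent[OF m d])
  fix i assume i: "i \<in> {1..r}" "bk n m i = bk n m (i + 1)"
  show "d i < d (i + 1)"
  proof (rule ccontr)
    assume "\<not> d i < d (i + 1)"
    then have "lenB r d = lenB r (d \<circ> cs r i) + 2" using lenB_down[OF d i(1)] WB_up_or_down[OF d] by blast
    then show False using min[OF cs_stab[OF m i]] by simp
  qed
qed

lemma right_min_exists:
  assumes m: "m \<in> Lam n r" and w: "w \<in> WB r"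
  obtains v where "v \<in> stab n r m" "incr n r m (w \<circ> v)"
proof -
  obtain v where v: "v \<in> stab n r m" "\<And>v'. v' \<in> stab n r m \<Longrightarrow> lenB r (w \<circ> v) \<le> lenB r (w \<circ> v')"
    using ex_has_least_nat[of "\<lambda>v. v \<in> stab n r m" id "\<lambda>v. lenB r (w \<circ> v)"] stab_id by blast
  have "incr n r m (w \<circ> v)"
  proof (rule incr_of_min[OF m WB_comp[OF w stab_WB[OF v(1)]]])
    fix v' assume "v' \<in> stab n r m"
    then show "lenB r (w \<circ> v) \<le> lenB r (w \<circ> v \<circ> v')"
      unfolding comp_assoc by (intro v(2) stab_comp[OF v(1)])
  qed
  then show ?thesis using that v(1) by blast
qed

lemma left_min_exists:
  assumes l: "l \<in> Lam n r" and w: "w \<in> WB r"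
  obtains u where "u \<in> stab n r l" "incr n r l (pinv (u \<circ> w))"
proof -
  obtain v where v: "v \<in> stab n r l" "incr n r l (pinv w \<circ> v)" by (rule right_min_exists[OF l WB_inv[OF w]])
  have "pinv (pinv v \<circ> w) = pinv w \<circ> v"
    using WB_inv_compose[OF WB_inv[OF stab_WB[OF v(1)]] w] WB_inv_inv[OF stab_WB[OF v(1)]] by simp
  then show ?thesis using that[OF stab_inv[OF v(1)]] v(2) by simp
qed

text \<open>The triple of \<open>A\<close> is any choice of a minimal triple with matrix \<open>A\<close>. Everything needed later holds for
  each such choice: minimality in the double coset gives minimality on both sides.\<close>

lemma triple_of_Xi:
  assumes A: "A \<in> Xi n r"
  shows "row_comp n r A \<in> Lam n r" "col_comp n r A \<in> Lam n r"
    "ro n A = hat n (row_comp n r A)" "co n A = hat n (col_comp n r A)"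
    "d_of n r A \<in> WB r" "mat n r (row_comp n r A) (d_of n r A) (col_comp n r A) = A"
    "incr n r (col_comp n r A) (d_of n r A)" "incr n r (row_comp n r A) (pinv (d_of n r A))"
proof -
  obtain l where l: "l \<in> Lam n r" "ro n A = hat n l" by (rule Xi_row[OF A])
  obtain m where m: "m \<in> Lam n r" "co n A = hat n m" by (rule Xi_col[OF A])
  have rc: "row_comp n r A = l" "col_comp n r A = m" using row_comp_eq l col_comp_eq m by blast+
  obtain d0 where d0: "d0 \<in> WB r" "mat n r l d0 m = A" by (rule mat_exists[OF A l m])
  \<comment> \<open>An element of least length in the whole fibre is minimal in its double coset.\<close>
  obtain d where d: "d \<in> WB r" "mat n r l d m = A"
    "\<And>w. w \<in> WB r \<and> mat n r l w m = A \<Longrightarrow> word_length (gensB r) d \<le> word_length (gensB r) w"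
    using ex_has_least_nat[of "\<lambda>w. w \<in> WB r \<and> mat n r l w m = A" d0 "word_length (gensB r)"] d0 by blast
  have "\<forall>w\<in>dcoset (stab n r l) d (stab n r m). word_length (gensB r) d \<le> word_length (gensB r) w"
  proof
    fix w assume "w \<in> dcoset (stab n r l) d (stab n r m)"
    then obtain u v where uv: "u \<in> stab n r l" "v \<in> stab n r m" "w = u \<circ> d \<circ> v" by (auto simp: dcoset_def)
    have "w \<in> WB r" unfolding uv(3) by (intro WB_comp d(1) stab_WB[OF uv(1)] stab_WB[OF uv(2)])
    moreover have "mat n r l w m = A" unfolding uv(3) mat_stab[OF l(1) m(1) d(1) uv(1,2)] by (rule d(2))
    ultimately show "word_length (gensB r) d \<le> word_length (gensB r) w" by (intro d(3) conjI)
  qed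
  then have "(l, d, m) \<in> min_triples n r"
    by (simp add: min_triples_def parabolic_stab[OF l(1)] parabolic_stab[OF m(1)] l(1) m(1) d(1))
  moreover have "triple_matrix n (l, d, m) = A" using triple_matrix_mat[OF l(1) m(1) d(1)] d(2) by simp
  ultimately have im: "A \<in> triple_matrix n ` min_triples n r" by (metis imageI)
  obtain l' d' m' where t: "triple_of n r A = (l', d', m')" by (metis prod_cases3)
  have tm: "(l', d', m') \<in> min_triples n r" using inv_into_into[OF im] t unfolding triple_of_def by simp
  have tA: "triple_matrix n (l', d', m') = A" using f_inv_into_f[OF im] t unfolding triple_of_def by simp
  have Lm: "l' \<in> Lam n r" "m' \<in> Lam n r" "d' \<in> WB r"
    and min: "\<And>w. w \<in> dcoset (stab n r l') d' (stab n r m') \<Longrightarrow> word_length (gensB r) d' \<le> word_length (gensB r) w"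
    using tm parabolic_stab[of l' n r] parabolic_stab[of m' n r] unfolding min_triples_def by auto
  have mA: "mat n r l' d' m' = A" using tA triple_matrix_mat[OF Lm] by simp
  have "l' = l" "m' = m" using ro_mat[OF Lm] co_mat[OF Lm] mA row_comp_eq[OF Lm(1), of A] col_comp_eq[OF Lm(2), of A] rc by auto
  note lm = this
  have dd: "d_of n r A = d'" by (simp add: d_of_def t)
  have min': "lenB r d' \<le> lenB r (u \<circ> d' \<circ> v)" if "u \<in> stab n r l'" "v \<in> stab n r m'" for u v
  proof -
    have "u \<circ> d' \<circ> v \<in> WB r" by (intro WB_comp Lm(3) stab_WB[OF that(1)] stab_WB[OF that(2)])
    moreover have "u \<circ> d' \<circ> v \<in> dcoset (stab n r l') d' (stab n r m')" using that unfolding dcoset_def by blast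
    ultimately show ?thesis using min word_length_lenB[OF Lm(3)] word_length_lenB by (metis mult_le_mono2)
  qed
  have i1: "incr n r m' d'"
    by (rule incr_of_min[OF Lm(2,3)]) (use min'[OF stab_id] in simp)
  have i2: "incr n r l' (pinv d')"
  proof (rule incr_of_min[OF Lm(1) WB_inv[OF Lm(3)]])
    fix v assume v: "v \<in> stab n r l'"
    have "lenB r (pinv d' \<circ> v) = lenB r (pinv v \<circ> d')"
      using lenB_inv[OF WB_comp[OF WB_inv[OF Lm(3)] stab_WB[OF v]]]
        WB_inv_compose[OF WB_inv[OF Lm(3)] stab_WB[OF v]] WB_inv_inv[OF Lm(3)] by simp
    then show "lenB r (pinv d') \<le> lenB r (pinv d' \<circ> v)"
      using min'[OF stab_inv[OF v] stab_id] lenB_inv[OF Lm(3)] by simp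
  qed
  show "row_comp n r A \<in> Lam n r" "col_comp n r A \<in> Lam n r"
    "ro n A = hat n (row_comp n r A)" "co n A = hat n (col_comp n r A)"
    "d_of n r A \<in> WB r" "mat n r (row_comp n r A) (d_of n r A) (col_comp n r A) = A"
    "incr n r (col_comp n r A) (d_of n r A)" "incr n r (row_comp n r A) (pinv (d_of n r A))"
    using rc l m Lm lm dd mA i1 i2 by simp_all
qed

section \<open>Signs\<close>

definition psign :: "nat \<Rightarrow> (nat \<Rightarrow> nat) \<Rightarrow> sign" where
  "psign r w = (if w \<in> WD r then Pos else Neg)"

lemma sign_simps [simp]:
  "Pos * e = e" "e * Pos = e" "Neg * Neg = Pos" "Neg * e = - e" "e * Neg = - e" "- (- e) = e" "- Pos = Neg" "- Neg = Pos"
  "e * e = Pos" "e * (e * f) = f" "- e \<noteq> e" "e \<noteq> - e" "- e = - f \<longleftrightarrow> e = f" "- e * f = - (e * f)" "e * - f = - (e * f)" for e f :: sign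
  by (cases e; cases f; simp add: times_sign_def uminus_sign_def)+

lemma sign_assoc: "(e * f) * g = e * (f * g)" and sign_comm: "e * f = f * e" for e f g :: sign
  by (cases e; cases f; cases g; simp)+

lemma psign_comp: "v \<in> WB r \<Longrightarrow> w \<in> WB r \<Longrightarrow> psign r (v \<circ> w) = psign r v * psign r w"
  by (simp add: psign_def WD_comp_iff)

lemma psign_id: "psign r id = Pos"
  by (simp add: psign_def WD_id)

lemma psign_inv: "w \<in> WB r \<Longrightarrow> psign r (pinv w) = psign r w"
  by (simp add: psign_def WD_inv_iff)

lemma spow_WB: "r \<ge> 1 \<Longrightarrow> spow r e \<in> WB r"
  by (cases e) (auto simp: WB_id cs_WB)

lemma psign_spow: "r \<ge> 1 \<Longrightarrow> psign r (spow r e) = e"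
  using cs_WD_iff[of r r] by (cases e) (auto simp: psign_def WD_id)

lemma spow_spow: "spow r e \<circ> spow r e = id"
  by (cases e) (simp_all add: cs_cs)

lemma spow_comp: "spow r e \<circ> spow r f = spow r (e * f)"
  by (cases e; cases f) (simp_all add: cs_cs)

lemma spow_inv: "pinv (spow r e) = spow r e"
  by (rule inv_unique_comp) (simp_all add: spow_spow)

lemma spow_cancel: "spow r e \<circ> (spow r e \<circ> w) = w" "w \<circ> spow r e \<circ> spow r e = w"
  by (metis comp_assoc spow_spow comp_id id_comp)+

text \<open>Exchanging \<open>x\<close> and its opposite is the odd reflection used to change the parity of a representative.\<close>

lemma refl_WB:
  assumes x: "x \<in> {1..2*r}"
  shows "transpose x (2*r + 1 - x) \<in> WB r" "psign r (transpose x (2*r + 1 - x)) = Neg"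
proof -
  let ?t = "transpose x (2*r + 1 - x)"
  show W: "?t \<in> WB r"
  proof (rule WB_I)
    show "?t permutes {1..2*r}" by (rule permutes_swap_id) (use x in auto)
    fix y assume y: "y \<in> {1..2*r}"
    consider "y = x" | "y = 2*r + 1 - x" | "y \<noteq> x" "y \<noteq> 2*r + 1 - x" by blast
    then show "?t (2*r + 1 - y) = 2*r + 1 - ?t y"
    proof cases
      case 1
      have "2*r + 1 - (2*r + 1 - x) = x" using x by auto
      then show ?thesis unfolding 1 by (simp only: transpose_apply_first transpose_apply_second)
    next
      case 2 then have "2*r + 1 - y = x" using x by auto
      then show ?thesis using 2 by (simp only: transpose_apply_first transpose_apply_second)
    next
      case 3
      then have "2*r + 1 - y \<noteq> x" "2*r + 1 - y \<noteq> 2*r + 1 - x" using x y by auto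
      then show ?thesis using 3 by (simp only: transpose_def if_False)
    qed
  qed
  have "{i \<in> {1..r}. r < ?t i} = {if x \<le> r then x else 2*r + 1 - x}"
    using x by (auto simp: transpose_def split: if_splits)
  then have "neg r ?t = 1" by (simp add: neg_def)
  then show "psign r ?t = Neg" by (simp add: psign_def WD_iff)
qed

lemma refl_stab:
  assumes l: "l \<in> Lam n r" and x: "x \<in> {1..2*r}" "bk n l x = n + 1"
  shows "transpose x (2*r + 1 - x) \<in> stab n r l"
proof -
  have "bk n l (2*r + 1 - x) = n + 1" using bk_sym[OF l x(1)] x(2) by simp
  then have "bk n l (transpose x (2*r + 1 - x) y) = bk n l y" for y
    using x(2) by (cases "y = x \<or> y = 2*r + 1 - x") (auto simp: transpose_def)
  then show ?thesis using refl_WB(1)[OF x(1)] by (simp add: stab_def)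
qed

text \<open>Minimality forbids sign changes of points in the middle block or with image in the middle block. So a
  point \<open>x \<le> r\<close> with \<open>d x > r\<close> comes from a column left of the middle and goes to a row below it; the
  entries counting such points equal those above and right of the middle by central symmetry.\<close>

lemma psign_msgn:
  assumes l: "l \<in> Lam n r" and m: "m \<in> Lam n r" and d: "d \<in> WB r"
    and i1: "incr n r m d" and i2: "incr n r l (pinv d)"
  shows "psign r d = msgn n (mat n r l d m)"
proof -
  \<comment> \<open>An increasing map does not exchange the halves of the middle block.\<close>
  have lo: "y \<le> r" if "incr n r k w" "k \<in> Lam n r" "w \<in> WB r" "x \<in> {1..r}" "bk n k x = n + 1" "y = w x" for k w x y
  proof -
    have x: "x \<in> {1..2*r}" "2*r + 1 - x \<in> {1..2*r}" "x < 2*r + 1 - x" using that(4) by auto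
    have "w x < w (2*r + 1 - x)" using incrD[OF that(1) x] bk_sym[OF that(2) x(1)] that(5) by simp
    then show ?thesis using WB_opp[OF that(3) x(1)] that(6) by simp
  qed
  have eq: "x \<in> {1..r} \<and> r < d x \<longleftrightarrow> x \<in> {1..2*r} \<and> bk n l (d x) \<in> {n+2..2*n+1} \<and> bk n m x \<in> {1..n}" for x
  proof
    assume a: "x \<in> {1..r} \<and> r < d x"
    then have x: "x \<in> {1..2*r}" "x \<in> {1..r}" by auto
    have dx: "d x \<in> {1..2*r}" "d x \<in> {r+1..2*r}" using WB_mem[OF d, of x] x a by auto
    have "bk n m x \<noteq> n + 1" using lo[OF i1 m d x(2) _ refl] a by auto
    then have 1: "bk n m x \<in> {1..n}" using bk_le_mid[OF m x(2)] bk_bounds(1)[OF m x(1)] by auto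
    have "bk n l (d x) \<noteq> n + 1"
    proof
      assume b: "bk n l (d x) = n + 1"
      define y where "y = 2*r + 1 - d x"
      have y: "y \<in> {1..r}" using dx by (auto simp: y_def)
      have "bk n l y = n + 1" using bk_sym[OF l dx(1)] b by (simp add: y_def)
      then have "pinv d y \<le> r" using lo[OF i2 l WB_inv[OF d] y _ refl] by simp
      moreover have "pinv d y = 2*r + 1 - x"
        using WB_opp[OF WB_inv[OF d] dx(1)] WB_inv_apply(1)[OF d, of x] by (simp add: y_def)
      ultimately show False using x by auto
    qed
    then show "x \<in> {1..2*r} \<and> bk n l (d x) \<in> {n+2..2*n+1} \<and> bk n m x \<in> {1..n}"
      using 1 x bk_ge_mid[OF l dx(2)] bk_bounds(2)[OF l dx(1)] by auto
  next
    assume a: "x \<in> {1..2*r} \<and> bk n l (d x) \<in> {n+2..2*n+1} \<and> bk n m x \<in> {1..n}"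
    then have dx: "d x \<in> {1..2*r}" using WB_mem[OF d, of x] by blast
    have "\<not> x \<in> {r+1..2*r}" using bk_ge_mid[OF m, of x] a by auto
    moreover have "\<not> d x \<in> {1..r}" using bk_le_mid[OF l, of "d x"] a by auto
    ultimately show "x \<in> {1..r} \<and> r < d x" using a dx by auto
  qed
  have "{x \<in> {1..r}. r < d x} = {x \<in> {1..2*r}. bk n l (d x) \<in> {n+2..2*n+1} \<and> bk n m x \<in> {1..n}}"
    using eq by blast
  then have "neg r d = (\<Sum>i\<in>{n+2..2*n+1}. \<Sum>j\<in>{1..n}. mat n r l d m i j)"
    unfolding neg_def by (subst sum_mat) auto
  also have "\<dots> = (\<Sum>i\<in>{1..n}. \<Sum>j\<in>{1..n}. mat n r l d m (2*n + 2 - i) j)"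
    by (rule sum.reindex_bij_witness[of _ "\<lambda>i. 2*n + 2 - i" "\<lambda>i. 2*n + 2 - i"]) auto
  also have "\<dots> = (\<Sum>i\<in>{1..n}. \<Sum>j\<in>{n+2..2*n+1}. mat n r l d m i j)"
  proof (rule sum.cong[OF refl])
    fix i assume i: "i \<in> {1..n}"
    show "(\<Sum>j\<in>{1..n}. mat n r l d m (2*n + 2 - i) j) = (\<Sum>j\<in>{n+2..2*n+1}. mat n r l d m i j)"
    proof (rule sum.reindex_bij_witness[of _ "\<lambda>j. 2*n + 2 - j" "\<lambda>j. 2*n + 2 - j"])
      fix j assume j: "j \<in> {1..n}"
      show "mat n r l d m i (2*n + 2 - j) = mat n r l d m (2*n + 2 - i) j"
      proof -
        have "i \<in> {1..2*n+1}" "2*n + 2 - j \<in> {1..2*n+1}" "2*n + 2 - (2*n + 2 - j) = j" using i j by auto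
        then show ?thesis using Xi_sym[OF mat_Xi[OF l m d], of i "2*n + 2 - j"] by metis
      qed
    qed auto
  qed
  finally show ?thesis using d by (simp add: psign_def WD_iff msgn_def)
qed

section \<open>Even parabolic subgroups and their double cosets\<close>

text \<open>The parabolic subgroup of type D for the labels \<open>\<bullet>\<close> and \<open>+\<close>.\<close>

definition PD :: "nat \<Rightarrow> nat \<Rightarrow> (nat \<Rightarrow> nat) \<Rightarrow> (nat \<Rightarrow> nat) set" where
  "PD n r l = {w \<in> stab n r l. psign r w = Pos}"

lemma PD_stab: "w \<in> PD n r l \<Longrightarrow> w \<in> stab n r l"
  by (simp add: PD_def)

lemma PD_WB: "w \<in> PD n r l \<Longrightarrow> w \<in> WB r"
  by (simp add: PD_def stab_def)

lemma PD_psign: "w \<in> PD n r l \<Longrightarrow> psign r w = Pos"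
  by (simp add: PD_def)

lemma PD_id: "id \<in> PD n r l"
  by (simp add: PD_def stab_id psign_id)

lemma PD_comp: "u \<in> PD n r l \<Longrightarrow> v \<in> PD n r l \<Longrightarrow> u \<circ> v \<in> PD n r l"
  using psign_comp[OF PD_WB PD_WB, of u n r l v n l] by (simp add: PD_def stab_comp)

lemma PD_inv: "u \<in> PD n r l \<Longrightarrow> pinv u \<in> PD n r l"
  using psign_inv[OF PD_WB, of u n r l] by (simp add: PD_def stab_inv)

text \<open>Without a middle part no block crosses the line between \<open>r\<close> and \<open>r+1\<close>.\<close>

lemma stab_psign_no_mid:
  assumes l: "l \<in> Lam n r" "l (n + 1) = 0" and w: "w \<in> stab n r l"
  shows "psign r w = Pos"
proof -
  have "\<not> r < w x" if x: "x \<in> {1..r}" for x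
  proof
    assume "r < w x"
    have x2: "x \<in> {1..2*r}" using x by auto
    then have wx: "w x \<in> {r+1..2*r}" "w x \<in> {1..2*r}" using WB_mem[OF stab_WB[OF w], of x] \<open>r < w x\<close> by auto
    have "bk n l (w x) = bk n l x" by (rule stab_bk[OF w x2])
    then have "bk n l x = n + 1" using bk_ge_mid[OF l(1) wx(1)] bk_le_mid[OF l(1) x] by simp
    then show False using bk_no_mid[OF l x2] by simp
  qed
  then have "neg r w = 0" by (simp add: neg_def)
  then show ?thesis using stab_WB[OF w] by (simp add: psign_def WD_iff)
qed

lemma PD_no_mid: "l \<in> Lam n r \<Longrightarrow> l (n + 1) = 0 \<Longrightarrow> PD n r l = stab n r l"
  unfolding PD_def using stab_psign_no_mid by blast

lemma spow_stab: "l \<in> Lam n r \<Longrightarrow> l (n + 1) \<noteq> 0 \<Longrightarrow> r \<ge> 1 \<Longrightarrow> spow r e \<in> stab n r l"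
  using cs_stab[of l n r r] bk_r_mid[of l n r] by (cases e) (auto simp: stab_id)

text \<open>If there is a middle part then \<open>s\<^sub>r\<close> lies in the stabilizer, and a label sign makes no difference.\<close>

lemma PD_conj_mid:
  assumes l: "l \<in> Lam n r" "l (n + 1) \<noteq> 0" "r \<ge> 1"
  shows "{spow r e \<circ> w \<circ> spow r e | w. w \<in> PD n r l} = PD n r l"
proof -
  have *: "spow r e \<circ> w \<circ> spow r e \<in> PD n r l" if w: "w \<in> PD n r l" for w
    using w spow_stab[OF l, of e] psign_spow[OF l(3), of e] PD_WB[OF w] spow_WB[OF l(3), of e]
    by (simp add: PD_def stab_comp psign_comp WB_comp)
  moreover have "w = spow r e \<circ> (spow r e \<circ> w \<circ> spow r e) \<circ> spow r e" for w
    by (simp add: comp_assoc spow_cancel spow_spow)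
  ultimately show ?thesis by blast
qed

lemma parabolicD_decor:
  assumes l: "l \<in> Lam n r" and r: "r \<ge> 1"
  shows "parabolicD n r (decor n l e) = {spow r e \<circ> w \<circ> spow r e | w. w \<in> PD n r l}"
proof (cases "l (n + 1) = 0")
  case True
  then show ?thesis using parabolic_stab[OF l] PD_no_mid[OF l True] by (cases e) (simp_all add: decor_def)
next
  case False
  have "stab n r l \<inter> WD r = PD n r l" by (auto simp: PD_def psign_def)
  then show ?thesis using False parabolic_stab[OF l] PD_conj_mid[OF l False r, of e] by (simp add: decor_def)
qed

text \<open>This reduces double cosets for negative labels to those of the subgroups \<open>PD\<close>.\<close>

lemma dcoset_conj:
  "dcoset {spow r e \<circ> w \<circ> spow r e | w. w \<in> P} (spow r e \<circ> d \<circ> spow r f) {spow r f \<circ> w \<circ> spow r f | w. w \<in> Q}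
   = {spow r e \<circ> w \<circ> spow r f | w. w \<in> dcoset P d Q}"
proof -
  have "(spow r e \<circ> u \<circ> spow r e) \<circ> (spow r e \<circ> d \<circ> spow r f) \<circ> (spow r f \<circ> v \<circ> spow r f)
    = spow r e \<circ> (u \<circ> d \<circ> v) \<circ> spow r f" for u v
    by (simp add: comp_assoc spow_cancel)
  then show ?thesis unfolding dcoset_def by (auto; metis)
qed

definition fibre :: "nat \<Rightarrow> nat \<Rightarrow> (nat \<Rightarrow> nat) \<Rightarrow> (nat \<Rightarrow> nat) \<Rightarrow> (nat \<Rightarrow> nat \<Rightarrow> nat) \<Rightarrow> sign \<Rightarrow> (nat \<Rightarrow> nat) set" where
  "fibre n r l m A \<sigma> = {w \<in> WB r. mat n r l w m = A \<and> psign r w = \<sigma>}"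

lemma dcoset_PD_subset:
  assumes l: "l \<in> Lam n r" and m: "m \<in> Lam n r" and d: "d \<in> WB r"
  shows "dcoset (PD n r l) d (PD n r m) \<subseteq> fibre n r l m (mat n r l d m) (psign r d)"
proof
  fix w assume "w \<in> dcoset (PD n r l) d (PD n r m)"
  then obtain u v where uv: "u \<in> PD n r l" "v \<in> PD n r m" "w = u \<circ> d \<circ> v" by (auto simp: dcoset_def)
  then show "w \<in> fibre n r l m (mat n r l d m) (psign r d)"
    using mat_stab[OF l m d PD_stab[OF uv(1)] PD_stab[OF uv(2)]] PD_WB[OF uv(1)] PD_WB[OF uv(2)] d
    by (simp add: fibre_def WB_comp psign_comp PD_psign)
qed

text \<open>Two elements with equal matrix differ by \<open>u\<close> and \<open>v\<close> in the stabilizers, of equal parity. If both are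
  odd, there is a point \<open>x\<close> in the middle column with image in the middle row; the reflections at \<open>x\<close> and
  at \<open>d x\<close> are exchanged by \<open>d\<close>, and inserting them makes both factors even.\<close>

lemma dcoset_fibre:
  assumes l: "l \<in> Lam n r" and m: "m \<in> Lam n r" and d: "d \<in> WB r"
    and c: "l (n + 1) = 0 \<or> mat n r l d m (n+1) (n+1) \<noteq> 0"
  shows "dcoset (PD n r l) d (PD n r m) = fibre n r l m (mat n r l d m) (psign r d)"
proof (rule subset_antisym[OF dcoset_PD_subset[OF l m d] subsetI])
  fix w assume "w \<in> fibre n r l m (mat n r l d m) (psign r d)"
  then have w: "w \<in> WB r" "mat n r l w m = mat n r l d m" "psign r w = psign r d" by (auto simp: fibre_def)
  obtain u v where uv: "u \<in> stab n r l" "v \<in> stab n r m" "w = u \<circ> d \<circ> v"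
    by (rule double_coset[OF l m w(1) d w(2)])
  note W = stab_WB[OF uv(1)] stab_WB[OF uv(2)]
  have "psign r u * (psign r d * psign r v) = psign r d"
    using w(3) uv(3) W d by (simp add: psign_comp WB_comp sign_assoc)
  then have ps: "psign r u = psign r v" by (cases "psign r u"; cases "psign r v"; cases "psign r d") auto
  show "w \<in> dcoset (PD n r l) d (PD n r m)"
  proof (cases "psign r u = Pos")
    case True
    then show ?thesis using uv ps unfolding dcoset_def PD_def by auto
  next
    case False
    then have "psign r u = Neg" by (cases "psign r u") auto
    have "l (n + 1) \<noteq> 0" using False stab_psign_no_mid[OF l _ uv(1)] by blast
    then have "card {x \<in> {1..2*r}. bk n l (d x) = n + 1 \<and> bk n m x = n + 1} \<noteq> 0" using c by (simp add: mat_def)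
    then obtain x where x: "x \<in> {1..2*r}" "bk n l (d x) = n + 1" "bk n m x = n + 1"
      by (metis (mono_tags, lifting) card_eq_0_iff empty_Collect_eq)
    have dx: "d x \<in> {1..2*r}" using WB_mem[OF d, of x] x(1) by blast
    let ?t = "transpose x (2*r + 1 - x)" and ?t' = "transpose (d x) (2*r + 1 - d x)"
    have t: "?t \<in> stab n r m" "psign r ?t = Neg" using refl_stab[OF m x(1,3)] refl_WB[OF x(1)] by auto
    have t': "?t' \<in> stab n r l" "psign r ?t' = Neg" using refl_stab[OF l dx x(2)] refl_WB[OF dx] by auto
    \<comment> \<open>\<open>d\<close> conjugates the reflection at \<open>x\<close> into the reflection at \<open>d x\<close>.\<close>
    have dt: "d \<circ> ?t = ?t' \<circ> d"
    proof
      fix y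
      have "d y = d x \<longleftrightarrow> y = x" "d y = 2*r + 1 - d x \<longleftrightarrow> y = 2*r + 1 - x"
        unfolding WB_opp[OF d x(1), symmetric] by (rule WB_eq[OF d])+
      then show "(d \<circ> ?t) y = (?t' \<circ> d) y"
        using WB_opp[OF d x(1)] by (cases "y = x"; cases "y = 2*r + 1 - x") (simp_all only: comp_apply transpose_def simp_thms if_True if_False refl)
    qed
    have "w = (u \<circ> ?t') \<circ> d \<circ> (?t \<circ> v)"
    proof -
      have "(u \<circ> ?t') \<circ> d \<circ> (?t \<circ> v) = u \<circ> (?t' \<circ> ?t') \<circ> d \<circ> v"
        using dt by (simp add: fun_eq_iff comp_def)
      then show ?thesis using uv(3) by simp
    qed
    moreover have "u \<circ> ?t' \<in> PD n r l" "?t \<circ> v \<in> PD n r m"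
      using t t' uv ps \<open>psign r u = Neg\<close> psign_comp[OF W(1) stab_WB[OF t'(1)]] psign_comp[OF stab_WB[OF t(1)] W(2)]
      by (simp_all add: PD_def stab_comp)
    ultimately show ?thesis unfolding dcoset_def by blast
  qed
qed

section \<open>Splitting a middle block of size two\<close>

text \<open>The composition with its middle part, which will be \<open>1\<close>, moved to part \<open>n\<close>.\<close>

definition drop_mid :: "nat \<Rightarrow> (nat \<Rightarrow> nat) \<Rightarrow> nat \<Rightarrow> nat" where
  "drop_mid n m i = (if i = n then m n + 1 else if i = n + 1 then 0 else m i)"

lemma drop_mid_Lam:
  assumes n: "n \<ge> 1" and m: "m \<in> Lam n r" "m (n + 1) = 1"
  shows "drop_mid n m \<in> Lam n r"
proof -
  have u: "{1..n+1} = insert (n+1) (insert n {1..<n})" using n by auto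
  have "(\<Sum>i\<in>{1..<n}. drop_mid n m i) = (\<Sum>i\<in>{1..<n}. m i)" by (rule sum.cong) (auto simp: drop_mid_def)
  then have "(\<Sum>i\<in>{1..n+1}. drop_mid n m i) = (\<Sum>i\<in>{1..n+1}. m i)"
    unfolding u using n m(2) by (simp add: drop_mid_def)
  then show ?thesis using m n by (auto simp: Lam_def drop_mid_def)
qed

lemma card_split_two:
  assumes "finite X" "a \<in> X" "b \<in> X" "a \<noteq> b"
  shows "card {x \<in> X. P x} = card {x \<in> X - {a, b}. P x} + (if P a then 1 else 0) + (if P b then 1 else (0::nat))"
proof -
  have "card {x \<in> X. P x} = (\<Sum>x\<in>X. if P x then 1 else 0)"
    using assms(1) by (simp add: sum.If_cases Int_def)
  also have "\<dots> = (\<Sum>x\<in>insert a (insert b (X - {a, b})). if P x then 1 else (0::nat))"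
    by (rule sum.cong) (use assms in auto)
  also have "\<dots> = (if P a then 1 else 0) + ((if P b then 1 else 0) + (\<Sum>x\<in>X - {a, b}. if P x then 1 else 0))"
    using assms by (subst sum.insert, simp, simp, subst sum.insert) auto
  also have "(\<Sum>x\<in>X - {a, b}. if P x then 1 else (0::nat)) = card {x \<in> X - {a, b}. P x}"
    using assms(1) by (simp add: sum.If_cases Int_def)
  finally show ?thesis by (simp only: ac_simps)
qed

text \<open>Only the shift at \<open>p\<close> increases the entry \<open>(n, p)\<close>.\<close>

lemma shiftA_inj:
  assumes pos: "A (n+1) p > 0" "A (n+1) q > 0" and eq: "shiftA n A p = shiftA n A q"
  shows "p = q"
proof (rule ccontr)
  assume ne: "p \<noteq> q"
  have "shiftA n A p n p = A n p + 1" "shiftA n A q n p = A n p" using ne by (auto simp: shiftA_def Eth_def)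
  then show False using eq by simp
qed

text \<open>In this situation \<open>{r, r+1}\<close> is the middle block of \<open>m\<close>, and \<open>l\<close> has the same blocks except that \<open>r\<close>
  has moved to block \<open>n\<close> and \<open>r+1\<close> to block \<open>n+2\<close>.\<close>

locale middle_one =
  fixes n r :: nat and m l :: "nat \<Rightarrow> nat"
  assumes n: "n \<ge> 1" and m: "m \<in> Lam n r" and m1: "m (n + 1) = 1" and l_def: "l = drop_mid n m"
begin

lemma dm_l: "l \<in> Lam n r"
  unfolding l_def by (rule drop_mid_Lam[OF n m m1])

lemma dm_l0: "l (n + 1) = 0"
  by (simp add: l_def drop_mid_def)

lemma dm_r: "r \<ge> 1"
  using Lam_cum_mid[OF m] m1 by simp

lemma dm_cum: "i \<le> n \<Longrightarrow> cum n l i = cum n m i"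
  using cum_low[of i n l] cum_low[of i n m] by (simp add: l_def drop_mid_def)

lemma dm_bk_m: "bk n m r = n + 1" "bk n m (r + 1) = n + 1"
  using bk_r_mid[OF m] m1 by auto

lemma dm_bk_m_mid: "x \<in> {1..2*r} \<Longrightarrow> bk n m x = n + 1 \<longleftrightarrow> x = r \<or> x = r + 1"
  using bk_bounds(3,4)[OF m, of x] Lam_cum_mid[OF m] Lam_cum_mid2[OF m] m1 dm_bk_m by auto

lemma dm_bk_l: "bk n l r = n" "bk n l (r + 1) = n + 2"
proof -
  have e: "cum n l (n + 1) = r" using Lam_cum_mid[OF dm_l] dm_l0 by simp
  have "cum n l n < r" using dm_cum[of n] cum_Suc[of n n m] Lam_cum_mid[OF m] m1 n by simp
  then show r: "bk n l r = n" using e dm_r by (intro bk_unique[OF dm_l]) auto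
  have "r \<in> {1..2*r}" "2*r + 1 - r = r + 1" using dm_r by auto
  then show "bk n l (r + 1) = n + 2" using bk_sym[OF dm_l, of r] r by simp
qed

lemma dm_bk_same:
  assumes x: "x \<in> {1..2*r}" "x \<noteq> r" "x \<noteq> r + 1"
  shows "bk n l x = bk n m x"
proof -
  have low: "bk n l x = bk n m x" if x: "x \<in> {1..<r}" for x
  proof (rule bk_unique[OF dm_l])
    have x2: "x \<in> {1..2*r}" "x \<in> {1..r}" using x by auto
    note b = bk_bounds[OF m x2(1)]
    have k: "bk n m x \<le> n" using bk_le_mid[OF m x2(2)] dm_bk_m_mid[OF x2(1)] x by auto
    show "x \<in> {1..2*r}" by (rule x2)
    show "cum n l (bk n m x) < x" using b(3) dm_cum[OF k] by simp
    show "x \<le> cum n l (bk n m x + 1)"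
    proof (cases "bk n m x = n")
      case True
      then show ?thesis using Lam_cum_mid[OF dm_l] dm_l0 x by simp
    next
      case False
      then show ?thesis using b(4) dm_cum[of "bk n m x + 1"] k by simp
    qed
  qed
  show ?thesis
  proof (cases "x < r")
    case True then show ?thesis using low x by simp
  next
    case False
    define y where "y = 2*r + 1 - x"
    have y: "y \<in> {1..<r}" "y \<in> {1..2*r}" "x = 2*r + 1 - y" using False x by (auto simp: y_def)
    show ?thesis unfolding y(3) bk_sym[OF dm_l y(2)] bk_sym[OF m y(2)] low[OF y(1)] ..
  qed
qed

text \<open>Passing from \<open>m\<close> to \<open>l\<close> changes the row of just two points, the opposite preimages of \<open>r\<close> and \<open>r+1\<close>.
  The equation is written additively because subtraction of natural numbers truncates.\<close>

lemma mat_drop_mid: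
  assumes k: "k \<in> Lam n r" and w: "w \<in> WB r" and p: "p = bk n k (pinv w r)"
  shows "mat n r l w k i j + Eth n (n+1) p i j = mat n r m w k i j + Eth n n p i j"
proof (cases "i \<in> {1..2*n+1} \<and> j \<in> {1..2*n+1}")
  case True
  define a where "a = pinv w r"
  define b where "b = pinv w (r + 1)"
  have rr: "r \<in> {1..2*r}" "r + 1 \<in> {1..2*r}" "2*r + 1 - r = r + 1" using dm_r by auto
  have a: "a \<in> {1..2*r}" "w a = r" and b: "b \<in> {1..2*r}" "w b = r + 1"
    unfolding a_def b_def using WB_mem[OF WB_inv[OF w]] rr WB_inv_apply(2)[OF w] by (simp_all only:)
  have ab: "a \<noteq> b" using a b by auto
  have "b = 2*r + 1 - a" using WB_opp[OF WB_inv[OF w] rr(1)] rr(3) by (simp add: a_def b_def)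
  then have pb: "bk n k b = 2*n + 2 - p" using bk_sym[OF k a(1)] by (simp add: p a_def)
  have pa: "bk n k a = p" by (simp add: p a_def)
  have pp: "1 \<le> p" "p \<le> 2*n+1" using bk_bounds[OF k a(1)] pa by auto
  let ?X = "{1..2*r} - {a, b}"
  have same: "bk n l (w x) = bk n m (w x)" if "x \<in> ?X" for x
  proof (rule dm_bk_same)
    show "w x \<in> {1..2*r}" using WB_mem[OF w, of x] that by blast
    show "w x \<noteq> r" "w x \<noteq> r + 1" using WB_eq[OF w, of x a] WB_eq[OF w, of x b] a b that by auto
  qed
  then have "{x \<in> ?X. bk n l (w x) = i \<and> bk n k x = j} = {x \<in> ?X. bk n m (w x) = i \<and> bk n k x = j}" by auto
  then have "mat n r l w k i j + (if n + 1 = i \<and> p = j then 1 else 0) + (if n + 1 = i \<and> 2*n + 2 - p = j then 1 else 0)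
      = mat n r m w k i j + (if n = i \<and> p = j then 1 else 0) + (if n + 2 = i \<and> 2*n + 2 - p = j then 1 else 0)"
    using True card_split_two[OF _ a(1) b(1) ab, of "\<lambda>x. bk n l (w x) = i \<and> bk n k x = j"]
      card_split_two[OF _ a(1) b(1) ab, of "\<lambda>x. bk n m (w x) = i \<and> bk n k x = j"]
    unfolding mat_def a(2) b(2) dm_bk_l dm_bk_m pa pb by simp
  moreover have "Eth n (n+1) p i j = (if n + 1 = i \<and> p = j then 1 else 0) + (if n + 1 = i \<and> 2*n + 2 - p = j then 1 else 0)"
    by (auto simp: Eth_def)
  moreover have "Eth n n p i j = (if n = i \<and> p = j then 1 else 0) + (if n + 2 = i \<and> 2*n + 2 - p = j then 1 else 0)"
    by (auto simp: Eth_def)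
  ultimately show ?thesis by linarith
next
  case False
  have "pinv w r \<in> {1..2*r}" using WB_mem[OF WB_inv[OF w], of r] dm_r by auto
  then have "1 \<le> p" "p \<le> 2*n+1" unfolding p using bk_bounds[OF k] by auto
  then have "Eth n (n+1) p i j = 0" "Eth n n p i j = 0" using False n by (auto simp: Eth_def)
  then show ?thesis using False by (simp only: mat_def if_False)
qed

lemma mat_shiftA:
  assumes k: "k \<in> Lam n r" and w: "w \<in> WB r"
  shows "mat n r l w k = shiftA n (mat n r m w k) (bk n k (pinv w r))"
proof (intro ext)
  fix i j
  show "mat n r l w k i j = shiftA n (mat n r m w k) (bk n k (pinv w r)) i j"
    using mat_drop_mid[OF k w refl, of i j] by (simp add: shiftA_def)
qed

text \<open>A point of column \<open>p\<close> in the middle row goes to \<open>r\<close> or to \<open>r+1\<close>; in the second case multiply by \<open>s\<^sub>r\<close>.\<close>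

lemma fibre_column_exists:
  assumes k: "k \<in> Lam n r" and d: "d \<in> WB r" and pos: "mat n r m d k (n+1) p > 0"
  obtains d' where "d' \<in> WB r" "mat n r m d' k = mat n r m d k" "bk n k (pinv d' r) = p"
proof -
  have p: "n + 1 \<in> {1..2*n+1} \<and> p \<in> {1..2*n+1}" using pos by (auto simp: mat_def split: if_splits)
  have "0 < card {x \<in> {1..2*r}. bk n m (d x) = n + 1 \<and> bk n k x = p}"
    using pos by (simp only: mat_def p if_True simp_thms)
  then have "card {x \<in> {1..2*r}. bk n m (d x) = n + 1 \<and> bk n k x = p} \<noteq> 0" by (rule gr_implies_not0)
  then obtain x where x: "x \<in> {1..2*r}" "bk n m (d x) = n + 1" "bk n k x = p"
    by (metis (mono_tags, lifting) card_eq_0_iff empty_Collect_eq)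
  have dx: "d x \<in> {1..2*r}" using WB_mem[OF d, of x] x(1) by blast
  define e where "e = (if d x = r then Pos else Neg)"
  have s: "spow r e \<in> stab n r m" by (rule spow_stab[OF m]) (use m1 dm_r in auto)
  have W: "spow r e \<circ> d \<in> WB r" by (rule WB_comp[OF stab_WB[OF s] d])
  have "(spow r e \<circ> d) x = r"
    using dm_bk_m_mid[OF dx] x(2) cs_right[of r r] dm_r by (auto simp: e_def)
  then have "pinv (spow r e \<circ> d) r = x" using WB_inv_apply(1)[OF W, of x] by simp
  moreover have "mat n r m (spow r e \<circ> d) k = mat n r m d k"
    using mat_stab[OF m k d s stab_id] by simp
  ultimately show ?thesis using that[OF W] x(3) by simp
qed

lemma shiftA_fibre_iff:
  assumes k: "k \<in> Lam n r" and d: "d \<in> WB r" and w: "w \<in> WB r"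
    and pos: "mat n r m d k (n+1) p > 0" and p: "bk n k (pinv w r) = p"
  shows "mat n r l w k = shiftA n (mat n r m d k) p \<longleftrightarrow> mat n r m w k = mat n r m d k"
proof -
  obtain d' where d': "d' \<in> WB r" "mat n r m d' k = mat n r m d k" "bk n k (pinv d' r) = p"
    by (rule fibre_column_exists[OF k d pos])
  have s: "shiftA n (mat n r m d k) p = mat n r l d' k" using mat_shiftA[OF k d'(1)] d' by simp
  show ?thesis
  proof
    assume "mat n r l w k = shiftA n (mat n r m d k) p"
    then have e: "mat n r l w k = mat n r l d' k" using s by simp
    show "mat n r m w k = mat n r m d k"
    proof (intro ext)
      fix i j
      show "mat n r m w k i j = mat n r m d k i j"
        using mat_drop_mid[OF k w p[symmetric], of i j] mat_drop_mid[OF k d'(1) d'(3)[symmetric], of i j] e d'(2) by simp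
    qed
  next
    assume "mat n r m w k = mat n r m d k"
    then show "mat n r l w k = shiftA n (mat n r m d k) p" using mat_shiftA[OF k w] p by simp
  qed
qed

text \<open>The shift adds one to an entry above and right of the middle exactly when \<open>p\<close> is right of the middle.\<close>

lemma msgn_shiftA:
  assumes "p \<in> {1..2*n+1}"
  shows "msgn n (shiftA n A p) = (if p \<le> n + 1 then msgn n A else - msgn n A)"
proof -
  have row: "(\<Sum>j\<in>{n+2..2*n+1}. shiftA n A p i j)
      = (\<Sum>j\<in>{n+2..2*n+1}. A i j) + (if i = n \<and> p \<in> {n+2..2*n+1} then 1 else 0)" if i: "i \<in> {1..n}" for i
  proof -
    have "shiftA n A p i j = A i j + (if p = j then (if i = n then 1 else 0) else 0)" for j
      using i by (auto simp: shiftA_def Eth_def)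
    then have "(\<Sum>j\<in>{n+2..2*n+1}. shiftA n A p i j)
      = (\<Sum>j\<in>{n+2..2*n+1}. A i j) + (\<Sum>j\<in>{n+2..2*n+1}. if p = j then (if i = n then 1 else 0) else 0)"
      by (simp only: sum.distrib)
    then show ?thesis by (simp only: sum.delta' sum.delta finite_atLeastAtMost) auto
  qed
  have "(\<Sum>i\<in>{1..n}. \<Sum>j\<in>{n+2..2*n+1}. shiftA n A p i j)
    = (\<Sum>i\<in>{1..n}. (\<Sum>j\<in>{n+2..2*n+1}. A i j) + (if n = i then (if p \<in> {n+2..2*n+1} then 1 else 0) else 0))"
    by (rule sum.cong[OF refl], subst row) auto
  also have "\<dots> = (\<Sum>i\<in>{1..n}. \<Sum>j\<in>{n+2..2*n+1}. A i j) + (if p \<in> {n+2..2*n+1} then 1 else 0)"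
    unfolding sum.distrib using n by simp
  finally show ?thesis using assms unfolding msgn_def by auto
qed

text \<open>In the stabilizer of \<open>m\<close> only the points \<open>r\<close> and \<open>r+1\<close> can change the half.\<close>

lemma PD_m_fix: "u \<in> stab n r m \<Longrightarrow> psign r u = Pos \<longleftrightarrow> u r = r"
proof -
  assume u: "u \<in> stab n r m"
  have uW: "u \<in> WB r" by (rule stab_WB[OF u])
  have low: "\<not> r < u x" if x: "x \<in> {1..<r}" for x
  proof
    assume gt: "r < u x"
    have x2: "x \<in> {1..2*r}" "x \<in> {1..r}" using x by auto
    have ux: "u x \<in> {r+1..2*r}" using gt WB_mem[OF uW, of x] x2 by auto
    have "bk n m (u x) = bk n m x" by (rule stab_bk[OF u x2(1)])
    then have "bk n m x = n + 1" using bk_ge_mid[OF m ux] bk_le_mid[OF m x2(2)] by simp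
    then show False using dm_bk_m_mid[OF x2(1)] x by simp
  qed
  have rr: "r \<in> {1..2*r}" using dm_r by auto
  have ur: "u r = r \<or> u r = r + 1"
    using stab_bk[OF u rr] dm_bk_m dm_bk_m_mid[of "u r"] WB_mem[OF uW, of r] rr by simp
  have "{i \<in> {1..r}. r < u i} = (if u r = r then {} else {r})"
  proof (rule Set.set_eqI)
    fix i show "i \<in> {i \<in> {1..r}. r < u i} \<longleftrightarrow> i \<in> (if u r = r then {} else {r})"
      using ur low[of i] dm_r by (cases "i = r") auto
  qed
  then have "neg r u = (if u r = r then 0 else 1)" by (simp add: neg_def)
  then show "psign r u = Pos \<longleftrightarrow> u r = r" using uW by (simp add: psign_def WD_iff)
qed

text \<open>The part of a fibre where the column of the point sent to \<open>r\<close> is restricted to \<open>Pr\<close>.\<close>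

definition mid_fibre :: "(nat \<Rightarrow> nat) \<Rightarrow> (nat \<Rightarrow> nat \<Rightarrow> nat) \<Rightarrow> sign \<Rightarrow> nat set \<Rightarrow> (nat \<Rightarrow> nat) set" where
  "mid_fibre k A \<sigma> Pr = {w \<in> WB r. mat n r m w k = A \<and> psign r w = \<sigma> \<and> bk n k (pinv w r) \<in> Pr}"

text \<open>The middle row meets no middle column, so the preimages of \<open>r\<close> and \<open>r+1\<close> lie in columns on different
  sides of the middle. Even elements on the left fix \<open>r\<close> and keep these sides, odd ones exchange them;
  and the minimal \<open>d\<close> has the preimage of \<open>r\<close> on the left side.\<close>

lemma dcoset_mid_fibre:
  assumes k: "k \<in> Lam n r" and d: "d \<in> WB r" and i: "incr n r m (pinv d)"
    and c: "mat n r m d k (n+1) (n+1) = 0"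
  shows "dcoset (PD n r m) d (PD n r k) = mid_fibre k (mat n r m d k) (psign r d) {1..n}"
proof -
  have rr: "r \<in> {1..2*r}" "r + 1 \<in> {1..2*r}" "2*r + 1 - r = r + 1" using dm_r by auto
  have pr: "pinv w r \<in> {1..2*r}" if "w \<in> WB r" for w using WB_mem[OF WB_inv[OF that], of r] rr by blast
  \<comment> \<open>By minimality of \<open>d\<close> the preimage of \<open>r\<close> lies in the left half.\<close>
  have pd: "pinv d r < pinv d (r + 1)" by (rule incrD[OF i rr(1,2)]) (use dm_bk_m in auto)
  have opp: "pinv d (r + 1) = 2*r + 1 - pinv d r" using WB_opp[OF WB_inv[OF d] rr(1)] rr(3) by simp
  have "pinv d r \<in> {1..r}" using pd opp pr[OF d] by auto
  then have "bk n k (pinv d r) \<le> n + 1" by (rule bk_le_mid[OF k])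
  moreover have "bk n k (pinv d r) \<noteq> n + 1"
  proof
    assume "bk n k (pinv d r) = n + 1"
    then have in0: "pinv d r \<in> {x \<in> {1..2*r}. bk n m (d x) = n + 1 \<and> bk n k x = n + 1}"
      using pr[OF d] WB_inv_apply(2)[OF d, of r] dm_bk_m by simp
    have nn: "n + 1 \<in> {1..2*n+1}" by simp
    have "card {x \<in> {1..2*r}. bk n m (d x) = n + 1 \<and> bk n k x = n + 1} = 0"
      using c by (simp only: mat_def nn simp_thms if_True)
    then have "{x \<in> {1..2*r}. bk n m (d x) = n + 1 \<and> bk n k x = n + 1} = {}"
      by (rule card_0_eq[THEN iffD1, rotated]) simp
    with in0 show False by (simp only: empty_iff)
  qed
  ultimately have bd: "bk n k (pinv d r) \<le> n" by simp
  then have bd1: "bk n k (pinv d (r + 1)) \<ge> n + 2" unfolding opp bk_sym[OF k pr[OF d]] by simp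
  have bw: "bk n k (pinv (u \<circ> d \<circ> v) r) = bk n k (pinv d (pinv u r))"
    if u: "u \<in> stab n r m" and v: "v \<in> stab n r k" for u v
  proof -
    have "pinv (u \<circ> d \<circ> v) r = pinv v (pinv d (pinv u r))"
      using WB_inv_compose[OF WB_comp[OF stab_WB[OF u] d] stab_WB[OF v]] WB_inv_compose[OF stab_WB[OF u] d] by simp
    moreover have "pinv d (pinv u r) \<in> {1..2*r}"
      using WB_mem[OF WB_inv[OF d], of "pinv u r"] pr[OF stab_WB[OF u]] by blast
    ultimately show ?thesis using stab_bk[OF stab_inv[OF v]] by simp
  qed
  have fx: "pinv u r = r \<longleftrightarrow> u r = r" if "u \<in> WB r" for u using WB_inv_apply[OF that] by metis
  show ?thesis
  proof (rule subset_antisym; rule subsetI)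
    fix w assume w: "w \<in> dcoset (PD n r m) d (PD n r k)"
    then obtain u v where uv: "u \<in> PD n r m" "v \<in> PD n r k" "w = u \<circ> d \<circ> v" by (auto simp: dcoset_def)
    have "pinv u r = r" using PD_m_fix[OF PD_stab[OF uv(1)]] PD_psign[OF uv(1)] fx[OF PD_WB[OF uv(1)]] by simp
    then have "bk n k (pinv w r) \<le> n" using bw[OF PD_stab[OF uv(1)] PD_stab[OF uv(2)]] uv(3) bd by simp
    moreover have "w \<in> fibre n r m k (mat n r m d k) (psign r d)" using dcoset_PD_subset[OF m k d] w by blast
    ultimately show "w \<in> mid_fibre k (mat n r m d k) (psign r d) {1..n}"
      using bk_bounds(1)[OF k pr] by (auto simp: mid_fibre_def fibre_def)
  next
    fix w assume "w \<in> mid_fibre k (mat n r m d k) (psign r d) {1..n}"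
    then have w: "w \<in> WB r" "mat n r m w k = mat n r m d k" "psign r w = psign r d" "bk n k (pinv w r) \<le> n"
      by (auto simp: mid_fibre_def)
    obtain u v where uv: "u \<in> stab n r m" "v \<in> stab n r k" "w = u \<circ> d \<circ> v"
      by (rule double_coset[OF m k w(1) d w(2)])
    note W = stab_WB[OF uv(1)] stab_WB[OF uv(2)]
    have "pinv u r = r \<or> pinv u r = r + 1"
      using stab_bk[OF stab_inv[OF uv(1)] rr(1)] dm_bk_m dm_bk_m_mid[OF pr[OF W(1)]] by simp
    \<comment> \<open>If \<open>u\<close> exchanged \<open>r\<close> and \<open>r+1\<close>, then \<open>w\<close> would send a point of the right side to \<open>r\<close>.\<close>
    then have "pinv u r = r" using bw[OF uv(1,2)] uv(3) w(4) bd1 by auto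
    then have pu: "psign r u = Pos" using PD_m_fix[OF uv(1)] fx[OF W(1)] by simp
    have "psign r u * (psign r d * psign r v) = psign r d"
      using w(3) uv(3) W d by (simp add: psign_comp WB_comp sign_assoc)
    then have "psign r v = Pos" using pu by (cases "psign r v"; cases "psign r d") auto
    then show "w \<in> dcoset (PD n r m) d (PD n r k)" using uv pu unfolding dcoset_def PD_def by blast
  qed
qed

lemma spow_mid_fibre:
  assumes k: "k \<in> Lam n r"
  shows "(\<lambda>w. spow r Neg \<circ> w) ` mid_fibre k A \<sigma> {1..n} = mid_fibre k A (- \<sigma>) {n+2..2*n+1}"
proof -
  have rr: "r \<in> {1..2*r}" "r + 1 \<in> {1..2*r}" "2*r + 1 - r = r + 1" using dm_r by auto
  have s: "spow r Neg \<in> stab n r m" by (rule spow_stab[OF m]) (use m1 dm_r in auto)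
  have ps: "psign r (spow r Neg) = Neg" by (rule psign_spow[OF dm_r])
  have *: "spow r Neg \<circ> w \<in> WB r \<and> mat n r m (spow r Neg \<circ> w) k = mat n r m w k
      \<and> psign r (spow r Neg \<circ> w) = - psign r w \<and> bk n k (pinv (spow r Neg \<circ> w) r) = 2*n + 2 - bk n k (pinv w r)
      \<and> bk n k (pinv w r) \<in> {1..2*n+1}"
    if w: "w \<in> WB r" for w
  proof -
    have pw: "pinv w r \<in> {1..2*r}" using WB_mem[OF WB_inv[OF w], of r] rr by blast
    have "pinv (spow r Neg \<circ> w) r = pinv w (spow r Neg r)"
      using WB_inv_compose[OF stab_WB[OF s] w] spow_inv[of r Neg] by simp
    also have "\<dots> = pinv w (r + 1)" using cs_left[of r r] dm_r by simp
    also have "\<dots> = 2*r + 1 - pinv w r" using WB_opp[OF WB_inv[OF w] rr(1)] rr(3) by simp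
    finally have "bk n k (pinv (spow r Neg \<circ> w) r) = 2*n + 2 - bk n k (pinv w r)" using bk_sym[OF k pw] by simp
    moreover have "mat n r m (spow r Neg \<circ> w) k = mat n r m w k" using mat_stab[OF m k w s stab_id] by simp
    ultimately show ?thesis
      using WB_comp[OF stab_WB[OF s] w] psign_comp[OF stab_WB[OF s] w] ps bk_bounds(1,2)[OF k pw]
      by (simp del: spow.simps)
  qed
  show ?thesis
  proof (rule subset_antisym; rule subsetI)
    fix w assume "w \<in> (\<lambda>w. spow r Neg \<circ> w) ` mid_fibre k A \<sigma> {1..n}"
    then obtain w' where w': "w = spow r Neg \<circ> w'" "w' \<in> mid_fibre k A \<sigma> {1..n}" by blast
    then show "w \<in> mid_fibre k A (- \<sigma>) {n+2..2*n+1}" using *[of w'] by (auto simp: mid_fibre_def simp del: spow.simps)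
  next
    fix w assume w: "w \<in> mid_fibre k A (- \<sigma>) {n+2..2*n+1}"
    then have "spow r Neg \<circ> w \<in> mid_fibre k A \<sigma> {1..n}" using *[of w] by (auto simp: mid_fibre_def simp del: spow.simps)
    moreover have "w = spow r Neg \<circ> (spow r Neg \<circ> w)" by (simp only: spow_cancel)
    ultimately show "w \<in> (\<lambda>w. spow r Neg \<circ> w) ` mid_fibre k A \<sigma> {1..n}" by blast
  qed
qed

end

section \<open>The Hecke algebra as a ring\<close>

definition okw :: "nat \<Rightarrow> gword \<Rightarrow> bool" where
  "okw r w \<longleftrightarrow> set (letters w) \<subseteq> {1..r}"

lemma okw_plus: "okw r (u + v) \<longleftrightarrow> okw r u \<and> okw r v"
  by (simp add: okw_def plus_gword_def)

lemma okw_zero: "okw r 0"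
  by (simp add: okw_def zero_gword_def)

text \<open>The carrier of the free algebra on \<open>r\<close> letters is a proper subset of its type. The projection to it is
  a ring homomorphism; composed with the passage to classes it gives a total function on the type, so
  that computations can be done in the ring type of all letters.\<close>

definition restr :: "nat \<Rightarrow> free_elt \<Rightarrow> free_elt" where
  "restr r f = (\<Sum>w\<in>{w \<in> Poly_Mapping.keys f. okw r w}. Poly_Mapping.single w (Poly_Mapping.lookup f w))"

lemma lookup_restr: "Poly_Mapping.lookup (restr r f) k = (if okw r k then Poly_Mapping.lookup f k else 0)"
proof -
  let ?K = "{w \<in> Poly_Mapping.keys f. okw r w}"
  have "Poly_Mapping.lookup (restr r f) k = (\<Sum>w\<in>?K. if w = k then Poly_Mapping.lookup f w else 0)"
    unfolding restr_def lookup_sum by (rule sum.cong) (auto simp: lookup_single when_def)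
  also have "\<dots> = (if k \<in> ?K then Poly_Mapping.lookup f k else 0)" by (subst sum.delta) auto
  also have "\<dots> = (if okw r k then Poly_Mapping.lookup f k else 0)" by (auto simp: in_keys_iff)
  finally show ?thesis .
qed

lemma restr_add: "restr r (f + g) = restr r f + restr r g"
  by (rule poly_mapping_eqI) (simp add: lookup_restr lookup_add)

lemma restr_mult: "restr r (f * g) = restr r f * restr r g"
proof (rule poly_mapping_eqI)
  fix k
  show "Poly_Mapping.lookup (restr r (f * g)) k = Poly_Mapping.lookup (restr r f * restr r g) k"
  proof (cases "okw r k")
    case True
    have "(Poly_Mapping.lookup f l * (\<Sum>q. Poly_Mapping.lookup g q when k = l + q))
      = (Poly_Mapping.lookup (restr r f) l * (\<Sum>q. Poly_Mapping.lookup (restr r g) q when k = l + q))" for l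
    proof (cases "okw r l")
      case lt: True
      have "(Poly_Mapping.lookup g q when k = l + q) = (Poly_Mapping.lookup (restr r g) q when k = l + q)" for q
        using True by (auto simp: when_def lookup_restr okw_plus)
      then show ?thesis using lt by (simp add: lookup_restr)
    next
      case False
      then have "k \<noteq> l + q" for q using True by (auto simp: okw_plus)
      then show ?thesis by simp
    qed
    then show ?thesis using True by (simp add: lookup_restr lookup_mult)
  next
    case False
    have z: "Poly_Mapping.lookup (restr r f) l * (\<Sum>q. Poly_Mapping.lookup (restr r g) q when k = l + q) = 0" for l
    proof (cases "okw r l")
      case True
      then have "(Poly_Mapping.lookup (restr r g) q when k = l + q) = 0" for q
        using False by (auto simp: when_def lookup_restr okw_plus)
      then show ?thesis by simp
    qed (simp add: lookup_restr)
    have "Poly_Mapping.lookup (restr r f * restr r g) k = 0" by (simp only: lookup_mult z Sum_any.neutral)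
    then show ?thesis using False by (simp add: lookup_restr)
  qed
qed

lemma restr_single: "okw r w \<Longrightarrow> restr r (Poly_Mapping.single w c) = Poly_Mapping.single w c"
  by (rule poly_mapping_eqI) (auto simp: lookup_restr lookup_single when_def)

lemma restr_one: "restr r 1 = 1"
  using restr_single[OF okw_zero, of r 1] by (simp add: single_one)

lemma carrier_free_alg: "f \<in> carrier (free_alg r) \<longleftrightarrow> (\<forall>w\<in>Poly_Mapping.keys f. okw r w)"
  by (simp add: free_alg_def okw_def)

lemma restr_carrier: "restr r f \<in> carrier (free_alg r)"
  by (auto simp: carrier_free_alg in_keys_iff lookup_restr split: if_splits)

lemma restr_id: "f \<in> carrier (free_alg r) \<Longrightarrow> restr r f = f"
  by (rule poly_mapping_eqI) (auto simp: carrier_free_alg in_keys_iff lookup_restr)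

lemma restr_in_carrier_iff: "f \<in> carrier (free_alg r) \<longleftrightarrow> restr r f = f"
  using restr_id restr_carrier by metis

lemma free_alg_simps: "x \<otimes>\<^bsub>free_alg r\<^esub> y = x * y" "x \<oplus>\<^bsub>free_alg r\<^esub> y = x + y"
  "\<one>\<^bsub>free_alg r\<^esub> = 1" "\<zero>\<^bsub>free_alg r\<^esub> = 0"
  by (simp_all add: free_alg_def)

lemma restr_zero: "restr r 0 = 0" and restr_uminus: "restr r (- f) = - restr r f"
  by (rule poly_mapping_eqI; simp add: lookup_restr)+

lemma ring_free_alg: "ring (free_alg r)"
proof (rule ringI)
  show "abelian_group (free_alg r)"
  proof (rule abelian_groupI)
    fix x assume x: "x \<in> carrier (free_alg r)"
    then show "\<exists>y\<in>carrier (free_alg r). y \<oplus>\<^bsub>free_alg r\<^esub> x = \<zero>\<^bsub>free_alg r\<^esub>"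
      by (intro bexI[of _ "- x"]) (simp_all add: free_alg_simps restr_in_carrier_iff restr_uminus)
  qed (simp_all add: free_alg_simps restr_in_carrier_iff restr_add restr_zero ac_simps)
  show "monoid (free_alg r)"
    by (rule monoidI) (simp_all add: free_alg_simps restr_in_carrier_iff restr_mult restr_one mult.assoc)
qed (simp_all add: free_alg_simps algebra_simps)

lemma restr_fgen: "i \<in> {1..r} \<Longrightarrow> restr r (fgen i) = fgen i"
  unfolding fgen_def by (rule restr_single) (simp add: okw_def)

lemma restr_fconst: "restr r (fconst c) = fconst c"
  unfolding fconst_def by (rule restr_single) (simp add: okw_def)

lemma restr_diff: "restr r (f - g) = restr r f - restr r g"
  using restr_add[of r f "- g"] by (simp add: restr_uminus)

lemma hecke_rels_carrier:
  assumes "r \<ge> 2" shows "hecke_rels r \<subseteq> carrier (free_alg r)"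
proof
  fix f assume "f \<in> hecke_rels r"
  then show "f \<in> carrier (free_alg r)"
    unfolding hecke_rels_def restr_in_carrier_iff using assms
    by (elim UnE CollectE exE conjE singletonE; hypsubst)
      (simp_all add: restr_diff restr_add restr_mult restr_fgen restr_fconst restr_one)
qed

lemma ring_with_smult:
  assumes "ring R"
  shows "ring \<lparr>carrier = carrier R, mult = mult R, one = one R, zero = zero R, add = add R, smult = s\<rparr>"
proof -
  interpret ring R by (rule assms)
  show ?thesis
  proof (rule ringI)
    show "abelian_group \<lparr>carrier = carrier R, mult = mult R, one = one R, zero = zero R, add = add R, smult = s\<rparr>"
    proof (rule abelian_groupI)
      fix x assume "x \<in> carrier \<lparr>carrier = carrier R, mult = mult R, one = one R, zero = zero R, add = add R, smult = s\<rparr>"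
      then show "\<exists>y\<in>carrier \<lparr>carrier = carrier R, mult = mult R, one = one R, zero = zero R, add = add R, smult = s\<rparr>.
        y \<oplus>\<^bsub>\<lparr>carrier = carrier R, mult = mult R, one = one R, zero = zero R, add = add R, smult = s\<rparr>\<^esub> x
        = \<zero>\<^bsub>\<lparr>carrier = carrier R, mult = mult R, one = one R, zero = zero R, add = add R, smult = s\<rparr>\<^esub>"
        by (intro bexI[of _ "\<ominus>\<^bsub>R\<^esub> x"]) (simp_all add: l_neg)
    qed (simp_all add: a_ac)
    show "monoid \<lparr>carrier = carrier R, mult = mult R, one = one R, zero = zero R, add = add R, smult = s\<rparr>"
      by (rule monoidI) (simp_all add: m_assoc)
  qed (simp_all add: l_distr r_distr)
qed

text \<open>The element of the Hecke algebra represented by \<open>f\<close>. All identities in the Hecke algebra are written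
  as \<open>cl r f = cl r g\<close>, with \<open>f\<close> and \<open>g\<close> in the free algebra.\<close>

definition cl :: "nat \<Rightarrow> free_elt \<Rightarrow> hecke_elt" where
  "cl r f = hecke_class r (restr r f)"

text \<open>For \<open>r \<ge> 2\<close> the letters of all defining relations lie in \<open>{1..r}\<close>.\<close>

locale hecke_rank =
  fixes r :: nat
  assumes r2: "r \<ge> 2"
begin

lemma ideal_hecke: "ideal (hecke_ideal r) (free_alg r)"
  unfolding hecke_ideal_def by (rule ring.genideal_ideal[OF ring_free_alg hecke_rels_carrier[OF r2]])

lemma ring_hecke: "ring (hecke r)"
  unfolding hecke_def Let_def by (rule ring_with_smult[OF ideal.quotient_is_ring[OF ideal_hecke]])

interpretation H: ring "hecke r" by (rule ring_hecke)

lemma class_hom: "hecke_class r \<in> ring_hom (free_alg r) (free_alg r Quot hecke_ideal r)"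
  unfolding hecke_class_def by (rule ideal.rcos_ring_hom[OF ideal_hecke])

lemma hecke_sel: "carrier (hecke r) = carrier (free_alg r Quot hecke_ideal r)"
  "x \<otimes>\<^bsub>hecke r\<^esub> y = x \<otimes>\<^bsub>free_alg r Quot hecke_ideal r\<^esub> y"
  "x \<oplus>\<^bsub>hecke r\<^esub> y = x \<oplus>\<^bsub>free_alg r Quot hecke_ideal r\<^esub> y"
  "\<one>\<^bsub>hecke r\<^esub> = \<one>\<^bsub>free_alg r Quot hecke_ideal r\<^esub>"
  "\<zero>\<^bsub>hecke r\<^esub> = \<zero>\<^bsub>free_alg r Quot hecke_ideal r\<^esub>"
  by (simp_all add: hecke_def Let_def)

lemma cl_carrier: "cl r f \<in> carrier (hecke r)"
  unfolding cl_def hecke_sel by (rule ring_hom_closed[OF class_hom restr_carrier])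

lemma cl_mult: "cl r (f * g) = cl r f \<otimes>\<^bsub>hecke r\<^esub> cl r g"
  unfolding cl_def hecke_sel restr_mult
  using ring_hom_mult[OF class_hom restr_carrier restr_carrier] by (simp add: free_alg_simps)

lemma cl_add: "cl r (f + g) = cl r f \<oplus>\<^bsub>hecke r\<^esub> cl r g"
  unfolding cl_def hecke_sel restr_add
  using ring_hom_add[OF class_hom restr_carrier restr_carrier] by (simp add: free_alg_simps)

lemma cl_one: "cl r 1 = \<one>\<^bsub>hecke r\<^esub>"
  unfolding cl_def hecke_sel restr_one using ring_hom_one[OF class_hom] by (simp add: free_alg_simps)

lemma cl_zero: "cl r 0 = \<zero>\<^bsub>hecke r\<^esub>"
proof -
  have "cl r 0 \<oplus>\<^bsub>hecke r\<^esub> cl r 0 = cl r 0" using cl_add[of 0 0] by simp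
  then show ?thesis using H.add.l_cancel_one'[of "cl r 0" "cl r 0"] cl_carrier by auto
qed

lemma cl_surj: assumes "x \<in> carrier (hecke r)" obtains f where "x = cl r f"
proof -
  obtain f where f: "f \<in> carrier (free_alg r)" "x = hecke_class r f"
    using assms unfolding hecke_sel hecke_class_def FactRing_def A_RCOSETS_def' by auto
  then show ?thesis using that[of f] by (simp add: cl_def restr_id)
qed

lemma cl_rel: assumes "f - g \<in> hecke_rels r" shows "cl r f = cl r g"
proof -
  have c: "f - g \<in> carrier (free_alg r)" using assms hecke_rels_carrier[OF r2] by blast
  have "f - g \<in> hecke_ideal r"
    unfolding hecke_ideal_def using assms ring.genideal_self[OF ring_free_alg hecke_rels_carrier[OF r2]] by blast
  then have "hecke_class r (f - g) = hecke_ideal r"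
    unfolding hecke_class_def by (rule ring.a_rcos_zero[OF ring_free_alg ideal_hecke])
  then have z: "cl r (f - g) = \<zero>\<^bsub>hecke r\<^esub>"
    unfolding cl_def restr_id[OF c] hecke_sel by (simp add: FactRing_def)
  have "cl r f = cl r (f - g) \<oplus>\<^bsub>hecke r\<^esub> cl r g" using cl_add[of "f - g" g] by simp
  then show ?thesis using z cl_carrier by simp
qed

lemma cl_sum_cong:
  assumes "\<And>i. i \<in> I \<Longrightarrow> cl r (f i) = cl r (g i)"
  shows "cl r (sum f I) = cl r (sum g I)"
  using assms
proof (induction I rule: infinite_finite_induct)
  case (insert x F) then show ?case by (simp add: cl_add)
qed simp_all

lemma cl_mult_cong: "cl r f = cl r f' \<Longrightarrow> cl r g = cl r g' \<Longrightarrow> cl r (f * g) = cl r (f' * g')"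
  by (simp add: cl_mult)

lemma cl_add_cong: "cl r f = cl r f' \<Longrightarrow> cl r g = cl r g' \<Longrightarrow> cl r (f + g) = cl r (f' + g')"
  by (simp add: cl_add)

lemma cl_finsum:
  assumes "finite I" shows "cl r (sum f I) = (\<Oplus>\<^bsub>hecke r\<^esub>i\<in>I. cl r (f i))"
  using assms
proof (induction I)
  case (insert x F)
  then show ?case using cl_carrier by (simp add: cl_add H.finsum_insert)
qed (simp add: cl_zero)

lemma Tgen_cl: "i \<in> {1..r} \<Longrightarrow> Tgen r i = cl r (fgen i)"
  by (simp add: Tgen_def cl_def restr_fgen)

lemma smult_cl: "c \<odot>\<^bsub>hecke r\<^esub> x = cl r (fconst c) \<otimes>\<^bsub>hecke r\<^esub> x"
  by (simp add: hecke_def Let_def cl_def restr_fconst)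

end

lemma fconst_zero: "fconst 0 = 0" and fconst_one: "fconst 1 = 1"
  and fconst_mult: "fconst (c * d) = fconst c * fconst d"
  and fconst_add: "fconst (c + d) = fconst c + fconst d"
  and fconst_diff: "fconst (c - d) = fconst c - fconst d"
proof -
  show "fconst 0 = 0" by (simp add: fconst_def)
  show "fconst 1 = 1" by (simp add: fconst_def single_one flip: zero_gword_def)
  show "fconst (c * d) = fconst c * fconst d" by (simp add: fconst_def mult_single plus_gword_def)
  show "fconst (c + d) = fconst c + fconst d" by (simp add: fconst_def single_add)
  show "fconst (c - d) = fconst c - fconst d" by (simp add: fconst_def single_diff)
qed

lemma fconst_sum: "fconst (sum f I) = (\<Sum>i\<in>I. fconst (f i))"
  by (induction I rule: infinite_finite_induct) (simp_all add: fconst_zero fconst_add)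

lemma fconst_central: "fconst c * f = f * fconst c"
proof -
  have "f = (\<Sum>w\<in>Poly_Mapping.keys f. Poly_Mapping.single w (Poly_Mapping.lookup f w))"
  proof (rule poly_mapping_eqI)
    fix k
    have "(\<Sum>w\<in>Poly_Mapping.keys f. Poly_Mapping.lookup (Poly_Mapping.single w (Poly_Mapping.lookup f w)) k)
      = (\<Sum>w\<in>Poly_Mapping.keys f. if w = k then Poly_Mapping.lookup f w else 0)"
      by (rule sum.cong) (auto simp: lookup_single when_def)
    also have "\<dots> = Poly_Mapping.lookup f k" by (subst sum.delta) (auto simp: in_keys_iff)
    finally show "Poly_Mapping.lookup f k
      = Poly_Mapping.lookup (\<Sum>w\<in>Poly_Mapping.keys f. Poly_Mapping.single w (Poly_Mapping.lookup f w)) k"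
      by (simp add: lookup_sum)
  qed
  moreover have "fconst c * Poly_Mapping.single w a = Poly_Mapping.single w a * fconst c" for w a
    by (simp add: fconst_def mult_single plus_gword_def mult.commute)
  ultimately show ?thesis by (metis (no_types, lifting) sum.cong sum_distrib_left sum_distrib_right)
qed

section \<open>The standard basis elements and Matsumoto's theorem\<close>

definition tword :: "nat list \<Rightarrow> free_elt" where
  "tword is = prod_list (map fgen is)"

lemma tword_simps: "tword [] = 1" "tword (i # is) = fgen i * tword is" "tword (is @ js) = tword is * tword js"
  by (simp_all add: tword_def)

text \<open>A representative of \<open>T\<^sub>w\<close> in the free algebra.\<close>

definition tw :: "nat \<Rightarrow> (nat \<Rightarrow> nat) \<Rightarrow> free_elt" where
  "tw r w = tword (SOME is. reduced_expr r is w)"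

context hecke_rank
begin

lemma rel_comm: "i \<in> {1..r} \<Longrightarrow> j \<in> {1..r} \<Longrightarrow> i + 2 \<le> j \<or> j + 2 \<le> i \<Longrightarrow> cl r (fgen i * fgen j) = cl r (fgen j * fgen i)"
  by (rule cl_rel, unfold hecke_rels_def) blast

lemma rel_braid: "1 \<le> j \<Longrightarrow> j < r - 1 \<Longrightarrow> cl r (fgen j * fgen (j+1) * fgen j) = cl r (fgen (j+1) * fgen j * fgen (j+1))"
  by (rule cl_rel, unfold hecke_rels_def) blast

lemma rel_braid4: "cl r (fgen (r-1) * fgen r * fgen (r-1) * fgen r) = cl r (fgen r * fgen (r-1) * fgen r * fgen (r-1))"
  by (rule cl_rel, unfold hecke_rels_def) blast

lemma rel_quad: "1 \<le> i \<Longrightarrow> i < r \<Longrightarrow> cl r (fgen i * fgen i) = cl r (fconst (qq - 1) * fgen i + fconst qq)"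
  by (rule cl_rel, unfold hecke_rels_def) blast

lemma rel_last: "cl r (fgen r * fgen r) = cl r 1"
  by (rule cl_rel, unfold hecke_rels_def) blast

text \<open>If \<open>i\<close> and \<open>j\<close> are both descents of \<open>w\<close>, then \<open>w\<close> ends in the longest element of the dihedral group
  generated by \<open>s\<^sub>i\<close> and \<open>s\<^sub>j\<close>; its two reduced words are the sides of a braid relation, of length two, three
  or four.\<close>

lemma two_descents:
  assumes w: "w \<in> WB r" and i: "i \<in> {1..r}" and j: "j \<in> {1..r}" and ij: "i < j"
    and di: "w (i+1) < w i" and dj: "w (j+1) < w j"
  shows "\<exists>u x y. reduced_expr r (u @ x @ [i]) w \<and> reduced_expr r (u @ y @ [j]) w
      \<and> cl r (tword (x @ [i])) = cl r (tword (y @ [j]))"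
proof -
  have up: "reduced_expr r (us @ [k]) v"
    if "v \<in> WB r" "k \<in> {1..r}" "v (k+1) < v k" "reduced_expr r us (v \<circ> cs r k)" for v k us
  proof -
    have W: "v \<circ> cs r k \<in> WB r" by (rule WB_comp[OF that(1) cs_WB[OF that(2)]])
    have "(v \<circ> cs r k) k < (v \<circ> cs r k) (k+1)" using that cs_left[OF that(2)] cs_right[OF that(2)] by simp
    from reduced_snoc[OF W that(2) this that(4)] show ?thesis by (simp only: comp_cs_cs)
  qed
  have W: "v \<circ> cs r k \<in> WB r" if "v \<in> WB r" "k \<in> {1..r}" for v k using WB_comp[OF that(1) cs_WB[OF that(2)]] .
  consider "i + 2 \<le> j" | "j = i + 1" "j < r" | "j = i + 1" "j = r" using ij j by force
  then show ?thesis
  proof cases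
    case 1
    \<comment> \<open>Commuting generators: the two words have length two.\<close>
    have ci: "cs r i j = j" "cs r i (j+1) = j+1" using 1 i j by (auto intro!: cs_other)
    have cj: "cs r j i = i" "cs r j (i+1) = i+1" using 1 i j by (auto intro!: cs_other)
    have comm: "w \<circ> cs r i \<circ> cs r j = w \<circ> cs r j \<circ> cs r i"
    proof -
      have "cs r i (cs r j z) = cs r j (cs r i z)" for z
      proof (cases "z \<in> {i, i+1, 2*r - i, 2*r + 1 - i}")
        case True
        have o: "cs r j (2*r + 1 - i) = 2*r + 1 - i" "cs r j (2*r + 1 - (i+1)) = 2*r + 1 - (i+1)"
          using WB_opp[OF cs_WB[OF j], of i] WB_opp[OF cs_WB[OF j], of "i+1"] cj i ij j by auto
        have oi: "cs r i (2*r + 1 - i) = 2*r + 1 - (i+1)" "cs r i (2*r + 1 - (i+1)) = 2*r + 1 - i"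
          using WB_opp[OF cs_WB[OF i], of i] WB_opp[OF cs_WB[OF i], of "i+1"] cs_left[OF i] cs_right[OF i] i ij j by auto
        have "2*r - i = 2*r + 1 - (i+1)" by simp
        then show ?thesis using True o oi cj cs_left[OF i] cs_right[OF i] by (elim insertE emptyE) metis+
      next
        case False
        then have z: "cs r i z = z" by (auto intro!: cs_other[OF i])
        show ?thesis
        proof (cases "z \<in> {j, j+1, 2*r - j, 2*r + 1 - j}")
          case True
          have o: "cs r i (2*r + 1 - j) = 2*r + 1 - j" "cs r i (2*r + 1 - (j+1)) = 2*r + 1 - (j+1)"
            using WB_opp[OF cs_WB[OF i], of j] WB_opp[OF cs_WB[OF i], of "j+1"] ci i ij j by auto
          have oj: "cs r j (2*r + 1 - j) = 2*r + 1 - (j+1)" "cs r j (2*r + 1 - (j+1)) = 2*r + 1 - j"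
            using WB_opp[OF cs_WB[OF j], of j] WB_opp[OF cs_WB[OF j], of "j+1"] cs_left[OF j] cs_right[OF j] i ij j by auto
          have "2*r - j = 2*r + 1 - (j+1)" by simp
          then show ?thesis using True z o oj ci cs_left[OF j] cs_right[OF j] by (elim insertE emptyE) metis+
        next
          case False
          then have "cs r j z = z" by (auto intro!: cs_other[OF j])
          then show ?thesis using z by simp
        qed
      qed
      then show ?thesis by (auto simp: fun_eq_iff)
    qed
    obtain u where u: "reduced_expr r u (w \<circ> cs r i \<circ> cs r j)" using reduced_exists W[OF W[OF w i] j] by blast
    have "reduced_expr r (u @ [j]) (w \<circ> cs r i)"
      by (rule up[OF W[OF w i] j _ u]) (use ci dj in simp)
    then have r1: "reduced_expr r ((u @ [j]) @ [i]) w" by (rule up[OF w i di])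
    have "reduced_expr r (u @ [i]) (w \<circ> cs r j)"
      by (rule up[OF W[OF w j] i _ u[unfolded comm]]) (use cj di in simp)
    then have r2': "reduced_expr r ((u @ [i]) @ [j]) w" by (rule up[OF w j dj])
    have "cl r (tword ([j] @ [i])) = cl r (tword ([i] @ [j]))"
      using rel_comm[OF j i] 1 by (simp add: tword_simps)
    then show ?thesis using r1 r2' by (intro exI[of _ u] exI[of _ "[j]"] exI[of _ "[i]"]) simp
  next
    case 2
    \<comment> \<open>The braid relation of length three. The generators act on \<open>i\<close>, \<open>i+1\<close>, \<open>i+2\<close> and, by
      reversal, on the opposite points.\<close>
    have c: "cs r i i = i+1" "cs r i (i+1) = i" "cs r i (i+2) = i+2"
      "cs r j i = i" "cs r j (i+1) = i+2" "cs r j (i+2) = i+1"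
      using cs_small[of i r i] cs_small[of i r "i+1"] cs_small[of i r "i+2"]
        cs_small[of j r i] cs_small[of j r "i+1"] cs_small[of j r "i+2"] 2 i by (auto simp: transpose_def)
    have d: "w (i+1) < w i" "w (i+2) < w (i+1)" using di dj 2 by simp_all
    have jj: "i + 1 + 1 = i + 2" by simp
    note ev = comp_apply c[unfolded 2(1)] jj 2(1)
    have br: "w \<circ> cs r i \<circ> cs r j \<circ> cs r i = w \<circ> cs r j \<circ> cs r i \<circ> cs r j"
    proof -
      have "cs r i (cs r j (cs r i z)) = cs r j (cs r i (cs r j z))" for z
      proof -
        have tri: "z = i \<or> z = i+1 \<or> z = i+2 \<or> z = 2*r + 1 - i \<or> z = 2*r + 1 - (i+1) \<or> z = 2*r + 1 - (i+2) \<or>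
          z \<notin> {i, i+1, i+2, 2*r + 1 - i, 2*r + 1 - (i+1), 2*r + 1 - (i+2)}" by blast
        have m: "i \<in> {1..2*r}" "i+1 \<in> {1..2*r}" "i+2 \<in> {1..2*r}" using i 2 by auto
        have o: "cs r i (2*r + 1 - i) = 2*r + 1 - (i+1)" "cs r i (2*r + 1 - (i+1)) = 2*r + 1 - i"
          "cs r i (2*r + 1 - (i+2)) = 2*r + 1 - (i+2)" "cs r j (2*r + 1 - i) = 2*r + 1 - i"
          "cs r j (2*r + 1 - (i+1)) = 2*r + 1 - (i+2)" "cs r j (2*r + 1 - (i+2)) = 2*r + 1 - (i+1)"
          by (simp_all only: WB_opp[OF cs_WB[OF i] m(1)] WB_opp[OF cs_WB[OF i] m(2)] WB_opp[OF cs_WB[OF i] m(3)]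
            WB_opp[OF cs_WB[OF j] m(1)] WB_opp[OF cs_WB[OF j] m(2)] WB_opp[OF cs_WB[OF j] m(3)] c)
        have out: "cs r i z = z" "cs r j z = z" if z: "z \<notin> {i, i+1, i+2, 2*r + 1 - i, 2*r + 1 - (i+1), 2*r + 1 - (i+2)}"
        proof -
          show "cs r i z = z" by (rule cs_other[OF i]) (use z in auto)
          have "j + 1 = i + 2" "2*r - j = 2*r + 1 - (i+2)" "2*r + 1 - j = 2*r + 1 - (i+1)" using 2 by auto
          then show "cs r j z = z" using z 2(1) by (intro cs_other[OF j]) (simp_all only: insert_iff de_Morgan_disj simp_thms)
        qed
        show ?thesis
          using tri by (elim disjE; (hypsubst, simp only: c o)?) (simp only: out not_False_eq_True)
      qed
      then show ?thesis by (auto simp: fun_eq_iff)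
    qed
    let ?w' = "w \<circ> cs r i \<circ> cs r j \<circ> cs r i"
    obtain u where u: "reduced_expr r u ?w'" using reduced_exists W[OF W[OF W[OF w i] j] i] by blast
    have "reduced_expr r (u @ [i]) (w \<circ> cs r i \<circ> cs r j)"
      by (rule up[OF W[OF W[OF w i] j] i _ u]) (use d in \<open>simp only: ev\<close>)
    then have "reduced_expr r ((u @ [i]) @ [j]) (w \<circ> cs r i)"
      by (rule up[OF W[OF w i] j, rotated]) (use d less_trans[OF d(2,1)] in \<open>simp only: ev\<close>)
    then have r1: "reduced_expr r (((u @ [i]) @ [j]) @ [i]) w" by (rule up[OF w i di])
    have "reduced_expr r (u @ [j]) (w \<circ> cs r j \<circ> cs r i)"
      by (rule up[OF W[OF W[OF w j] i] j _ u[unfolded br]]) (use d in \<open>simp only: ev\<close>)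
    then have "reduced_expr r ((u @ [j]) @ [i]) (w \<circ> cs r j)"
      by (rule up[OF W[OF w j] i, rotated]) (use d less_trans[OF d(2,1)] in \<open>simp only: ev\<close>)
    then have r2': "reduced_expr r (((u @ [j]) @ [i]) @ [j]) w" by (rule up[OF w j dj])
    have "cl r (tword ([i, j] @ [i])) = cl r (tword ([j, i] @ [j]))"
      using rel_braid[of i] 2 i by (simp add: tword_simps mult.assoc)
    then show ?thesis using r1 r2' by (intro exI[of _ u] exI[of _ "[i, j]"] exI[of _ "[j, i]"]) simp
  next
    case 3
    \<comment> \<open>The braid relation of length four. Here the moved points are \<open>i, ..., i+3\<close>, the four central ones.\<close>
    have ir: "i = r - 1" "i + 1 = r" "i < r" using 3 by auto
    have c: "cs r i i = i+1" "cs r i (i+1) = i" "cs r i (i+2) = i+3" "cs r i (i+3) = i+2"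
      "cs r j i = i" "cs r j (i+1) = i+2" "cs r j (i+2) = i+1" "cs r j (i+3) = i+3"
      using i 3 by (auto simp: cs_def transpose_def)
    have vals: "w (i+2) = 2*r + 1 - w (i+1)" "w (i+3) = 2*r + 1 - w i"
      using WB_opp[OF w, of "i+1"] WB_opp[OF w, of i] ir i by (auto simp: numeral_3_eq_3)
    have rng: "w i \<in> {1..2*r}" "w (i+1) \<in> {1..2*r}" using WB_mem[OF w, of i] WB_mem[OF w, of "i+1"] i ir by auto
    have d: "w (i+1) < w i" "w (i+2) < w (i+1)" "w (i+3) < w (i+2)"
      using di dj 3 vals rng by auto
    have jj: "i + 1 + 1 = i + 2" by simp
    note ev = comp_apply c[unfolded 3(1)] jj 3(1)
    have t: "w (i+2) < w i" "w (i+3) < w (i+1)" "w (i+3) < w i" using d by linarith+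
    have br: "w \<circ> cs r i \<circ> cs r j \<circ> cs r i \<circ> cs r j = w \<circ> cs r j \<circ> cs r i \<circ> cs r j \<circ> cs r i"
    proof -
      have "cs r i (cs r j (cs r i (cs r j z))) = cs r j (cs r i (cs r j (cs r i z)))" for z
      proof -
        have tri: "z = i \<or> z = i+1 \<or> z = i+2 \<or> z = i+3 \<or> z \<notin> {i, i+1, i+2, i+3}" by blast
        have out: "cs r i z = z" "cs r j z = z" if z: "z \<notin> {i, i+1, i+2, i+3}"
        proof -
          have "2*r - i = i + 2" "2*r + 1 - i = i + 3" using ir by auto
          then show "cs r i z = z" using z by (intro cs_other[OF i]) (simp_all only: insert_iff de_Morgan_disj simp_thms)
          have "j + 1 = i + 2" "2*r - j = i + 1" "2*r + 1 - j = i + 2" using 3 by auto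
          then show "cs r j z = z" using z 3(1) by (intro cs_other[OF j]) (simp_all only: insert_iff de_Morgan_disj simp_thms)
        qed
        show ?thesis using tri c out by metis
      qed
      then show ?thesis by (auto simp: fun_eq_iff)
    qed
    obtain u where u: "reduced_expr r u (w \<circ> cs r i \<circ> cs r j \<circ> cs r i \<circ> cs r j)"
      using reduced_exists W[OF W[OF W[OF W[OF w i] j] i] j] by blast
    have "reduced_expr r (u @ [j]) (w \<circ> cs r i \<circ> cs r j \<circ> cs r i)"
      by (rule up[OF W[OF W[OF W[OF w i] j] i] j _ u]) (use d t in \<open>simp only: ev\<close>)
    then have "reduced_expr r ((u @ [j]) @ [i]) (w \<circ> cs r i \<circ> cs r j)"
      by (rule up[OF W[OF W[OF w i] j] i, rotated]) (use d t in \<open>simp only: ev\<close>)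
    then have "reduced_expr r (((u @ [j]) @ [i]) @ [j]) (w \<circ> cs r i)"
      by (rule up[OF W[OF w i] j, rotated]) (use d t in \<open>simp only: ev\<close>)
    then have r1: "reduced_expr r ((((u @ [j]) @ [i]) @ [j]) @ [i]) w" by (rule up[OF w i di])
    have "reduced_expr r (u @ [i]) (w \<circ> cs r j \<circ> cs r i \<circ> cs r j)"
      by (rule up[OF W[OF W[OF W[OF w j] i] j] i _ u[unfolded br]]) (use d t in \<open>simp only: ev\<close>)
    then have "reduced_expr r ((u @ [i]) @ [j]) (w \<circ> cs r j \<circ> cs r i)"
      by (rule up[OF W[OF W[OF w j] i] j, rotated]) (use d t in \<open>simp only: ev\<close>)
    then have "reduced_expr r (((u @ [i]) @ [j]) @ [i]) (w \<circ> cs r j)"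
      by (rule up[OF W[OF w j] i, rotated]) (use d t in \<open>simp only: ev\<close>)
    then have r2': "reduced_expr r ((((u @ [i]) @ [j]) @ [i]) @ [j]) w" by (rule up[OF w j dj])
    have "cl r (tword ([j, i, j] @ [i])) = cl r (tword ([i, j, i] @ [j]))"
    proof -
      have "cl r (fgen i * fgen j * fgen i * fgen j) = cl r (fgen j * fgen i * fgen j * fgen i)"
        unfolding ir(1) 3(2) by (rule rel_braid4)
      then show ?thesis by (simp add: tword_simps mult.assoc)
    qed
    then show ?thesis using r1 r2' by (intro exI[of _ u] exI[of _ "[j, i, j]"] exI[of _ "[i, j, i]"]) simp
  qed
qed

text \<open>Two words with the same last letter agree by induction on their shorter beginnings. If the last
  letters differ, both are descents, and \<open>two_descents\<close> supplies intermediate words ending in either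
  letter.\<close>

lemma matsumoto:
  assumes "w \<in> WB r" "reduced_expr r is w" "reduced_expr r js w"
  shows "cl r (tword is) = cl r (tword js)"
  using assms
proof (induction "length is" arbitrary: w "is" js rule: less_induct)
  case less
  have len: "length is = length js" using less.prems(2,3) by (simp add: reduced_expr_def)
  show ?case
  proof (cases "is" rule: rev_cases)
    case Nil then show ?thesis using len by simp
  next
    case (snoc is' i)
    then obtain js' j where js: "js = js' @ [j]" using len by (cases js rule: rev_cases) auto
    have li: "length is' < length is" "length js' < length is" using snoc js len by auto
    have i: "i \<in> {1..r}" "w (i+1) < w i" "reduced_expr r is' (w \<circ> cs r i)"
      using reduced_snocD[OF less.prems(1)] less.prems(2) snoc by auto
    have j: "j \<in> {1..r}" "w (j+1) < w j" "reduced_expr r js' (w \<circ> cs r j)"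
      using reduced_snocD[OF less.prems(1)] less.prems(3) js by auto
    have Wi: "w \<circ> cs r i \<in> WB r" and Wj: "w \<circ> cs r j \<in> WB r"
      using WB_comp[OF less.prems(1)] cs_WB i j by blast+
    have ab: "cl r (tword (a' @ [k])) = cl r (tword (b' @ [k]))"
      if "cl r (tword a') = cl r (tword b')" for a' b' k
      using cl_mult_cong[OF that refl] by (simp add: tword_simps)
    have step: "\<exists>u x y. reduced_expr r (u @ x @ [i]) w \<and> reduced_expr r (u @ y @ [j]) w
      \<and> cl r (tword (x @ [i])) = cl r (tword (y @ [j]))" if "i \<noteq> j"
      using that two_descents[OF less.prems(1) i(1) j(1) _ i(2) j(2)] two_descents[OF less.prems(1) j(1) i(1) _ j(2) i(2)]
      by (metis linorder_neqE_nat)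
    show ?thesis
    proof (cases "i = j")
      case True
      have "cl r (tword is') = cl r (tword js')" using less.hyps[OF li(1) Wi i(3)] j(3) True by simp
      then show ?thesis unfolding snoc js True by (rule ab)
    next
      case False
      then obtain u x y where u: "reduced_expr r (u @ x @ [i]) w" "reduced_expr r (u @ y @ [j]) w"
        "cl r (tword (x @ [i])) = cl r (tword (y @ [j]))" using step by blast
      have ux: "reduced_expr r (u @ x) (w \<circ> cs r i)" using reduced_snocD[OF less.prems(1), of "u @ x" i] u(1) by simp
      have uy: "reduced_expr r (u @ y) (w \<circ> cs r j)" using reduced_snocD[OF less.prems(1), of "u @ y" j] u(2) by simp
      have "cl r (tword is) = cl r (tword ((u @ x) @ [i]))"
        unfolding snoc by (rule ab, rule less.hyps[OF li(1) Wi i(3) ux])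
      also have "\<dots> = cl r (tword u * tword (x @ [i]))" by (simp add: tword_simps mult.assoc)
      also have "\<dots> = cl r (tword u * tword (y @ [j]))" by (rule cl_mult_cong[OF refl u(3)])
      also have "\<dots> = cl r (tword ((u @ y) @ [j]))" by (simp add: tword_simps mult.assoc)
      also have "\<dots> = cl r (tword js)"
        unfolding js by (rule ab, rule less.hyps[OF li(2) Wj j(3) uy, symmetric])
      finally show ?thesis .
    qed
  qed
qed

lemma tw_reduced: "w \<in> WB r \<Longrightarrow> reduced_expr r is w \<Longrightarrow> cl r (tw r w) = cl r (tword is)"
  unfolding tw_def by (rule matsumoto) (auto intro: someI[of "\<lambda>is. reduced_expr r is w"])

lemma Tw_tw: assumes "w \<in> WB r" shows "Tw r w = cl r (tw r w)"
proof -
  have "foldr (\<lambda>i x. Tgen r i \<otimes>\<^bsub>hecke r\<^esub> x) is \<one>\<^bsub>hecke r\<^esub> = cl r (tword is)" if "set is \<subseteq> {1..r}" for "is"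
    using that by (induction "is") (simp_all add: tword_simps cl_one cl_mult Tgen_cl)
  moreover have "reduced_expr r (SOME is. reduced_expr r is w) w" using someI_ex[OF reduced_exists[OF assms]] .
  ultimately show ?thesis unfolding Tw_def tw_def by (simp add: reduced_expr_def)
qed

lemma tw_right: "w \<in> WB r \<Longrightarrow> i \<in> {1..r} \<Longrightarrow> w i < w (i+1) \<Longrightarrow> cl r (tw r (w \<circ> cs r i)) = cl r (tw r w * fgen i)"
proof -
  assume w: "w \<in> WB r" "i \<in> {1..r}" "w i < w (i+1)"
  obtain "is" where i: "reduced_expr r is w" using reduced_exists w by blast
  have "cl r (tw r (w \<circ> cs r i)) = cl r (tword (is @ [i]))"
    by (rule tw_reduced[OF WB_comp[OF w(1) cs_WB[OF w(2)]] reduced_snoc[OF w i]])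
  also have "\<dots> = cl r (tword is * fgen i)" by (simp add: tword_simps)
  also have "\<dots> = cl r (tw r w * fgen i)" by (rule cl_mult_cong[OF tw_reduced[OF w(1) i, symmetric] refl])
  finally show ?thesis .
qed

lemma tw_left: "w \<in> WB r \<Longrightarrow> i \<in> {1..r} \<Longrightarrow> pinv w i < pinv w (i+1) \<Longrightarrow> cl r (tw r (cs r i \<circ> w)) = cl r (fgen i * tw r w)"
proof -
  assume w: "w \<in> WB r" "i \<in> {1..r}" "pinv w i < pinv w (i+1)"
  obtain "is" where i: "reduced_expr r is w" using reduced_exists w by blast
  have "cl r (tw r (cs r i \<circ> w)) = cl r (tword (i # is))"
    by (rule tw_reduced[OF WB_comp[OF cs_WB[OF w(2)] w(1)] reduced_Cons[OF w i]])
  also have "\<dots> = cl r (fgen i * tword is)" by (simp add: tword_simps)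
  also have "\<dots> = cl r (fgen i * tw r w)" by (rule cl_mult_cong[OF refl tw_reduced[OF w(1) i, symmetric]])
  finally show ?thesis .
qed

lemma tw_id: "cl r (tw r id) = cl r 1"
proof -
  have "reduced_expr r [] id" using reduced_expr_iff[OF WB_id, of r "[]"] lenB_id[of r] by (simp add: wprod_Nil)
  from tw_reduced[OF WB_id this] show ?thesis by (simp add: tword_simps)
qed

text \<open>The relation \<open>T\<^sub>r\<^sup>2 = 1\<close> makes the rule for ascents valid for descents as well.\<close>

lemma tw_right_last: assumes w: "w \<in> WB r" shows "cl r (tw r (w \<circ> cs r r)) = cl r (tw r w * fgen r)"
proof -
  have r: "r \<in> {1..r}" using r2 by simp
  show ?thesis
  proof (cases "w r < w (r+1)")
    case True then show ?thesis by (rule tw_right[OF w r])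
  next
    case False
    then have "w (r+1) < w r" using WB_up_or_down[OF w] by blast
    then have "cl r (tw r (w \<circ> cs r r \<circ> cs r r)) = cl r (tw r (w \<circ> cs r r) * fgen r)"
      using cs_left[OF r] cs_right[OF r] by (intro tw_right[OF WB_comp[OF w cs_WB[OF r]] r]) simp
    then have e: "cl r (tw r w) = cl r (tw r (w \<circ> cs r r) * fgen r)" by (simp only: comp_cs_cs)
    have "cl r (tw r w * fgen r) = cl r (tw r (w \<circ> cs r r) * (fgen r * fgen r))"
      using cl_mult_cong[OF e refl, of "fgen r"] by (simp only: mult.assoc)
    also have "\<dots> = cl r (tw r (w \<circ> cs r r) * 1)" by (rule cl_mult_cong[OF refl rel_last])
    finally show ?thesis by simp
  qed
qed

lemma tw_left_last: assumes w: "w \<in> WB r" shows "cl r (tw r (cs r r \<circ> w)) = cl r (fgen r * tw r w)"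
proof -
  have r: "r \<in> {1..r}" using r2 by simp
  show ?thesis
  proof (cases "pinv w r < pinv w (r+1)")
    case True then show ?thesis by (rule tw_left[OF w r])
  next
    case False
    then have dn: "pinv w (r+1) < pinv w r" using WB_up_or_down[OF WB_inv[OF w]] by blast
    have "pinv (cs r r \<circ> w) = pinv w \<circ> cs r r" using WB_inv_compose[OF cs_WB[OF r] w] by (simp add: cs_inv)
    then have "cl r (tw r (cs r r \<circ> (cs r r \<circ> w))) = cl r (fgen r * tw r (cs r r \<circ> w))"
      using dn cs_left[OF r] cs_right[OF r] by (intro tw_left[OF WB_comp[OF cs_WB[OF r] w] r]) simp
    then have e: "cl r (tw r w) = cl r (fgen r * tw r (cs r r \<circ> w))" by (simp only: comp_cs_cs)
    have "cl r (fgen r * tw r w) = cl r ((fgen r * fgen r) * tw r (cs r r \<circ> w))"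
      using cl_mult_cong[OF refl e, of "fgen r"] by (simp only: mult.assoc)
    also have "\<dots> = cl r (1 * tw r (cs r r \<circ> w))" by (rule cl_mult_cong[OF rel_last refl])
    finally show ?thesis by simp
  qed
qed

lemma tw_spow_right: assumes w: "w \<in> WB r" shows "cl r (tw r (w \<circ> spow r e)) = cl r (tw r w * tw r (spow r e))"
proof (cases e)
  case Pos
  then show ?thesis using cl_mult_cong[OF refl tw_id[symmetric], of "tw r w"] by simp
next
  case Neg
  have "cl r (tw r (cs r r)) = cl r (fgen r)"
    using tw_right_last[OF WB_id] cl_mult_cong[OF tw_id refl, of "fgen r"] by simp
  then show ?thesis using Neg tw_right_last[OF w] cl_mult_cong[OF refl, of "tw r (cs r r)" "fgen r" "tw r w"] by simp
qed

lemma tw_spow_left: assumes w: "w \<in> WB r" shows "cl r (tw r (spow r e \<circ> w)) = cl r (tw r (spow r e) * tw r w)"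
proof (cases e)
  case Pos
  then show ?thesis using cl_mult_cong[OF tw_id[symmetric] refl, of "tw r w"] by simp
next
  case Neg
  have "cl r (tw r (cs r r)) = cl r (fgen r)"
    using tw_right_last[OF WB_id] cl_mult_cong[OF tw_id refl, of "fgen r"] by simp
  then show ?thesis using Neg tw_left_last[OF w] cl_mult_cong[OF _ refl, of "tw r (cs r r)" "fgen r" "tw r w"] by simp
qed

end

section \<open>Multiplicativity along parabolic cosets\<close>

definition tsum :: "nat \<Rightarrow> (nat \<Rightarrow> nat) set \<Rightarrow> free_elt" where
  "tsum r X = (\<Sum>w\<in>X. tw r w)"

context hecke_rank
begin

text \<open>Along a reduced word of \<open>v\<close> the ascents of \<open>v\<close> are ascents of \<open>d \<circ> v\<close>, because they lie within blocks and
  \<open>d\<close> is increasing there.\<close>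

lemma tw_mult_right:
  assumes m: "m \<in> Lam n r" and d: "d \<in> WB r" and inc: "incr n r m d" and v: "v \<in> stab n r m"
  shows "cl r (tw r (d \<circ> v)) = cl r (tw r d * tw r v)"
proof -
  have "v \<in> stab n r m \<longrightarrow> cl r (tw r (d \<circ> v)) = cl r (tw r d * tw r v)" if "v \<in> WB r" for v
    using that
  proof (induction rule: WB_induct)
    case id
    have "cl r (tw r (d \<circ> id)) = cl r (tw r d * tw r id)"
      using cl_mult_cong[OF refl tw_id[symmetric], of "tw r d"] by simp
    then show ?case by blast
  next
    case (step v i)
    have "cl r (tw r (d \<circ> (v \<circ> cs r i))) = cl r (tw r d * tw r (v \<circ> cs r i))" if st: "v \<circ> cs r i \<in> stab n r m"
    proof -
      note b = stab_step[OF m step(1,2,3) st]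
      have IH: "cl r (tw r (d \<circ> v)) = cl r (tw r d * tw r v)" using step.IH b(2) by blast
      have i2: "i \<in> {1..2*r}" "i + 1 \<in> {1..2*r}" using step(2) by auto
      have "bk n m (v i) = bk n m (v (i+1))" using stab_bk[OF b(2) i2(1)] stab_bk[OF b(2) i2(2)] b(1) by simp
      moreover have "v i \<in> {1..2*r}" "v (i+1) \<in> {1..2*r}" using WB_mem[OF step(1), of i] WB_mem[OF step(1), of "i+1"] i2 by (simp_all only:)
      ultimately have "(d \<circ> v) i < (d \<circ> v) (i+1)" using incrD[OF inc _ _ step(3)] by simp
      then have "cl r (tw r (d \<circ> v \<circ> cs r i)) = cl r (tw r (d \<circ> v) * fgen i)"
        by (rule tw_right[OF WB_comp[OF d step(1)] step(2)])
      also have "\<dots> = cl r (tw r d * tw r v * fgen i)" by (rule cl_mult_cong[OF IH refl])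
      also have "\<dots> = cl r (tw r d * (tw r v * fgen i))" by (simp only: mult.assoc)
      also have "\<dots> = cl r (tw r d * tw r (v \<circ> cs r i))"
        by (rule cl_mult_cong[OF refl tw_right[OF step(1,2,3), symmetric]])
      finally show ?thesis by (simp only: comp_assoc)
    qed
    then show ?case by blast
  qed
  then show ?thesis using v stab_WB[OF v] by blast
qed

lemma tw_mult_left:
  assumes l: "l \<in> Lam n r" and d: "d \<in> WB r" and inc: "incr n r l (pinv d)" and u: "u \<in> stab n r l"
  shows "cl r (tw r (u \<circ> d)) = cl r (tw r u * tw r d)"
proof -
  have "v \<in> stab n r l \<longrightarrow> cl r (tw r (pinv v \<circ> d)) = cl r (tw r (pinv v) * tw r d)" if "v \<in> WB r" for v
    using that
  proof (induction rule: WB_induct)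
    case id
    have "cl r (tw r (pinv id \<circ> d)) = cl r (tw r (pinv id) * tw r d)"
      using cl_mult_cong[OF tw_id[symmetric] refl, of "tw r d"] by simp
    then show ?case by blast
  next
    case (step v i)
    have "cl r (tw r (pinv (v \<circ> cs r i) \<circ> d)) = cl r (tw r (pinv (v \<circ> cs r i)) * tw r d)" if st: "v \<circ> cs r i \<in> stab n r l"
    proof -
      note b = stab_step[OF l step(1,2,3) st]
      have IH: "cl r (tw r (pinv v \<circ> d)) = cl r (tw r (pinv v) * tw r d)" using step.IH b(2) by blast
      have i2: "i \<in> {1..2*r}" "i + 1 \<in> {1..2*r}" using step(2) by auto
      have p: "pinv (v \<circ> cs r i) = cs r i \<circ> pinv v" using WB_inv_compose[OF step(1) cs_WB[OF step(2)]] by (simp add: cs_inv)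
      have vW: "pinv v \<in> WB r" by (rule WB_inv[OF step(1)])
      have "bk n l (v i) = bk n l (v (i+1))" using stab_bk[OF b(2) i2(1)] stab_bk[OF b(2) i2(2)] b(1) by simp
      moreover have "v i \<in> {1..2*r}" "v (i+1) \<in> {1..2*r}" using WB_mem[OF step(1), of i] WB_mem[OF step(1), of "i+1"] i2 by (simp_all only:)
      ultimately have "pinv d (v i) < pinv d (v (i+1))" using incrD[OF inc _ _ step(3)] by simp
      moreover have "pinv (pinv v \<circ> d) = pinv d \<circ> v" using WB_inv_compose[OF vW d] WB_inv_inv[OF step(1)] by simp
      ultimately have "pinv (pinv v \<circ> d) i < pinv (pinv v \<circ> d) (i+1)" by simp
      then have "cl r (tw r (cs r i \<circ> (pinv v \<circ> d))) = cl r (fgen i * tw r (pinv v \<circ> d))"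
        by (rule tw_left[OF WB_comp[OF vW d] step(2)])
      also have "\<dots> = cl r (fgen i * (tw r (pinv v) * tw r d))" by (rule cl_mult_cong[OF refl IH])
      also have "\<dots> = cl r (fgen i * tw r (pinv v) * tw r d)" by (simp only: mult.assoc)
      also have "\<dots> = cl r (tw r (cs r i \<circ> pinv v) * tw r d)"
        by (rule cl_mult_cong[OF tw_left[OF vW step(2), symmetric] refl]) (use step(3) WB_inv_inv[OF step(1)] in simp)
      finally show ?thesis by (simp only: p comp_assoc)
    qed
    then show ?case by blast
  qed
  from this[OF WB_inv[OF stab_WB[OF u]]] show ?thesis using stab_inv[OF u] WB_inv_inv[OF stab_WB[OF u]] by simp
qed

lemma tw_spow_spow: assumes "w \<in> WB r"
  shows "cl r (tw r (spow r e \<circ> w \<circ> spow r f)) = cl r (tw r (spow r e) * tw r w * tw r (spow r f))"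
proof -
  have "spow r e \<in> WB r" using spow_WB r2 by simp
  then have "spow r e \<circ> w \<in> WB r" by (rule WB_comp) (rule assms)
  then have "cl r (tw r (spow r e \<circ> w \<circ> spow r f)) = cl r (tw r (spow r e \<circ> w) * tw r (spow r f))"
    by (rule tw_spow_right)
  also have "\<dots> = cl r (tw r (spow r e) * tw r w * tw r (spow r f))"
    by (rule cl_mult_cong[OF tw_spow_left[OF assms] refl])
  finally show ?thesis .
qed

lemma tw_spow_sq: "cl r (tw r (spow r e) * tw r (spow r e)) = cl r 1"
proof -
  have "spow r e \<in> WB r" using spow_WB r2 by simp
  from tw_spow_right[OF this, of e] show ?thesis using tw_id by (simp add: spow_spow)
qed

text \<open>The parabolic subgroup of type D with label sign \<open>e\<close>; the sign is irrelevant if there is a middle part.\<close>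

definition PL :: "nat \<Rightarrow> (nat \<Rightarrow> nat) \<Rightarrow> sign \<Rightarrow> (nat \<Rightarrow> nat) set" where
  "PL n l e = {spow r e \<circ> w \<circ> spow r e | w. w \<in> PD n r l}"

lemma PL_I: "w \<in> PD n r l \<Longrightarrow> spow r e \<circ> w \<circ> spow r e \<in> PL n l e"
  by (auto simp: PL_def)

lemma PL_WB: "x \<in> PL n l e \<Longrightarrow> x \<in> WB r"
proof -
  assume "x \<in> PL n l e"
  then obtain w where w: "w \<in> PD n r l" "x = spow r e \<circ> w \<circ> spow r e" by (auto simp: PL_def)
  have s: "spow r e \<in> WB r" by (rule spow_WB) (use r2 in simp)
  show ?thesis unfolding w(2) by (rule WB_comp[OF WB_comp[OF s PD_WB[OF w(1)]] s])
qed

lemma PL_psign: "x \<in> PL n l e \<Longrightarrow> psign r x = Pos"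
proof -
  assume "x \<in> PL n l e"
  then obtain w where w: "w \<in> PD n r l" "x = spow r e \<circ> w \<circ> spow r e" by (auto simp: PL_def)
  have s: "spow r e \<in> WB r" "psign r (spow r e) = e" using spow_WB psign_spow r2 by auto
  show ?thesis using w s PD_WB[OF w(1)] PD_psign[OF w(1)] by (simp add: psign_comp WB_comp)
qed

lemma PL_id: "id \<in> PL n l e"
  using PL_I[OF PD_id, of e n l] by (simp add: spow_spow)

lemma PL_comp: "x \<in> PL n l e \<Longrightarrow> y \<in> PL n l e \<Longrightarrow> x \<circ> y \<in> PL n l e"
proof -
  assume "x \<in> PL n l e" "y \<in> PL n l e"
  then obtain v w where vw: "v \<in> PD n r l" "w \<in> PD n r l" "x = spow r e \<circ> v \<circ> spow r e" "y = spow r e \<circ> w \<circ> spow r e"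
    by (auto simp: PL_def)
  have "x \<circ> y = spow r e \<circ> (v \<circ> w) \<circ> spow r e" unfolding vw by (simp add: comp_assoc spow_cancel)
  then show ?thesis using PL_I[OF PD_comp[OF vw(1,2)]] by simp
qed

lemma PL_inv: "x \<in> PL n l e \<Longrightarrow> pinv x \<in> PL n l e"
proof -
  assume "x \<in> PL n l e"
  then obtain w where w: "w \<in> PD n r l" "x = spow r e \<circ> w \<circ> spow r e" by (auto simp: PL_def)
  have s: "spow r e \<in> WB r" using spow_WB r2 by auto
  have "pinv x = spow r e \<circ> pinv w \<circ> spow r e"
    unfolding w(2) using s PD_WB[OF w(1)] by (simp add: WB_inv_compose WB_comp spow_inv comp_assoc)
  then show ?thesis using PL_I[OF PD_inv[OF w(1)]] by simp
qed

lemma parabolicD_PL: "l \<in> Lam n r \<Longrightarrow> parabolicD n r (decor n l e) = PL n l e"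
  unfolding PL_def by (rule parabolicD_decor) (use r2 in simp_all)

text \<open>The shortest element of a coset of the full stabilizer may have the wrong parity. Then it is multiplied by
  \<open>s\<^sub>r\<close>, which preserves the product rule by \<open>tw_spow_left\<close> and \<open>tw_spow_right\<close>.\<close>

lemma PD_right_rep:
  assumes m: "m \<in> Lam n r" and w: "w \<in> WB r"
  shows "\<exists>v\<in>PD n r m. \<forall>c\<in>PD n r m. cl r (tw r (w \<circ> v \<circ> c)) = cl r (tw r (w \<circ> v) * tw r c)"
proof -
  obtain v where v: "v \<in> stab n r m" "incr n r m (w \<circ> v)" by (rule right_min_exists[OF m w])
  have W: "w \<circ> v \<in> WB r" by (rule WB_comp[OF w stab_WB[OF v(1)]])
  show ?thesis
  proof (cases "psign r v = Pos")
    case True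
    then show ?thesis using v tw_mult_right[OF m W v(2)] by (intro bexI[of _ v]) (auto simp: PD_def)
  next
    case False
    then have neg: "psign r v = Neg" by (cases "psign r v") auto
    have m0: "m (n+1) \<noteq> 0" using stab_psign_no_mid[OF m _ v(1)] False by blast
    have s: "spow r Neg \<in> stab n r m" by (rule spow_stab[OF m m0]) (use r2 in simp)
    have ps: "psign r (spow r Neg) = Neg" by (rule psign_spow) (use r2 in simp)
    have vs: "v \<circ> spow r Neg \<in> PD n r m"
      using v(1) s neg ps psign_comp[OF stab_WB[OF v(1)] stab_WB[OF s]] by (simp add: PD_def stab_comp del: spow.simps)
    have "cl r (tw r (w \<circ> (v \<circ> spow r Neg) \<circ> c)) = cl r (tw r (w \<circ> (v \<circ> spow r Neg)) * tw r c)" if c: "c \<in> PD n r m" for c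
    proof -
      have "cl r (tw r (w \<circ> v \<circ> (spow r Neg \<circ> c))) = cl r (tw r (w \<circ> v) * tw r (spow r Neg \<circ> c))"
        by (rule tw_mult_right[OF m W v(2) stab_comp[OF s PD_stab[OF c]]])
      also have "\<dots> = cl r (tw r (w \<circ> v) * (tw r (spow r Neg) * tw r c))"
        by (rule cl_mult_cong[OF refl tw_spow_left[OF PD_WB[OF c]]])
      also have "\<dots> = cl r (tw r (w \<circ> v) * tw r (spow r Neg) * tw r c)" by (simp only: mult.assoc)
      also have "\<dots> = cl r (tw r (w \<circ> v \<circ> spow r Neg) * tw r c)"
        by (rule cl_mult_cong[OF tw_spow_right[OF W, symmetric] refl])
      finally show ?thesis by (simp only: comp_assoc)
    qed
    then show ?thesis using vs by blast
  qed
qed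

text \<open>What survives of \<open>incr\<close> when a minimal representative is corrected by \<open>s\<^sub>r\<close>: nothing is claimed about
  the middle block.\<close>

definition low_incr :: "nat \<Rightarrow> (nat \<Rightarrow> nat) \<Rightarrow> (nat \<Rightarrow> nat) \<Rightarrow> bool" where
  "low_incr n l w \<longleftrightarrow> (\<forall>x\<in>{1..r}. \<forall>y\<in>{1..r}. x < y \<longrightarrow> bk n l x = bk n l y \<longrightarrow> bk n l x \<le> n \<longrightarrow> w x < w y)"

lemma PD_left_rep:
  assumes l: "l \<in> Lam n r" and w: "w \<in> WB r"
  shows "\<exists>u\<in>PD n r l. low_incr n l (pinv (u \<circ> w)) \<and> (\<forall>c\<in>PD n r l. cl r (tw r (c \<circ> (u \<circ> w))) = cl r (tw r c * tw r (u \<circ> w)))"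
proof -
  obtain u where u: "u \<in> stab n r l" "incr n r l (pinv (u \<circ> w))" by (rule left_min_exists[OF l w])
  have W: "u \<circ> w \<in> WB r" by (rule WB_comp[OF stab_WB[OF u(1)] w])
  have low: "pinv (u \<circ> w) x < pinv (u \<circ> w) y" if "x \<in> {1..r}" "y \<in> {1..r}" "x < y" "bk n l x = bk n l y" for x y
    by (rule incrD[OF u(2)]) (use that in auto)
  show ?thesis
  proof (cases "psign r u = Pos")
    case True
    then show ?thesis using u tw_mult_left[OF l W u(2)] low by (intro bexI[of _ u]) (auto simp: PD_def low_incr_def)
  next
    case False
    then have neg: "psign r u = Neg" by (cases "psign r u") auto
    have l0: "l (n+1) \<noteq> 0" using stab_psign_no_mid[OF l _ u(1)] False by blast
    have s: "spow r Neg \<in> stab n r l" by (rule spow_stab[OF l l0]) (use r2 in simp)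
    have ps: "psign r (spow r Neg) = Neg" by (rule psign_spow) (use r2 in simp)
    have su: "spow r Neg \<circ> u \<in> PD n r l"
      using u(1) s neg ps psign_comp[OF stab_WB[OF s] stab_WB[OF u(1)]] by (simp add: PD_def stab_comp del: spow.simps)
    have "cl r (tw r (c \<circ> ((spow r Neg \<circ> u) \<circ> w))) = cl r (tw r c * tw r ((spow r Neg \<circ> u) \<circ> w))" if c: "c \<in> PD n r l" for c
    proof -
      have "cl r (tw r ((c \<circ> spow r Neg) \<circ> (u \<circ> w))) = cl r (tw r (c \<circ> spow r Neg) * tw r (u \<circ> w))"
        by (rule tw_mult_left[OF l W u(2) stab_comp[OF PD_stab[OF c] s]])
      also have "\<dots> = cl r ((tw r c * tw r (spow r Neg)) * tw r (u \<circ> w))"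
        by (rule cl_mult_cong[OF tw_spow_right[OF PD_WB[OF c]] refl])
      also have "\<dots> = cl r (tw r c * (tw r (spow r Neg) * tw r (u \<circ> w)))" by (simp only: mult.assoc)
      also have "\<dots> = cl r (tw r c * tw r (spow r Neg \<circ> (u \<circ> w)))"
        by (rule cl_mult_cong[OF refl tw_spow_left[OF W, symmetric]])
      finally show ?thesis by (simp only: comp_assoc)
    qed
    moreover have "low_incr n l (pinv ((spow r Neg \<circ> u) \<circ> w))"
      unfolding low_incr_def
    proof (intro ballI impI)
      fix x y assume xy: "x \<in> {1..r}" "y \<in> {1..r}" "x < y" "bk n l x = bk n l y" "bk n l x \<le> n"
      have "x \<noteq> r" "y \<noteq> r" using bk_r_mid(1)[OF l l0] xy by auto
      then have "spow r Neg x = x" "spow r Neg y = y" using xy by (auto simp: cs_last transpose_def)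
      moreover have "pinv ((spow r Neg \<circ> u) \<circ> w) = pinv (u \<circ> w) \<circ> spow r Neg"
        using WB_inv_compose[OF stab_WB[OF s] W] spow_inv[of r Neg] by (simp only: comp_assoc)
      ultimately show "pinv ((spow r Neg \<circ> u) \<circ> w) x < pinv ((spow r Neg \<circ> u) \<circ> w) y"
        using low[OF xy(1-4)] by (simp only: comp_apply)
    qed
    ultimately show ?thesis using su by blast
  qed
qed

text \<open>Conjugation by \<open>T\<^sub>r\<close>, whose square is \<open>1\<close>, transports the statement from the positive label.\<close>

lemma PL_right_rep:
  assumes m: "m \<in> Lam n r" and w: "w \<in> WB r"
  shows "\<exists>v\<in>PL n m e. \<forall>x\<in>PL n m e. cl r (tw r (w \<circ> v \<circ> x)) = cl r (tw r (w \<circ> v) * tw r x)"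
proof -
  let ?s = "spow r e"
  have s: "?s \<in> WB r" using spow_WB r2 by simp
  obtain v where v: "v \<in> PD n r m"
    "\<And>c. c \<in> PD n r m \<Longrightarrow> cl r (tw r (w \<circ> ?s \<circ> v \<circ> c)) = cl r (tw r (w \<circ> ?s \<circ> v) * tw r c)"
    using PD_right_rep[OF m WB_comp[OF w s]] by blast
  let ?d = "w \<circ> ?s \<circ> v"
  have d: "?d \<in> WB r" by (intro WB_comp w s PD_WB[OF v(1)])
  have "cl r (tw r (w \<circ> (?s \<circ> v \<circ> ?s) \<circ> x)) = cl r (tw r (w \<circ> (?s \<circ> v \<circ> ?s)) * tw r x)" if x: "x \<in> PL n m e" for x
  proof -
    obtain c where c: "c \<in> PD n r m" "x = ?s \<circ> c \<circ> ?s" using x by (auto simp: PL_def)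
    have cW: "c \<in> WB r" by (rule PD_WB[OF c(1)])
    have "cl r (tw r (w \<circ> (?s \<circ> v \<circ> ?s) \<circ> x)) = cl r (tw r (?d \<circ> c \<circ> ?s))"
      unfolding c(2) by (simp only: comp_assoc spow_cancel)
    also have "\<dots> = cl r (tw r (?d \<circ> c) * tw r ?s)" by (rule tw_spow_right[OF WB_comp[OF d cW]])
    also have "\<dots> = cl r (tw r ?d * tw r c * tw r ?s)" by (rule cl_mult_cong[OF v(2)[OF c(1)] refl])
    also have "\<dots> = cl r (tw r ?d * 1 * (tw r c * tw r ?s))" by (simp only: mult.assoc mult_1_right)
    also have "\<dots> = cl r (tw r ?d * (tw r ?s * tw r ?s) * (tw r c * tw r ?s))"
      by (intro cl_mult_cong refl tw_spow_sq[symmetric])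
    also have "\<dots> = cl r ((tw r ?d * tw r ?s) * (tw r ?s * tw r c * tw r ?s))" by (simp only: mult.assoc)
    also have "\<dots> = cl r (tw r (?d \<circ> ?s) * tw r x)"
      unfolding c(2) by (intro cl_mult_cong tw_spow_right[OF d, symmetric] tw_spow_spow[OF cW, symmetric])
    finally show ?thesis by (simp only: comp_assoc)
  qed
  then show ?thesis using PL_I[OF v(1)] by blast
qed

lemma PL_left_rep:
  assumes l: "l \<in> Lam n r" and w: "w \<in> WB r"
  shows "\<exists>u\<in>PL n l e. \<forall>x\<in>PL n l e. cl r (tw r (x \<circ> (u \<circ> w))) = cl r (tw r x * tw r (u \<circ> w))"
proof -
  let ?s = "spow r e"
  have s: "?s \<in> WB r" using spow_WB r2 by simp
  obtain u where u: "u \<in> PD n r l"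
    "\<And>c. c \<in> PD n r l \<Longrightarrow> cl r (tw r (c \<circ> (u \<circ> (?s \<circ> w)))) = cl r (tw r c * tw r (u \<circ> (?s \<circ> w)))"
    using PD_left_rep[OF l WB_comp[OF s w]] by blast
  let ?d = "u \<circ> (?s \<circ> w)"
  have d: "?d \<in> WB r" by (intro WB_comp w s PD_WB[OF u(1)])
  have "cl r (tw r (x \<circ> ((?s \<circ> u \<circ> ?s) \<circ> w))) = cl r (tw r x * tw r ((?s \<circ> u \<circ> ?s) \<circ> w))" if x: "x \<in> PL n l e" for x
  proof -
    obtain c where c: "c \<in> PD n r l" "x = ?s \<circ> c \<circ> ?s" using x by (auto simp: PL_def)
    have cW: "c \<in> WB r" by (rule PD_WB[OF c(1)])
    have "cl r (tw r (x \<circ> ((?s \<circ> u \<circ> ?s) \<circ> w))) = cl r (tw r (?s \<circ> (c \<circ> ?d)))"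
      unfolding c(2) by (simp only: comp_assoc spow_cancel)
    also have "\<dots> = cl r (tw r ?s * tw r (c \<circ> ?d))" by (rule tw_spow_left[OF WB_comp[OF cW d]])
    also have "\<dots> = cl r (tw r ?s * (tw r c * tw r ?d))" by (rule cl_mult_cong[OF refl u(2)[OF c(1)]])
    also have "\<dots> = cl r ((tw r ?s * tw r c) * (1 * tw r ?d))" by (simp only: mult.assoc mult_1_left)
    also have "\<dots> = cl r ((tw r ?s * tw r c) * ((tw r ?s * tw r ?s) * tw r ?d))"
      by (intro cl_mult_cong refl tw_spow_sq[symmetric])
    also have "\<dots> = cl r ((tw r ?s * tw r c * tw r ?s) * (tw r ?s * tw r ?d))" by (simp only: mult.assoc)
    also have "\<dots> = cl r (tw r x * tw r (?s \<circ> ?d))"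
      unfolding c(2) by (intro cl_mult_cong tw_spow_left[OF d, symmetric] tw_spow_spow[OF cW, symmetric])
    finally show ?thesis by (simp only: comp_assoc)
  qed
  then show ?thesis using PL_I[OF u(1)] by blast
qed

end

section \<open>Orbit representatives\<close>

text \<open>In every orbit of a free action a representative with the property \<open>G\<close> can be chosen.\<close>

lemma free_action_reps:
  assumes act: "\<And>d c. d \<in> D \<Longrightarrow> c \<in> P \<Longrightarrow> act d c \<in> D"
    and unit: "\<exists>e\<in>P. \<forall>d\<in>D. act d e = d"
    and comp: "\<And>c c'. c \<in> P \<Longrightarrow> c' \<in> P \<Longrightarrow> \<exists>c''\<in>P. \<forall>d\<in>D. act (act d c) c' = act d c''"
    and inv: "\<And>c. c \<in> P \<Longrightarrow> \<exists>c'\<in>P. \<forall>d\<in>D. act (act d c) c' = d"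
    and free: "\<And>d c c'. d \<in> D \<Longrightarrow> c \<in> P \<Longrightarrow> c' \<in> P \<Longrightarrow> act d c = act d c' \<Longrightarrow> c = c'"
    and good: "\<And>d. d \<in> D \<Longrightarrow> \<exists>c\<in>P. G (act d c)"
  shows "\<exists>R\<subseteq>D. (\<forall>d\<in>R. G d) \<and> bij_betw (\<lambda>(d, c). act d c) (R \<times> P) D"
proof -
  define orb where "orb d = act d ` P" for d
  have orb_eq: "orb (act d c) = orb d" if d: "d \<in> D" and c: "c \<in> P" for d c
  proof
    show "orb (act d c) \<subseteq> orb d"
    proof
      fix x assume "x \<in> orb (act d c)"
      then obtain c' where "c' \<in> P" "x = act (act d c) c'" by (auto simp: orb_def)
      then show "x \<in> orb d" using comp[OF c, of c'] d by (auto simp: orb_def)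
    qed
    show "orb d \<subseteq> orb (act d c)"
    proof
      fix x assume "x \<in> orb d"
      then obtain c' where c': "c' \<in> P" "x = act d c'" by (auto simp: orb_def)
      obtain i where i: "i \<in> P" "act (act d c) i = d" using inv[OF c] d by blast
      obtain c'' where "c'' \<in> P" "act (act (act d c) i) c' = act (act d c) c''"
        using comp[OF i(1) c'(1)] act[OF d c] by blast
      then show "x \<in> orb (act d c)" using i(2) c'(2) by (auto simp: orb_def)
    qed
  qed
  define f where "f d = (SOME x. x \<in> orb d \<and> G x)" for d
  have f: "f d \<in> orb d \<and> G (f d)" if "d \<in> D" for d
    unfolding f_def by (rule someI_ex) (use good[OF that] in \<open>auto simp: orb_def\<close>)
  have f_orb: "f d = f d'" if "orb d = orb d'" for d d' using that by (simp add: f_def)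
  let ?R = "f ` D"
  have fD: "f d \<in> D" "orb (f d) = orb d" if dD: "d \<in> D" for d
  proof -
    obtain c where c: "c \<in> P" "f d = act d c" using f[OF dD] unfolding orb_def by blast
    show "f d \<in> D" "orb (f d) = orb d" unfolding c(2) by (rule act[OF dD c(1)], rule orb_eq[OF dD c(1)])
  qed
  have "bij_betw (\<lambda>(d, c). act d c) (?R \<times> P) D"
    unfolding bij_betw_def
  proof
    show "inj_on (\<lambda>(d, c). act d c) (?R \<times> P)"
    proof (rule inj_onI, clarify)
      fix d1 c1 d2 c2 assume a: "d1 \<in> D" "c1 \<in> P" "d2 \<in> D" "c2 \<in> P" "act (f d1) c1 = act (f d2) c2"
      have "orb d1 = orb d2"
        using orb_eq[OF fD(1)[OF a(1)] a(2)] orb_eq[OF fD(1)[OF a(3)] a(4)] a(5) fD(2)[OF a(1)] fD(2)[OF a(3)] by simp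
      then have e: "f d1 = f d2" by (rule f_orb)
      then show "f d1 = f d2 \<and> c1 = c2" using free[OF fD(1)[OF a(3)] a(2,4)] a(5) by simp
    qed
    show "(\<lambda>(d, c). act d c) ` (?R \<times> P) = D"
    proof
      show "(\<lambda>(d, c). act d c) ` (?R \<times> P) \<subseteq> D" using act fD by auto
      show "D \<subseteq> (\<lambda>(d, c). act d c) ` (?R \<times> P)"
      proof
        fix d assume d: "d \<in> D"
        obtain e where e: "e \<in> P" "act d e = d" using unit d by blast
        then have "d \<in> orb (f d)" using fD(2)[OF d] by (force simp: orb_def)
        then obtain c where "c \<in> P" "d = act (f d) c" by (auto simp: orb_def)
        then show "d \<in> (\<lambda>(d, c). act d c) ` (?R \<times> P)" using d by force
      qed
    qed
  qed
  then show ?thesis using f fD by (intro exI[of _ ?R]) auto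
qed

section \<open>Factoring double coset sums\<close>

context hecke_rank
begin

lemma right_reps:
  assumes P: "id \<in> P" "\<And>x y. x \<in> P \<Longrightarrow> y \<in> P \<Longrightarrow> x \<circ> y \<in> P" "\<And>x. x \<in> P \<Longrightarrow> pinv x \<in> P" "P \<subseteq> WB r"
    and D: "D \<subseteq> WB r" "\<And>d c. d \<in> D \<Longrightarrow> c \<in> P \<Longrightarrow> d \<circ> c \<in> D"
    and good: "\<And>d. d \<in> D \<Longrightarrow> \<exists>c\<in>P. G (d \<circ> c)"
  shows "\<exists>R\<subseteq>D. (\<forall>d\<in>R. G d) \<and> bij_betw (\<lambda>(d, c). d \<circ> c) (R \<times> P) D"
proof (rule free_action_reps[where act = "\<lambda>d c. d \<circ> c"])
  show "\<exists>e\<in>P. \<forall>d\<in>D. d \<circ> e = d" using P(1) by (intro bexI[of _ id]) auto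
  show "\<exists>c''\<in>P. \<forall>d\<in>D. d \<circ> c \<circ> c' = d \<circ> c''" if "c \<in> P" "c' \<in> P" for c c'
    using P(2)[OF that] by (intro bexI[of _ "c \<circ> c'"]) (auto simp: comp_assoc)
  show "\<exists>c'\<in>P. \<forall>d\<in>D. d \<circ> c \<circ> c' = d" if c: "c \<in> P" for c
    using P(3)[OF c] WB_inv_comp(2)[of c r] P(4) c by (intro bexI[of _ "pinv c"]) (auto simp: comp_assoc)
  show "c = c'" if "d \<in> D" "d \<circ> c = d \<circ> c'" for d c c'
    using that D(1) WB_inv_comp(1)[of d r] by (metis comp_assoc id_comp subsetD)
qed (use D good in auto)

lemma left_reps:
  assumes P: "id \<in> P" "\<And>x y. x \<in> P \<Longrightarrow> y \<in> P \<Longrightarrow> x \<circ> y \<in> P" "\<And>x. x \<in> P \<Longrightarrow> pinv x \<in> P" "P \<subseteq> WB r"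
    and D: "D \<subseteq> WB r" "\<And>d c. d \<in> D \<Longrightarrow> c \<in> P \<Longrightarrow> c \<circ> d \<in> D"
    and good: "\<And>d. d \<in> D \<Longrightarrow> \<exists>c\<in>P. G (c \<circ> d)"
  shows "\<exists>R\<subseteq>D. (\<forall>d\<in>R. G d) \<and> bij_betw (\<lambda>(d, c). c \<circ> d) (R \<times> P) D"
proof (rule free_action_reps[where act = "\<lambda>d c. c \<circ> d"])
  show "\<exists>e\<in>P. \<forall>d\<in>D. e \<circ> d = d" using P(1) by (intro bexI[of _ id]) auto
  show "\<exists>c''\<in>P. \<forall>d\<in>D. c' \<circ> (c \<circ> d) = c'' \<circ> d" if "c \<in> P" "c' \<in> P" for c c'
    using P(2)[OF that(2,1)] by (intro bexI[of _ "c' \<circ> c"]) (auto simp: comp_assoc)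
  show "\<exists>c'\<in>P. \<forall>d\<in>D. c' \<circ> (c \<circ> d) = d" if c: "c \<in> P" for c
    using P(3)[OF c] WB_inv_comp(1)[of c r] P(4) c by (intro bexI[of _ "pinv c"]) (auto simp: comp_assoc[symmetric])
  show "c = c'" if "d \<in> D" "c \<circ> d = c' \<circ> d" for d c c'
    using that D(1) WB_inv_comp(2)[of d r] by (metis comp_assoc comp_id subsetD)
qed (use D good in auto)

text \<open>With representatives for which lengths add, the sum over a union of cosets is a product.\<close>

lemma tsum_right_factor:
  assumes bij: "bij_betw (\<lambda>(d, c). d \<circ> c) (R \<times> P) D"
    and mult: "\<And>d c. d \<in> R \<Longrightarrow> c \<in> P \<Longrightarrow> cl r (tw r (d \<circ> c)) = cl r (tw r d * tw r c)"
  shows "cl r (tsum r D) = cl r (tsum r R * tsum r P)"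
proof -
  have "tsum r D = (\<Sum>(d, c)\<in>R \<times> P. tw r (d \<circ> c))"
    unfolding tsum_def by (subst sum.reindex_bij_betw[OF bij, symmetric]) (simp add: case_prod_unfold)
  then have "cl r (tsum r D) = cl r (\<Sum>(d, c)\<in>R \<times> P. tw r d * tw r c)"
    by (simp only:) (rule cl_sum_cong, auto simp: mult)
  also have "(\<Sum>(d, c)\<in>R \<times> P. tw r d * tw r c) = tsum r R * tsum r P"
    unfolding tsum_def sum_product by (rule sum.cartesian_product[symmetric])
  finally show ?thesis .
qed

lemma tsum_left_factor:
  assumes bij: "bij_betw (\<lambda>(d, c). c \<circ> d) (R \<times> P) D"
    and mult: "\<And>d c. d \<in> R \<Longrightarrow> c \<in> P \<Longrightarrow> cl r (tw r (c \<circ> d)) = cl r (tw r c * tw r d)"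
  shows "cl r (tsum r D) = cl r (tsum r P * tsum r R)"
proof -
  have "tsum r D = (\<Sum>(d, c)\<in>R \<times> P. tw r (c \<circ> d))"
    unfolding tsum_def by (subst sum.reindex_bij_betw[OF bij, symmetric]) (simp add: case_prod_unfold)
  then have "cl r (tsum r D) = cl r (\<Sum>(d, c)\<in>R \<times> P. tw r c * tw r d)"
    by (simp only:) (rule cl_sum_cong, auto simp: mult)
  also have "(\<Sum>(d, c)\<in>R \<times> P. tw r c * tw r d) = (\<Sum>d\<in>R. \<Sum>c\<in>P. tw r c * tw r d)"
    by (rule sum.cartesian_product[symmetric])
  also have "\<dots> = tsum r P * tsum r R" unfolding tsum_def sum_product by (rule sum.swap)
  finally show ?thesis .
qed

lemma Tsum_tsum: assumes "X \<subseteq> WB r" shows "Tsum r X = cl r (tsum r X)"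
proof -
  interpret H: ring "hecke r" by (rule ring_hecke)
  have fin: "finite X" using assms finite_WB finite_subset by blast
  have "cl r (tsum r X) = (\<Oplus>\<^bsub>hecke r\<^esub>w\<in>X. cl r (tw r w))" unfolding tsum_def by (rule cl_finsum[OF fin])
  also have "\<dots> = (\<Oplus>\<^bsub>hecke r\<^esub>w\<in>X. Tw r w)"
    by (rule H.finsum_cong') (use Tw_tw assms cl_carrier in auto)
  finally show ?thesis by (simp add: Tsum_def)
qed

lemma tsum_conj:
  assumes "S \<subseteq> WB r"
  shows "cl r (tsum r {spow r e \<circ> w \<circ> spow r f | w. w \<in> S}) = cl r (tw r (spow r e) * tsum r S * tw r (spow r f))"
proof -
  have "{spow r e \<circ> w \<circ> spow r f | w. w \<in> S} = (\<lambda>w. spow r e \<circ> w \<circ> spow r f) ` S" by auto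
  moreover have "inj_on (\<lambda>w. spow r e \<circ> w \<circ> spow r f) S"
    by (rule inj_on_inverseI[of _ "\<lambda>w. spow r e \<circ> w \<circ> spow r f"]) (simp add: comp_assoc spow_cancel spow_spow)
  ultimately have "tsum r {spow r e \<circ> w \<circ> spow r f | w. w \<in> S} = (\<Sum>w\<in>S. tw r (spow r e \<circ> w \<circ> spow r f))"
    by (simp add: tsum_def sum.reindex)
  also have "cl r \<dots> = cl r (\<Sum>w\<in>S. tw r (spow r e) * tw r w * tw r (spow r f))"
    by (rule cl_sum_cong, rule tw_spow_spow) (use assms in auto)
  finally show ?thesis by (simp add: tsum_def sum_distrib_left sum_distrib_right)
qed

section \<open>The type D subalgebra\<close>

definition HDgens :: "hecke_elt set" where
  "HDgens = Tgen r ` {1..<r} \<union> {Tgen r r \<otimes>\<^bsub>hecke r\<^esub> Tgen r (r - 1) \<otimes>\<^bsub>hecke r\<^esub> Tgen r r}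
      \<union> {c \<odot>\<^bsub>hecke r\<^esub> \<one>\<^bsub>hecke r\<^esub> | c. True}"

lemma heckeD_gen: "heckeD r = generate_ring (hecke r) HDgens"
  by (simp add: heckeD_def HDgens_def)

lemma HDgens_carrier: "HDgens \<subseteq> carrier (hecke r)"
proof -
  interpret H: ring "hecke r" by (rule ring_hecke)
  have "Tgen r i \<in> carrier (hecke r)" if "i \<in> {1..r}" for i using Tgen_cl[OF that] cl_carrier by simp
  then show ?thesis using r2 cl_carrier by (auto simp: HDgens_def smult_cl)
qed

lemma subring_heckeD: "subring (heckeD r) (hecke r)"
  unfolding heckeD_gen by (rule ring.generate_ring_is_subring[OF ring_hecke HDgens_carrier])

lemma heckeD_carrier: "h \<in> heckeD r \<Longrightarrow> h \<in> carrier (hecke r)"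
  using subringE(1)[OF subring_heckeD] by blast

lemma heckeD_mult: "cl r f \<in> heckeD r \<Longrightarrow> cl r g \<in> heckeD r \<Longrightarrow> cl r (f * g) \<in> heckeD r"
  unfolding cl_mult by (rule subringE(6)[OF subring_heckeD])

lemma heckeD_add: "cl r f \<in> heckeD r \<Longrightarrow> cl r g \<in> heckeD r \<Longrightarrow> cl r (f + g) \<in> heckeD r"
  unfolding cl_add by (rule subringE(7)[OF subring_heckeD])

lemma heckeD_zero: "cl r 0 \<in> heckeD r"
  unfolding cl_zero by (rule subringE(2)[OF subring_heckeD])

lemma heckeD_one: "cl r 1 \<in> heckeD r"
  unfolding cl_one by (rule subringE(3)[OF subring_heckeD])

lemma heckeD_const: "cl r (fconst c) \<in> heckeD r"
proof -
  interpret H: ring "hecke r" by (rule ring_hecke)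
  have "c \<odot>\<^bsub>hecke r\<^esub> \<one>\<^bsub>hecke r\<^esub> \<in> heckeD r"
    unfolding heckeD_gen HDgens_def by (rule generate_ring.incl) blast
  then show ?thesis using cl_carrier by (simp add: smult_cl)
qed

lemma heckeD_sum: "(\<And>i. i \<in> I \<Longrightarrow> cl r (f i) \<in> heckeD r) \<Longrightarrow> cl r (sum f I) \<in> heckeD r"
  by (induction I rule: infinite_finite_induct) (simp_all add: heckeD_zero heckeD_add)

lemma heckeD_fgen: "i \<in> {1..<r} \<Longrightarrow> cl r (fgen i) \<in> heckeD r"
proof -
  assume i: "i \<in> {1..<r}"
  then have "Tgen r i \<in> heckeD r" unfolding heckeD_gen HDgens_def by (intro generate_ring.incl) blast
  then show ?thesis using Tgen_cl[of i] i by auto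
qed

text \<open>For \<open>i < r - 1\<close> the generators commute and the conjugate is \<open>T\<^sub>i\<close>; for \<open>i = r - 1\<close> it is a generator of
  the subalgebra.\<close>

lemma heckeD_conj: assumes i: "i \<in> {1..<r}" shows "cl r (fgen r * fgen i * fgen r) \<in> heckeD r"
proof (cases "i = r - 1")
  case True
  have "Tgen r r \<otimes>\<^bsub>hecke r\<^esub> Tgen r (r - 1) \<otimes>\<^bsub>hecke r\<^esub> Tgen r r \<in> heckeD r"
    unfolding heckeD_gen HDgens_def by (rule generate_ring.incl) blast
  then show ?thesis using Tgen_cl[of r] Tgen_cl[of "r - 1"] r2 True by (simp add: cl_mult)
next
  case False
  have "cl r (fgen r * fgen i * fgen r) = cl r (fgen i * fgen r * fgen r)"
    by (rule cl_mult_cong[OF rel_comm refl]) (use i False in auto)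
  also have "\<dots> = cl r (fgen i * (fgen r * fgen r))" by (simp only: mult.assoc)
  also have "\<dots> = cl r (fgen i * 1)" by (rule cl_mult_cong[OF refl rel_last])
  finally show ?thesis using heckeD_fgen[OF i] by simp
qed

text \<open>A letter \<open>i < r\<close> read after an odd number of letters \<open>r\<close> enters as \<open>T\<^sub>r T\<^sub>i T\<^sub>r\<close>, because
  \<open>T\<^sub>r\<^sup>2 = 1\<close>; with an even total number no \<open>T\<^sub>r\<close> is left over.\<close>

lemma heckeD_tword:
  assumes "set is \<subseteq> {1..r}"
  shows "(even (count_list is r) \<longrightarrow> cl r (tword is) \<in> heckeD r)
    \<and> (odd (count_list is r) \<longrightarrow> cl r (tword is * fgen r) \<in> heckeD r)"
  using assms
proof (induction "is" rule: rev_induct)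
  case Nil
  then show ?case using heckeD_one by (simp add: tword_simps)
next
  case (snoc i js)
  have sq: "cl r (a * fgen r * fgen r) = cl r a" for a
    using cl_mult_cong[OF refl rel_last, of a] by (simp add: mult.assoc)
  have IH: "even (count_list js r) \<Longrightarrow> cl r (tword js) \<in> heckeD r"
    "odd (count_list js r) \<Longrightarrow> cl r (tword js * fgen r) \<in> heckeD r" using snoc by auto
  show ?case
  proof (cases "i = r")
    case True
    then show ?thesis using IH sq[of "tword js"] by (simp add: tword_simps)
  next
    case False
    then have i: "i \<in> {1..<r}" using snoc.prems by auto
    have "cl r (tword js * fgen i) \<in> heckeD r" if "even (count_list js r)"
      by (rule heckeD_mult[OF IH(1)[OF that] heckeD_fgen[OF i]])
    moreover have "cl r (tword js * fgen i * fgen r) \<in> heckeD r" if "odd (count_list js r)"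
    proof -
      have "cl r (tword js * fgen i * fgen r) = cl r ((tword js * fgen r * fgen r) * (fgen i * fgen r))"
        using cl_mult_cong[OF sq[of "tword js", symmetric] refl, of "fgen i * fgen r"] by (simp only: mult.assoc)
      also have "\<dots> = cl r ((tword js * fgen r) * (fgen r * fgen i * fgen r))" by (simp only: mult.assoc)
      also have "\<dots> \<in> heckeD r" by (rule heckeD_mult[OF IH(2)[OF that] heckeD_conj[OF i]])
      finally show ?thesis .
    qed
    ultimately show ?thesis using False by (simp add: tword_simps mult.assoc)
  qed
qed

lemma psign_wprod: "set is \<subseteq> {1..r} \<Longrightarrow> psign r (wprod r is) = Pos \<longleftrightarrow> even (count_list is r)"
proof (induction "is")
  case Nil
  show "psign r (wprod r []) = Pos \<longleftrightarrow> even (count_list [] r)" by (simp add: wprod_Nil psign_id)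
next
  case (Cons i js)
  have i: "i \<in> {1..r}" and js: "set js \<subseteq> {1..r}" using Cons.prems by auto
  have "psign r (cs r i) = (if i = r then Neg else Pos)" using cs_WD_iff[OF i] by (simp add: psign_def)
  then show "psign r (wprod r (i # js)) = Pos \<longleftrightarrow> even (count_list (i # js) r)"
    using Cons.IH[OF js] psign_comp[OF cs_WB[OF i] wprod_WB[OF js]]
    by (cases "psign r (wprod r js)") (auto simp: wprod_Cons)
qed

lemma heckeD_tw: assumes w: "w \<in> WB r" "psign r w = Pos" shows "cl r (tw r w) \<in> heckeD r"
proof -
  obtain "is" where red: "reduced_expr r is w" using reduced_exists w by blast
  then have i: "set is \<subseteq> {1..r}" "wprod r is = w" using reduced_expr_iff[OF w(1)] by auto
  show ?thesis using tw_reduced[OF w(1) red] heckeD_tword[OF i(1)] psign_wprod[OF i(1)] i(2) w(2) by simp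
qed

lemma heckeD_tsum: "(\<And>w. w \<in> X \<Longrightarrow> w \<in> WB r \<and> psign r w = Pos) \<Longrightarrow> cl r (tsum r X) \<in> heckeD r"
  unfolding tsum_def by (rule heckeD_sum) (auto intro: heckeD_tw)

end

section \<open>Quantum integers\<close>

lemma qint_geometric: "qint m = (\<Sum>i<m. qq ^ i)"
proof -
  have ne: "qq - 1 \<noteq> 0" by (simp add: qq_def one_pCons)
  have "qq ^ m - 1 = (qq - 1) * (\<Sum>i<m. qq ^ i)" by (rule power_diff_1_eq)
  then show ?thesis unfolding qint_def using ne by simp
qed

lemma qint_Suc: "qint (Suc m) = qint m + qq ^ m"
  by (simp add: qint_geometric)

text \<open>The exponents are \<open>0, ..., card M - 1\<close>, taken on in decreasing order of \<open>x\<close>.\<close>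

lemma qint_count_greater:
  assumes "finite (M :: nat set)"
  shows "(\<Sum>x\<in>M. qq ^ card {y \<in> M. x < y}) = qint (card M)"
  using assms
proof (induction M rule: finite_linorder_min_induct)
  case empty
  then show ?case by (simp add: qint_geometric)
next
  case (insert b A)
  have b: "b \<notin> A" using insert by auto
  have 1: "{y \<in> insert b A. b < y} = A" using insert by auto
  have 2: "{y \<in> insert b A. x < y} = {y \<in> A. x < y}" if "x \<in> A" for x using insert that by auto
  have "(\<Sum>x\<in>insert b A. qq ^ card {y \<in> insert b A. x < y}) = qq ^ card A + (\<Sum>x\<in>A. qq ^ card {y \<in> insert b A. x < y})"
    unfolding sum.insert[OF insert(1) b] 1 ..
  also have "(\<Sum>x\<in>A. qq ^ card {y \<in> insert b A. x < y}) = (\<Sum>x\<in>A. qq ^ card {y \<in> A. x < y})"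
    by (rule sum.cong) (simp_all only: 2)
  finally show ?case using insert b by (simp add: qint_Suc add.commute)
qed

lemma qint_nonzero: "m > 0 \<Longrightarrow> qint m \<noteq> 0"
proof
  assume m: "m > 0" "qint m = 0"
  have "poly (qint m) 1 = of_nat m" by (simp add: qint_geometric poly_sum qq_def)
  then show False using m by simp
qed

section \<open>Symmetrizers absorb parabolic factors\<close>

text \<open>The inversions of the inverse of \<open>d\<close> inside the blocks of \<open>l\<close>, which measure how far \<open>d\<close> is from the
  shortest element of its coset when \<open>l\<close> has no middle part.\<close>

definition ell :: "nat \<Rightarrow> nat \<Rightarrow> (nat \<Rightarrow> nat) \<Rightarrow> (nat \<Rightarrow> nat) \<Rightarrow> nat" where
  "ell n r l d = linv {(a, b). a \<in> {1..r} \<and> b \<in> {1..r} \<and> bk n l a = bk n l b} (pinv d)"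

context hecke_rank
begin

lemma tw_down:
  assumes w: "w \<in> WB r" and i: "i \<in> {1..<r}" and dn: "w (i+1) < w i"
  shows "cl r (tw r w * fgen i) = cl r (fconst (qq - 1) * tw r w + fconst qq * tw r (w \<circ> cs r i))"
proof -
  have i': "i \<in> {1..r}" using i by auto
  have W: "w \<circ> cs r i \<in> WB r" by (rule WB_comp[OF w cs_WB[OF i']])
  have "(w \<circ> cs r i) i < (w \<circ> cs r i) (i+1)" using dn cs_left[OF i'] cs_right[OF i'] by simp
  from tw_right[OF W i' this] have e: "cl r (tw r w) = cl r (tw r (w \<circ> cs r i) * fgen i)" by (simp only: comp_cs_cs)
  have "cl r (tw r w * fgen i) = cl r (tw r (w \<circ> cs r i) * fgen i * fgen i)" by (rule cl_mult_cong[OF e refl])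
  also have "\<dots> = cl r (tw r (w \<circ> cs r i) * (fgen i * fgen i))" by (simp only: mult.assoc)
  also have "\<dots> = cl r (tw r (w \<circ> cs r i) * (fconst (qq - 1) * fgen i + fconst qq))"
    by (rule cl_mult_cong[OF refl rel_quad]) (use i in auto)
  also have "tw r (w \<circ> cs r i) * (fconst (qq - 1) * fgen i + fconst qq)
      = fconst (qq - 1) * (tw r (w \<circ> cs r i) * fgen i) + fconst qq * tw r (w \<circ> cs r i)"
    by (simp only: distrib_left fconst_central[of _ "tw r (w \<circ> cs r i)"] mult.assoc[symmetric])
  also have "cl r \<dots> = cl r (fconst (qq - 1) * tw r w + fconst qq * tw r (w \<circ> cs r i))"
    by (rule cl_add_cong[OF cl_mult_cong[OF refl e[symmetric]] refl])
  finally show ?thesis .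
qed

text \<open>Pair \<open>w\<close> with \<open>w s\<^sub>i\<close>. The relation \<open>T\<^sub>i\<^sup>2 = (q-1) T\<^sub>i + q\<close> shows that \<open>x T\<^sub>i = q x\<close> on each pair.\<close>

lemma tsum_stab_fgen:
  assumes l: "l \<in> Lam n r" and i: "i \<in> {1..<r}" and b: "bk n l i = bk n l (i+1)"
  shows "cl r (tsum r (stab n r l) * fgen i) = cl r (fconst qq * tsum r (stab n r l))"
proof -
  let ?X = "stab n r l" and ?s = "\<lambda>w. w \<circ> cs r i"
  have i': "i \<in> {1..r}" using i by auto
  have s: "cs r i \<in> ?X" by (rule cs_stab[OF l i' b])
  have fin: "finite ?X" by (rule finite_subset[OF _ finite_WB]) (auto simp: stab_def)
  define U where "U = {w \<in> ?X. w i < w (i+1)}"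
  define D where "D = {w \<in> ?X. w (i+1) < w i}"
  have ud: "w i < w (i+1) \<or> w (i+1) < w i" if "w \<in> ?X" for w by (rule WB_up_or_down[OF stab_WB[OF that]])
  have X: "?X = U \<union> D" "U \<inter> D = {}" using ud by (auto simp: U_def D_def)
  have finUD: "finite U" "finite D" using fin X by (metis finite_Un)+
  have bij: "bij_betw ?s U D"
  proof (rule bij_betwI[where g = ?s])
    show "?s \<in> U \<rightarrow> D" "?s \<in> D \<rightarrow> U"
      using stab_comp[OF _ s] cs_left[OF i'] cs_right[OF i'] by (auto simp: U_def D_def)
  qed (simp_all add: comp_cs_cs)
  have bij': "bij_betw ?s D U"
  proof (rule bij_betwI[where g = ?s])
    show "?s \<in> U \<rightarrow> D" "?s \<in> D \<rightarrow> U"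
      using stab_comp[OF _ s] cs_left[OF i'] cs_right[OF i'] by (auto simp: U_def D_def)
  qed (simp_all add: comp_cs_cs)
  have tX: "tsum r ?X = tsum r U + tsum r D"
    unfolding tsum_def X(1) by (rule sum.union_disjoint[OF finUD X(2)])
  have U: "cl r (tsum r U * fgen i) = cl r (tsum r D)"
  proof -
    have "cl r (\<Sum>w\<in>U. tw r w * fgen i) = cl r (\<Sum>w\<in>U. tw r (w \<circ> cs r i))"
      by (rule cl_sum_cong, rule tw_right[OF _ i', symmetric]) (auto simp: U_def stab_def)
    then show ?thesis unfolding tsum_def sum_distrib_right sum.reindex_bij_betw[OF bij] .
  qed
  have D: "cl r (tsum r D * fgen i) = cl r (fconst (qq - 1) * tsum r D + fconst qq * tsum r U)"
  proof -
    have "cl r (\<Sum>w\<in>D. tw r w * fgen i) = cl r (\<Sum>w\<in>D. fconst (qq - 1) * tw r w + fconst qq * tw r (w \<circ> cs r i))"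
      by (rule cl_sum_cong, rule tw_down[OF _ i]) (auto simp: D_def stab_def)
    then show ?thesis unfolding tsum_def sum_distrib_right sum.distrib sum_distrib_left[symmetric]
        sum.reindex_bij_betw[OF bij', of "tw r"] .
  qed
  have "cl r (tsum r ?X * fgen i) = cl r (tsum r D + (fconst (qq - 1) * tsum r D + fconst qq * tsum r U))"
    unfolding tX distrib_right by (rule cl_add_cong[OF U D])
  also have "tsum r D + (fconst (qq - 1) * tsum r D + fconst qq * tsum r U) = fconst qq * tsum r ?X"
    unfolding tX by (simp add: fconst_diff fconst_one algebra_simps)
  finally show ?thesis .
qed

lemma linv_cong: "(\<And>a b. (a, b) \<in> Q \<Longrightarrow> f a = g a \<and> f b = g b) \<Longrightarrow> linv Q f = linv Q g"
  unfolding linv_def by (rule arg_cong[where f = card]) auto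

text \<open>As long as \<open>d\<close> has a left descent inside a block, it is moved into the symmetrizer, where it becomes
  a factor \<open>q\<close> and lowers \<open>ell\<close> by one. What remains is the shortest element of the coset, where lengths
  add. Without a middle part the generator \<open>s\<^sub>r\<close>, which has parameter \<open>1\<close>, does not occur.\<close>

lemma tsum_stab_tw:
  assumes l: "l \<in> Lam n r" "l (n + 1) = 0" and d: "d \<in> WB r"
  shows "cl r (tsum r (stab n r l) * tw r d) = cl r (fconst (qq ^ ell n r l d) * tsum r ((\<lambda>u. u \<circ> d) ` stab n r l))"
  using d
proof (induction "ell n r l d" arbitrary: d rule: less_induct)
  case less
  let ?X = "stab n r l" and ?Q = "{(a, b). a \<in> {1..r} \<and> b \<in> {1..r} \<and> bk n l a = bk n l b}"
  \<comment> \<open>Without a middle part a block ends at \<open>r\<close>, so the generators in the stabilizer have parameter \<open>q\<close>.\<close>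
  have last: "i < r" if "i \<in> {1..r}" "bk n l i = bk n l (i+1)" for i
  proof (rule ccontr)
    assume "\<not> i < r"
    then have ir: "i = r" using that by auto
    have "r \<in> {1..2*r}" "r \<in> {1..r}" "r + 1 \<in> {r+1..2*r}" using r2 by auto
    then have "bk n l r = n + 1" using bk_le_mid[OF l(1), of r] bk_ge_mid[OF l(1), of "r+1"] that(2) ir by simp
    then show False using bk_no_mid[OF l \<open>r \<in> {1..2*r}\<close>] by simp
  qed
  show ?case
  proof (cases "\<exists>i\<in>{1..r}. bk n l i = bk n l (i+1) \<and> pinv d (i+1) < pinv d i")
    case True
    then obtain i where i: "i \<in> {1..r}" "bk n l i = bk n l (i+1)" "pinv d (i+1) < pinv d i" by blast
    have i': "i \<in> {1..<r}" using i(1) last[OF i(1,2)] by auto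
    have s: "cs r i \<in> ?X" by (rule cs_stab[OF l(1) i(1,2)])
    define d1 where "d1 = cs r i \<circ> d"
    have d1: "d1 \<in> WB r" unfolding d1_def by (rule WB_comp[OF cs_WB[OF i(1)] less.prems])
    have dd: "d = cs r i \<circ> d1" by (simp add: d1_def comp_cs_cs)
    have p1: "pinv d1 = pinv d \<circ> cs r i" unfolding d1_def WB_inv_compose[OF cs_WB[OF i(1)] less.prems] cs_inv ..
    then have p: "pinv d = pinv d1 \<circ> cs r i" by (simp add: comp_cs_cs)
    have up: "pinv d1 i < pinv d1 (i+1)" using i(3) p1 cs_left[OF i(1)] cs_right[OF i(1)] by simp
    have "ell n r l d = linv ?Q (pinv d1 \<circ> transpose i (Suc i))"
      unfolding ell_def p
    proof (rule linv_cong)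
      fix a b assume "(a, b) \<in> ?Q"
      then show "(pinv d1 \<circ> cs r i) a = (pinv d1 \<circ> transpose i (Suc i)) a
          \<and> (pinv d1 \<circ> cs r i) b = (pinv d1 \<circ> transpose i (Suc i)) b"
        using cs_small[OF i', of a] cs_small[OF i', of b] by simp
    qed
    also have "\<dots> = Suc (linv ?Q (pinv d1))"
    proof (rule linv_swap)
      show "finite ?Q" by (rule finite_subset[of _ "{1..r} \<times> {1..r}"]) auto
      show "(i, Suc i) \<in> ?Q" using i i' by auto
      show "pinv d1 i < pinv d1 (Suc i)" using up by simp
      have t: "transpose i (Suc i) a \<in> {1..r} \<and> bk n l (transpose i (Suc i) a) = bk n l a" if "a \<in> {1..r}" for a
        using that i i' by (auto simp: transpose_def)
      fix a b assume "(a, b) \<in> ?Q"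
      then show "(transpose i (Suc i) a, transpose i (Suc i) b) \<in> ?Q" using t[of a] t[of b] by simp
    qed
    finally have e: "ell n r l d = Suc (ell n r l d1)" by (simp add: ell_def)
    have im: "(\<lambda>u. u \<circ> d) ` ?X = (\<lambda>u. u \<circ> d1) ` ?X"
    proof -
      have "u \<circ> d = (u \<circ> cs r i) \<circ> d1" for u by (simp add: dd comp_assoc)
      moreover have "u \<circ> d1 = (u \<circ> cs r i) \<circ> d" for u by (simp add: d1_def comp_assoc)
      ultimately show ?thesis using stab_comp[OF _ s] by (metis (no_types, lifting) image_cong image_subset_iff imageI subset_antisym)
    qed
    have "cl r (tsum r ?X * tw r d) = cl r (tsum r ?X * (fgen i * tw r d1))"
      by (rule cl_mult_cong[OF refl]) (use tw_left[OF d1 i(1) up] dd in simp)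
    also have "\<dots> = cl r (tsum r ?X * fgen i * tw r d1)" by (simp only: mult.assoc)
    also have "\<dots> = cl r (fconst qq * tsum r ?X * tw r d1)"
      by (rule cl_mult_cong[OF tsum_stab_fgen[OF l(1) i' i(2)] refl])
    also have "\<dots> = cl r (fconst qq * (tsum r ?X * tw r d1))" by (simp only: mult.assoc)
    also have "\<dots> = cl r (fconst qq * (fconst (qq ^ ell n r l d1) * tsum r ((\<lambda>u. u \<circ> d1) ` ?X)))"
      by (rule cl_mult_cong[OF refl less.hyps]) (use e d1 in auto)
    also have "\<dots> = cl r (fconst (qq ^ ell n r l d) * tsum r ((\<lambda>u. u \<circ> d) ` ?X))"
      by (simp only: e im power_Suc fconst_mult mult.assoc)
    finally show ?thesis .
  next
    case False
    have inc: "incr n r l (pinv d)"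
    proof (rule incr_adjacent[OF l(1) WB_inv[OF less.prems]])
      fix i assume "i \<in> {1..r}" "bk n l i = bk n l (i+1)"
      then show "pinv d i < pinv d (i+1)" using False WB_up_or_down[OF WB_inv[OF less.prems], of i] by blast
    qed
    have "{(a, b) \<in> ?Q. a < b \<and> pinv d b < pinv d a} = {}"
    proof -
      have False if "(a, b) \<in> ?Q" "a < b" "pinv d b < pinv d a" for a b
      proof -
        have "a \<in> {1..2*r}" "b \<in> {1..2*r}" "bk n l a = bk n l b" using that(1) by auto
        then have "pinv d a < pinv d b" using incrD[OF inc _ _ that(2)] by blast
        then show False using that(3) by simp
      qed
      then show ?thesis by blast
    qed
    then have e: "ell n r l d = 0" unfolding ell_def linv_def by (metis (no_types, lifting) card.empty)
    have inj: "inj_on (\<lambda>u. u \<circ> d) ?X"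
      by (rule inj_on_inverseI[of _ "\<lambda>u. u \<circ> pinv d"]) (simp add: comp_assoc WB_inv_comp[OF less.prems])
    have "cl r (tsum r ?X * tw r d) = cl r (\<Sum>u\<in>?X. tw r u * tw r d)" by (simp add: tsum_def sum_distrib_right)
    also have "\<dots> = cl r (\<Sum>u\<in>?X. tw r (u \<circ> d))"
      by (rule cl_sum_cong, rule tw_mult_left[OF l(1) less.prems inc, symmetric])
    also have "(\<Sum>u\<in>?X. tw r (u \<circ> d)) = tsum r ((\<lambda>u. u \<circ> d) ` ?X)" unfolding tsum_def using sum.reindex[OF inj, of "tw r"] by simp
    finally show ?thesis by (simp add: e fconst_one)
  qed
qed

end

section \<open>The product of a symmetrizer and a coset sum\<close>

text \<open>The data of a product: \<open>l\<close> and \<open>m\<close> are the compositions of the left factor, \<open>m\<close> and \<open>k\<close> those of the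
  right factor.\<close>

locale box_product = hecke_rank r + middle_one n r m l for n r and m l :: "nat \<Rightarrow> nat" +
  fixes k :: "nat \<Rightarrow> nat"
  assumes k: "k \<in> Lam n r"
begin

lemma rr: "r \<in> {1..2*r}" "r \<in> {1..r}" "r + 1 \<in> {1..2*r}" "r + 1 \<in> {r+1..2*r}" "2*r + 1 - r = r + 1"
  using r2 by auto

lemma stab_m_l:
  assumes "u r = r" shows "u \<in> stab n r m \<longleftrightarrow> u \<in> stab n r l"
proof (cases "u \<in> WB r")
  case True
  have u1: "u (r+1) = r+1" using WB_opp[OF True rr(1)] rr(5) assms by simp
  have "bk n m (u x) = bk n m x \<longleftrightarrow> bk n l (u x) = bk n l x" if x: "x \<in> {1..2*r}" for x
  proof (cases "x = r \<or> x = r + 1")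
    case True then show ?thesis using assms u1 by auto
  next
    case False
    have "u x \<noteq> r" "u x \<noteq> r + 1" using WB_eq[OF True, of x r] WB_eq[OF True, of x "r+1"] assms u1 False by auto
    moreover have "u x \<in> {1..2*r}" using WB_mem[OF True, of x] x by blast
    ultimately show ?thesis using dm_bk_same x False by simp
  qed
  then show ?thesis by (simp add: stab_def)
qed (simp add: stab_def)

text \<open>The key to the left factor: the small parabolic subgroup is a point stabilizer in the big one.\<close>

lemma PD_m_iff: "u \<in> PD n r m \<longleftrightarrow> u \<in> stab n r l \<and> u r = r"
  using stab_m_l[of u] PD_m_fix[of u] by (auto simp: PD_def)

lemma stab_l_psign: "u \<in> stab n r l \<Longrightarrow> psign r u = Pos"
  by (rule stab_psign_no_mid[OF dm_l dm_l0])

text \<open>The stabilizer of \<open>l\<close> acts transitively on block \<open>n\<close>, and \<open>r\<close> belongs to this block.\<close>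

lemma swap_in_block:
  assumes a: "a \<in> {1..2*r}" "bk n l a = n"
  obtains u where "u \<in> stab n r l" "u a = r"
proof (cases "a = r")
  case True then show ?thesis using that[OF stab_id] by simp
next
  case False
  note lL = dm_l
  have ar: "a < r"
  proof (rule ccontr)
    assume "\<not> a < r"
    then have "a \<in> {r+1..2*r}" using False a by auto
    then show False using bk_ge_mid[OF lL, of a] a by simp
  qed
  define a' where "a' = 2*r + 1 - a"
  have a': "r + 1 < a'" "a' \<le> 2*r" "2*r + 1 - a' = a" using ar a by (auto simp: a'_def)
  have br: "bk n l r = n" "bk n l (r+1) = n + 2" by (rule dm_bk_l)+
  have ba': "bk n l a' = n + 2" using bk_sym[OF lL a(1)] a(2) by (simp add: a'_def)
  let ?u = "transpose a r \<circ> transpose a' (r+1)"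
  have vals: "?u a = r" "?u r = a" "?u a' = r+1" "?u (r+1) = a'" using ar a' by (auto simp: transpose_def)
  have oth: "?u x = x" if "x \<noteq> a" "x \<noteq> r" "x \<noteq> a'" "x \<noteq> r + 1" for x using that by (simp add: transpose_def)
  have "?u \<in> WB r"
  proof (rule WB_I)
    show "?u permutes {1..2*r}" using a a' rr by (intro permutes_compose permutes_swap_id) auto
    fix x assume x: "x \<in> {1..2*r}"
    have o: "2*r + 1 - a = a'" "2*r + 1 - r = r + 1" "2*r + 1 - (r + 1) = r" using a'_def r2 by auto
    consider "x = a" | "x = r" | "x = a'" | "x = r + 1" | "x \<noteq> a" "x \<noteq> r" "x \<noteq> a'" "x \<noteq> r + 1" by blast
    then show "?u (2*r + 1 - x) = 2*r + 1 - ?u x"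
    proof cases
      case 5
      have "2*r + 1 - x \<noteq> a" "2*r + 1 - x \<noteq> r" "2*r + 1 - x \<noteq> a'" "2*r + 1 - x \<noteq> r + 1"
        using 5 x a' a'_def a by auto
      then show ?thesis unfolding oth[OF 5] by (rule oth)
    qed (simp_all only: vals o a'(3))
  qed
  moreover have "bk n l (?u x) = bk n l x" for x
  proof -
    consider "x = a" | "x = r" | "x = a'" | "x = r + 1" | "x \<noteq> a" "x \<noteq> r" "x \<noteq> a'" "x \<noteq> r + 1" by blast
    then show ?thesis
    proof cases
      case 5 show ?thesis unfolding oth[OF 5] ..
    qed (simp_all only: vals a(2) br ba')
  qed
  ultimately show ?thesis using that[of ?u] vals(1) by (simp add: stab_def)
qed

text \<open>The coefficient of \<open>T\<^sub>w\<close> in the sum of the \<open>q\<^sup>e T(Xd)\<close> with \<open>e = ell d\<close>, where \<open>X\<close> is the stabilizer of \<open>l\<close>. The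
  representatives \<open>d \<in> R\<close> with \<open>w \<in> Xd\<close> correspond to points \<open>x\<close> sent by \<open>d\<close> to \<open>r\<close>. All such \<open>x\<close> lie in a
  single column \<open>p\<close>, and \<open>ell d\<close> is the number of points beyond \<open>x\<close> that \<open>w\<close> sends to block \<open>n\<close>: those in
  the columns after \<open>p\<close> and those behind \<open>x\<close> in column \<open>p\<close>. The first number is constant, the second runs
  through \<open>0, ..., A n p\<close>.\<close>

lemma coset_sum_coefficient:
  fixes d0 \<sigma> Pr R
  defines "A \<equiv> mat n r m d0 k"
  defines "S \<equiv> mid_fibre k A \<sigma> Pr"
  assumes d0: "d0 \<in> WB r" and Pr: "Pr \<subseteq> {1..2*n+1}"
    and RS: "R \<subseteq> S" and bij: "bij_betw (\<lambda>(d, c). c \<circ> d) (R \<times> PD n r m) S"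
    and low: "\<And>d. d \<in> R \<Longrightarrow> low_incr n m (pinv d)"
    and w: "w \<in> WB r"
  shows "(\<Sum>d\<in>{d \<in> R. w \<in> (\<lambda>u. u \<circ> d) ` stab n r l}. qq ^ ell n r l d)
    = (\<Sum>p\<in>{p \<in> Pr. A (n+1) p > 0 \<and> w \<in> fibre n r l k (shiftA n A p) \<sigma>}. gcoef n A p)"
proof -
  note lL = dm_l
  \<comment> \<open>\<open>M\<close> consists of the points sent to block \<open>n\<close>, \<open>M'\<close> of those that occur as \<open>x\<close>, and \<open>Rw\<close> of the
    representatives whose coset contains \<open>w\<close>.\<close>
  define M where "M = {x \<in> {1..2*r}. bk n l (w x) = n}"
  define M' where "M' = {x \<in> M. bk n k x \<in> Pr \<and> A (n+1) (bk n k x) > 0 \<and> w \<in> fibre n r l k (shiftA n A (bk n k x)) \<sigma>}"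
  define Rw where "Rw = {d \<in> R. w \<in> (\<lambda>u. u \<circ> d) ` stab n r l}"
  have S: "d \<in> WB r" "mat n r m d k = A" "psign r d = \<sigma>" "bk n k (pinv d r) \<in> Pr" if "d \<in> S" for d
    using that unfolding S_def mid_fibre_def by auto
  have M_d: "M = {x \<in> {1..2*r}. bk n l (d x) = n}" if u: "u \<in> stab n r l" "w = u \<circ> d" and d: "d \<in> WB r" for u d
  proof -
    have "bk n l (w x) = bk n l (d x)" if x: "x \<in> {1..2*r}" for x
    proof -
      have "d x \<in> {1..2*r}" using WB_mem[OF d, of x] x by blast
      from stab_bk[OF u(1) this] show ?thesis unfolding u(2) by (simp only: comp_apply)
    qed
    then show ?thesis unfolding M_def by auto
  qed
  \<comment> \<open>Two representatives in \<open>Rw\<close> with the same \<open>x\<close> differ by an element of the stabilizer of \<open>l\<close> that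
    fixes \<open>r\<close>, hence lie in the same coset of \<open>PD n r m\<close>.\<close>
  have inj: "inj_on (\<lambda>d. pinv d r) Rw"
  proof (rule inj_onI)
    fix d1 d2 assume d12: "d1 \<in> Rw" "d2 \<in> Rw" and e: "pinv d1 r = pinv d2 r"
    obtain u1 where u1: "u1 \<in> stab n r l" "w = u1 \<circ> d1" using d12 by (auto simp: Rw_def)
    obtain u2 where u2: "u2 \<in> stab n r l" "w = u2 \<circ> d2" using d12 by (auto simp: Rw_def)
    have dS: "d1 \<in> R" "d2 \<in> R" "d1 \<in> WB r" "d2 \<in> WB r" using d12 RS S(1) by (auto simp: Rw_def)
    define v where "v = pinv u1 \<circ> u2"
    have v: "v \<in> stab n r l" unfolding v_def by (rule stab_comp[OF stab_inv[OF u1(1)] u2(1)])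
    have "pinv u1 \<circ> (u1 \<circ> d1) = pinv u1 \<circ> (u2 \<circ> d2)" using u1(2) u2(2) by simp
    then have vd: "d1 = v \<circ> d2" unfolding v_def comp_assoc[symmetric] WB_inv_comp(1)[OF stab_WB[OF u1(1)]] by simp
    have "v r = d1 (pinv d2 r)" unfolding vd using WB_inv_apply(2)[OF dS(4)] by simp
    then have "v r = r" using e WB_inv_apply(2)[OF dS(3)] by metis
    then have "v \<in> PD n r m" using v PD_m_iff by blast
    then have "(d2, v) \<in> R \<times> PD n r m" "(d1, id) \<in> R \<times> PD n r m" using dS PD_id by auto
    moreover have "(\<lambda>(d, c). c \<circ> d) (d2, v) = (\<lambda>(d, c). c \<circ> d) (d1, id)" using vd by simp
    ultimately have "(d2, v) = (d1, id)" using bij_betw_imp_inj_on[OF bij] inj_onD by metis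
    then show "d1 = d2" by simp
  qed
  have img: "(\<lambda>d. pinv d r) ` Rw = M'"
  proof (rule subset_antisym; rule subsetI)
    fix x assume "x \<in> (\<lambda>d. pinv d r) ` Rw"
    then obtain d where d: "d \<in> Rw" "x = pinv d r" by blast
    obtain u where u: "u \<in> stab n r l" "w = u \<circ> d" using d by (auto simp: Rw_def)
    have dS: "d \<in> S" using d RS by (auto simp: Rw_def)
    note Sd = S[OF dS]
    have x: "x \<in> {1..2*r}" unfolding d(2) using WB_mem[OF WB_inv[OF Sd(1)], of r] rr by blast
    have dx: "d x = r" unfolding d(2) by (rule WB_inv_apply(2)[OF Sd(1)])
    have "x \<in> M" unfolding M_d[OF u Sd(1)] using x dx dm_bk_l by simp
    moreover have "bk n k x \<in> Pr" using Sd(4) d(2) by simp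
    moreover have "A (n+1) (bk n k x) > 0"
    proof -
      have "x \<in> {x' \<in> {1..2*r}. bk n m (d x') = n + 1 \<and> bk n k x' = bk n k x}"
        using x dx dm_bk_m by simp
      then have "card {x' \<in> {1..2*r}. bk n m (d x') = n + 1 \<and> bk n k x' = bk n k x} > 0"
        by (intro card_gt_0_iff[THEN iffD2] conjI) (blast, simp)
      moreover have "n + 1 \<in> {1..2*n+1} \<and> bk n k x \<in> {1..2*n+1}" using bk_bounds[OF k x] by simp
      ultimately show ?thesis unfolding Sd(2)[symmetric] mat_def by (simp only: if_True simp_thms)
    qed
    moreover have "w \<in> fibre n r l k (shiftA n A (bk n k x)) \<sigma>"
    proof -
      have "mat n r l w k = mat n r l d k" unfolding u(2) using mat_stab[OF lL k Sd(1) u(1) stab_id] by simp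
      also have "\<dots> = shiftA n A (bk n k x)" using mat_shiftA[OF k Sd(1)] Sd(2) d(2) by simp
      finally have "mat n r l w k = shiftA n A (bk n k x)" .
      moreover have "psign r w = \<sigma>" unfolding u(2) using psign_comp[OF stab_WB[OF u(1)] Sd(1)] stab_l_psign[OF u(1)] Sd(3) by simp
      ultimately show ?thesis using w by (simp add: fibre_def)
    qed
    ultimately show "x \<in> M'" by (simp add: M'_def)
  next
    fix x assume "x \<in> M'"
    then have x: "x \<in> {1..2*r}" "bk n l (w x) = n" "bk n k x \<in> Pr" "A (n+1) (bk n k x) > 0"
      and F: "mat n r l w k = shiftA n A (bk n k x)" "psign r w = \<sigma>" by (auto simp: M'_def M_def fibre_def)
    have wx: "w x \<in> {1..2*r}" using WB_mem[OF w, of x] x by blast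
    obtain u where u: "u \<in> stab n r l" "u (w x) = r" by (rule swap_in_block[OF wx x(2)])
    let ?w = "u \<circ> w"
    have W: "?w \<in> WB r" by (rule WB_comp[OF stab_WB[OF u(1)] w])
    have pw: "pinv ?w r = x" using WB_inv_apply(1)[OF W, of x] u(2) by simp
    have "mat n r l ?w k = shiftA n A (bk n k x)" using mat_stab[OF lL k w u(1) stab_id] F(1) by simp
    then have "mat n r m ?w k = A"
      using shiftA_fibre_iff[OF k d0 W, of "bk n k x"] x(4) pw unfolding A_def by simp
    moreover have "psign r ?w = \<sigma>" using psign_comp[OF stab_WB[OF u(1)] w] stab_l_psign[OF u(1)] F(2) by simp
    ultimately have "?w \<in> S" using W pw x(3) unfolding S_def mid_fibre_def by simp
    then obtain d c where dc: "d \<in> R" "c \<in> PD n r m" "?w = c \<circ> d" using bij by (auto simp: bij_betw_def)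
    have dW: "d \<in> WB r" using dc RS S(1) by blast
    have c: "c \<in> stab n r l" "c r = r" using dc(2) PD_m_iff by auto
    have "pinv c r = r" using c WB_inv_apply(1)[OF stab_WB[OF c(1)], of r] by simp
    moreover have "pinv ?w = pinv d \<circ> pinv c" unfolding dc(3) by (rule WB_inv_compose[OF stab_WB[OF c(1)] dW])
    ultimately have px: "pinv d r = x" using pw by simp
    have "w = pinv u \<circ> ?w" using WB_inv_comp(1)[OF stab_WB[OF u(1)]] by (simp add: comp_assoc[symmetric])
    then have "w = (pinv u \<circ> c) \<circ> d" unfolding dc(3) by (simp add: comp_assoc)
    moreover have "pinv u \<circ> c \<in> stab n r l" by (rule stab_comp[OF stab_inv[OF u(1)] c(1)])
    ultimately have "d \<in> Rw" using dc(1) by (auto simp: Rw_def)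
    then show "x \<in> (\<lambda>d. pinv d r) ` Rw" using px by blast
  qed
  \<comment> \<open>The inverse of \<open>d\<close> is increasing on the blocks of \<open>m\<close>, so an inversion inside a block of \<open>l\<close> must
    involve \<open>r\<close>, the last point of block \<open>n\<close>.\<close>
  have ell: "ell n r l d = card {y \<in> M. pinv d r < y}" if d: "d \<in> Rw" for d
  proof -
    obtain u where u: "u \<in> stab n r l" "w = u \<circ> d" using d by (auto simp: Rw_def)
    have dR: "d \<in> R" using d by (simp add: Rw_def)
    have dW: "d \<in> WB r" using dR RS S(1) by blast
    have "{(a, b) \<in> {(a, b). a \<in> {1..r} \<and> b \<in> {1..r} \<and> bk n l a = bk n l b}. a < b \<and> pinv d b < pinv d a}
      = (\<lambda>y. (d y, r)) ` {y \<in> M. pinv d r < y}" (is "?L = ?R")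
    proof (rule subset_antisym; rule subrelI)
      fix a b assume "(a, b) \<in> ?L"
      then have ab: "a \<in> {1..r}" "b \<in> {1..r}" "bk n l a = bk n l b" "a < b" "pinv d b < pinv d a" by auto
      have a2: "a \<in> {1..2*r}" "b \<in> {1..2*r}" using ab by auto
      have bl: "bk n l b \<le> n" using bk_le_mid[OF lL ab(2)] bk_no_mid[OF lL dm_l0 a2(2)] by simp
      have br: "b = r"
      proof (rule ccontr)
        assume "b \<noteq> r"
        then have "a \<noteq> r" "a \<noteq> r + 1" "b \<noteq> r" "b \<noteq> r + 1" using ab by auto
        then have "bk n m a = bk n m b" "bk n m a \<le> n"
          using dm_bk_same[OF a2(1)] dm_bk_same[OF a2(2)] ab(3) bl by auto
        then have "pinv d a < pinv d b" using low[OF dR] ab unfolding low_incr_def by blast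
        then show False using ab(5) by simp
      qed
      have "pinv d a \<in> M" unfolding M_d[OF u dW]
        using WB_mem[OF WB_inv[OF dW], of a] a2(1) WB_inv_apply(2)[OF dW, of a] ab(3) br dm_bk_l by simp
      then have "pinv d a \<in> {y \<in> M. pinv d r < y}" "(a, b) = (d (pinv d a), r)"
        using ab(5) br WB_inv_apply(2)[OF dW, of a] by auto
      then show "(a, b) \<in> ?R" by blast
    next
      fix a b assume "(a, b) \<in> ?R"
      then obtain y where y: "y \<in> M" "pinv d r < y" "a = d y" "b = r" by blast
      have yy: "y \<in> {1..2*r}" "bk n l (d y) = n" using y(1) M_d[OF u dW] by auto
      have dy: "d y \<in> {1..2*r}" using WB_mem[OF dW, of y] yy by blast
      have "\<not> d y \<in> {r+1..2*r}" using bk_ge_mid[OF lL, of "d y"] yy(2) by auto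
      moreover have "d y \<noteq> r" using y(2) WB_inv_apply(1)[OF dW, of y] by auto
      ultimately have "d y < r" "d y \<in> {1..r}" using dy by auto
      then show "(a, b) \<in> ?L" using y yy rr dm_bk_l WB_inv_apply(1)[OF dW, of y] by simp
    qed
    moreover have "inj_on (\<lambda>y. (d y, r)) {y \<in> M. pinv d r < y}" using WB_eq[OF dW] by (auto simp: inj_on_def)
    ultimately show ?thesis unfolding ell_def linv_def by (simp only: card_image)
  qed
  have finM: "finite M" by (simp add: M_def)
  have "(\<Sum>d\<in>Rw. qq ^ ell n r l d) = (\<Sum>d\<in>Rw. qq ^ card {y \<in> M. pinv d r < y})"
    by (rule sum.cong[OF refl]) (simp only: ell)
  also have "\<dots> = (\<Sum>x\<in>(\<lambda>d. pinv d r) ` Rw. qq ^ card {y \<in> M. x < y})"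
    using sum.reindex[OF inj, of "\<lambda>x. qq ^ card {y \<in> M. x < y}"] by simp
  also have "\<dots> = (\<Sum>x\<in>M'. qq ^ card {y \<in> M. x < y})" by (simp only: img)
  also have "\<dots> = (\<Sum>p\<in>{p \<in> Pr. A (n+1) p > 0 \<and> w \<in> fibre n r l k (shiftA n A p) \<sigma>}. gcoef n A p)"
  proof (cases "\<exists>p. p \<in> Pr \<and> A (n+1) p > 0 \<and> w \<in> fibre n r l k (shiftA n A p) \<sigma>")
    case False
    then have "M' = {}" "{p \<in> Pr. A (n+1) p > 0 \<and> w \<in> fibre n r l k (shiftA n A p) \<sigma>} = {}" by (auto simp: M'_def)
    then show ?thesis by (simp only: sum.empty)
  next
    case True
    then obtain p where p: "p \<in> Pr" "A (n+1) p > 0" "w \<in> fibre n r l k (shiftA n A p) \<sigma>" by blast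
    have uniq: "p' = p" if "A (n+1) p' > 0" "w \<in> fibre n r l k (shiftA n A p') \<sigma>" for p'
      by (rule shiftA_inj[where A = A, OF that(1) p(2)]) (use that p in \<open>simp add: fibre_def\<close>)
    have P1: "{p \<in> Pr. A (n+1) p > 0 \<and> w \<in> fibre n r l k (shiftA n A p) \<sigma>} = {p}" using p uniq by blast
    define Mp where "Mp = {x \<in> M. bk n k x = p}"
    have M'p: "M' = Mp" unfolding M'_def Mp_def using p uniq by blast
    have pr: "p \<in> {1..2*n+1}" "n \<in> {1..2*n+1}" using p Pr n by auto
    have matp: "mat n r l w k = shiftA n A p" using p(3) by (simp add: fibre_def)
    have sh: "shiftA n A p n j = A n j + (if j = p then 1 else 0)" for j by (auto simp: shiftA_def Eth_def)
    have "mat n r l w k n p = card {x \<in> {1..2*r}. bk n l (w x) = n \<and> bk n k x = p}"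
      using pr by (simp only: mat_def simp_thms if_True)
    moreover have "Mp = {x \<in> {1..2*r}. bk n l (w x) = n \<and> bk n k x = p}" by (auto simp: Mp_def M_def)
    ultimately have cMp: "card Mp = A n p + 1" using matp sh[of p] by simp
    have "(\<Sum>i\<in>{n}. \<Sum>j\<in>{p<..2*n+1}. mat n r l w k i j) = card {x \<in> {1..2*r}. bk n l (w x) \<in> {n} \<and> bk n k x \<in> {p<..2*n+1}}"
      by (rule sum_mat) (use pr in auto)
    moreover have "{x \<in> {1..2*r}. bk n l (w x) \<in> {n} \<and> bk n k x \<in> {p<..2*n+1}} = {x \<in> M. p < bk n k x}"
      using bk_bounds(2)[OF k] by (auto simp: M_def)
    moreover have "(\<Sum>i\<in>{n}. \<Sum>j\<in>{p<..2*n+1}. mat n r l w k i j) = (\<Sum>j\<in>{p<..2*n+1}. A n j)"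
      using matp sh by (simp add: sum.distrib)
    ultimately have cg: "card {x \<in> M. p < bk n k x} = (\<Sum>j\<in>{p<..2*n+1}. A n j)" by simp
    have cnt: "card {y \<in> M. x < y} = (\<Sum>j\<in>{p<..2*n+1}. A n j) + card {y \<in> Mp. x < y}" if x: "x \<in> Mp" for x
    proof -
      have x1: "x \<in> {1..2*r}" "bk n k x = p" using x by (auto simp: Mp_def M_def)
      have "x < y \<longleftrightarrow> p < bk n k y \<or> (bk n k y = p \<and> x < y)" if y: "y \<in> M" for y
      proof -
        have y1: "y \<in> {1..2*r}" using y by (simp add: M_def)
        have "p \<le> bk n k y" if "x < y" using bk_mono[OF k x1(1) y1] that x1(2) by simp
        moreover have "x < y" if "p < bk n k y"
        proof (rule ccontr)
          assume "\<not> x < y"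
          then have "bk n k y \<le> p" using bk_mono[OF k y1 x1(1)] x1(2) by simp
          then show False using that by simp
        qed
        ultimately show ?thesis by (metis le_neq_implies_less)
      qed
      then have "{y \<in> M. x < y} = {y \<in> M. p < bk n k y} \<union> {y \<in> Mp. x < y}" by (auto simp: Mp_def)
      moreover have "{y \<in> M. p < bk n k y} \<inter> {y \<in> Mp. x < y} = {}" by (auto simp: Mp_def)
      moreover have "finite Mp" using finM by (simp add: Mp_def)
      ultimately show ?thesis using cg finM by (simp add: card_Un_disjoint)
    qed
    have "(\<Sum>x\<in>M'. qq ^ card {y \<in> M. x < y}) = (\<Sum>x\<in>Mp. qq ^ (\<Sum>j\<in>{p<..2*n+1}. A n j) * qq ^ card {y \<in> Mp. x < y})"
      unfolding M'p by (rule sum.cong[OF refl]) (simp only: cnt power_add)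
    also have "\<dots> = qq ^ (\<Sum>j\<in>{p<..2*n+1}. A n j) * qint (card Mp)"
      unfolding sum_distrib_left[symmetric] using qint_count_greater[of Mp] finM by (simp add: Mp_def)
    also have "\<dots> = gcoef n A p" unfolding gcoef_def cMp using p(2) by simp
    finally show ?thesis unfolding P1 by simp
  qed
  finally show ?thesis unfolding Rw_def .
qed

text \<open>Both sides are compared by collecting the coefficient of every \<open>T\<^sub>w\<close>.\<close>

lemma symmetrizer_formula:
  fixes d0 \<sigma> Pr R
  defines "A \<equiv> mat n r m d0 k"
  defines "S \<equiv> mid_fibre k A \<sigma> Pr"
  assumes d0: "d0 \<in> WB r" and Pr: "Pr \<subseteq> {1..2*n+1}"
    and RS: "R \<subseteq> S" and bij: "bij_betw (\<lambda>(d, c). c \<circ> d) (R \<times> PD n r m) S"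
    and low: "\<And>d. d \<in> R \<Longrightarrow> low_incr n m (pinv d)"
  shows "cl r (tsum r (stab n r l) * tsum r R)
    = cl r (\<Sum>p\<in>{p \<in> Pr. A (n+1) p > 0}. fconst (gcoef n A p) * tsum r (fibre n r l k (shiftA n A p) \<sigma>))"
proof -
  let ?X = "stab n r l" and ?P = "{p \<in> Pr. A (n+1) p > 0}" and ?F = "\<lambda>p. fibre n r l k (shiftA n A p) \<sigma>"
  note lL = dm_l
  have RW: "d \<in> WB r" if "d \<in> R" for d using that RS unfolding S_def mid_fibre_def by auto
  have finR: "finite R" by (rule finite_subset[OF _ finite_WB]) (use RW in blast)
  have finP: "finite ?P" using Pr finite_subset by fastforce
  have XW: "(\<lambda>u. u \<circ> d) ` ?X \<subseteq> WB r" if "d \<in> R" for d using WB_comp[OF stab_WB RW[OF that]] by blast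
  have ind: "tsum r Y = (\<Sum>w\<in>WB r. if w \<in> Y then tw r w else 0)" if "Y \<subseteq> WB r" for Y
    unfolding tsum_def using that finite_WB by (subst sum.inter_restrict[symmetric]) (auto intro!: sum.cong)
  \<comment> \<open>Rearranging a combination of sums over sets by the group elements.\<close>
  have collect: "(\<Sum>d\<in>J. fconst (g d) * tsum r (Y d)) = (\<Sum>w\<in>WB r. fconst (\<Sum>d\<in>{d \<in> J. w \<in> Y d}. g d) * tw r w)"
    if finJ: "finite J" and Y: "\<And>d. d \<in> J \<Longrightarrow> Y d \<subseteq> WB r" for J :: "'b set" and g Y
  proof -
    have "(\<Sum>d\<in>J. fconst (g d) * tsum r (Y d)) = (\<Sum>d\<in>J. \<Sum>w\<in>WB r. if w \<in> Y d then fconst (g d) * tw r w else 0)"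
      by (rule sum.cong[OF refl]) (simp add: ind[OF Y] sum_distrib_left if_distrib[of "\<lambda>x. _ * x"] cong: if_cong)
    also have "\<dots> = (\<Sum>w\<in>WB r. \<Sum>d\<in>J. if w \<in> Y d then fconst (g d) * tw r w else 0)" by (rule sum.swap)
    also have "\<dots> = (\<Sum>w\<in>WB r. fconst (\<Sum>d\<in>{d \<in> J. w \<in> Y d}. g d) * tw r w)"
    proof (rule sum.cong[OF refl])
      fix w
      show "(\<Sum>d\<in>J. if w \<in> Y d then fconst (g d) * tw r w else 0) = fconst (\<Sum>d\<in>{d \<in> J. w \<in> Y d}. g d) * tw r w"
        unfolding sum.inter_filter[OF finJ, symmetric] fconst_sum sum_distrib_right ..
    qed
    finally show ?thesis .
  qed
  have "cl r (tsum r ?X * tsum r R) = cl r (\<Sum>d\<in>R. tsum r ?X * tw r d)" unfolding tsum_def sum_distrib_left ..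
  also have "\<dots> = cl r (\<Sum>d\<in>R. fconst (qq ^ ell n r l d) * tsum r ((\<lambda>u. u \<circ> d) ` ?X))"
    by (rule cl_sum_cong, rule tsum_stab_tw[OF lL dm_l0]) (rule RW)
  also have "(\<Sum>d\<in>R. fconst (qq ^ ell n r l d) * tsum r ((\<lambda>u. u \<circ> d) ` ?X))
    = (\<Sum>w\<in>WB r. fconst (\<Sum>d\<in>{d \<in> R. w \<in> (\<lambda>u. u \<circ> d) ` ?X}. qq ^ ell n r l d) * tw r w)"
    by (rule collect[OF finR XW])
  also have "\<dots> = (\<Sum>w\<in>WB r. fconst (\<Sum>p\<in>{p \<in> ?P. w \<in> ?F p}. gcoef n A p) * tw r w)"
  proof (rule sum.cong[OF refl])
    fix w assume w: "w \<in> WB r"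
    have "{p \<in> ?P. w \<in> ?F p} = {p \<in> Pr. A (n+1) p > 0 \<and> w \<in> ?F p}" by blast
    then show "fconst (\<Sum>d\<in>{d \<in> R. w \<in> (\<lambda>u. u \<circ> d) ` ?X}. qq ^ ell n r l d) * tw r w
      = fconst (\<Sum>p\<in>{p \<in> ?P. w \<in> ?F p}. gcoef n A p) * tw r w"
      using coset_sum_coefficient[OF d0 Pr RS[unfolded S_def A_def] bij[unfolded S_def A_def] low w]
      unfolding A_def by (simp only:)
  qed
  also have "\<dots> = (\<Sum>p\<in>?P. fconst (gcoef n A p) * tsum r (?F p))"
    by (rule collect[symmetric, OF finP]) (auto simp: fibre_def)
  finally show ?thesis .
qed

end

section \<open>Homomorphisms between cyclic modules\<close>

lemma finite_Lam: "finite (Lam n r)"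
proof (rule finite_subset)
  show "Lam n r \<subseteq> {l. \<forall>i. (i \<in> {1..n+1} \<longrightarrow> l i \<in> {0..r}) \<and> (i \<notin> {1..n+1} \<longrightarrow> l i = 0)}"
  proof
    fix l assume l: "l \<in> Lam n r"
    have "l i \<le> r" if "i \<in> {1..n+1}" for i
      using member_le_sum[OF that, of l] l by (simp add: Lam_def)
    then show "l \<in> {l. \<forall>i. (i \<in> {1..n+1} \<longrightarrow> l i \<in> {0..r}) \<and> (i \<notin> {1..n+1} \<longrightarrow> l i = 0)}"
      using l by (auto simp: Lam_def)
  qed
  show "finite {l. \<forall>i. (i \<in> {1..n+1} \<longrightarrow> l i \<in> {0..r}) \<and> (i \<notin> {1..n+1} \<longrightarrow> l i = (0::nat))}"
    by (rule finite_set_of_finite_funs) auto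
qed

lemma finite_LamD: "finite (LamD n r)"
proof (rule finite_subset)
  show "LamD n r \<subseteq> Bullet ` Lam n r \<union> (\<lambda>(e, l). Signed e l) ` (UNIV \<times> Lam n r)" by (auto simp: LamD_def)
  have "(UNIV :: sign set) \<subseteq> {Pos, Neg}" using sign.exhaust by auto
  then have "finite (UNIV :: sign set)" by (rule finite_subset) simp
  then show "finite (Bullet ` Lam n r \<union> (\<lambda>(e, l). Signed e l) ` (UNIV \<times> Lam n r))" using finite_Lam by blast
qed

lemma decor_LamD: "l \<in> Lam n r \<Longrightarrow> decor n l e \<in> LamD n r"
  by (auto simp: decor_def LamD_def)

lemma LamD_decor: assumes "c \<in> LamD n r" obtains l e where "l \<in> Lam n r" "c = decor n l e"
proof -
  from assms consider l where "l \<in> Lam n r" "l (n+1) \<noteq> 0" "c = Bullet l"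
    | e l where "l \<in> Lam n r" "l (n+1) = 0" "c = Signed e l" unfolding LamD_def by blast
  then show ?thesis
  proof cases
    case (1 l) then show ?thesis using that[of l Pos] by (simp add: decor_def)
  next
    case (2 e l) then show ?thesis using that[of l e] by (simp add: decor_def)
  qed
qed

definition Mcomp :: "nat \<Rightarrow> nat \<Rightarrow> dsym \<Rightarrow> hecke_elt set" where
  "Mcomp n r a = xD n r a <#\<^bsub>hecke r\<^esub> heckeD r"

text \<open>Left multiplication by \<open>y\<close> from the summand of \<open>b\<close> to the summand of \<open>a\<close>, and zero on the other
  summands.\<close>

definition Fmap :: "nat \<Rightarrow> nat \<Rightarrow> dsym \<Rightarrow> hecke_elt \<Rightarrow> dsym \<Rightarrow> (dsym \<Rightarrow> hecke_elt) \<Rightarrow> dsym \<Rightarrow> hecke_elt" where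
  "Fmap n r a y b = (\<lambda>x\<in>Msum n r. Mincl n r a (y \<otimes>\<^bsub>hecke r\<^esub> x b))"

context hecke_rank
begin

context
  fixes n :: nat
begin

interpretation H: ring "hecke r" by (rule ring_hecke)

lemma xD_decor: "l \<in> Lam n r \<Longrightarrow> xD n r (decor n l e) = cl r (tsum r (PL n l e))"
  unfolding xD_def parabolicD_PL by (rule Tsum_tsum) (auto intro: PL_WB)

lemma xD_heckeD: "c \<in> LamD n r \<Longrightarrow> xD n r c \<in> heckeD r"
  by (erule LamD_decor) (auto simp: xD_decor intro!: heckeD_tsum PL_WB PL_psign)

lemma xD_carrier: "c \<in> LamD n r \<Longrightarrow> xD n r c \<in> carrier (hecke r)"
  by (rule heckeD_carrier[OF xD_heckeD])

lemma Mcomp_iff: "v \<in> Mcomp n r c \<longleftrightarrow> (\<exists>h\<in>heckeD r. v = xD n r c \<otimes>\<^bsub>hecke r\<^esub> h)"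
  by (auto simp: Mcomp_def l_coset_def)

lemma Mcomp_carrier: "c \<in> LamD n r \<Longrightarrow> v \<in> Mcomp n r c \<Longrightarrow> v \<in> carrier (hecke r)"
  using xD_carrier heckeD_carrier by (auto simp: Mcomp_iff)

lemma Mcomp_zero: "c \<in> LamD n r \<Longrightarrow> \<zero>\<^bsub>hecke r\<^esub> \<in> Mcomp n r c"
  unfolding Mcomp_iff using subringE(2)[OF subring_heckeD] xD_carrier
  by (intro bexI[of _ "\<zero>\<^bsub>hecke r\<^esub>"]) auto

lemma Mcomp_add: "c \<in> LamD n r \<Longrightarrow> u \<in> Mcomp n r c \<Longrightarrow> v \<in> Mcomp n r c \<Longrightarrow> u \<oplus>\<^bsub>hecke r\<^esub> v \<in> Mcomp n r c"
proof -
  assume c: "c \<in> LamD n r" and "u \<in> Mcomp n r c" "v \<in> Mcomp n r c"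
  then obtain h h' where h: "h \<in> heckeD r" "h' \<in> heckeD r" "u = xD n r c \<otimes>\<^bsub>hecke r\<^esub> h" "v = xD n r c \<otimes>\<^bsub>hecke r\<^esub> h'"
    unfolding Mcomp_iff by blast
  have "u \<oplus>\<^bsub>hecke r\<^esub> v = xD n r c \<otimes>\<^bsub>hecke r\<^esub> (h \<oplus>\<^bsub>hecke r\<^esub> h')"
    unfolding h using H.r_distr xD_carrier[OF c] heckeD_carrier h by simp
  then show ?thesis unfolding Mcomp_iff using subringE(7)[OF subring_heckeD h(1,2)] by blast
qed

lemma Mcomp_act: "c \<in> LamD n r \<Longrightarrow> u \<in> Mcomp n r c \<Longrightarrow> g \<in> heckeD r \<Longrightarrow> u \<otimes>\<^bsub>hecke r\<^esub> g \<in> Mcomp n r c"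
proof -
  assume c: "c \<in> LamD n r" and "u \<in> Mcomp n r c" and g: "g \<in> heckeD r"
  then obtain h where h: "h \<in> heckeD r" "u = xD n r c \<otimes>\<^bsub>hecke r\<^esub> h" unfolding Mcomp_iff by blast
  have "u \<otimes>\<^bsub>hecke r\<^esub> g = xD n r c \<otimes>\<^bsub>hecke r\<^esub> (h \<otimes>\<^bsub>hecke r\<^esub> g)"
    unfolding h using H.m_assoc xD_carrier[OF c] heckeD_carrier h g by simp
  then show ?thesis unfolding Mcomp_iff using subringE(6)[OF subring_heckeD h(1) g] by blast
qed

lemma Msum_iff: "x \<in> Msum n r \<longleftrightarrow> (\<forall>c\<in>LamD n r. x c \<in> Mcomp n r c) \<and> x \<in> extensional (LamD n r)"
  unfolding Msum_def Mcomp_def PiE_iff by blast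

lemma Msum_comp: "x \<in> Msum n r \<Longrightarrow> c \<in> LamD n r \<Longrightarrow> x c \<in> Mcomp n r c"
  unfolding Msum_iff by blast

lemma Msum_eqI: "x \<in> extensional (LamD n r) \<Longrightarrow> y \<in> extensional (LamD n r) \<Longrightarrow> (\<And>c. c \<in> LamD n r \<Longrightarrow> x c = y c) \<Longrightarrow> x = y"
  by (rule extensionalityI)

lemma Mops_ext: "Madd n r x y \<in> extensional (LamD n r)" "Mact n r x h \<in> extensional (LamD n r)"
  "Mincl n r b v \<in> extensional (LamD n r)" "Mzero n r \<in> extensional (LamD n r)"
  by (simp_all add: Madd_def Mact_def Mincl_def Mzero_def)

lemma Mops_app: "c \<in> LamD n r \<Longrightarrow> Madd n r x y c = x c \<oplus>\<^bsub>hecke r\<^esub> y c"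
  "c \<in> LamD n r \<Longrightarrow> Mact n r x h c = x c \<otimes>\<^bsub>hecke r\<^esub> h"
  "c \<in> LamD n r \<Longrightarrow> Mincl n r b v c = (if c = b then v else \<zero>\<^bsub>hecke r\<^esub>)"
  "c \<in> LamD n r \<Longrightarrow> Mzero n r c = \<zero>\<^bsub>hecke r\<^esub>"
  by (simp_all add: Madd_def Mact_def Mincl_def Mzero_def)

lemma Madd_Msum: "x \<in> Msum n r \<Longrightarrow> y \<in> Msum n r \<Longrightarrow> Madd n r x y \<in> Msum n r"
  unfolding Msum_iff by (simp add: Mops_ext Mops_app Mcomp_add)

lemma Mact_Msum: "x \<in> Msum n r \<Longrightarrow> h \<in> heckeD r \<Longrightarrow> Mact n r x h \<in> Msum n r"
  unfolding Msum_iff by (simp add: Mops_ext Mops_app Mcomp_act)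

lemma Mzero_Msum: "Mzero n r \<in> Msum n r"
  unfolding Msum_iff by (simp add: Mops_ext Mops_app Mcomp_zero)

lemma Mincl_Msum: "v \<in> Mcomp n r b \<Longrightarrow> Mincl n r b v \<in> Msum n r"
  unfolding Msum_iff by (simp add: Mops_ext Mops_app Mcomp_zero)

lemma Mincl_zero: "Mincl n r b \<zero>\<^bsub>hecke r\<^esub> = Mzero n r"
  by (rule Msum_eqI) (simp_all add: Mops_ext Mops_app)

lemma Madd_Mincl: "u \<in> carrier (hecke r) \<Longrightarrow> v \<in> carrier (hecke r) \<Longrightarrow>
    Madd n r (Mincl n r b u) (Mincl n r b v) = Mincl n r b (u \<oplus>\<^bsub>hecke r\<^esub> v)"
  by (rule Msum_eqI) (simp_all add: Mops_ext Mops_app)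

lemma Mact_Mincl: "u \<in> carrier (hecke r) \<Longrightarrow> h \<in> heckeD r \<Longrightarrow> Mact n r (Mincl n r b u) h = Mincl n r b (u \<otimes>\<^bsub>hecke r\<^esub> h)"
  by (rule Msum_eqI) (simp_all add: Mops_ext Mops_app heckeD_carrier)

lemma SD_carrier_iff: "f \<in> carrier (SD n r) \<longleftrightarrow> f \<in> Msum n r \<rightarrow> Msum n r \<and> f \<in> extensional (Msum n r) \<and>
    (\<forall>x\<in>Msum n r. \<forall>y\<in>Msum n r. f (Madd n r x y) = Madd n r (f x) (f y)) \<and>
    (\<forall>x\<in>Msum n r. \<forall>h\<in>heckeD r. f (Mact n r x h) = Mact n r (f x) h)"
  unfolding SD_def by (auto simp: PiE_def)

text \<open>A family is the sum of its finitely many components, so additive maps that agree on components agree.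
  Some index \<open>a\<close> must exist, since the empty sum is obtained as the zero of a component.\<close>

lemma SD_eqI:
  assumes ne: "a \<in> LamD n r" and f: "f \<in> carrier (SD n r)" and g: "g \<in> carrier (SD n r)"
    and eq: "\<And>c v. c \<in> LamD n r \<Longrightarrow> v \<in> Mcomp n r c \<Longrightarrow> f (Mincl n r c v) = g (Mincl n r c v)"
  shows "f = g"
proof (rule extensionalityI)
  show "f \<in> extensional (Msum n r)" "g \<in> extensional (Msum n r)" using f g unfolding SD_carrier_iff by blast+
  fix x assume x: "x \<in> Msum n r"
  \<comment> \<open>The part of the family \<open>x\<close> supported in \<open>F\<close>.\<close>
  define xF where "xF F = (\<lambda>c\<in>LamD n r. if c \<in> F then x c else \<zero>\<^bsub>hecke r\<^esub>)" for F
  have xF: "xF F \<in> Msum n r" for F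
    using x unfolding Msum_iff xF_def by (simp add: Mcomp_zero)
  have "F \<subseteq> LamD n r \<Longrightarrow> f (xF F) = g (xF F)" if "finite F" for F
    using that
  proof (induction F)
    case empty
    have "xF {} = Mincl n r a \<zero>\<^bsub>hecke r\<^esub>"
      unfolding Mincl_zero by (rule Msum_eqI) (simp_all add: Mops_ext Mops_app xF_def)
    then show ?case using eq[OF ne Mcomp_zero[OF ne]] by simp
  next
    case (insert c F)
    have c: "c \<in> LamD n r" using insert by simp
    have v: "x c \<in> Mcomp n r c" by (rule Msum_comp[OF x c])
    have car: "x c' \<in> carrier (hecke r)" if "c' \<in> LamD n r" for c' by (rule Mcomp_carrier[OF that Msum_comp[OF x that]])
    have "xF (insert c F) = Madd n r (xF F) (Mincl n r c (x c))"
      by (rule Msum_eqI) (use insert(2) car car[OF c] in \<open>auto simp: Mops_ext Mops_app xF_def\<close>)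
    moreover have "h (Madd n r (xF F) (Mincl n r c (x c))) = Madd n r (h (xF F)) (h (Mincl n r c (x c)))"
      if "h \<in> carrier (SD n r)" for h
      using that xF Mincl_Msum[OF v] unfolding SD_carrier_iff by blast
    ultimately show ?case using insert eq[OF c v] f g by simp
  qed
  from this[OF finite_LamD subset_refl] have "f (xF (LamD n r)) = g (xF (LamD n r))" .
  moreover have "xF (LamD n r) = x"
    by (rule Msum_eqI) (use x in \<open>simp_all add: xF_def Msum_iff\<close>)
  ultimately show "f x = g x" by simp
qed

text \<open>The condition under which \<open>Fmap\<close> is well defined: \<open>y\<close> maps the generator of the summand of \<open>b\<close> into
  the summand of \<open>a\<close>.\<close>

definition okmap :: "dsym \<Rightarrow> hecke_elt \<Rightarrow> dsym \<Rightarrow> bool" where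
  "okmap a y b \<longleftrightarrow> a \<in> LamD n r \<and> b \<in> LamD n r \<and> y \<in> carrier (hecke r) \<and> y \<otimes>\<^bsub>hecke r\<^esub> xD n r b \<in> Mcomp n r a"

lemma okmap_comp: "okmap a y b \<Longrightarrow> v \<in> Mcomp n r b \<Longrightarrow> y \<otimes>\<^bsub>hecke r\<^esub> v \<in> Mcomp n r a"
proof -
  assume ok: "okmap a y b" and "v \<in> Mcomp n r b"
  then obtain h where h: "h \<in> heckeD r" "v = xD n r b \<otimes>\<^bsub>hecke r\<^esub> h" unfolding Mcomp_iff by blast
  have "y \<otimes>\<^bsub>hecke r\<^esub> v = (y \<otimes>\<^bsub>hecke r\<^esub> xD n r b) \<otimes>\<^bsub>hecke r\<^esub> h"
    using ok h heckeD_carrier[OF h(1)] xD_carrier by (simp add: okmap_def H.m_assoc)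
  then show ?thesis using Mcomp_act[of a _ h] ok h(1) by (simp add: okmap_def)
qed

lemma Fmap_app: "x \<in> Msum n r \<Longrightarrow> Fmap n r a y b x = Mincl n r a (y \<otimes>\<^bsub>hecke r\<^esub> x b)"
  by (simp add: Fmap_def)

lemma Fmap_carrier: assumes ok: "okmap a y b" shows "Fmap n r a y b \<in> carrier (SD n r)"
proof -
  have ab: "a \<in> LamD n r" "b \<in> LamD n r" "y \<in> carrier (hecke r)" using ok by (simp_all add: okmap_def)
  have xb: "x b \<in> carrier (hecke r)" if "x \<in> Msum n r" for x by (rule Mcomp_carrier[OF ab(2) Msum_comp[OF that ab(2)]])
  show ?thesis unfolding SD_carrier_iff
  proof (intro conjI ballI)
    show "Fmap n r a y b \<in> Msum n r \<rightarrow> Msum n r"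
      using okmap_comp[OF ok Msum_comp[OF _ ab(2)]] by (auto simp: Fmap_app intro!: Mincl_Msum)
    show "Fmap n r a y b \<in> extensional (Msum n r)" by (simp add: Fmap_def)
    fix x assume x: "x \<in> Msum n r"
    show "Fmap n r a y b (Madd n r x x') = Madd n r (Fmap n r a y b x) (Fmap n r a y b x')" if x': "x' \<in> Msum n r" for x'
      using x x' ab xb[OF x] xb[OF x'] by (simp add: Fmap_app Madd_Msum Madd_Mincl Mops_app H.r_distr)
    show "Fmap n r a y b (Mact n r x h) = Mact n r (Fmap n r a y b x) h" if h: "h \<in> heckeD r" for h
      using x h ab xb[OF x] heckeD_carrier[OF h] by (simp add: Fmap_app Mact_Msum Mact_Mincl Mops_app H.m_assoc)
  qed
qed

text \<open>The map depends on \<open>y\<close> only through the image of the generator.\<close>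

lemma Fmap_cong:
  assumes "okmap a y b" "okmap a y' b" "y \<otimes>\<^bsub>hecke r\<^esub> xD n r b = y' \<otimes>\<^bsub>hecke r\<^esub> xD n r b"
  shows "Fmap n r a y b = Fmap n r a y' b"
proof -
  have "y \<otimes>\<^bsub>hecke r\<^esub> x b = y' \<otimes>\<^bsub>hecke r\<^esub> x b" if x: "x \<in> Msum n r" for x
  proof -
    have b: "b \<in> LamD n r" and y: "y \<in> carrier (hecke r)" "y' \<in> carrier (hecke r)" using assms by (simp_all add: okmap_def)
    obtain h where h: "h \<in> heckeD r" "x b = xD n r b \<otimes>\<^bsub>hecke r\<^esub> h" using Msum_comp[OF x b] unfolding Mcomp_iff by blast
    show ?thesis unfolding h(2) using y xD_carrier[OF b] heckeD_carrier[OF h(1)] assms(3)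
      by (simp flip: H.m_assoc)
  qed
  then show ?thesis unfolding Fmap_def by (auto intro: restrict_ext)
qed

text \<open>The conditions on \<open>\<phi>\<close> fix its values on all components, so they have exactly one solution.\<close>

lemma phi_Fmap:
  assumes ok: "okmap a y b" and t: "y \<otimes>\<^bsub>hecke r\<^esub> xD n r b = Tsum r (dcoset (parabolicD n r a) d (parabolicD n r b))"
  shows "phi n r a d b = Fmap n r a y b"
proof -
  let ?t = "Tsum r (dcoset (parabolicD n r a) d (parabolicD n r b))"
  have ab: "a \<in> LamD n r" "b \<in> LamD n r" "y \<in> carrier (hecke r)" using ok by (simp_all add: okmap_def)
  have val: "Fmap n r a y b (Mincl n r c (xD n r c \<otimes>\<^bsub>hecke r\<^esub> h))
      = (if b = c then Mincl n r a (?t \<otimes>\<^bsub>hecke r\<^esub> h) else Mzero n r)" if c: "c \<in> LamD n r" and h: "h \<in> heckeD r" for c h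
  proof -
    have "xD n r c \<otimes>\<^bsub>hecke r\<^esub> h \<in> Mcomp n r c" using h by (auto simp: Mcomp_iff)
    then have m: "Mincl n r c (xD n r c \<otimes>\<^bsub>hecke r\<^esub> h) \<in> Msum n r" by (rule Mincl_Msum)
    show ?thesis
    proof (cases "b = c")
      case True
      then show ?thesis using ab xD_carrier[OF c] heckeD_carrier[OF h] t
        by (simp add: Fmap_app[OF m] Mops_app flip: H.m_assoc)
    next
      case False
      then show ?thesis using ab by (simp add: Fmap_app[OF m] Mops_app Mincl_zero)
    qed
  qed
  show ?thesis unfolding phi_def
  proof (rule the_equality)
    show "Fmap n r a y b \<in> carrier (SD n r) \<and> (\<forall>c\<in>LamD n r. \<forall>h\<in>heckeD r.
        Fmap n r a y b (Mincl n r c (xD n r c \<otimes>\<^bsub>hecke r\<^esub> h)) =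
          (if b = c then Mincl n r a (?t \<otimes>\<^bsub>hecke r\<^esub> h) else Mzero n r))"
      using Fmap_carrier[OF ok] val by blast
    fix f assume f: "f \<in> carrier (SD n r) \<and> (\<forall>c\<in>LamD n r. \<forall>h\<in>heckeD r.
        f (Mincl n r c (xD n r c \<otimes>\<^bsub>hecke r\<^esub> h)) = (if b = c then Mincl n r a (?t \<otimes>\<^bsub>hecke r\<^esub> h) else Mzero n r))"
    show "f = Fmap n r a y b"
    proof (rule SD_eqI[OF ab(1)])
      show "f \<in> carrier (SD n r)" using f by blast
      show "Fmap n r a y b \<in> carrier (SD n r)" by (rule Fmap_carrier[OF ok])
      fix c v assume c: "c \<in> LamD n r" and "v \<in> Mcomp n r c"
      then obtain h where h: "h \<in> heckeD r" "v = xD n r c \<otimes>\<^bsub>hecke r\<^esub> h" unfolding Mcomp_iff by blast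
      have "f (Mincl n r c (xD n r c \<otimes>\<^bsub>hecke r\<^esub> h)) = (if b = c then Mincl n r a (?t \<otimes>\<^bsub>hecke r\<^esub> h) else Mzero n r)"
        using f c h(1) by blast
      then show "f (Mincl n r c v) = Fmap n r a y b (Mincl n r c v)" unfolding h(2) using val[OF c h(1)] by simp
    qed
  qed
qed

lemma Fmap_mult:
  assumes "okmap a y b" "okmap b y' c"
  shows "okmap a (y \<otimes>\<^bsub>hecke r\<^esub> y') c" "Fmap n r a y b \<otimes>\<^bsub>SD n r\<^esub> Fmap n r b y' c = Fmap n r a (y \<otimes>\<^bsub>hecke r\<^esub> y') c"
proof -
  have c: "a \<in> LamD n r" "b \<in> LamD n r" "c \<in> LamD n r" "y \<in> carrier (hecke r)" "y' \<in> carrier (hecke r)"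
    using assms by (simp_all add: okmap_def)
  have "y \<otimes>\<^bsub>hecke r\<^esub> (y' \<otimes>\<^bsub>hecke r\<^esub> xD n r c) \<in> Mcomp n r a"
    by (rule okmap_comp[OF assms(1)]) (use assms(2) in \<open>simp add: okmap_def\<close>)
  then show "okmap a (y \<otimes>\<^bsub>hecke r\<^esub> y') c" using c xD_carrier[OF c(3)] by (simp add: okmap_def H.m_assoc)
  have "Fmap n r a y b (Fmap n r b y' c x) = Mincl n r a ((y \<otimes>\<^bsub>hecke r\<^esub> y') \<otimes>\<^bsub>hecke r\<^esub> x c)" if x: "x \<in> Msum n r" for x
  proof -
    have "x c \<in> carrier (hecke r)" by (rule Mcomp_carrier[OF c(3) Msum_comp[OF x c(3)]])
    moreover have "Mincl n r b (y' \<otimes>\<^bsub>hecke r\<^esub> x c) \<in> Msum n r"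
      by (rule Mincl_Msum[OF okmap_comp[OF assms(2) Msum_comp[OF x c(3)]]])
    ultimately show ?thesis using c x by (simp add: Fmap_app Mops_app H.m_assoc)
  qed
  then show "Fmap n r a y b \<otimes>\<^bsub>SD n r\<^esub> Fmap n r b y' c = Fmap n r a (y \<otimes>\<^bsub>hecke r\<^esub> y') c"
    by (auto simp: SD_def compose_def Fmap_def[of n r a "y \<otimes>\<^bsub>hecke r\<^esub> y'"] intro: restrict_ext)
qed

lemma Fmap_zero:
  assumes "a \<in> LamD n r" "b \<in> LamD n r"
  shows "okmap a \<zero>\<^bsub>hecke r\<^esub> b" "\<zero>\<^bsub>SD n r\<^esub> = Fmap n r a \<zero>\<^bsub>hecke r\<^esub> b"
proof -
  show "okmap a \<zero>\<^bsub>hecke r\<^esub> b" using assms xD_carrier[OF assms(2)] Mcomp_zero[OF assms(1)] by (simp add: okmap_def)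
  have "\<zero>\<^bsub>hecke r\<^esub> \<otimes>\<^bsub>hecke r\<^esub> x b = \<zero>\<^bsub>hecke r\<^esub>" if x: "x \<in> Msum n r" for x
    using Mcomp_carrier[OF assms(2) Msum_comp[OF x assms(2)]] by simp
  then show "\<zero>\<^bsub>SD n r\<^esub> = Fmap n r a \<zero>\<^bsub>hecke r\<^esub> b"
    by (auto simp: SD_def Fmap_def Mincl_zero intro: restrict_ext)
qed

lemma Fmap_add:
  assumes "okmap a y b" "okmap a y' b"
  shows "okmap a (y \<oplus>\<^bsub>hecke r\<^esub> y') b" "Fmap n r a y b \<oplus>\<^bsub>SD n r\<^esub> Fmap n r a y' b = Fmap n r a (y \<oplus>\<^bsub>hecke r\<^esub> y') b"
proof -
  have c: "a \<in> LamD n r" "b \<in> LamD n r" "y \<in> carrier (hecke r)" "y' \<in> carrier (hecke r)"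
    using assms by (simp_all add: okmap_def)
  show "okmap a (y \<oplus>\<^bsub>hecke r\<^esub> y') b" using assms c xD_carrier[OF c(2)] by (simp add: okmap_def H.l_distr Mcomp_add)
  have "Madd n r (Fmap n r a y b x) (Fmap n r a y' b x) = Mincl n r a ((y \<oplus>\<^bsub>hecke r\<^esub> y') \<otimes>\<^bsub>hecke r\<^esub> x b)"
    if x: "x \<in> Msum n r" for x
    using x c Mcomp_carrier[OF c(2) Msum_comp[OF x c(2)]] by (simp add: Fmap_app Madd_Mincl H.l_distr)
  then show "Fmap n r a y b \<oplus>\<^bsub>SD n r\<^esub> Fmap n r a y' b = Fmap n r a (y \<oplus>\<^bsub>hecke r\<^esub> y') b"
    by (auto simp: SD_def Fmap_def[of n r a "y \<oplus>\<^bsub>hecke r\<^esub> y'"] intro: restrict_ext)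
qed

lemma Fmap_smult:
  assumes "okmap a y b"
  shows "okmap a (c \<odot>\<^bsub>hecke r\<^esub> y) b" "c \<odot>\<^bsub>SD n r\<^esub> Fmap n r a y b = Fmap n r a (c \<odot>\<^bsub>hecke r\<^esub> y) b"
proof -
  have c: "a \<in> LamD n r" "b \<in> LamD n r" "y \<in> carrier (hecke r)" using assms by (simp_all add: okmap_def)
  let ?q = "cl r (fconst c)"
  have q: "?q \<in> carrier (hecke r)" by (rule cl_carrier)
  have comm: "?q \<otimes>\<^bsub>hecke r\<^esub> z = z \<otimes>\<^bsub>hecke r\<^esub> ?q" if z: "z \<in> carrier (hecke r)" for z
  proof -
    obtain f where f: "z = cl r f" by (rule cl_surj[OF z])
    show ?thesis unfolding f cl_mult[symmetric] fconst_central ..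
  qed
  have yx: "y \<otimes>\<^bsub>hecke r\<^esub> xD n r b \<in> carrier (hecke r)" using c xD_carrier[OF c(2)] by simp
  have "(?q \<otimes>\<^bsub>hecke r\<^esub> y) \<otimes>\<^bsub>hecke r\<^esub> xD n r b = (y \<otimes>\<^bsub>hecke r\<^esub> xD n r b) \<otimes>\<^bsub>hecke r\<^esub> ?q"
    using H.m_assoc[OF q c(3) xD_carrier[OF c(2)]] comm[OF yx] by simp
  then show "okmap a (c \<odot>\<^bsub>hecke r\<^esub> y) b"
    using assms c q Mcomp_act[OF c(1) _ heckeD_const[of c]] by (simp add: okmap_def smult_cl)
  have "(\<lambda>a'\<in>LamD n r. c \<odot>\<^bsub>hecke r\<^esub> Fmap n r a y b x a') = Mincl n r a ((c \<odot>\<^bsub>hecke r\<^esub> y) \<otimes>\<^bsub>hecke r\<^esub> x b)"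
    if x: "x \<in> Msum n r" for x
    by (rule Msum_eqI) (use x c q Mcomp_carrier[OF c(2) Msum_comp[OF x c(2)]] in
      \<open>simp_all add: Mops_ext Mops_app Fmap_app smult_cl H.m_assoc\<close>)
  then show "c \<odot>\<^bsub>SD n r\<^esub> Fmap n r a y b = Fmap n r a (c \<odot>\<^bsub>hecke r\<^esub> y) b"
    by (auto simp: SD_def Fmap_def[of n r a "c \<odot>\<^bsub>hecke r\<^esub> y"] intro: restrict_ext)
qed

lemma SD_abelian_monoid: "abelian_monoid (SD n r)"
proof -
  have sel: "x \<oplus>\<^bsub>SD n r\<^esub> y = (\<lambda>z\<in>Msum n r. Madd n r (x z) (y z))" "\<zero>\<^bsub>SD n r\<^esub> = (\<lambda>z\<in>Msum n r. Mzero n r)" for x y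
    by (simp_all add: SD_def)
  have car: "f x \<in> Msum n r" if "f \<in> carrier (SD n r)" "x \<in> Msum n r" for f x
    using that unfolding SD_carrier_iff by blast
  have cc: "x c \<in> carrier (hecke r)" if "x \<in> Msum n r" "c \<in> LamD n r" for x c
    by (rule Mcomp_carrier[OF that(2) Msum_comp[OF that]])
  have assoc: "Madd n r (Madd n r x y) z = Madd n r x (Madd n r y z)" if "x \<in> Msum n r" "y \<in> Msum n r" "z \<in> Msum n r" for x y z
    by (rule Msum_eqI) (use that cc in \<open>simp_all add: Mops_ext Mops_app H.a_assoc\<close>)
  have comm: "Madd n r x y = Madd n r y x" if "x \<in> Msum n r" "y \<in> Msum n r" for x y
    by (rule Msum_eqI) (use that cc in \<open>simp_all add: Mops_ext Mops_app H.a_comm\<close>)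
  have zero: "Madd n r (Mzero n r) x = x" if "x \<in> Msum n r" for x
    by (rule Msum_eqI) (use that cc in \<open>simp_all add: Mops_ext Mops_app Msum_iff\<close>)
  have mid: "Madd n r (Madd n r x y) (Madd n r x' y') = Madd n r (Madd n r x x') (Madd n r y y')"
    if "x \<in> Msum n r" "y \<in> Msum n r" "x' \<in> Msum n r" "y' \<in> Msum n r" for x y x' y'
    by (rule Msum_eqI) (use that cc in \<open>simp_all add: Mops_ext Mops_app H.add.m_ac\<close>)
  have act: "Madd n r (Mact n r x h) (Mact n r y h) = Mact n r (Madd n r x y) h"
    if "x \<in> Msum n r" "y \<in> Msum n r" "h \<in> heckeD r" for x y h
    by (rule Msum_eqI) (use that cc heckeD_carrier[OF that(3)] in \<open>simp_all add: Mops_ext Mops_app H.l_distr\<close>)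
  have zact: "Mact n r (Mzero n r) h = Mzero n r" if "h \<in> heckeD r" for h
    by (rule Msum_eqI) (use heckeD_carrier[OF that] in \<open>simp_all add: Mops_ext Mops_app\<close>)
  show ?thesis
  proof (rule abelian_monoidI)
    fix f g assume f: "f \<in> carrier (SD n r)" and g: "g \<in> carrier (SD n r)"
    have fx: "f (Madd n r x y) = Madd n r (f x) (f y)" "g (Madd n r x y) = Madd n r (g x) (g y)"
      if "x \<in> Msum n r" "y \<in> Msum n r" for x y using f g that unfolding SD_carrier_iff by blast+
    have fh: "f (Mact n r x h) = Mact n r (f x) h" "g (Mact n r x h) = Mact n r (g x) h"
      if "x \<in> Msum n r" "h \<in> heckeD r" for x h using f g that unfolding SD_carrier_iff by blast+
    show "f \<oplus>\<^bsub>SD n r\<^esub> g \<in> carrier (SD n r)"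
      unfolding SD_carrier_iff sel
      using car[OF f] car[OF g] by (auto simp: Madd_Msum Mact_Msum fx fh mid act)
    show "f \<oplus>\<^bsub>SD n r\<^esub> g = g \<oplus>\<^bsub>SD n r\<^esub> f"
      unfolding sel using car[OF f] car[OF g] by (auto intro!: restrict_ext comm)
    show "\<zero>\<^bsub>SD n r\<^esub> \<oplus>\<^bsub>SD n r\<^esub> f = f"
    proof (rule extensionalityI)
      show "\<zero>\<^bsub>SD n r\<^esub> \<oplus>\<^bsub>SD n r\<^esub> f \<in> extensional (Msum n r)" by (simp add: sel)
      show "f \<in> extensional (Msum n r)" using f unfolding SD_carrier_iff by blast
    qed (use car[OF f] in \<open>simp add: sel zero\<close>)
    fix h assume h: "h \<in> carrier (SD n r)"
    show "f \<oplus>\<^bsub>SD n r\<^esub> g \<oplus>\<^bsub>SD n r\<^esub> h = f \<oplus>\<^bsub>SD n r\<^esub> (g \<oplus>\<^bsub>SD n r\<^esub> h)"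
      unfolding sel using car[OF f] car[OF g] car[OF h] by (auto intro!: restrict_ext assoc)
  next
    show "\<zero>\<^bsub>SD n r\<^esub> \<in> carrier (SD n r)"
      unfolding SD_carrier_iff sel using zero[OF Mzero_Msum]
      by (auto simp: Madd_Msum Mact_Msum Mzero_Msum zact)
  qed
qed

lemma Fmap_finsum:
  assumes "finite I" "a \<in> LamD n r" "b \<in> LamD n r" "\<And>i. i \<in> I \<Longrightarrow> okmap a (cl r (f i)) b \<and> g i = Fmap n r a (cl r (f i)) b"
  shows "okmap a (cl r (sum f I)) b \<and> (\<Oplus>\<^bsub>SD n r\<^esub>i\<in>I. g i) = Fmap n r a (cl r (sum f I)) b"
  using assms(1,4)
proof (induction I)
  case empty
  interpret S: abelian_monoid "SD n r" by (rule SD_abelian_monoid)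
  show ?case using Fmap_zero[OF assms(2,3)] by (simp add: cl_zero)
next
  case (insert i I)
  interpret S: abelian_monoid "SD n r" by (rule SD_abelian_monoid)
  have IH: "okmap a (cl r (sum f I)) b" "(\<Oplus>\<^bsub>SD n r\<^esub>i\<in>I. g i) = Fmap n r a (cl r (sum f I)) b"
    using insert by auto
  have gi: "okmap a (cl r (f i)) b" "g i = Fmap n r a (cl r (f i)) b" using insert by auto
  have "g j \<in> carrier (SD n r)" if "j \<in> insert i I" for j using Fmap_carrier insert(4)[OF that] by simp
  then have "(\<Oplus>\<^bsub>SD n r\<^esub>i\<in>insert i I. g i) = g i \<oplus>\<^bsub>SD n r\<^esub> (\<Oplus>\<^bsub>SD n r\<^esub>i\<in>I. g i)"
    using insert by (intro S.finsum_insert) auto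
  then show ?case using IH gi Fmap_add[OF gi(1) IH(1)] insert by (simp add: cl_add)
qed

lemma dcoset_min_rep:
  assumes P: "id \<in> P" "\<And>x y. x \<in> P \<Longrightarrow> y \<in> P \<Longrightarrow> x \<circ> y \<in> P" "\<And>x. x \<in> P \<Longrightarrow> pinv x \<in> P" "P \<subseteq> WB r"
    and Q: "id \<in> Q" "\<And>x y. x \<in> Q \<Longrightarrow> y \<in> Q \<Longrightarrow> x \<circ> y \<in> Q" "\<And>x. x \<in> Q \<Longrightarrow> pinv x \<in> Q" "Q \<subseteq> WB r"
  shows "dcoset P (min_repD r (dcoset P w Q)) Q = dcoset P w Q"
proof -
  have "w \<in> dcoset P w Q" unfolding dcoset_def using P(1) Q(1) by (auto intro!: exI[of _ id])
  then have "min_repD r (dcoset P w Q) \<in> dcoset P w Q"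
    unfolding min_repD_def arg_min_on_def
    using arg_min_nat_lemma[of "\<lambda>x. x \<in> dcoset P w Q" w "word_length (gensD r)"] by blast
  then obtain u v where uv: "u \<in> P" "v \<in> Q" "min_repD r (dcoset P w Q) = u \<circ> w \<circ> v" unfolding dcoset_def by blast
  have "dcoset P (u \<circ> w \<circ> v) Q = dcoset P w Q"
  proof (rule subset_antisym; rule subsetI)
    fix x assume "x \<in> dcoset P (u \<circ> w \<circ> v) Q"
    then obtain u' v' where "u' \<in> P" "v' \<in> Q" "x = u' \<circ> (u \<circ> w \<circ> v) \<circ> v'" unfolding dcoset_def by blast
    then have "x = (u' \<circ> u) \<circ> w \<circ> (v \<circ> v')" "u' \<circ> u \<in> P" "v \<circ> v' \<in> Q" using P(2) Q(2) uv by (auto simp: comp_assoc)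
    then show "x \<in> dcoset P w Q" unfolding dcoset_def by blast
  next
    fix x assume "x \<in> dcoset P w Q"
    then obtain u' v' where x: "u' \<in> P" "v' \<in> Q" "x = u' \<circ> w \<circ> v'" unfolding dcoset_def by blast
    have c: "pinv u \<circ> u = id" "v \<circ> pinv v = id" using WB_inv_comp[of u r] WB_inv_comp[of v r] uv P(4) Q(4) by auto
    have "(u' \<circ> pinv u) \<circ> (u \<circ> w \<circ> v) \<circ> (pinv v \<circ> v') = u' \<circ> (pinv u \<circ> u) \<circ> w \<circ> (v \<circ> pinv v) \<circ> v'"
      by (simp only: comp_assoc)
    then have "x = (u' \<circ> pinv u) \<circ> (u \<circ> w \<circ> v) \<circ> (pinv v \<circ> v')" using x(3) c by simp
    moreover have "u' \<circ> pinv u \<in> P" "pinv v \<circ> v' \<in> Q" using P(2,3) Q(2,3) uv x by auto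
    ultimately show "x \<in> dcoset P (u \<circ> w \<circ> v) Q" unfolding dcoset_def by blast
  qed
  then show ?thesis using uv(3) by simp
qed

text \<open>The sum over the double coset \<open>D\<close> factors on both sides. The factorization \<open>T(D) = T(R) x\<^sub>b\<close> shows that
  \<open>\<phi>\<close> is left multiplication by \<open>T(R)\<close>, and \<open>T(D) = x\<^sub>a T(R')\<close> shows that its values lie in the
  summand of \<open>a\<close>.\<close>

lemma phi_dcoset:
  fixes e e' w
  assumes l: "l \<in> Lam n r" and k: "k \<in> Lam n r" and w: "w \<in> WB r" "psign r w = Pos"
  defines "a \<equiv> decor n l e" and "b \<equiv> decor n k e'"
  defines "D \<equiv> dcoset (PL n l e) w (PL n k e')"
  obtains f where "okmap a (cl r f) b" "cl r (f * tsum r (PL n k e')) = cl r (tsum r D)"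
    "phi n r a (min_repD r (dcoset (parabolicD n r a) w (parabolicD n r b))) b = Fmap n r a (cl r f) b"
proof -
  let ?P = "PL n l e" and ?Q = "PL n k e'"
  have P: "id \<in> ?P" "\<And>x y. x \<in> ?P \<Longrightarrow> y \<in> ?P \<Longrightarrow> x \<circ> y \<in> ?P" "\<And>x. x \<in> ?P \<Longrightarrow> pinv x \<in> ?P" "?P \<subseteq> WB r"
    using PL_id PL_comp PL_inv PL_WB by blast+
  have Q: "id \<in> ?Q" "\<And>x y. x \<in> ?Q \<Longrightarrow> y \<in> ?Q \<Longrightarrow> x \<circ> y \<in> ?Q" "\<And>x. x \<in> ?Q \<Longrightarrow> pinv x \<in> ?Q" "?Q \<subseteq> WB r"
    using PL_id PL_comp PL_inv PL_WB by blast+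
  have ab: "a \<in> LamD n r" "b \<in> LamD n r" unfolding a_def b_def by (rule decor_LamD[OF l], rule decor_LamD[OF k])
  have D: "x \<in> WB r \<and> psign r x = Pos" if xD: "x \<in> D" for x
  proof -
    obtain u v where uv: "u \<in> ?P" "v \<in> ?Q" "x = u \<circ> w \<circ> v" using xD unfolding D_def dcoset_def by blast
    have W: "u \<in> WB r" "v \<in> WB r" "u \<circ> w \<in> WB r" using uv P(4) Q(4) w(1) WB_comp by blast+
    show ?thesis unfolding uv(3)
      using WB_comp[OF W(3,2)] psign_comp[OF W(3,2)] psign_comp[OF W(1) w(1)] PL_psign[OF uv(1)] PL_psign[OF uv(2)] w(2) by simp
  qed
  have DW: "D \<subseteq> WB r" using D by blast
  have Dr: "d \<circ> c \<in> D" if dD: "d \<in> D" and c: "c \<in> ?Q" for d c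
  proof -
    obtain u v where uv: "u \<in> ?P" "v \<in> ?Q" "d = u \<circ> w \<circ> v" using dD unfolding D_def dcoset_def by blast
    then have "d \<circ> c = u \<circ> w \<circ> (v \<circ> c)" by (simp add: comp_assoc)
    then show ?thesis unfolding D_def dcoset_def using uv(1) Q(2)[OF uv(2) c] by blast
  qed
  have Dl: "c \<circ> d \<in> D" if dD: "d \<in> D" and c: "c \<in> ?P" for d c
  proof -
    obtain u v where uv: "u \<in> ?P" "v \<in> ?Q" "d = u \<circ> w \<circ> v" using dD unfolding D_def dcoset_def by blast
    then have "c \<circ> d = (c \<circ> u) \<circ> w \<circ> v" by (simp add: comp_assoc)
    then show ?thesis unfolding D_def dcoset_def using uv(2) P(2)[OF c uv(1)] by blast
  qed
  obtain R where R: "R \<subseteq> D" "\<forall>d\<in>R. \<forall>x\<in>?Q. cl r (tw r (d \<circ> x)) = cl r (tw r d * tw r x)"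
    "bij_betw (\<lambda>(d, c). d \<circ> c) (R \<times> ?Q) D"
    using right_reps[OF Q DW Dr, of "\<lambda>d. \<forall>x\<in>?Q. cl r (tw r (d \<circ> x)) = cl r (tw r d * tw r x)"]
      PL_right_rep[OF k] DW by blast
  obtain R' where R': "R' \<subseteq> D" "\<forall>d\<in>R'. \<forall>x\<in>?P. cl r (tw r (x \<circ> d)) = cl r (tw r x * tw r d)"
    "bij_betw (\<lambda>(d, c). c \<circ> d) (R' \<times> ?P) D"
    using left_reps[OF P DW Dl, of "\<lambda>d. \<forall>x\<in>?P. cl r (tw r (x \<circ> d)) = cl r (tw r x * tw r d)"]
      PL_left_rep[OF l] DW by blast
  have right: "cl r (tsum r D) = cl r (tsum r R * tsum r ?Q)" by (rule tsum_right_factor[OF R(3)]) (use R(2) in blast)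
  have left: "cl r (tsum r D) = cl r (tsum r ?P * tsum r R')" by (rule tsum_left_factor[OF R'(3)]) (use R'(2) in blast)
  have xa: "xD n r a = cl r (tsum r ?P)" and xb: "xD n r b = cl r (tsum r ?Q)"
    unfolding a_def b_def by (rule xD_decor[OF l], rule xD_decor[OF k])
  have yb: "cl r (tsum r R) \<otimes>\<^bsub>hecke r\<^esub> xD n r b = cl r (tsum r D)" unfolding xb right cl_mult ..
  have "cl r (tsum r R') \<in> heckeD r" by (rule heckeD_tsum) (use D R'(1) in blast)
  moreover have "cl r (tsum r D) = xD n r a \<otimes>\<^bsub>hecke r\<^esub> cl r (tsum r R')" unfolding xa left cl_mult ..
  ultimately have "cl r (tsum r D) \<in> Mcomp n r a" unfolding Mcomp_iff by blast
  then have ok: "okmap a (cl r (tsum r R)) b" using ab cl_carrier yb by (simp add: okmap_def)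
  have par: "parabolicD n r a = ?P" "parabolicD n r b = ?Q" unfolding a_def b_def
    by (rule parabolicD_PL[OF l], rule parabolicD_PL[OF k])
  have "dcoset ?P (min_repD r (dcoset ?P w ?Q)) ?Q = D" unfolding D_def by (rule dcoset_min_rep[OF P Q])
  then have t: "cl r (tsum r R) \<otimes>\<^bsub>hecke r\<^esub> xD n r b
      = Tsum r (dcoset (parabolicD n r a) (min_repD r (dcoset (parabolicD n r a) w (parabolicD n r b))) (parabolicD n r b))"
    unfolding par yb using Tsum_tsum[OF DW] by simp
  show ?thesis
    by (rule that[of "tsum r R", OF ok right[symmetric] phi_Fmap[OF ok t]])
qed

end

end

section \<open>The multiplication formulas\<close>

lemma mat_id:
  assumes m: "m \<in> Lam n r" and ij: "i \<in> {1..2*n+1}" "j \<in> {1..2*n+1}"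
  shows "mat n r m id m i j = (if i = j then hat n m i else 0)"
proof (cases "i = j")
  case True
  then have "{x \<in> {1..2*r}. bk n m (id x) = i \<and> bk n m x = j} = {x \<in> {1..2*r}. bk n m x = i}" by auto
  then show ?thesis using True ij card_bk[OF m ij(1)] unfolding mat_def by simp
next
  case False
  then have "{x \<in> {1..2*r}. bk n m (id x) = i \<and> bk n m x = j} = {}" by auto
  then show ?thesis using False unfolding mat_def by (simp only: card.empty if_False if_cancel)
qed

text \<open>The middle column of \<open>B\<close> contains just the two ones of \<open>E\<^sup>\<theta>(n, n+1)\<close>, so the middle part of \<open>m\<close> is \<open>1\<close>. All
  other columns are diagonal, so \<open>B\<close> is the matrix of the identity between \<open>l\<close> and \<open>m\<close>.\<close>

lemma near_diagonal:
  assumes n: "n \<ge> 1" and B: "B \<in> Xi_oob n r"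
    and diag: "\<forall>i\<in>{1..2*n+1}. \<forall>j\<in>{1..2*n+1}. i \<noteq> j \<longrightarrow> int (B i j) - int (Eth n n (n+1) i j) = 0"
  defines "m \<equiv> col_comp n r B" and "l \<equiv> row_comp n r B"
  shows "m \<in> Lam n r" "m (n+1) = 1" "l = drop_mid n m" "mat n r l id m = B"
proof -
  have BX: "B \<in> Xi n r" and B0: "B (n+1) (n+1) = 0" "l (n+1) = 0" using B by (auto simp: Xi_oob_def l_def)
  note t = triple_of_Xi[OF BX]
  show mL: "m \<in> Lam n r" unfolding m_def by (rule t)
  have lL: "l \<in> Lam n r" unfolding l_def by (rule t)
  have ro: "ro n B = hat n l" and co: "co n B = hat n m" unfolding l_def m_def by (rule t)+
  have off: "B i j = Eth n n (n+1) i j" if "i \<in> {1..2*n+1}" "j \<in> {1..2*n+1}" "i \<noteq> j" for i j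
    using diag that by auto
  have col: "hat n m j = B j j" if j: "j \<in> {1..2*n+1}" "j \<noteq> n + 1" for j
  proof -
    have "hat n m j = B j j + (\<Sum>i\<in>{1..2*n+1} - {j}. B i j)"
      unfolding co[symmetric] co_def by (rule sum.remove) (use j in auto)
    moreover have "(\<Sum>i\<in>{1..2*n+1} - {j}. B i j) = 0"
      by (rule sum.neutral) (use j off in \<open>auto simp: Eth_def\<close>)
    ultimately show ?thesis by simp
  qed
  have hm: "hat n m (n+1) = 2"
  proof -
    have "hat n m (n+1) = B (n+1) (n+1) + (\<Sum>i\<in>{1..2*n+1} - {n+1}. B i (n+1))"
      unfolding co[symmetric] co_def by (rule sum.remove) auto
    also have "(\<Sum>i\<in>{1..2*n+1} - {n+1}. B i (n+1)) = (\<Sum>i\<in>{1..2*n+1} - {n+1}. Eth n n (n+1) i (n+1))"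
      by (rule sum.cong[OF refl]) (rule off, auto)
    also have "\<dots> = (\<Sum>i\<in>{n, n+2}. 1)"
    proof (rule sum.mono_neutral_cong_right)
      show "{n, n+2} \<subseteq> {1..2*n+1} - {n+1}" using n by auto
    qed (auto simp: Eth_def)
    finally show ?thesis using B0 by simp
  qed
  then show m1: "m (n+1) = 1" by (simp add: hat_def)
  have row: "hat n l i = B i i + (if i = n then 1 else 0)" if i: "i \<in> {1..n}" for i
  proof -
    have "hat n l i = B i i + (\<Sum>j\<in>{1..2*n+1} - {i}. B i j)"
      unfolding ro[symmetric] ro_def by (rule sum.remove) (use i in auto)
    also have "(\<Sum>j\<in>{1..2*n+1} - {i}. B i j) = (\<Sum>j\<in>{1..2*n+1} - {i}. if j = n + 1 then (if i = n then 1 else 0) else 0)"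
      by (rule sum.cong[OF refl]) (use off i in \<open>auto simp: Eth_def\<close>)
    also have "\<dots> = (if i = n then 1 else 0)" using i by (subst sum.delta) auto
    finally show ?thesis .
  qed
  show lm: "l = drop_mid n m"
  proof
    fix i
    consider "i \<in> {1..n}" | "i = n + 1" | "i \<notin> {1..n+1}" by force
    then show "l i = drop_mid n m i"
    proof cases
      case 1
      then have "hat n l i = l i" "hat n m i = m i" "hat n m i = B i i" using col[of i] by (auto simp: hat_def)
      then show ?thesis using row[OF 1] 1 by (cases "i = n") (auto simp: drop_mid_def)
    next
      case 2 then show ?thesis using B0 by (simp add: drop_mid_def)
    next
      case 3 then show ?thesis using lL mL n by (auto simp: drop_mid_def Lam_def)
    qed
  qed
  interpret middle_one n r m l by unfold_locales (rule n mL m1 lm)+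
  have p: "n + 1 = bk n m (pinv id r)" using dm_bk_m(1) by simp
  show "mat n r l id m = B"
  proof (intro ext)
    fix i j
    show "mat n r l id m i j = B i j"
    proof (cases "i \<in> {1..2*n+1} \<and> j \<in> {1..2*n+1}")
      case True
      have e: "mat n r l id m i j + Eth n (n+1) (n+1) i j = (if i = j then hat n m i else 0) + Eth n n (n+1) i j"
        using mat_drop_mid[OF mL WB_id p, of i j] mat_id[OF mL] True by simp
      show ?thesis
      proof (cases "i = j")
        case eq: True
        show ?thesis
        proof (cases "i = n + 1")
          case True then show ?thesis using e eq hm B0 by (simp add: Eth_def)
        next
          case False then show ?thesis using e eq col[of i] \<open>i \<in> {1..2*n+1} \<and> j \<in> {1..2*n+1}\<close> by (auto simp: Eth_def)
        qed
      next
        case False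
        then have "Eth n (n+1) (n+1) i j = 0" by (auto simp: Eth_def)
        then show ?thesis using e off[of i j] True False by simp
      qed
    next
      case False
      then show ?thesis using Xi_out[OF BX, of i j] by (auto simp: mat_def)
    qed
  qed
qed

context hecke_rank
begin

text \<open>The shift of \<open>d\<close> by the powers of \<open>s\<^sub>r\<close> is even exactly because the label signs multiply to the sign of
  the matrix; so the double coset consists of even elements.\<close>

lemma phi_eps_dcoset:
  assumes A: "A \<in> Xi n r" and sg: "e * e' = msgn n A"
  defines "l \<equiv> row_comp n r A" and "k \<equiv> col_comp n r A"
  obtains f where "okmap n (decor n l e) (cl r f) (decor n k e')"
    "cl r (f * tsum r (PL n k e')) = cl r (tsum r {spow r e \<circ> w \<circ> spow r e' | w. w \<in> dcoset (PD n r l) (d_of n r A) (PD n r k)})"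
    "phi_eps n r e A e' = Fmap n r (decor n l e) (cl r f) (decor n k e')"
proof -
  note t = triple_of_Xi[OF A]
  let ?d = "d_of n r A" let ?w = "spow r e \<circ> ?d \<circ> spow r e'"
  have lL: "l \<in> Lam n r" and kL: "k \<in> Lam n r" unfolding l_def k_def by (rule t)+
  have s: "spow r f \<in> WB r" "psign r (spow r f) = f" for f using spow_WB psign_spow r2 by auto
  have w: "?w \<in> WB r" by (intro WB_comp s t)
  have "psign r ?d = msgn n A"
    using psign_msgn[OF t(1,2,5,7,8)] t(6) by simp
  then have "psign r ?w = e * (e * e') * e'"
    using psign_comp[OF WB_comp[OF s(1) t(5)] s(1), of e e'] psign_comp[OF s(1) t(5), of e] s(2) sg by simp
  then have pw: "psign r ?w = Pos" by (cases e; cases e') auto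
  obtain f where f: "okmap n (decor n l e) (cl r f) (decor n k e')"
    "cl r (f * tsum r (PL n k e')) = cl r (tsum r (dcoset (PL n l e) ?w (PL n k e')))"
    "phi n r (decor n l e) (min_repD r (dcoset (parabolicD n r (decor n l e)) ?w (parabolicD n r (decor n k e')))) (decor n k e')
      = Fmap n r (decor n l e) (cl r f) (decor n k e')"
    by (rule phi_dcoset[OF lL kL w pw])
  have "dcoset (PL n l e) ?w (PL n k e') = {spow r e \<circ> w \<circ> spow r e' | w. w \<in> dcoset (PD n r l) ?d (PD n r k)}"
    unfolding PL_def by (rule dcoset_conj)
  moreover have "phi_eps n r e A e' = phi n r (decor n l e)
      (min_repD r (dcoset (parabolicD n r (decor n l e)) ?w (parabolicD n r (decor n k e')))) (decor n k e')"
    unfolding phi_eps_def Let_def l_def k_def ..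
  ultimately show ?thesis using that[OF f(1)] f(2,3) by simp
qed

end

context box_product
begin

text \<open>Even elements of the stabilizer of \<open>m\<close> fix \<open>r\<close>, so they do not change the preimage of \<open>r\<close>.\<close>

lemma mid_fibre_stable:
  assumes w: "w \<in> mid_fibre k A \<sigma> Pr" and c: "c \<in> PD n r m"
  shows "c \<circ> w \<in> mid_fibre k A \<sigma> Pr"
proof -
  have w': "w \<in> WB r" "mat n r m w k = A" "psign r w = \<sigma>" "bk n k (pinv w r) \<in> Pr"
    using w unfolding mid_fibre_def by auto
  have cW: "c \<in> WB r" "c \<in> stab n r m" "psign r c = Pos" using c by (auto simp: PD_def stab_def)
  have "c r = r" using PD_m_fix[OF cW(2)] cW(3) by simp
  then have "pinv c r = r" using WB_inv_apply(1)[OF cW(1), of r] by simp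
  then have "pinv (c \<circ> w) r = pinv w r" using WB_inv_compose[OF cW(1) w'(1)] by simp
  then show ?thesis unfolding mid_fibre_def
    using w' WB_comp[OF cW(1) w'(1)] psign_comp[OF cW(1) w'(1)] cW(3) mat_stab[OF m k w'(1) cW(2) stab_id] by simp
qed

context
  fixes B :: "nat \<Rightarrow> nat \<Rightarrow> nat"
  assumes B: "mat n r l id m = B"
begin

text \<open>The double coset of \<open>B\<close> is the stabilizer of \<open>l\<close>, because it contains the even stabilizer of \<open>m\<close>.\<close>

lemma phi_B:
  obtains f where "okmap n (decor n l e) (cl r f) (decor n m e)"
    "cl r (f * tsum r (PD n r m)) = cl r (tw r (spow r e) * tsum r (stab n r l) * tw r (spow r e))"
    "phi_eps n r e B e = Fmap n r (decor n l e) (cl r f) (decor n m e)"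
proof -
  have lL: "l \<in> Lam n r" by (rule dm_l)
  have l0: "l (n+1) = 0" by (rule dm_l0)
  have BX: "B \<in> Xi n r" using mat_Xi[OF lL m WB_id] B by simp
  note t = triple_of_Xi[OF BX]
  have rc: "row_comp n r B = l" "col_comp n r B = m"
    using row_comp_eq[OF lL] col_comp_eq[OF m] ro_mat[OF lL m WB_id] co_mat[OF lL m WB_id] B by auto
  have inc: "incr n r q id" for q by (simp add: incr_def)
  have sB: "msgn n B = Pos"
    using psign_msgn[OF lL m WB_id inc] inc[of l] psign_id[of r] B by (simp add: id_def[symmetric])
  obtain f where f: "okmap n (decor n l e) (cl r f) (decor n m e)"
    "cl r (f * tsum r (PL n m e)) = cl r (tsum r {spow r e \<circ> w \<circ> spow r e | w. w \<in> dcoset (PD n r l) (d_of n r B) (PD n r m)})"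
    "phi_eps n r e B e = Fmap n r (decor n l e) (cl r f) (decor n m e)"
    using phi_eps_dcoset[OF BX, of e e] sB rc by auto
  have d: "d_of n r B \<in> WB r" "mat n r l (d_of n r B) m = B" using t(5,6) rc by auto
  have "psign r (d_of n r B) = Pos" using psign_msgn[OF t(1,2,5,7,8)] t(6) sB by simp
  then have "dcoset (PD n r l) (d_of n r B) (PD n r m) = dcoset (PD n r l) id (PD n r m)"
    using dcoset_fibre[OF lL m d(1)] dcoset_fibre[OF lL m WB_id] l0 d(2) B psign_id[of r] by simp
  also have "\<dots> = stab n r l"
  proof (rule subset_antisym; rule subsetI)
    fix x assume "x \<in> dcoset (PD n r l) id (PD n r m)"
    then obtain u v where uv: "u \<in> PD n r l" "v \<in> PD n r m" "x = u \<circ> v" unfolding dcoset_def by auto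
    then have "v \<in> stab n r l" using PD_m_iff by blast
    then show "x \<in> stab n r l" unfolding uv(3) by (rule stab_comp[OF PD_stab[OF uv(1)]])
  next
    fix x assume "x \<in> stab n r l"
    then have "x \<in> PD n r l" using PD_no_mid[OF lL l0] by simp
    moreover have "x = x \<circ> id \<circ> id" by simp
    ultimately show "x \<in> dcoset (PD n r l) id (PD n r m)" unfolding dcoset_def using PD_id by blast
  qed
  finally have dc: "dcoset (PD n r l) (d_of n r B) (PD n r m) = stab n r l" .
  have PLm: "PL n m e = PD n r m" unfolding PL_def by (rule PD_conj_mid[OF m]) (use m1 r2 in auto)
  have "stab n r l \<subseteq> WB r" by (auto simp: stab_def)
  then have "cl r (f * tsum r (PD n r m)) = cl r (tw r (spow r e) * tsum r (stab n r l) * tw r (spow r e))"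
    using f(2) unfolding dc PLm by (simp only: tsum_conj)
  then show ?thesis using that f by blast
qed

text \<open>The common part of all cases: the double coset of the right factor is described as a part of a fibre
  with restricted columns \<open>Pr\<close>. In \<open>y\<^sub>B y\<^sub>A x\<close> the factor \<open>y\<^sub>A x\<close> is a sum over this set, which begins with
  the symmetrizer of \<open>m\<close>; \<open>y\<^sub>B\<close> turns it into the symmetrizer of \<open>l\<close>, and \<open>symmetrizer_formula\<close>
  applies. The powers of \<open>T\<^sub>r\<close> coming from the labels of \<open>B\<close> cancel against each other, since \<open>T\<^sub>r\<close>
  commutes with the symmetrizer of \<open>m\<close>.\<close>

lemma product_formula:
  fixes e ec \<sigma> eA wA Pr A d0
  assumes d0: "d0 \<in> WB r" "A = mat n r m d0 k" and Pr: "Pr \<subseteq> {1..2*n+1}"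
    and sg: "\<And>p. p \<in> Pr \<Longrightarrow> A (n+1) p > 0 \<Longrightarrow> msgn n (shiftA n A p) = e * ec"
    and wA: "wA \<in> WB r" "psign r wA = Pos"
    and DA: "dcoset (PL n m eA) wA (PL n k ec) = {spow r e \<circ> w \<circ> spow r ec | w. w \<in> mid_fibre k A (e * ec) Pr}"
  shows "phi_eps n r e B e \<otimes>\<^bsub>SD n r\<^esub> phi n r (decor n m eA)
      (min_repD r (dcoset (parabolicD n r (decor n m eA)) wA (parabolicD n r (decor n k ec)))) (decor n k ec)
    = (\<Oplus>\<^bsub>SD n r\<^esub>p\<in>Pr. sterm n r (gcoef n A p) (phi_eps n r e (shiftA n A p) ec))"
    and "\<And>p. p \<in> Pr \<Longrightarrow> sterm n r (gcoef n A p) (phi_eps n r e (shiftA n A p) ec) \<in> carrier (SD n r)"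
proof -
  let ?\<sigma> = "e * ec" let ?S = "mid_fibre k A ?\<sigma> Pr" let ?T = "\<lambda>e. tw r (spow r e)"
  let ?a = "decor n l e" let ?b = "decor n k ec" let ?tQ = "tsum r (PL n k ec)"
  let ?X = "stab n r l" let ?Ym = "tsum r (PD n r m)"
  let ?P = "{p \<in> Pr. A (n+1) p > 0}" let ?F = "\<lambda>p. fibre n r l k (shiftA n A p) ?\<sigma>"
  have lL: "l \<in> Lam n r" by (rule dm_l)
  have l0: "l (n+1) = 0" by (rule dm_l0)
  have ab: "?a \<in> LamD n r" "?b \<in> LamD n r" by (rule decor_LamD[OF lL], rule decor_LamD[OF k])
  have dm: "decor n m eA = decor n m e" using m1 by (simp add: decor_def)
  note cong = cl_mult_cong
  have sq: "cl r (?T e * ?T e) = cl r 1" for e by (rule tw_spow_sq)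

  \<comment> \<open>Each shifted matrix labels one double coset, a full fibre, because \<open>l\<close> has no middle part.\<close>
  have target: "\<exists>f. okmap n ?a (cl r f) ?b \<and> cl r (f * ?tQ) = cl r (?T e * tsum r (?F p) * ?T ec)
      \<and> phi_eps n r e (shiftA n A p) ec = Fmap n r ?a (cl r f) ?b" if p: "p \<in> ?P" for p
  proof -
    obtain d' where d': "d' \<in> WB r" "mat n r m d' k = mat n r m d0 k" "bk n k (pinv d' r) = p"
      using fibre_column_exists[OF k d0(1), of p] p d0(2) by auto
    have Ap: "shiftA n A p = mat n r l d' k" using mat_shiftA[OF k d'(1)] d' d0(2) by simp
    have X: "shiftA n A p \<in> Xi n r" unfolding Ap by (rule mat_Xi[OF lL k d'(1)])
    note t = triple_of_Xi[OF X]
    have rc: "row_comp n r (shiftA n A p) = l" "col_comp n r (shiftA n A p) = k"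
      using row_comp_eq[OF lL ro_mat[OF lL k d'(1)]] col_comp_eq[OF k co_mat[OF lL k d'(1)]] Ap by simp_all
    have ms: "msgn n (shiftA n A p) = ?\<sigma>" using sg p by blast
    then have ps: "psign r (d_of n r (shiftA n A p)) = ?\<sigma>" using psign_msgn[OF t(1,2,5,7,8)] t(6) by simp
    obtain f where f: "okmap n ?a (cl r f) ?b"
      "cl r (f * ?tQ) = cl r (tsum r {spow r e \<circ> w \<circ> spow r ec | w. w \<in> dcoset (PD n r l) (d_of n r (shiftA n A p)) (PD n r k)})"
      "phi_eps n r e (shiftA n A p) ec = Fmap n r ?a (cl r f) ?b"
      using phi_eps_dcoset[OF X ms[symmetric]] unfolding rc by blast
    have "dcoset (PD n r l) (d_of n r (shiftA n A p)) (PD n r k) = ?F p"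
      using dcoset_fibre[OF lL k t(5)] l0 t(6) rc ps by simp
    then have "cl r (f * ?tQ) = cl r (?T e * tsum r (?F p) * ?T ec)"
      using f(2) tsum_conj[of "?F p" e ec] by (simp add: fibre_def)
    then show ?thesis using f by blast
  qed
  then have "\<forall>p\<in>?P. \<exists>f. okmap n ?a (cl r f) ?b \<and> cl r (f * ?tQ) = cl r (?T e * tsum r (?F p) * ?T ec)
      \<and> phi_eps n r e (shiftA n A p) ec = Fmap n r ?a (cl r f) ?b" by blast
  from bchoice[OF this] obtain fp where fp0: "\<forall>p\<in>?P. okmap n ?a (cl r (fp p)) ?b
      \<and> cl r (fp p * ?tQ) = cl r (?T e * tsum r (?F p) * ?T ec)
      \<and> phi_eps n r e (shiftA n A p) ec = Fmap n r ?a (cl r (fp p)) ?b" by blast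
  have fp: "okmap n ?a (cl r (fp p)) ?b" "cl r (fp p * ?tQ) = cl r (?T e * tsum r (?F p) * ?T ec)"
    "phi_eps n r e (shiftA n A p) ec = Fmap n r ?a (cl r (fp p)) ?b" if "p \<in> ?P" for p
    using bspec[OF fp0 that] by (simp_all only:)
  \<comment> \<open>If \<open>A (n+1) p = 0\<close> then the shift at \<open>p\<close> need not be a matrix in \<open>Xi n r\<close>; its term is zero by convention.\<close>
  define gp where "gp p = (if p \<in> ?P then fconst (gcoef n A p) * fp p else 0)" for p
  have g0: "gcoef n A p = 0 \<longleftrightarrow> A (n+1) p = 0" for p
    using qint_nonzero[of "A n p + 1"] by (auto simp: gcoef_def qq_def)
  have trm: "okmap n ?a (cl r (gp p)) ?b \<and> sterm n r (gcoef n A p) (phi_eps n r e (shiftA n A p) ec) = Fmap n r ?a (cl r (gp p)) ?b"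
    if p: "p \<in> Pr" for p
  proof (cases "A (n+1) p > 0")
    case True
    then have pP: "p \<in> ?P" using p by simp
    have "cl r (gp p) = gcoef n A p \<odot>\<^bsub>hecke r\<^esub> cl r (fp p)"
      using pP by (simp only: gp_def if_True smult_cl cl_mult)
    then show ?thesis
      using Fmap_smult[OF fp(1)[OF pP], of "gcoef n A p"] fp(3)[OF pP] g0[of p] True by (simp add: sterm_def)
  next
    case False
    then show ?thesis using Fmap_zero[OF ab] g0[of p] by (simp add: sterm_def gp_def cl_zero)
  qed
  show "sterm n r (gcoef n A p) (phi_eps n r e (shiftA n A p) ec) \<in> carrier (SD n r)" if "p \<in> Pr" for p
    using trm[OF that] Fmap_carrier by metis
  have finPr: "finite Pr" using Pr finite_subset by blast
  have RHS0: "okmap n ?a (cl r (sum gp Pr)) ?b \<and>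
    (\<Oplus>\<^bsub>SD n r\<^esub>p\<in>Pr. sterm n r (gcoef n A p) (phi_eps n r e (shiftA n A p) ec)) = Fmap n r ?a (cl r (sum gp Pr)) ?b"
    by (rule Fmap_finsum[OF finPr ab]) (rule trm)
  note RHS = RHS0[THEN conjunct1] RHS0[THEN conjunct2]

  obtain fB where fB: "okmap n ?a (cl r fB) (decor n m e)" "cl r (fB * ?Ym) = cl r (?T e * tsum r ?X * ?T e)"
    "phi_eps n r e B e = Fmap n r ?a (cl r fB) (decor n m e)" by (rule phi_B)
  obtain fA where fA: "okmap n (decor n m eA) (cl r fA) ?b"
    "cl r (fA * ?tQ) = cl r (tsum r (dcoset (PL n m eA) wA (PL n k ec)))"
    "phi n r (decor n m eA) (min_repD r (dcoset (parabolicD n r (decor n m eA)) wA (parabolicD n r ?b))) ?b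
      = Fmap n r (decor n m eA) (cl r fA) ?b"
    by (rule phi_dcoset[OF m k wA])
  note fm = Fmap_mult[OF fB(1) fA(1)[unfolded dm]]

  have SW: "?S \<subseteq> WB r" by (auto simp: mid_fibre_def)
  obtain R where R: "R \<subseteq> ?S"
    "\<forall>d\<in>R. low_incr n m (pinv d) \<and> (\<forall>c\<in>PD n r m. cl r (tw r (c \<circ> d)) = cl r (tw r c * tw r d))"
    "bij_betw (\<lambda>(d, c). c \<circ> d) (R \<times> PD n r m) ?S"
  proof -
    have PW: "PD n r m \<subseteq> WB r" using PD_WB by blast
    have good: "\<exists>c\<in>PD n r m. low_incr n m (pinv (c \<circ> d))
        \<and> (\<forall>c'\<in>PD n r m. cl r (tw r (c' \<circ> (c \<circ> d))) = cl r (tw r c' * tw r (c \<circ> d)))" if "d \<in> ?S" for d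
      by (rule PD_left_rep[OF m]) (use SW that in blast)
    show ?thesis
      using left_reps[where G = "\<lambda>d. low_incr n m (pinv d) \<and> (\<forall>c\<in>PD n r m. cl r (tw r (c \<circ> d)) = cl r (tw r c * tw r d))",
          OF PD_id PD_comp PD_inv PW SW mid_fibre_stable good] that by blast
  qed
  have S: "cl r (tsum r ?S) = cl r (?Ym * tsum r R)" by (rule tsum_left_factor[OF R(3)]) (use R(2) in blast)
  have core: "cl r (tsum r ?X * tsum r R) = cl r (\<Sum>p\<in>?P. fconst (gcoef n A p) * tsum r (?F p))"
    unfolding d0(2) by (rule symmetrizer_formula[OF d0(1) Pr]) (use R d0(2) in auto)
  have Ym: "cl r ?Ym = cl r (?T e * ?Ym * ?T e)"
  proof -
    have "{spow r e \<circ> w \<circ> spow r e | w. w \<in> PD n r m} = PD n r m" by (rule PD_conj_mid[OF m]) (use m1 r2 in auto)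
    moreover have "PD n r m \<subseteq> WB r" using PD_WB by blast
    ultimately show ?thesis using tsum_conj[of "PD n r m" e e] by simp
  qed
  \<comment> \<open>Conjugation by \<open>s\<^sub>r\<close> maps the even stabilizer of \<open>m\<close> to itself.\<close>
  have YT: "cl r (?T e * ?Ym) = cl r (?Ym * ?T e)"
  proof -
    have "cl r (?T e * ?Ym) = cl r (?T e * (?T e * ?Ym * ?T e))" by (rule cong[OF refl Ym])
    also have "\<dots> = cl r ((?T e * ?T e) * (?Ym * ?T e))" by (simp only: mult.assoc)
    also have "\<dots> = cl r (1 * (?Ym * ?T e))" by (rule cong[OF sq refl])
    finally show ?thesis by simp
  qed
  have "cl r ((fB * fA) * ?tQ) = cl r (fB * (fA * ?tQ))" by (simp only: mult.assoc)
  also have "\<dots> = cl r (fB * (?T e * tsum r ?S * ?T ec))"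
    by (rule cong[OF refl]) (simp only: fA(2) DA tsum_conj[OF SW])
  also have "\<dots> = cl r (fB * (?T e * (?Ym * tsum r R) * ?T ec))" by (intro cong refl S)
  also have "\<dots> = cl r (fB * ((?T e * ?Ym) * (tsum r R * ?T ec)))" by (simp only: mult.assoc)
  also have "\<dots> = cl r (fB * ((?Ym * ?T e) * (tsum r R * ?T ec)))" by (intro cong refl YT)
  also have "\<dots> = cl r ((fB * ?Ym) * (?T e * (tsum r R * ?T ec)))" by (simp only: mult.assoc)
  also have "\<dots> = cl r ((?T e * tsum r ?X * ?T e) * (?T e * (tsum r R * ?T ec)))" by (intro cong refl fB(2))
  also have "\<dots> = cl r ((?T e * tsum r ?X) * ((?T e * ?T e) * (tsum r R * ?T ec)))" by (simp only: mult.assoc)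
  also have "\<dots> = cl r ((?T e * tsum r ?X) * (1 * (tsum r R * ?T ec)))" by (intro cong refl sq)
  also have "\<dots> = cl r (?T e * (tsum r ?X * tsum r R) * ?T ec)" by (simp only: mult.assoc mult_1_left)
  also have "\<dots> = cl r (?T e * (\<Sum>p\<in>?P. fconst (gcoef n A p) * tsum r (?F p)) * ?T ec)" by (intro cong refl core)
  also have "?T e * (\<Sum>p\<in>?P. fconst (gcoef n A p) * tsum r (?F p)) * ?T ec
    = (\<Sum>p\<in>?P. fconst (gcoef n A p) * (?T e * tsum r (?F p) * ?T ec))"
    unfolding sum_distrib_left sum_distrib_right
    by (rule sum.cong[OF refl]) (simp only: mult.assoc[symmetric] fconst_central[of _ "?T e"])
  also have "cl r \<dots> = cl r (\<Sum>p\<in>?P. fconst (gcoef n A p) * (fp p * ?tQ))"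
    by (rule cl_sum_cong, rule cong[OF refl fp(2)[symmetric]])
  also have "(\<Sum>p\<in>?P. fconst (gcoef n A p) * (fp p * ?tQ)) = sum gp Pr * ?tQ"
    unfolding gp_def sum_distrib_right using finPr
    by (subst sum.inter_filter) (auto intro!: sum.cong simp: mult.assoc)
  finally have eq: "cl r ((fB * fA) * ?tQ) = cl r (sum gp Pr * ?tQ)" .

  have "Fmap n r ?a (cl r fB \<otimes>\<^bsub>hecke r\<^esub> cl r fA) ?b = Fmap n r ?a (cl r (sum gp Pr)) ?b"
    by (rule Fmap_cong[OF fm(1) RHS(1)]) (use eq in \<open>simp add: xD_decor[OF k] flip: cl_mult\<close>)
  then show "phi_eps n r e B e \<otimes>\<^bsub>SD n r\<^esub> phi n r (decor n m eA)
      (min_repD r (dcoset (parabolicD n r (decor n m eA)) wA (parabolicD n r ?b))) ?b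
    = (\<Oplus>\<^bsub>SD n r\<^esub>p\<in>Pr. sterm n r (gcoef n A p) (phi_eps n r e (shiftA n A p) ec))"
    unfolding RHS(2) fB(3) dm fA(3)[unfolded dm] fm(2) .
qed

text \<open>The middle row of \<open>A\<close> has sum two and its middle entry is nonzero and even, so both preimages of \<open>r\<close> and
  \<open>r+1\<close> lie in the middle column. The only column is \<open>p = n+1\<close>, and the label of \<open>A\<close> can be given any sign.\<close>

lemma bullet_product:
  assumes A: "A \<in> Xi_b n r" and rA: "row_comp n r A = m" and cA: "col_comp n r A = k"
  shows "phi_eps n r e B e \<otimes>\<^bsub>SD n r\<^esub> phi_dot n r A
    = sterm n r (gcoef n A (n+1)) (phi_eps n r e (shiftA n A (n+1)) (e * msgn n A))"
proof -
  have AX: "A \<in> Xi n r" and A0: "A (n+1) (n+1) \<noteq> 0" using A by (auto simp: Xi_b_def)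
  note t = triple_of_Xi[OF AX, unfolded rA cA]
  let ?d = "d_of n r A" let ?\<epsilon> = "msgn n A" let ?ec = "e * msgn n A"
  have r1: "r \<ge> 1" using r2 by simp
  have k0: "k (n+1) \<noteq> 0"
  proof
    assume "k (n+1) = 0"
    then have "co n A (n+1) = 0" using t(4) by (simp add: hat_def)
    then have "\<forall>i\<in>{1..2*n+1}. A i (n+1) = 0" by (simp only: co_def sum_eq_0_iff finite_atLeastAtMost)
    then show False using A0 by auto
  qed
  have sm: "spow r f \<in> stab n r m" for f by (rule spow_stab[OF m]) (use m1 r1 in auto)
  have sk: "spow r f \<in> stab n r k" for f by (rule spow_stab[OF k k0 r1])
  have sW: "spow r f \<in> WB r" "psign r (spow r f) = f" for f using spow_WB psign_spow r1 by auto
  define wA where "wA = (if ?d \<in> WD r then ?d else cs r r \<circ> ?d)"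
  have wA': "wA = spow r (psign r ?d) \<circ> ?d" by (simp add: wA_def psign_def)
  have wA: "wA \<in> WB r" "psign r wA = Pos" "mat n r m wA k = A"
    unfolding wA' using WB_comp[OF sW(1) t(5)] psign_comp[OF sW(1) t(5)] sW(2) mat_stab[OF m k t(5) sm stab_id] t(6) by simp_all
  have mid: "bk n k (pinv w r) = n + 1" if w: "w \<in> WB r" "mat n r m w k = A" for w
  proof -
    have "card {x \<in> {1..2*r}. bk n m (w x) = n + 1 \<and> bk n k x = n + 1} \<noteq> 0"
      using A0 unfolding w(2)[symmetric] mat_def by auto
    then have "{x \<in> {1..2*r}. bk n m (w x) = n + 1 \<and> bk n k x = n + 1} \<noteq> {}" by (metis card.empty)
    then obtain x where x: "x \<in> {1..2*r}" "bk n m (w x) = n + 1" "bk n k x = n + 1" by blast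
    have wx: "w x \<in> {1..2*r}" using WB_mem[OF w(1), of x] x(1) by blast
    have "w x = r \<or> w x = r + 1" using dm_bk_m_mid[OF wx] x(2) by simp
    then show ?thesis
    proof
      assume "w x = r" then show ?thesis using WB_inv_apply(1)[OF w(1), of x] x(3) by simp
    next
      assume e: "w x = r + 1"
      have "w (2*r + 1 - x) = r" using WB_opp[OF w(1) x(1)] e by simp
      then have "pinv w r = 2*r + 1 - x" using WB_inv_apply(1)[OF w(1), of "2*r + 1 - x"] by simp
      then show ?thesis using bk_sym[OF k x(1)] x(3) by simp
    qed
  qed
  have S: "mid_fibre k A ?\<epsilon> {n+1} = fibre n r m k A ?\<epsilon>"
    unfolding mid_fibre_def fibre_def using mid by blast
  have conj: "spow r e \<circ> w \<circ> spow r ?ec \<in> fibre n r m k A (f * ?\<epsilon>)" if w: "w \<in> fibre n r m k A f" for w f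
  proof -
    have w': "w \<in> WB r" "mat n r m w k = A" "psign r w = f" using w by (auto simp: fibre_def)
    have "psign r (spow r e \<circ> w \<circ> spow r ?ec) = e * f * ?ec"
      using psign_comp[OF WB_comp[OF sW(1) w'(1)] sW(1), of e ?ec] psign_comp[OF sW(1) w'(1), of e] sW(2) w'(3) by simp
    also have "\<dots> = f * ?\<epsilon>" by (cases e; cases f; cases ?\<epsilon>) auto
    finally show ?thesis
      using w' mat_stab[OF m k w'(1) sm sk] WB_comp[OF WB_comp[OF sW(1) w'(1)] sW(1)] by (simp add: fibre_def)
  qed
  have F: "fibre n r m k A Pos = {spow r e \<circ> w \<circ> spow r ?ec | w. w \<in> fibre n r m k A ?\<epsilon>}"
  proof (rule subset_antisym; rule subsetI)
    fix w assume "w \<in> fibre n r m k A Pos"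
    then have "spow r e \<circ> w \<circ> spow r ?ec \<in> fibre n r m k A ?\<epsilon>" using conj[of w Pos] by simp
    moreover have "w = spow r e \<circ> (spow r e \<circ> w \<circ> spow r ?ec) \<circ> spow r ?ec" by (simp only: comp_assoc spow_cancel spow_spow comp_id)
    ultimately show "w \<in> {spow r e \<circ> w \<circ> spow r ?ec | w. w \<in> fibre n r m k A ?\<epsilon>}" by blast
  next
    fix w assume "w \<in> {spow r e \<circ> w \<circ> spow r ?ec | w. w \<in> fibre n r m k A ?\<epsilon>}"
    then show "w \<in> fibre n r m k A Pos" using conj[of _ ?\<epsilon>] by auto
  qed
  have PLs: "PL n m Pos = PD n r m" unfolding PL_def by (rule PD_conj_mid[OF m _ r1]) (use m1 in simp)
  have PLk: "PL n k ?ec = PD n r k" unfolding PL_def by (rule PD_conj_mid[OF k k0 r1])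
  have dc: "dcoset (PL n m Pos) wA (PL n k ?ec) = {spow r e \<circ> w \<circ> spow r ?ec | w. w \<in> mid_fibre k A (e * ?ec) {n+1}}"
    unfolding PLs PLk using dcoset_fibre[OF m k wA(1)] wA(2,3) A0 F S by simp
  have sg: "msgn n (shiftA n A p) = e * ?ec" if "p \<in> {n+1}" for p
    using msgn_shiftA[of p A] that by simp
  have Pr: "{n+1} \<subseteq> {1..2*n+1}" by simp
  note pf = product_formula[OF wA(1) wA(3)[symmetric] Pr sg wA(1,2) dc]
  have dec: "decor n m Pos = Bullet m" "decor n k ?ec = Bullet k" using m1 k0 by (simp_all add: decor_def)
  have "phi_dot n r A = phi n r (decor n m Pos)
      (min_repD r (dcoset (parabolicD n r (decor n m Pos)) wA (parabolicD n r (decor n k ?ec)))) (decor n k ?ec)"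
    unfolding phi_dot_def Let_def rA cA dec wA_def ..
  then have "phi_eps n r e B e \<otimes>\<^bsub>SD n r\<^esub> phi_dot n r A
    = (\<Oplus>\<^bsub>SD n r\<^esub>p\<in>{n+1}. sterm n r (gcoef n A p) (phi_eps n r e (shiftA n A p) ?ec))"
    using pf(1) by simp
  moreover have "(\<Oplus>\<^bsub>SD n r\<^esub>p\<in>{n+1}. sterm n r (gcoef n A p) (phi_eps n r e (shiftA n A p) ?ec))
    = sterm n r (gcoef n A (n+1)) (phi_eps n r e (shiftA n A (n+1)) ?ec)"
  proof -
    interpret S: abelian_monoid "SD n r" by (rule SD_abelian_monoid)
    show ?thesis using pf(2)[of "n+1"] S.finsum_insert[of "{}" "n+1"] by simp
  qed
  ultimately show ?thesis by simp
qed

text \<open>The double coset of \<open>A\<close> contributes the columns left of the middle. If the labels of the two factors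
  differ, an additional factor \<open>s\<^sub>r\<close> exchanges the sides.\<close>

lemma circ_product:
  assumes AX: "A \<in> Xi n r" and A0: "A (n+1) (n+1) = 0" and rA: "row_comp n r A = m" and cA: "col_comp n r A = k"
  shows "phi_eps n r e B e \<otimes>\<^bsub>SD n r\<^esub> phi_eps n r eA A (eA * msgn n A)
    = (\<Oplus>\<^bsub>SD n r\<^esub>p\<in>(if e = eA then {1..n} else {n+2..2*n+1}).
        sterm n r (gcoef n A p) (phi_eps n r e (shiftA n A p) (eA * msgn n A)))"
proof -
  note t = triple_of_Xi[OF AX, unfolded rA cA]
  let ?d = "d_of n r A" let ?\<epsilon> = "msgn n A" let ?ec = "eA * msgn n A"
  let ?Pr = "if e = eA then {1..n} else {n+2..2*n+1}"
  have sW: "spow r f \<in> WB r" "psign r (spow r f) = f" for f using spow_WB psign_spow r2 by auto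
  define wA where "wA = spow r eA \<circ> ?d \<circ> spow r ?ec"
  have pd: "psign r ?d = ?\<epsilon>" using psign_msgn[OF t(1,2,5,7,8)] t(6) by simp
  have w1: "wA \<in> WB r" unfolding wA_def by (intro WB_comp sW t)
  have "psign r wA = eA * ?\<epsilon> * ?ec" unfolding wA_def
    using psign_comp[OF WB_comp[OF sW(1) t(5)] sW(1), of eA ?ec] psign_comp[OF sW(1) t(5), of eA] sW(2) pd by simp
  then have w2: "psign r wA = Pos" by simp
  have S0: "dcoset (PD n r m) ?d (PD n r k) = mid_fibre k A ?\<epsilon> {1..n}"
    using dcoset_mid_fibre[OF k t(5,8)] A0 t(6) pd by simp
  have D: "dcoset (PL n m eA) wA (PL n k ?ec) = {spow r eA \<circ> w \<circ> spow r ?ec | w. w \<in> mid_fibre k A ?\<epsilon> {1..n}}"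
    unfolding PL_def wA_def dcoset_conj S0 ..
  also have "\<dots> = {spow r e \<circ> w \<circ> spow r ?ec | w. w \<in> mid_fibre k A (e * ?ec) ?Pr}"
  proof (cases "e = eA")
    case True then show ?thesis by simp
  next
    case False
    then have ee: "eA = e * Neg" "e * ?ec = - ?\<epsilon>" by (cases e; cases eA; cases ?\<epsilon>; simp)+
    have S: "mid_fibre k A (- ?\<epsilon>) {n+2..2*n+1} = (\<lambda>w. spow r Neg \<circ> w) ` mid_fibre k A ?\<epsilon> {1..n}"
      by (rule spow_mid_fibre[OF k, symmetric])
    have "spow r eA \<circ> w \<circ> spow r ?ec = spow r e \<circ> (spow r Neg \<circ> w) \<circ> spow r ?ec" for w
      unfolding comp_assoc[symmetric] spow_comp ee(1)[symmetric] ..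
    then show ?thesis using False ee(2) S by (auto simp del: spow.simps)
  qed
  finally have dc: "dcoset (PL n m eA) wA (PL n k ?ec)
    = {spow r e \<circ> w \<circ> spow r ?ec | w. w \<in> mid_fibre k A (e * ?ec) ?Pr}" .
  have Pr: "?Pr \<subseteq> {1..2*n+1}" by auto
  have sg: "msgn n (shiftA n A p) = e * ?ec" if "p \<in> ?Pr" for p
  proof (cases "e = eA")
    case True
    then show ?thesis using msgn_shiftA[of p A] that by auto
  next
    case False
    then have "e * ?ec = - ?\<epsilon>" by (cases e; cases eA; cases ?\<epsilon>; simp)
    then show ?thesis using msgn_shiftA[of p A] that False by auto
  qed
  have "phi_eps n r eA A ?ec = phi n r (decor n m eA)
      (min_repD r (dcoset (parabolicD n r (decor n m eA)) wA (parabolicD n r (decor n k ?ec)))) (decor n k ?ec)"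
    unfolding phi_eps_def Let_def rA cA wA_def ..
  then show ?thesis using product_formula(1)[OF t(5) t(6)[symmetric] Pr sg w1 w2 dc] by simp
qed

end

end

theorem theorem6p4:
  fixes n r :: nat and A B :: "nat \<Rightarrow> nat \<Rightarrow> nat" and \<epsilon> :: sign
  assumes "n \<ge> 1" and "r \<ge> 4"
    and "A \<in> Xi n r" and "B \<in> Xi n r"
    and "\<epsilon> = msgn n A"
    and "co n B = ro n A"
    and "B \<in> Xi_oob n r"
    and "\<forall>i\<in>{1..2*n+1}. \<forall>j\<in>{1..2*n+1}.
           i \<noteq> j \<longrightarrow> int (B i j) - int (Eth n n (n+1) i j) = 0"
  shows "(A \<in> Xi_b n r \<longrightarrow>
           phi_eps n r Pos B Pos \<otimes>\<^bsub>SD n r\<^esub> phi_dot n r A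
             = sterm n r (gcoef n A (n+1)) (phi_eps n r Pos (shiftA n A (n+1)) \<epsilon>)
         \<and> phi_eps n r Neg B Neg \<otimes>\<^bsub>SD n r\<^esub> phi_dot n r A
             = sterm n r (gcoef n A (n+1)) (phi_eps n r Neg (shiftA n A (n+1)) (- \<epsilon>)))
       \<and> (A \<in> Xi_bob n r \<union> Xi_boo n r \<longrightarrow>
           phi_eps n r Pos B Pos \<otimes>\<^bsub>SD n r\<^esub> phi_eps n r Pos A \<epsilon>
             = (\<Oplus>\<^bsub>SD n r\<^esub>p\<in>{1..<n+1}.
                  sterm n r (gcoef n A p) (phi_eps n r Pos (shiftA n A p) \<epsilon>))
         \<and> phi_eps n r Neg B Neg \<otimes>\<^bsub>SD n r\<^esub> phi_eps n r Neg A (- \<epsilon>)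
             = (\<Oplus>\<^bsub>SD n r\<^esub>p\<in>{1..<n+1}.
                  sterm n r (gcoef n A p) (phi_eps n r Neg (shiftA n A p) (- \<epsilon>)))
         \<and> phi_eps n r Pos B Pos \<otimes>\<^bsub>SD n r\<^esub> phi_eps n r Neg A (- \<epsilon>)
             = (\<Oplus>\<^bsub>SD n r\<^esub>p\<in>{n+1<..2*n+1}.
                  sterm n r (gcoef n A p) (phi_eps n r Pos (shiftA n A p) (- \<epsilon>)))
         \<and> phi_eps n r Neg B Neg \<otimes>\<^bsub>SD n r\<^esub> phi_eps n r Pos A \<epsilon>
             = (\<Oplus>\<^bsub>SD n r\<^esub>p\<in>{n+1<..2*n+1}.
                  sterm n r (gcoef n A p) (phi_eps n r Neg (shiftA n A p) \<epsilon>)))"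
proof -
  define m where "m = col_comp n r B"
  define l where "l = row_comp n r B"
  define k where "k = col_comp n r A"
  note nd = near_diagonal[OF assms(1,7,8), folded m_def l_def]
  have k: "k \<in> Lam n r" "k = col_comp n r A" unfolding k_def by (rule triple_of_Xi[OF assms(3)], rule refl)
  have r2: "r \<ge> 2" using assms(2) by simp
  have "ro n A = hat n m" using triple_of_Xi(4)[OF assms(4)] assms(6) unfolding m_def by simp
  then have rA: "row_comp n r A = m" using row_comp_eq[OF nd(1)] by blast
  interpret box: box_product n r m l k by unfold_locales (rule assms(1) nd(1,2,3) r2 k(1))+
  have iv: "{1..<n+1} = {1..n}" "{n+1<..2*n+1} = {n+2..2*n+1}" by auto
  note b = box.bullet_product[OF nd(4) _ rA k(2)[symmetric], folded assms(5)]
  have A0: "A (n+1) (n+1) = 0" if "A \<in> Xi_bob n r \<union> Xi_boo n r" using that by (auto simp: Xi_bob_def Xi_boo_def)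
  note c = box.circ_product[OF nd(4) assms(3) A0 rA k(2)[symmetric], folded assms(5)]
  show ?thesis
    unfolding iv using b[of Pos] b[of Neg] c[of Pos Pos] c[of Neg Neg] c[of Pos Neg] c[of Neg Pos] by simp
qed

end
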